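(* Let $n,r,s\in\mathbb{N}$ with $n\geq 3$ and $r+s=n$. Let $S$ be a finite set of primes and $T\subseteq S$. If $n=3$, suppose that $\#T$ is odd if $rs=0$ and even otherwise. For each $p\in S$, let $f_p$ be a nondegenerate $n$-ary quadratic form over $\mathbb{Z}_p$ that is anisotropic if and only if $p\in T$. Then there is an $n$-ary quadratic form $f$ over $\mathbb{Z}$ such that: (i) for every $p\in S$, $f$ is isometric over $\mathbb{Z}_p$ to $f_p$; (ii) $f$ has signature $(r,s)$ over $\mathbb{R}$; (iii) if $n=3$, then for every prime $p\notin S$, $f$ over $\mathbb{Z}_p$ is isotropic and maximal, hence universal; (iv) if $n\geq 4$, then for every prime $p\notin S$, $f$ over $\mathbb{Z}_p$ is universal.
   Context: Signature $(r,s)$ means $f$ is equivalent over $\mathbb{R}$ to $x_1^2+\dots+x_r^2-x_{r+1}^2-\dots-x_{r+s}^2$. A form over $\mathbb{Z}_p$ is universal if it represents every nonzero element of $\mathbb{Z}_p$. A form over $\mathbb{Z}_p$, viewed as a $\mathbb{Z}_p$-lattice $L$ in a quadratic space $(V,q)$ over $\mathbb{Q}_p$ on which $q$ is $\mathbb{Z}_p$-valued, is maximal if no $\mathbb{Z}_p$-lattice $M\supsetneq L$ in $V$ has $q$ $\mathbb{Z}_p$-valued on it. *)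

theory Defs
  imports Complex_Main "HOL-Algebra.QuotRing" "HOL-Algebra.Module"
    "HOL-Computational_Algebra.Primes"
begin

section \<open>The field of p-adic numbers and its ring of integers\<close>

definition padic_val :: "nat \<Rightarrow> rat \<Rightarrow> int" where
  "padic_val p x = int (multiplicity (int p) (fst (quotient_of x)))
                 - int (multiplicity (int p) (snd (quotient_of x)))"

definition padic_abs :: "nat \<Rightarrow> rat \<Rightarrow> real" where
  "padic_abs p x = (if x = 0 then 0 else real p powi (- padic_val p x))"

definition padic_cauchy :: "nat \<Rightarrow> (nat \<Rightarrow> rat) \<Rightarrow> bool" where
  "padic_cauchy p x \<longleftrightarrow> (\<forall>e>0. \<exists>N. \<forall>k\<ge>N. \<forall>l\<ge>N. padic_abs p (x k - x l) < e)"

definition cauchy_ring :: "nat \<Rightarrow> (nat \<Rightarrow> rat) ring" where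
  "cauchy_ring p = \<lparr>carrier = {x. padic_cauchy p x},
     monoid.mult = (\<lambda>x y k. x k * y k), one = (\<lambda>k. 1),
     zero = (\<lambda>k. 0), add = (\<lambda>x y k. x k + y k)\<rparr>"

definition null_ideal :: "nat \<Rightarrow> (nat \<Rightarrow> rat) set" where
  "null_ideal p = {x. (\<lambda>k. padic_abs p (x k)) \<longlonglongrightarrow> 0}"

text \<open>An element of \<open>\<rat>\<^sub>p\<close> is a class of Cauchy sequences of rationals modulo null sequences,
  so all the fields \<open>\<rat>\<^sub>p\<close> live on one HOL type and \<open>p\<close> can be quantified over.\<close>

type_synonym padic = "(nat \<Rightarrow> rat) set"

definition Qp :: "nat \<Rightarrow> padic ring" where
  "Qp p = cauchy_ring p Quot null_ideal p"

text \<open>\<open>\<int>\<^sub>p\<close> is the closed unit ball: a class of absolute value at most 1 always has a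
  representative all of whose terms have absolute value at most 1.\<close>

definition Zp :: "nat \<Rightarrow> padic ring" where
  "Zp p = (Qp p)\<lparr>carrier := {X \<in> carrier (Qp p). \<exists>x\<in>X. \<forall>k. padic_abs p (x k) \<le> 1}\<rparr>"

definition real_ring :: "real ring" where
  "real_ring = \<lparr>carrier = UNIV, monoid.mult = (*), one = 1, zero = 0, add = (+)\<rparr>"


section \<open>Coordinate modules\<close>

text \<open>The module \<open>R\<^sup>n\<close>. The record type for modules extends the one for rings; its
  multiplicative fields play no role.\<close>

definition coord_mod :: "('a, 'm) ring_scheme \<Rightarrow> nat \<Rightarrow> ('a, nat \<Rightarrow> 'a) module" where
  "coord_mod R n = \<lparr>carrier = {..<n} \<rightarrow>\<^sub>E carrier R,
     monoid.mult = undefined, one = undefined,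
     zero = (\<lambda>i\<in>{..<n}. \<zero>\<^bsub>R\<^esub>),
     add = (\<lambda>x y. \<lambda>i\<in>{..<n}. x i \<oplus>\<^bsub>R\<^esub> y i),
     smult = (\<lambda>a x. \<lambda>i\<in>{..<n}. a \<otimes>\<^bsub>R\<^esub> x i)\<rparr>"

definition lin_span ::
    "('a, 'm) ring_scheme \<Rightarrow> ('a, 'b, 'k) module_scheme \<Rightarrow> 'b set \<Rightarrow> 'b set" where
  "lin_span R M B = {\<Oplus>\<^bsub>M\<^esub>b\<in>B. c b \<odot>\<^bsub>M\<^esub> b |c. c \<in> B \<rightarrow> carrier R}"


section \<open>Quadratic forms\<close>

text \<open>An \<open>n\<close>-ary quadratic form is given by its coefficients \<open>f i j\<close> for \<open>i \<le> j < n\<close> (all other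
  values are irrelevant); cross terms \<open>x\<^sub>i x\<^sub>j\<close> need not have even coefficients.\<close>

definition qform :: "('a, 'm) ring_scheme \<Rightarrow> nat \<Rightarrow> (nat \<Rightarrow> nat \<Rightarrow> 'a) \<Rightarrow> bool" where
  "qform R n f \<longleftrightarrow> (\<forall>i j. i \<le> j \<and> j < n \<longrightarrow> f i j \<in> carrier R)"

definition qeval ::
    "('a, 'm) ring_scheme \<Rightarrow> nat \<Rightarrow> (nat \<Rightarrow> nat \<Rightarrow> 'a) \<Rightarrow> (nat \<Rightarrow> 'a) \<Rightarrow> 'a" where
  "qeval R n f x =
     (\<Oplus>\<^bsub>R\<^esub>j\<in>{..<n}. \<Oplus>\<^bsub>R\<^esub>i\<in>{..j}. f i j \<otimes>\<^bsub>R\<^esub> x i \<otimes>\<^bsub>R\<^esub> x j)"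

definition qpolar ::
    "('a, 'm) ring_scheme \<Rightarrow> nat \<Rightarrow> (nat \<Rightarrow> nat \<Rightarrow> 'a) \<Rightarrow> (nat \<Rightarrow> 'a) \<Rightarrow> (nat \<Rightarrow> 'a) \<Rightarrow> 'a" where
  "qpolar R n f x y =
     qeval R n f (x \<oplus>\<^bsub>coord_mod R n\<^esub> y) \<ominus>\<^bsub>R\<^esub> qeval R n f x \<ominus>\<^bsub>R\<^esub> qeval R n f y"

definition nondegenerate :: "('a, 'm) ring_scheme \<Rightarrow> nat \<Rightarrow> (nat \<Rightarrow> nat \<Rightarrow> 'a) \<Rightarrow> bool" where
  "nondegenerate R n f \<longleftrightarrow>
     (\<forall>x\<in>carrier (coord_mod R n).
        (\<forall>y\<in>carrier (coord_mod R n). qpolar R n f x y = \<zero>\<^bsub>R\<^esub>) \<longrightarrow> x = \<zero>\<^bsub>coord_mod R n\<^esub>)"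

definition isotropic :: "('a, 'm) ring_scheme \<Rightarrow> nat \<Rightarrow> (nat \<Rightarrow> nat \<Rightarrow> 'a) \<Rightarrow> bool" where
  "isotropic R n f \<longleftrightarrow>
     (\<exists>x\<in>carrier (coord_mod R n). x \<noteq> \<zero>\<^bsub>coord_mod R n\<^esub> \<and> qeval R n f x = \<zero>\<^bsub>R\<^esub>)"

abbreviation anisotropic :: "('a, 'm) ring_scheme \<Rightarrow> nat \<Rightarrow> (nat \<Rightarrow> nat \<Rightarrow> 'a) \<Rightarrow> bool" where
  "anisotropic R n f \<equiv> \<not> isotropic R n f"

definition universal :: "('a, 'm) ring_scheme \<Rightarrow> nat \<Rightarrow> (nat \<Rightarrow> nat \<Rightarrow> 'a) \<Rightarrow> bool" where
  "universal R n f \<longleftrightarrow>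
     (\<forall>a\<in>carrier R. a \<noteq> \<zero>\<^bsub>R\<^esub> \<longrightarrow> (\<exists>x\<in>carrier (coord_mod R n). qeval R n f x = a))"

definition isometric ::
    "('a, 'm) ring_scheme \<Rightarrow> nat \<Rightarrow> (nat \<Rightarrow> nat \<Rightarrow> 'a) \<Rightarrow> (nat \<Rightarrow> nat \<Rightarrow> 'a) \<Rightarrow> bool" where
  "isometric R n f g \<longleftrightarrow>
     (\<exists>\<phi>\<in>iso (add_monoid (coord_mod R n)) (add_monoid (coord_mod R n)).
        (\<forall>a\<in>carrier R. \<forall>x\<in>carrier (coord_mod R n).
           \<phi> (a \<odot>\<^bsub>coord_mod R n\<^esub> x) = a \<odot>\<^bsub>coord_mod R n\<^esub> \<phi> x) \<and>
        (\<forall>x\<in>carrier (coord_mod R n). qeval R n g (\<phi> x) = qeval R n f x))"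

definition base_change ::
    "('a, 'm) ring_scheme \<Rightarrow> (nat \<Rightarrow> nat \<Rightarrow> int) \<Rightarrow> nat \<Rightarrow> nat \<Rightarrow> 'a" where
  "base_change R f = (\<lambda>i j. [f i j] \<cdot>\<^bsub>R\<^esub> \<one>\<^bsub>R\<^esub>)"

definition has_signature :: "(nat \<Rightarrow> nat \<Rightarrow> real) \<Rightarrow> nat \<Rightarrow> nat \<Rightarrow> bool" where
  "has_signature f r s \<longleftrightarrow>
     isometric real_ring (r + s) f (\<lambda>i j. if i \<noteq> j then 0 else if i < r then 1 else - 1)"


section \<open>Maximal forms over the p-adic integers\<close>

definition padic_lattice :: "nat \<Rightarrow> nat \<Rightarrow> (nat \<Rightarrow> padic) set \<Rightarrow> bool" where
  "padic_lattice p n M \<longleftrightarrow>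
     (\<exists>B. finite B \<and> B \<subseteq> carrier (coord_mod (Qp p) n) \<and>
        M = lin_span (Zp p) (coord_mod (Qp p) n) B \<and>
        lin_span (Qp p) (coord_mod (Qp p) n) B = carrier (coord_mod (Qp p) n))"

definition integral_on ::
    "nat \<Rightarrow> nat \<Rightarrow> (nat \<Rightarrow> nat \<Rightarrow> padic) \<Rightarrow> (nat \<Rightarrow> padic) set \<Rightarrow> bool" where
  "integral_on p n f M \<longleftrightarrow> (\<forall>x\<in>M. qeval (Qp p) n f x \<in> carrier (Zp p))"

text \<open>A form over \<open>\<int>\<^sub>p\<close> is viewed as the lattice \<open>\<int>\<^sub>p\<^sup>n\<close> in \<open>\<rat>\<^sub>p\<^sup>n\<close>.\<close>

definition maximal_form :: "nat \<Rightarrow> nat \<Rightarrow> (nat \<Rightarrow> nat \<Rightarrow> padic) \<Rightarrow> bool" where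
  "maximal_form p n f \<longleftrightarrow>
     integral_on p n f (carrier (coord_mod (Zp p) n)) \<and>
     \<not> (\<exists>M. padic_lattice p n M \<and> carrier (coord_mod (Zp p) n) \<subset> M \<and> integral_on p n f M)"

end

theory Submission
  imports Defs "HOL-Number_Theory.Number_Theory" "HOL-Algebra.Subrings"
begin

text \<open>
  All \<open>p\<close>-adic conditions are reduced to congruences between integers: a form \<open>f\<close> is isometric over
  \<open>\<int>\<^sub>p\<close> to a nondegenerate form as soon as the two agree modulo a sufficiently high power of \<open>p\<close>
  (Newton iteration), a zero modulo \<open>p\<close> at which the polar form does not vanish makes \<open>f\<close> isotropic and
  universal over \<open>\<int>\<^sub>p\<close>, and a ternary form is maximal if \<open>p\<^sup>2\<close> does not divide its determinant \<open>D\<close>.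

  The coefficients of \<open>f\<close> are chosen column by column. The Chinese remainder theorem takes care of the
  primes of \<open>S\<close> and of the finitely many primes at which the part already built degenerates; the size of
  the diagonal coefficients fixes the signature. For \<open>n \<ge> 4\<close> there is room to produce nonsingular zeros
  at all primes outside \<open>S\<close>.

  For \<open>n = 3\<close> one first prescribes the determinant as \<open>D = \<sigma> P l\<close>, where \<open>P\<close> is supported on \<open>S\<close> and the
  prime \<open>l\<close> satisfies finitely many quadratic residue conditions, which needs only the nonvanishing of
  \<open>L(1,\<chi>)\<close> for real \<open>\<chi>\<close>. The last column is then determined by congruences and by \<open>D\<close>. With binary
  determinant \<open>\<Delta>\<close> and leading coefficient \<open>a\<close>, the form is isotropic at \<open>p\<close> iff the Hilbert symbol
  \<open>(-\<Delta>, -aD)\<^sub>p\<close> is 1. This holds by construction at all primes outside \<open>S\<close> other than \<open>l\<close>, so the product formula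
  and the parity hypothesis on \<open>T\<close> force it at \<open>l\<close> as well.
\<close>

section \<open>Primes with prescribed values of real characters\<close>

text \<open>In the ternary case congruences at finitely many primes cannot force isotropy everywhere
  else: the determinant D must also have controlled prime factors outside S, which seems to ask for
  primes in arbitrary progressions. Only the class of D modulo unit squares is constrained at p in
  S, however, since scaling the last basis vector by a p-adic unit \<epsilon> multiplies D by
  \<epsilon>^2 without changing the isometry class. This is why quadratic conditions on the
  auxiliary prime are enough, and also why the last column meets the given form only up to factors
  \<epsilon> and \<epsilon>^2. At primes q outside S dividing the leading coefficient a, the cross
  term r is made 1 modulo q: then -\<Delta> is a square modulo q and such q never obstruct. The
  prime 2 is treated as if it belonged to S, so that completing the square is legitimate at all
  remaining primes. Hilbert symbols are given by their explicit formula, which turns the product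
  formula into quadratic reciprocity; their link with zeros of conics is a separate local
  computation.\<close>

lemma sum_divisor_pairs:
  fixes F :: "nat \<Rightarrow> nat \<Rightarrow> real"
  shows "(\<Sum>n=1..M. \<Sum>k=1..M div n. F n k) = (\<Sum>m=1..M. \<Sum>d | d dvd m. F d (m div d))"
proof -
  have "(\<Sum>n=1..M. \<Sum>k=1..M div n. F n k) = (\<Sum>(n,k)\<in>(SIGMA n:{1..M}. {1..M div n}). F n k)"
    by (rule sum.Sigma) auto
  \<comment> \<open>A pair (n, k) with nk \<le> M corresponds to m = nk with the marked divisor d =
    n.\<close>
  also have "\<dots> = (\<Sum>(m,d)\<in>(SIGMA m:{1..M}. {d. d dvd m}). F d (m div d))"
  proof (rule sum.reindex_bij_witness[where i = "\<lambda>(m,d). (d, m div d)" and j = "\<lambda>(n,k). (n*k, n)"], goal_cases)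
    case (2 a)
    then obtain n k where a: "a = (n,k)" "1 \<le> n" "n \<le> M" "1 \<le> k" "k \<le> M div n" by auto
    have "n * k \<le> M"
      using a by (metis le_trans mult_le_mono2 times_div_less_eq_dividend)
    then show ?case using a by auto
  next
    case (4 b)
    then obtain m d where b: "b = (m,d)" "1 \<le> m" "m \<le> M" "d dvd m" by auto
    have "d \<le> m" "d \<noteq> 0" using b by (auto simp: dvd_imp_le)
    then show ?case using b by (auto simp: div_le_mono Suc_le_eq div_greater_zero_iff)
  qed auto
  also have "\<dots> = (\<Sum>m=1..M. \<Sum>d | d dvd m. F d (m div d))"
    by (rule sum.Sigma[symmetric]) auto
  finally show ?thesis .
qed

text \<open>Every divisor of \<open>a * b\<close> factors uniquely as xy with x dividing a and y
  dividing b, and x, y are recovered as its gcds with a and b; multiplicativity of g then separates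
  the double sum.\<close>

lemma sum_divisors_coprime:
  fixes g :: "nat \<Rightarrow> real"
  assumes "coprime a b" "a > 0" "b > 0" and mult: "\<And>m n. g (m * n) = g m * g n"
  shows "(\<Sum>d | d dvd a * b. g d) = (\<Sum>d | d dvd a. g d) * (\<Sum>d | d dvd b. g d)"
proof -
  have key: "gcd (x*y) a = x" "gcd (x*y) b = y" if "x dvd a" "y dvd b" for x y
  proof -
    have "coprime y a" "coprime x b"
      using that assms(1) by (meson coprime_commute coprime_divisors dvd_refl)+
    then have "gcd (x*y) a = gcd x a" "gcd (x*y) b = gcd y b"
      by (simp_all add: gcd_mult_right_right_cancel gcd_mult_left_right_cancel
          gcd_mult_left_left_cancel coprime_commute)
    then show "gcd (x*y) a = x" "gcd (x*y) b = y" using that by (simp_all add: gcd_nat.absorb1)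
  qed
  have "(\<Sum>d | d dvd a. g d) * (\<Sum>d | d dvd b. g d)
      = (\<Sum>(x,y)\<in>{d. d dvd a} \<times> {d. d dvd b}. g (x * y))"
    by (simp add: sum_product sum.cartesian_product mult)
  also have "\<dots> = (\<Sum>d | d dvd a * b. g d)"
  proof (rule sum.reindex_bij_witness[where i = "\<lambda>d. (gcd d a, gcd d b)" and j = "\<lambda>(x,y). x * y"], goal_cases)
    case (3 d)
    then obtain x y where "d = x * y" "x dvd a" "y dvd b" using division_decomp by blast
    then show ?case using key by simp
  qed (auto simp: mult_dvd_mono key)
  finally show ?thesis ..
qed

text \<open>Summation by parts: the increments of nonnegative decreasing weights telescope, so a
  uniform bound on the sums of c costs only the first weight \<open>b m\<close>.\<close>

lemma abel_bound:
  fixes c b :: "nat \<Rightarrow> real"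
  assumes C: "\<And>k. \<bar>\<Sum>n=m..<k. c n\<bar> \<le> C"
    and dec: "\<And>n. n \<ge> m \<Longrightarrow> b (Suc n) \<le> b n" and nn: "\<And>n. n \<ge> m \<Longrightarrow> 0 \<le> b n"
  shows "\<bar>\<Sum>n=m..<M. c n * b n\<bar> \<le> C * b m"
proof (cases "m \<le> M")
  case True
  define T where "T k = (\<Sum>n=m..<k. c n)" for k
  have parts: "(\<Sum>n=m..<M. c n * b n) = T M * b M + (\<Sum>n=m..<M. T (Suc n) * (b n - b (Suc n)))"
    using True
  proof (induction M rule: dec_induct)
    case base then show ?case by (simp add: T_def)
  next
    case (step M)
    have "T (Suc M) = T M + c M" using step by (simp add: T_def)
    then show ?case using step by (simp add: algebra_simps)
  qed
  have tel: "(\<Sum>n=m..<M. (b n - b (Suc n))) = b m - b M"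
    using True by (induction M rule: dec_induct) auto
  have C0: "C \<ge> 0" using C[of m] by simp
  have "\<bar>\<Sum>n=m..<M. c n * b n\<bar> \<le> \<bar>T M * b M\<bar> + \<bar>\<Sum>n=m..<M. T (Suc n) * (b n - b (Suc n))\<bar>"
    unfolding parts by (rule abs_triangle_ineq)
  also have "\<bar>T M * b M\<bar> \<le> C * b M"
    using C[of M] nn[OF True] by (simp add: abs_mult T_def mult_right_mono)
  also have "\<bar>\<Sum>n=m..<M. T (Suc n) * (b n - b (Suc n))\<bar> \<le> (\<Sum>n=m..<M. C * (b n - b (Suc n)))"
  proof (rule order_trans[OF sum_abs], rule sum_mono)
    fix n assume "n \<in> {m..<M}"
    then show "\<bar>T (Suc n) * (b n - b (Suc n))\<bar> \<le> C * (b n - b (Suc n))"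
      using C[of "Suc n"] dec[of n] by (simp add: abs_mult T_def mult_right_mono)
  qed
  also have "\<dots> = C * (b m - b M)" by (simp add: sum_distrib_left[symmetric] tel)
  finally show ?thesis by (simp add: algebra_simps)
next
  case False
  then show ?thesis using C[of m] nn[of m] by simp
qed

text \<open>A nonprincipal real character of period N. Values at arguments sharing a factor with N
  are left free, so that Legendre symbols modulo single prime factors of N fit the common modulus
  N.\<close>

locale real_character =
  fixes \<chi> :: "nat \<Rightarrow> real" and N :: nat
  assumes N_pos: "N > 0"
    and mult: "\<chi> (m * n) = \<chi> m * \<chi> n"
    and periodic: "\<chi> (n + N) = \<chi> n"
    and range: "\<chi> n \<in> {-1, 0, 1}"
    and nontriv: "\<exists>a. coprime a N \<and> \<chi> a = -1"
begin

lemma chi_1: "\<chi> (Suc 0) = 1"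
  using nontriv mult[of "Suc 0"] by (metis mult_cancel_right1 mult_1 One_nat_def zero_neq_neg_one)

lemma chi_0: "\<chi> 0 = 0"
  using nontriv mult[of 0] by (metis mult_minus1_right mult_zero_left neg_equal_zero)

lemma chi_abs: "\<bar>\<chi> n\<bar> \<le> 1"
  using range[of n] by auto

lemma chi_add_mult: "\<chi> (n + k * N) = \<chi> n"
  by (induction k) (auto simp: algebra_simps periodic[of "n + _", simplified algebra_simps])

lemma chi_mod: "\<chi> (n mod N) = \<chi> n"
  by (metis chi_add_mult mod_div_mult_eq)

text \<open>Multiplication by a unit a with \<open>\<chi> a = -1\<close> permutes the residues
  modulo N and changes the sign of the sum.\<close>

lemma sum_period: "(\<Sum>n<N. \<chi> n) = 0"
proof -
  obtain a where a: "coprime a N" "\<chi> a = -1" using nontriv by auto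
  have inj: "inj_on (\<lambda>n. a * n mod N) {..<N}"
  proof (rule inj_onI)
    fix x y assume "x \<in> {..<N}" "y \<in> {..<N}" "a * x mod N = a * y mod N"
    then have "[x = y] (mod N)" using a(1) by (metis cong_def cong_mult_lcancel_nat)
    then show "x = y" using \<open>x \<in> _\<close> \<open>y \<in> _\<close> by (simp add: cong_less_modulus_unique_nat)
  qed
  have "bij_betw (\<lambda>n. a * n mod N) {..<N} {..<N}"
    using inj N_pos by (simp add: bij_betw_def endo_inj_surj image_subset_iff)
  then have "(\<Sum>n<N. \<chi> n) = (\<Sum>n<N. \<chi> (a * n mod N))"
    by (rule sum.reindex_bij_betw[symmetric])
  also have "\<dots> = - (\<Sum>n<N. \<chi> n)"
    by (simp add: chi_mod mult a(2) sum_negf)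
  finally show ?thesis by simp
qed

lemma partial_sums: "\<bar>\<Sum>n<M. \<chi> n\<bar> \<le> real N"
proof -
  have *: "(\<Sum>n<r + k * N. \<chi> n) = (\<Sum>n<r. \<chi> n)" for r k
  proof (induction k)
    case (Suc k)
    have "(\<Sum>n<r + Suc k * N. \<chi> n) = (\<Sum>n<N + (r + k * N). \<chi> n)" by (simp add: algebra_simps)
    also have "\<dots> = (\<Sum>n<N. \<chi> n) + (\<Sum>n<r + k*N. \<chi> (n + N))"
      using sum.nat_group[of \<chi>] sum.atLeastLessThan_concat[of 0 N "N + (r + k*N)" \<chi>]
        sum.shift_bounds_nat_ivl[of \<chi> 0 N "r + k*N"]
      by (simp add: lessThan_atLeast0 add.commute)
    also have "\<dots> = (\<Sum>n<r. \<chi> n)" using Suc by (simp add: periodic sum_period)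
    finally show ?case .
  qed auto
  have "(\<Sum>n<M. \<chi> n) = (\<Sum>n<M mod N. \<chi> n)"
    using *[of "M mod N" "M div N"] by simp
  moreover have "\<bar>\<Sum>n<M mod N. \<chi> n\<bar> \<le> (\<Sum>n<M mod N. 1)"
    by (rule order_trans[OF sum_abs], rule sum_mono) (use chi_abs in auto)
  moreover have "real (M mod N) \<le> real N" using N_pos by (simp add: less_imp_le)
  ultimately show ?thesis by simp
qed

lemma interval_sums: "\<bar>\<Sum>n=m..<M. \<chi> n\<bar> \<le> 2 * real N"
proof (cases "m \<le> M")
  case True
  then have "(\<Sum>n<M. \<chi> n) = (\<Sum>n<m. \<chi> n) + (\<Sum>n=m..<M. \<chi> n)"
    by (simp add: lessThan_atLeast0 sum.atLeastLessThan_concat)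
  then show ?thesis using partial_sums[of M] partial_sums[of m] by linarith
qed auto

lemma abel_chi:
  assumes "\<And>n. n \<ge> m \<Longrightarrow> b (Suc n) \<le> b n" "\<And>n. n \<ge> m \<Longrightarrow> 0 \<le> b n"
  shows "\<bar>\<Sum>n=m..<M. \<chi> n * b n\<bar> \<le> 2 * real N * b m"
  by (rule abel_bound) (use interval_sums assms in auto)

definition "L1 = (\<Sum>n. \<chi> n / real n)"

lemma tail_bound: "m > 0 \<Longrightarrow> \<bar>\<Sum>n=m..<M. \<chi> n / real n\<bar> \<le> 2 * real N / real m"
  using abel_chi[of m "\<lambda>n. 1 / real n" M] by (simp add: field_simps)

lemma summable_L1: "summable (\<lambda>n. \<chi> n / real n)"
  unfolding summable_Cauchy
proof (intro allI impI)
  fix e :: real assume "e > 0"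
  obtain K :: nat where K: "real K > 2 * real N / e" using reals_Archimedean2 by blast
  show "\<exists>N. \<forall>m\<ge>N. \<forall>n. norm (\<Sum>n=m..<n. \<chi> n / real n) < e"
  proof (intro exI[of _ "Suc K"] allI impI)
    fix m n assume m: "m \<ge> Suc K"
    then have "real m > 2 * real N / e" using K by simp
    then have "2 * real N / real m < e" using \<open>e > 0\<close> m by (simp add: field_simps)
    then show "norm (\<Sum>n=m..<n. \<chi> n / real n) < e"
      using tail_bound[of m n] m by simp
  qed
qed

text \<open>The rate 1/m matters: summed against the Mangoldt function it produces an error of order
  psi(M)/M, hence a bounded one.\<close>

lemma L1_bound:
  assumes "m > 0"
  shows "\<bar>L1 - (\<Sum>n<m. \<chi> n / real n)\<bar> \<le> 2 * real N / real m"
proof -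
  have "(\<lambda>M. \<Sum>n<M. \<chi> n / real n) \<longlonglongrightarrow> L1"
    unfolding L1_def using summable_L1 by (rule summable_LIMSEQ)
  then have lim: "(\<lambda>M. \<bar>(\<Sum>n<M. \<chi> n / real n) - (\<Sum>n<m. \<chi> n / real n)\<bar>)
      \<longlonglongrightarrow> \<bar>L1 - (\<Sum>n<m. \<chi> n / real n)\<bar>"
    by (intro tendsto_intros)
  show ?thesis
  proof (rule LIMSEQ_le_const2[OF lim], intro exI allI impI)
    fix M assume "m \<le> M"
    then have "(\<Sum>n<M. \<chi> n / real n) - (\<Sum>n<m. \<chi> n / real n) = (\<Sum>n=m..<M. \<chi> n / real n)"
      using sum.atLeastLessThan_concat[of 0 m M "\<lambda>n. \<chi> n / real n"]
      by (simp add: lessThan_atLeast0)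
    then show "\<bar>(\<Sum>n<M. \<chi> n / real n) - (\<Sum>n<m. \<chi> n / real n)\<bar> \<le> 2 * real N / real m"
      using tail_bound[OF assms] by simp
  qed
qed

end

section \<open>Nonvanishing of L(1,\<chi>) by a Lambert series\<close>

lemma geometric_am_gm:
  fixes y :: real
  assumes "y > 0"
  shows "real n * y ^ (n - 1) \<le> (\<Sum>i<n. y ^ (2 * i))"
proof -
  \<comment> \<open>The exponents 2i and 2(n-1-i) have mean n-1, so the arithmetic-geometric
    inequality applies to each reflected pair.\<close>
  have "2 * (\<Sum>i<n. y ^ (2 * i)) = (\<Sum>i<n. y ^ (2 * i)) + (\<Sum>i<n. y ^ (2 * (n - Suc i)))"
    using sum.nat_diff_reindex[of "\<lambda>i. y ^ (2 * i)" n] by simp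
  also have "\<dots> = (\<Sum>i<n. y ^ (2 * i) + y ^ (2 * (n - Suc i)))" by (simp add: sum.distrib)
  also have "\<dots> \<ge> (\<Sum>i<n. 2 * y ^ (n - 1))"
  proof (rule sum_mono)
    fix i assume "i \<in> {..<n}"
    then have "y ^ (n - 1) = y ^ i * y ^ (n - Suc i)" by (simp add: power_add[symmetric])
    moreover have "2 * (y ^ i * y ^ (n - Suc i)) \<le> (y ^ i)^2 + (y ^ (n - Suc i))^2"
      using zero_le_power2[of "y ^ i - y ^ (n - Suc i)"] by (simp add: power2_diff mult_ac)
    ultimately show "2 * y ^ (n - 1) \<le> y ^ (2 * i) + y ^ (2 * (n - Suc i))"
      by (simp add: power_mult[symmetric] mult.commute)
  qed
  finally show ?thesis by simp
qed

text \<open>Once 1/(1-x) is factored out, the claim is x^n/(S_n S_(n+1)) \<le> 1/n - 1/(n+1) with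
  S_m = 1 + ... + x^(m-1), and this follows from the arithmetic-geometric bounds for S_n and
  S_(n+1). Monotonicity is what permits partial summation against \<chi>.\<close>

lemma lambert_term_decreasing:
  fixes x :: real
  assumes x: "0 < x" "x < 1" and n: "n \<ge> 1"
  shows "1 / (real (Suc n) * (1 - x)) - x ^ Suc n / (1 - x ^ Suc n)
       \<le> 1 / (real n * (1 - x)) - x ^ n / (1 - x ^ n)"
proof -
  define S where "S m = (\<Sum>i<m. x ^ i)" for m
  have S: "1 - x ^ m = (1 - x) * S m" for m
    by (simp add: S_def one_diff_power_eq)
  have Spos: "S m > 0" if "m \<ge> 1" for m
  proof -
    have "x ^ m < 1" using x that by (simp add: power_less_one_iff)
    then have "(1 - x) * S m > 0" using S[of m] by simp
    then show ?thesis using x by (simp add: zero_less_mult_iff)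
  qed
  \<comment> \<open>Half-integral powers of x are the geometric means of the terms of
    \<open>S\<close>.\<close>
  define y where "y = sqrt x"
  have y: "0 < y" "y < 1" "x = y^2" using x by (auto simp: y_def)
  have Sy: "S m = (\<Sum>i<m. y ^ (2 * i))" for m
    unfolding S_def y(3) by (simp add: power_mult)
  have S1: "real n * y ^ (n - 1) \<le> S n" and S2: "real (Suc n) * y ^ n \<le> S (Suc n)"
    using geometric_am_gm[OF y(1), of n] geometric_am_gm[OF y(1), of "Suc n"] by (simp_all add: Sy)
  have "(real n * y ^ (n - 1)) * (real (Suc n) * y ^ n) \<le> S n * S (Suc n)"
    by (intro mult_mono S1 S2) (use y Spos[of n] n in auto)
  moreover have "real n * real (Suc n) * x ^ n \<le> (real n * y ^ (n - 1)) * (real (Suc n) * y ^ n)"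
  proof -
    have "x ^ n = y ^ (n + n)" by (simp add: y(3) power_mult[symmetric] mult_2)
    also have "\<dots> \<le> y ^ (n - 1 + n)" using y by (intro power_decreasing) auto
    finally have "x ^ n \<le> y ^ (n - 1) * y ^ n" by (simp add: power_add)
    then have "(real n * real (Suc n)) * x ^ n \<le> (real n * real (Suc n)) * (y ^ (n - 1) * y ^ n)"
      by (intro mult_left_mono) auto
    then show ?thesis by (simp only: mult_ac)
  qed
  ultimately have key: "real n * real (Suc n) * x ^ n \<le> S n * S (Suc n)" by linarith
  have SS: "S (Suc n) - x * S n = 1"
    unfolding S_def by (simp only: sum.lessThan_Suc_shift sum_distrib_left) simp
  have pos: "S n > 0" "S (Suc n) > 0" "real n > 0" using Spos n by auto
  have "x ^ n / S n - x ^ Suc n / S (Suc n) = x ^ n * (S (Suc n) - x * S n) / (S n * S (Suc n))"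
    using pos by (simp add: field_simps)
  also have "\<dots> = x ^ n / (S n * S (Suc n))" by (simp add: SS)
  also have "\<dots> \<le> 1 / (real n * real (Suc n))"
  proof -
    have "t / P \<le> 1 / Q" if "Q * t \<le> P" "P > 0" "Q > 0" for t P Q :: real
      using that by (simp add: field_simps)
    then show ?thesis using key pos by simp
  qed
  also have "\<dots> = 1 / real n - 1 / real (Suc n)" using pos by (simp add: field_simps)
  finally have "(1 / real (Suc n) - x ^ Suc n / S (Suc n)) / (1 - x)
      \<le> (1 / real n - x ^ n / S n) / (1 - x)"
    using x by (intro divide_right_mono) auto
  then show ?thesis unfolding S using x by (simp add: diff_divide_distrib mult.commute)
qed

context real_character
begin

lemma chi_power: "\<chi> (p ^ k) = \<chi> p ^ k"
  by (induction k) (auto simp: mult chi_1)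

text \<open>The divisor sum is multiplicative, and at p^k it is 1 + c + ... + c^k with c in {-1, 0,
  1}, which is never negative and is at least 1 for even k.\<close>

lemma divisor_sum_nonneg:
  assumes "m > 0"
  shows "0 \<le> (\<Sum>d | d dvd m. \<chi> d) \<and> ((\<exists>j. m = j^2) \<longrightarrow> 1 \<le> (\<Sum>d | d dvd m. \<chi> d))"
  using assms
proof (induction m rule: less_induct)
  case (less m)
  show ?case
  proof (cases "m = 1")
    case True
    have "{d::nat. d dvd 1} = {1}" by auto
    then show ?thesis using True chi_1 by simp
  next
    case False
    then obtain p where p: "prime p" "p dvd m" using prime_factor_nat by blast
    define k where "k = multiplicity p m"
    obtain m' where m': "m = p ^ k * m'" "\<not> p dvd m'"
      using multiplicity_decompose'[of m p] p less.prems unfolding k_def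
      by (metis gr0_implies_Suc nat.distinct(1) not_prime_unit)
    have k: "k > 0" using p less.prems by (simp add: k_def prime_multiplicity_gt_zero_iff)
    have m'0: "m' > 0" using m' less.prems by (cases m') auto
    have "p ^ k > 1" using p k by (metis one_less_power prime_gt_1_nat)
    then have lt: "m' < m" using m' m'0 by simp
    have cop: "coprime (p ^ k) m'" using p m' by (simp add: prime_imp_coprime)
    have split: "(\<Sum>d | d dvd m. \<chi> d) = (\<Sum>d | d dvd p ^ k. \<chi> d) * (\<Sum>d | d dvd m'. \<chi> d)"
      unfolding m'(1) by (rule sum_divisors_coprime) (use cop p m'0 mult in \<open>auto simp: prime_gt_0_nat\<close>)
    have "{d. d dvd p ^ k} = (\<lambda>i. p ^ i) ` {..k}"
      using divides_primepow_nat[OF p(1)] by auto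
    moreover have "inj_on (\<lambda>i. p ^ i) {..k}"
      using p(1) by (intro inj_onI) (metis power_inject_exp prime_gt_1_nat)
    ultimately have "(\<Sum>d | d dvd p ^ k. \<chi> d) = (\<Sum>i\<le>k. \<chi> p ^ i)"
      by (simp add: sum.reindex chi_power)
    moreover have geo: "0 \<le> (\<Sum>i\<le>k. c ^ i) \<and> (even k \<longrightarrow> 1 \<le> (\<Sum>i\<le>k. c ^ i))"
      if "c \<in> {-1, 0, 1::real}" for c
    proof -
      have "(\<Sum>i\<le>k. (-1::real) ^ i) = (if even k then 1 else 0)" by (induction k) auto
      moreover have "(\<Sum>i\<le>k. (0::real) ^ i) = 1" by (induction k) auto
      ultimately show ?thesis using that by auto
    qed
    ultimately have pk: "0 \<le> (\<Sum>d | d dvd p ^ k. \<chi> d)" "even k \<Longrightarrow> 1 \<le> (\<Sum>d | d dvd p ^ k. \<chi> d)"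
      using range[of p] by auto
    have IH: "0 \<le> (\<Sum>d | d dvd m'. \<chi> d)" "(\<exists>j. m' = j^2) \<Longrightarrow> 1 \<le> (\<Sum>d | d dvd m'. \<chi> d)"
      using less.IH[OF lt m'0] by auto
    have sq: "even k \<and> (\<exists>i. m' = i^2)" if "m = j^2" for j
    proof -
      have j0: "j > 0" using that less.prems by (cases j) auto
      have "k = 2 * multiplicity p j"
        unfolding k_def that using p j0 by (simp add: prime_elem_multiplicity_power_distrib)
      then have ev: "even k" by simp
      obtain h where h: "k = 2 * h" using ev by blast
      have "p ^ h dvd j" using \<open>k = 2 * multiplicity p j\<close> h by (simp add: multiplicity_dvd)
      then obtain i where "j = p ^ h * i" by blast
      then have "p ^ k * m' = p ^ k * i^2"
        using that m'(1) h by (simp add: power_mult_distrib power_mult[symmetric] mult.commute)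
      then have "m' = i^2" using p by (simp add: prime_gt_0_nat)
      then show ?thesis using ev by blast
    qed
    show ?thesis
      unfolding split using pk IH sq mult_mono[of 1 _ 1, OF pk(2) IH(2)]
      by (metis mult_1 mult_nonneg_nonneg zero_le_one)
  qed
qed

text \<open>Monsky's argument: if \<open>L(1,\<chi>) = 0\<close>, the Lambert series \<open>\<Sum>\<chi>(n) x\<^sup>n / (1 - x\<^sup>n)\<close> stays bounded
  as \<open>x\<close> tends to 1, although its coefficients are nonnegative and at least 1 at the squares.\<close>
lemma L1_nonzero: "L1 \<noteq> 0"
proof
  assume L0: "L1 = 0"
  \<comment> \<open>At x = 1 the first J squares contribute 2N+3, against the bound 2N from partial
    summation. Taking x near 1 gives up at most 1 of this gap, and the truncation errors are kept
    below 1 in total.\<close>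
  define J where "J = 2 * N + 3"
  have "\<exists>x. 0 < x \<and> x < 1 \<and> real J * x ^ (J^2) \<ge> 2 * real N + 2"
  proof -
    have "((\<lambda>x. real J * x ^ (J^2)) \<longlongrightarrow> real J * 1 ^ (J^2)) (at_left (1::real))"
      by (intro tendsto_intros)
    then have "\<forall>\<^sub>F x in at_left (1::real). real J * x ^ (J^2) > 2 * real N + 2"
      by (rule order_tendstoD) (simp add: J_def)
    moreover have "\<forall>\<^sub>F x in at_left (1::real). x \<in> {0<..<1}"
      by (rule eventually_at_leftI[of 0]) auto
    ultimately have "\<forall>\<^sub>F x in at_left (1::real). 0 < x \<and> x < 1 \<and> real J * x ^ (J^2) \<ge> 2 * real N + 2"
      by eventually_elim auto
    then show ?thesis using eventually_happens by fastforce
  qed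
  then obtain x :: real where x: "0 < x" "x < 1" and xJ: "real J * x ^ (J^2) \<ge> 2 * real N + 2" by auto
  \<comment> \<open>The Lambert term is compared with 1/(n(1-x)), whose twisted sum is
    \<open>L1 / (1 - x)\<close>, assumed zero here. The difference decreases from
    \<open>b 1 = 1\<close> to 0, so its twisted sum is at most 2N.\<close>
  define b where "b n = 1 / (real n * (1 - x)) - x ^ n / (1 - x ^ n)" for n
  have dec: "b (Suc n) \<le> b n" if "n \<ge> 1" for n
    using lambert_term_decreasing[OF x that] by (simp add: b_def)
  have b1: "b 1 = 1" using x by (simp add: b_def field_simps)
  have lim: "b \<longlonglongrightarrow> 0"
  proof -
    have p: "(\<lambda>n. x ^ n) \<longlonglongrightarrow> 0" using x by (intro LIMSEQ_power_zero) auto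
    have "(\<lambda>n. (1 / real n) * (1 / (1 - x)) - x ^ n / (1 - x ^ n)) \<longlonglongrightarrow> 0 * (1 / (1 - x)) - 0 / (1 - 0)"
      by (intro tendsto_intros p lim_1_over_n) auto
    then show ?thesis by (simp add: b_def[abs_def] field_simps)
  qed
  have bnn: "0 \<le> b n" if "n \<ge> 1" for n
  proof (rule LIMSEQ_le_const2[OF lim], intro exI allI impI)
    fix k assume "n \<le> k"
    then show "b k \<le> b n" using that by (induction k rule: dec_induct) (use dec in \<open>auto intro: order_trans\<close>)
  qed
  define Lam where "Lam M = (\<Sum>n=1..M. \<chi> n * (x ^ n / (1 - x ^ n)))" for M
  have upper: "Lam M \<le> 2 * real N / (1 - x) / real M + 2 * real N" if M: "M > 0" for M
  proof -
    have "Lam M = (\<Sum>n=1..<Suc M. \<chi> n / real n) / (1 - x) - (\<Sum>n=1..<Suc M. \<chi> n * b n)"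
      unfolding Lam_def b_def sum_divide_distrib sum_subtractf[symmetric]
      by (intro sum.cong) (auto simp: algebra_simps)
    moreover have "\<bar>\<Sum>n=1..<Suc M. \<chi> n * b n\<bar> \<le> 2 * real N"
      using abel_chi[of 1 b "Suc M"] dec bnn b1 by auto
    moreover have "(\<Sum>n=1..<Suc M. \<chi> n / real n) = (\<Sum>n<Suc M. \<chi> n / real n)"
      unfolding lessThan_atLeast0 by (subst (2) sum.atLeast_Suc_lessThan) (auto simp: chi_0)
    moreover have "(\<Sum>n<Suc M. \<chi> n / real n) \<le> 2 * real N / real M"
    proof -
      have "(\<Sum>n<Suc M. \<chi> n / real n) \<le> 2 * real N / real (Suc M)"
        using L1_bound[of "Suc M"] L0 by simp
      also have "\<dots> \<le> 2 * real N / real M" using M by (intro divide_left_mono) auto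
      finally show ?thesis .
    qed
    ultimately show ?thesis
      using x divide_right_mono[of "\<Sum>n<Suc M. \<chi> n / real n" "2 * real N / real M" "1 - x"]
      by (simp add: mult.commute)
  qed
  have lower: "Lam M \<ge> real J * x ^ (J^2) - real M * x ^ M / (1 - x)" if M: "M \<ge> J^2" for M
  proof -
    define A where "A m = (\<Sum>d | d dvd m. \<chi> d)" for m
    \<comment> \<open>Cutting the expansion of x^n/(1-x^n) at exponents nk \<le> M leaves a tail of
      at most x^M/(1-x), an error that is harmless whatever the sign of
      \<open>\<chi> n\<close>.\<close>
    have trm: "\<chi> n * (x ^ n / (1 - x ^ n)) \<ge> (\<Sum>k=1..M div n. \<chi> n * x ^ (n * k)) - x ^ M / (1 - x)"
      if n: "n \<in> {1..M}" for n
    proof -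
      define K where "K = M div n"
      have xn: "x ^ n < 1" "x ^ n \<le> x"
        using x n by (auto simp: power_less_one_iff) (metis One_nat_def power_decreasing power_one_right less_imp_le)
      have geo: "(\<Sum>k=1..K. (x ^ n) ^ k) = (x ^ n - (x ^ n) ^ Suc K) / (1 - x ^ n)"
        using xn by (simp add: sum_gp del: power_Suc)
      have rem: "x ^ n / (1 - x ^ n) = (\<Sum>k=1..K. x ^ (n * k)) + (x ^ n) ^ Suc K / (1 - x ^ n)"
        using geo xn by (simp add: power_mult add_divide_distrib[symmetric])
      have "M \<le> n * Suc K" unfolding K_def using n
        by (metis One_nat_def Suc_le_eq atLeastAtMost_iff dividend_less_times_div less_imp_le mult_Suc_right)
      then have "(x ^ n) ^ Suc K \<le> x ^ M"
        using x by (simp only: power_mult[symmetric]) (intro power_decreasing, auto)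
      then have "(x ^ n) ^ Suc K / (1 - x ^ n) \<le> x ^ M / (1 - x)"
        using x xn by (intro frac_le) auto
      moreover have "0 \<le> (x ^ n) ^ Suc K / (1 - x ^ n)" using x xn by auto
      moreover have "\<bar>\<chi> n * ((x ^ n) ^ Suc K / (1 - x ^ n))\<bar> \<le> (x ^ n) ^ Suc K / (1 - x ^ n)"
        unfolding abs_mult using chi_abs[of n] calculation(2) by (simp only: abs_of_nonneg) (rule mult_left_le_one_le, auto)
      ultimately show ?thesis
        unfolding rem K_def[symmetric] distrib_left sum_distrib_left by linarith
    qed
    have "Lam M \<ge> (\<Sum>n=1..M. (\<Sum>k=1..M div n. \<chi> n * x ^ (n * k)) - x ^ M / (1 - x))"
      unfolding Lam_def by (rule sum_mono) (rule trm)
    moreover have "(\<Sum>n=1..M. (\<Sum>k=1..M div n. \<chi> n * x ^ (n * k)) - x ^ M / (1 - x))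
       = (\<Sum>m=1..M. \<Sum>d | d dvd m. \<chi> d * x ^ (d * (m div d))) - real M * x ^ M / (1 - x)"
      by (simp add: sum_subtractf sum_divisor_pairs[where M = M and F = "\<lambda>n k. \<chi> n * x ^ (n * k)", simplified])
    moreover have "(\<Sum>m=1..M. \<Sum>d | d dvd m. \<chi> d * x ^ (d * (m div d))) = (\<Sum>m=1..M. A m * x ^ m)"
      unfolding A_def sum_distrib_right by (intro sum.cong) auto
    \<comment> \<open>Nonnegativity of the divisor sums permits discarding every m that is not one
      of the first J squares.\<close>
    moreover have "(\<Sum>m=1..M. A m * x ^ m) \<ge> (\<Sum>m\<in>(\<lambda>j. j^2) ` {1..J}. A m * x ^ m)"
    proof (rule sum_mono2)
      show "(\<lambda>j. j^2) ` {1..J} \<subseteq> {1..M}"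
      proof
        fix m assume "m \<in> (\<lambda>j. j^2) ` {1..J}"
        then obtain j where j: "m = j^2" "1 \<le> j" "j \<le> J" by auto
        then have "j^2 \<le> M" using M power_mono[of j J 2] by linarith
        then show "m \<in> {1..M}" using j by (simp add: Suc_le_eq)
      qed
      show "0 \<le> A m * x ^ m" if "m \<in> {1..M} - (\<lambda>j. j^2) ` {1..J}" for m
        using divisor_sum_nonneg[of m] that x by (auto simp: A_def)
    qed auto
    moreover have "(\<Sum>m\<in>(\<lambda>j. j^2) ` {1..J}. A m * x ^ m) = (\<Sum>j=1..J. A (j^2) * x ^ (j^2))"
      by (subst sum.reindex) (auto intro!: inj_onI)
    moreover have "(\<Sum>j=1..J. A (j^2) * x ^ (j^2)) \<ge> (\<Sum>j=1..J. x ^ (J^2))"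
    proof (rule sum_mono)
      fix j assume j: "j \<in> {1..J}"
      then have "j^2 \<le> J^2" by (simp add: power_mono)
      then have "x ^ (J^2) \<le> x ^ (j^2)" using x by (intro power_decreasing) auto
      moreover have "1 \<le> A (j^2)" using divisor_sum_nonneg[of "j^2"] j by (auto simp: A_def)
      moreover have "1 * x ^ (j^2) \<le> A (j^2) * x ^ (j^2)"
        using calculation(2) x by (intro mult_right_mono) auto
      ultimately show "x ^ (J^2) \<le> A (j^2) * x ^ (j^2)" by linarith
    qed
    ultimately show ?thesis by simp
  qed
  have "(\<lambda>M. real M * x ^ M) \<longlonglongrightarrow> 0" using x by (intro powser_times_n_limit_0) auto
  then have "(\<lambda>M. real M * x ^ M / (1 - x) + 2 * real N / (1 - x) * (1 / real M)) \<longlonglongrightarrow>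
      0 / (1 - x) + 2 * real N / (1 - x) * 0"
    using x by (intro tendsto_intros lim_1_over_n) auto
  then have "\<forall>\<^sub>F M in sequentially. real M * x ^ M / (1 - x) + 2 * real N / (1 - x) * (1 / real M) < 1"
    by (rule order_tendstoD) auto
  then have "\<forall>\<^sub>F M in sequentially. real M * x ^ M / (1 - x) + 2 * real N / (1 - x) * (1 / real M) < 1 \<and> M \<ge> J^2 \<and> M > 0"
    by (intro eventually_conj eventually_ge_at_top eventually_gt_at_top)
  then obtain M where M: "real M * x ^ M / (1 - x) + 2 * real N / (1 - x) * (1 / real M) < 1" "M \<ge> J^2" "M > 0"
    unfolding eventually_sequentially by blast
  have "2 * real N / (1 - x) * (1 / real M) = 2 * real N / (1 - x) / real M" by simp
  then show False using M(1) upper[OF M(3)] lower[OF M(2)] xJ by linarith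
qed

end

section \<open>Chebyshev and Mertens bounds for the von Mangoldt function\<close>

lemma sum_mangoldt_floor:
  "(\<Sum>d=1..M. mangoldt d * real (M div d)) = ln (fact M :: real)"
proof -
  have "(\<Sum>d=1..M. mangoldt d * real (M div d)) = (\<Sum>d=1..M. \<Sum>k=1..M div d. mangoldt d)"
    by (simp add: mult.commute)
  also have "\<dots> = (\<Sum>m=1..M. \<Sum>d | d dvd m. mangoldt d)"
    by (rule sum_divisor_pairs)
  also have "\<dots> = (\<Sum>m=1..M. ln (real m))"
    by (intro sum.cong) (auto simp: mangoldt_sum)
  also have "\<dots> = ln (fact M)"
    by (induction M) (auto simp: ln_mult add.commute)
  finally show ?thesis .
qed

definition psi :: "nat \<Rightarrow> real" where "psi M = (\<Sum>d=1..M. mangoldt d)"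

lemma psi_mono: "a \<le> b \<Longrightarrow> psi a \<le> psi b"
  unfolding psi_def by (intro sum_mono2) (auto simp: mangoldt_nonneg)

text \<open>The weight floor(2m/d) - 2 floor(m/d) is never negative and equals 1 for m < d \<le> 2m;
  its Mangoldt sum is the logarithm of the central binomial coefficient, which is at most
  4^m.\<close>

lemma psi_double: "psi (2 * m) - psi m \<le> 2 * real m * ln 2"
proof -
  have "psi (2 * m) - psi m = (\<Sum>d\<in>{m<..2*m}. mangoldt d)"
  proof -
    have "{1..2*m} = {1..m} \<union> {m<..2*m}" by auto
    then have "psi (2*m) = psi m + (\<Sum>d\<in>{m<..2*m}. mangoldt d)"
      unfolding psi_def by (simp add: sum.union_disjoint ivl_disj_int)
    then show ?thesis by simp
  qed
  also have "\<dots> \<le> (\<Sum>d\<in>{m<..2*m}. mangoldt d * (real (2*m div d) - 2 * real (m div d)))"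
  proof (rule sum_mono)
    fix d assume d: "d \<in> {m<..2*m}"
    then have "2 * m div d \<ge> 1" by (simp add: Suc_le_eq div_greater_zero_iff)
    then have "1 \<le> real (2*m div d) - 2 * real (m div d)"
      using d by simp
    then show "mangoldt d \<le> mangoldt d * (real (2*m div d) - 2 * real (m div d))"
      using mult_left_mono[OF _ mangoldt_nonneg[of d]] by fastforce
  qed
  also have "\<dots> \<le> (\<Sum>d=1..2*m. mangoldt d * (real (2*m div d) - 2 * real (m div d)))"
  proof (rule sum_mono2)
    fix d assume "d \<in> {1..2*m} - {m<..2*m}"
    have "2 * (m div d) \<le> 2 * m div d"
      using div_add1_eq[of m m d] by (simp add: mult_2)
    then have "real (2 * (m div d)) \<le> real (2 * m div d)" by (rule of_nat_mono)
    then show "0 \<le> mangoldt d * (real (2*m div d) - 2 * real (m div d))"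
      using mangoldt_nonneg[of d] by simp
  qed auto
  also have "\<dots> = (\<Sum>d=1..2*m. mangoldt d * real (2*m div d)) - 2 * (\<Sum>d=1..2*m. mangoldt d * real (m div d))"
    by (simp add: sum_subtractf sum_distrib_left algebra_simps)
  also have "(\<Sum>d=1..2*m. mangoldt d * real (m div d)) = (\<Sum>d=1..m. mangoldt d * real (m div d))"
    by (rule sum.mono_neutral_right) auto
  also have "(\<Sum>d=1..2*m. mangoldt d * real (2*m div d)) - 2 * (\<Sum>d=1..m. mangoldt d * real (m div d))
      = ln (fact (2*m)) - 2 * ln (fact m :: real)"
    by (simp only: sum_mangoldt_floor)
  also have "\<dots> = ln (real (2*m choose m))"
    by (simp add: binomial_fact ln_div ln_mult)
  also have "\<dots> \<le> ln (2 ^ (2 * m))"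
  proof -
    have "2*m choose m \<le> 2 ^ (2*m)" by (rule binomial_le_pow2)
    then have "real (2*m choose m) \<le> 2 ^ (2*m)" by (metis of_nat_le_iff of_nat_numeral of_nat_power)
    then show ?thesis by (subst ln_le_cancel_iff) (auto simp: zero_less_binomial)
  qed
  also have "\<dots> = 2 * real m * ln 2" by (simp add: ln_realpow)
  finally show ?thesis .
qed

text \<open>With m the half of M rounded up, psi(M) \<le> psi(2m) \<le> psi(m) + 2m since log 2
  \<le> 1; the constant 6 closes the induction because 8m \<le> 4(M+1) \<le> 6M for M \<ge>
  2.\<close>

lemma psi_bound: "psi M \<le> 6 * real M"
proof (induction M rule: less_induct)
  case (less M)
  show ?case
  proof (cases "M \<le> 1")
    case True
    then have "M = 0 \<or> M = 1" by auto
    then show ?thesis by (auto simp: psi_def)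
  next
    case False
    define m where "m = (M + 1) div 2"
    have m: "m < M" "M \<le> 2 * m" "2 * m \<le> M + 1" using False by (auto simp: m_def)
    have "ln (2::real) \<le> 1" using ln_le_minus_one[of 2] by simp
    then have "2 * real m * ln 2 \<le> 2 * real m" using mult_left_mono[of "ln 2" 1 "2 * real m"] by simp
    have "psi M \<le> psi (2 * m)" by (rule psi_mono) (use m in auto)
    also have "\<dots> \<le> psi m + 2 * real m * ln 2" using psi_double[of m] by simp
    also have "\<dots> \<le> 6 * real m + 2 * real m" using less.IH[OF m(1)] \<open>2 * real m * ln 2 \<le> _\<close> by simp
    also have "\<dots> \<le> 4 * real (M + 1)" using of_nat_mono[OF m(3), where 'a = real] by simp
    also have "\<dots> \<le> 6 * real M" using False by simp
    finally show ?thesis .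
  qed
qed

lemma ln_Suc_diff:
  assumes "n > 0"
  shows "ln (real (Suc n)) - ln (real n) \<le> 1 / real n"
proof -
  have "real (Suc n) = real n * (1 + 1 / real n)" using assms by (simp add: field_simps)
  then have "ln (real (Suc n)) = ln (real n) + ln (1 + 1 / real n)"
    using assms by (simp only:) (subst ln_mult, auto simp: add_pos_pos)
  also have "ln (1 + 1 / real n) \<le> 1 / real n" by (intro ln_add_one_self_le_self) auto
  finally show ?thesis by simp
qed

text \<open>Dropping the floors in Legendre's formula for log M! only increases the sum, and log M!
  \<ge> M log M - M.\<close>

lemma mertens_lower: "M > 0 \<Longrightarrow> (\<Sum>d=1..M. mangoldt d / real d) \<ge> ln (real M) - 1"
proof -
  assume M: "M > 0"
  have fact: "ln (fact M :: real) \<ge> real M * ln (real M) - real M"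
    using M
  proof (induction M rule: nat_induct_non_zero)
    case (Suc n)
    have "real n * (ln (real (Suc n)) - ln (real n)) \<le> 1"
    proof -
      show ?thesis using ln_Suc_diff[of n] Suc by (simp add: field_simps)
    qed
    moreover have "ln (fact (Suc n) :: real) = ln (real (Suc n)) + ln (fact n)"
      unfolding fact_Suc by (subst ln_mult) auto
    ultimately show ?case using Suc by (simp add: algebra_simps del: fact_Suc)
  qed simp
  have "ln (fact M :: real) \<le> (\<Sum>d=1..M. mangoldt d * (real M / real d))"
    unfolding sum_mangoldt_floor[symmetric]
    by (intro sum_mono mult_left_mono mangoldt_nonneg) (auto simp: of_nat_div_le_of_nat)
  also have "\<dots> = real M * (\<Sum>d=1..M. mangoldt d / real d)"
    by (simp add: sum_distrib_left mult_ac)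
  finally have "real M * (ln (real M) - 1) \<le> real M * (\<Sum>d=1..M. mangoldt d / real d)"
    using fact by (simp add: algebra_simps)
  then show ?thesis using M by simp
qed

section \<open>Mangoldt sums twisted by a real character\<close>

context real_character
begin

text \<open>The weight log n / n is shown to decrease from n = 3 on, where log n \<ge> 1; partial
  summation handles that tail and the earlier terms are estimated separately.\<close>

lemma chi_log_bounded: "\<exists>C. \<forall>M. \<bar>\<Sum>n=1..M. \<chi> n * (ln (real n) / real n)\<bar> \<le> C"
proof -
  have dec: "ln (real (Suc n)) / real (Suc n) \<le> ln (real n) / real n" if "n \<ge> 3" for n
  proof -
    have 1: "real n * ln (real (Suc n)) \<le> real n * ln (real n) + 1"
      using ln_Suc_diff[of n] that by (simp add: field_simps)
    have "exp 1 \<le> real n" using exp_le that by linarith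
    then have "1 \<le> ln (real n)" using that by (subst ln_ge_iff) auto
    then have "real n * ln (real (Suc n)) \<le> real (Suc n) * ln (real n)"
      using 1 by (simp add: algebra_simps)
    then show ?thesis using that by (simp add: field_simps del: of_nat_Suc)
  qed
  have tail: "\<bar>\<Sum>n=3..<Suc M. \<chi> n * (ln (real n) / real n)\<bar> \<le> 2 * real N * (ln 3 / 3)" for M
    using abel_chi[of 3 "\<lambda>n. ln (real n) / real n" "Suc M"] dec by auto
  have "\<bar>\<Sum>n=1..M. \<chi> n * (ln (real n) / real n)\<bar> \<le> 2 * real N * (ln 3 / 3) + \<bar>\<chi> 2 * (ln 2 / 2)\<bar>" for M
  proof (cases "M \<ge> 2")
    case True
    then have "{1..M} = {1,2} \<union> {3..<Suc M}" by auto
    then have "(\<Sum>n=1..M. \<chi> n * (ln (real n) / real n)) =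
      (\<Sum>n\<in>{1,2}. \<chi> n * (ln (real n) / real n)) + (\<Sum>n=3..<Suc M. \<chi> n * (ln (real n) / real n))"
      by (simp only:) (rule sum.union_disjoint, auto)
    then show ?thesis using tail[of M] by simp
  next
    case False
    then have "M = 0 \<or> M = 1" by auto
    then show ?thesis by auto
  qed
  then show ?thesis by blast
qed

text \<open>Writing log as the divisor sum of the Mangoldt function turns the bounded sum of
  \<chi>(n) log n / n into a twisted Mangoldt sum weighted by truncations \<open>G d\<close> of the
  L-series. Replacing each \<open>G d\<close> by \<open>L1\<close> costs O(psi(M)/M) = O(1), and
  \<open>L1 \<noteq> 0\<close> allows division.\<close>

lemma chi_mangoldt_bounded: "\<exists>C. \<forall>M. \<bar>\<Sum>n=1..M. \<chi> n * mangoldt n / real n\<bar> \<le> C"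
proof -
  obtain C where C: "\<And>M. \<bar>\<Sum>n=1..M. \<chi> n * (ln (real n) / real n)\<bar> \<le> C"
    using chi_log_bounded by blast
  have "\<bar>\<Sum>n=1..M. \<chi> n * mangoldt n / real n\<bar> \<le> (C + 12 * real N) / \<bar>L1\<bar>" for M
  proof (cases "M = 0")
    case True
    have "0 \<le> C" using C[of 0] by simp
    then show ?thesis using True by simp
  next
    case False
    define G where "G d = (\<Sum>k=1..M div d. \<chi> k / real k)" for d
    have "(\<Sum>m=1..M. \<chi> m * (ln (real m) / real m))
        = (\<Sum>m=1..M. \<Sum>d | d dvd m. (\<chi> d * mangoldt d / real d) * (\<chi> (m div d) / real (m div d)))"
    proof (intro sum.cong refl)
      fix m assume m: "m \<in> {1..M}"
      then have "ln (real m) = (\<Sum>d | d dvd m. mangoldt d)" by (simp add: mangoldt_sum)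
      then have "\<chi> m * (ln (real m) / real m) = (\<Sum>d | d dvd m. \<chi> m * (mangoldt d / real m))"
        by (simp add: sum_distrib_left sum_divide_distrib)
      also have "\<dots> = (\<Sum>d | d dvd m. (\<chi> d * mangoldt d / real d) * (\<chi> (m div d) / real (m div d)))"
      proof (intro sum.cong refl)
        fix d assume "d \<in> {d. d dvd m}"
        then obtain k where k: "m = d * k" by auto
        then have "d > 0" "k > 0" using m by (auto intro!: Nat.gr0I)
        then show "\<chi> m * (mangoldt d / real m) = (\<chi> d * mangoldt d / real d) * (\<chi> (m div d) / real (m div d))"
          by (simp add: k mult)
      qed
      finally show "\<chi> m * (ln (real m) / real m) = \<dots>" .
    qed
    also have "\<dots> = (\<Sum>d=1..M. \<Sum>k=1..M div d. (\<chi> d * mangoldt d / real d) * (\<chi> k / real k))"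
      by (rule sum_divisor_pairs[symmetric])
    also have "\<dots> = (\<Sum>d=1..M. (\<chi> d * mangoldt d / real d) * G d)"
      by (simp add: G_def sum_distrib_left)
    also have "\<dots> = L1 * (\<Sum>d=1..M. \<chi> d * mangoldt d / real d) + (\<Sum>d=1..M. (\<chi> d * mangoldt d / real d) * (G d - L1))"
      unfolding sum_distrib_left sum.distrib[symmetric] by (intro sum.cong refl) (simp add: right_diff_distrib)
    finally have eq: "L1 * (\<Sum>d=1..M. \<chi> d * mangoldt d / real d) =
      (\<Sum>m=1..M. \<chi> m * (ln (real m) / real m)) - (\<Sum>d=1..M. (\<chi> d * mangoldt d / real d) * (G d - L1))"
      by simp
    have G: "\<bar>G d - L1\<bar> \<le> 2 * real N * real d / real M" if d: "d \<in> {1..M}" for d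
    proof -
      have "G d = (\<Sum>k<Suc (M div d). \<chi> k / real k)"
        unfolding G_def by (rule sum.mono_neutral_left) (auto simp: chi_0)
      then have "\<bar>G d - L1\<bar> \<le> 2 * real N / real (Suc (M div d))"
        using L1_bound[of "Suc (M div d)"] by (simp only: abs_minus_commute[of _ L1])
      also have "\<dots> \<le> 2 * real N / (real M / real d)"
      proof (rule divide_left_mono)
        have "M < d * Suc (M div d)" using d by (metis atLeastAtMost_iff dividend_less_times_div mult_Suc_right less_eq_Suc_le One_nat_def)
        then have "real M \<le> real d * real (Suc (M div d))" by (metis less_imp_le of_nat_le_iff of_nat_mult)
        then show "real M / real d \<le> real (Suc (M div d))" using d by (simp add: field_simps del: of_nat_Suc)
      qed (use d in auto)
      finally show ?thesis by simp
    qed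
    have "\<bar>\<Sum>d=1..M. (\<chi> d * mangoldt d / real d) * (G d - L1)\<bar> \<le> (\<Sum>d=1..M. mangoldt d * (2 * real N / real M))"
    proof (rule order_trans[OF sum_abs], rule sum_mono)
      fix d assume d: "d \<in> {1..M}"
      have "\<bar>(\<chi> d * mangoldt d / real d) * (G d - L1)\<bar> = \<bar>\<chi> d\<bar> * (mangoldt d / real d * \<bar>G d - L1\<bar>)"
        by (simp add: abs_mult)
      also have "\<dots> \<le> 1 * (mangoldt d / real d * (2 * real N * real d / real M))"
        by (intro mult_mono chi_abs G d order_refl mult_nonneg_nonneg divide_nonneg_nonneg mangoldt_nonneg) auto
      also have "\<dots> = mangoldt d * (2 * real N / real M)" using d by (simp add: field_simps)
      finally show "\<bar>(\<chi> d * mangoldt d / real d) * (G d - L1)\<bar> \<le> mangoldt d * (2 * real N / real M)" .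
    qed
    also have "\<dots> = psi M * (2 * real N / real M)" unfolding psi_def by (rule sum_distrib_right[symmetric])
    also have "\<dots> \<le> (6 * real M) * (2 * real N / real M)" by (intro mult_right_mono psi_bound) auto
    also have "\<dots> = 12 * real N" using False by simp
    finally have "\<bar>L1 * (\<Sum>d=1..M. \<chi> d * mangoldt d / real d)\<bar> \<le> C + 12 * real N"
      unfolding eq using C[of M] by linarith
    then show ?thesis using L1_nonzero by (simp add: abs_mult field_simps)
  qed
  then show ?thesis by blast
qed

end

text \<open>The Mangoldt value at m^2 is at most 2 log m = 4 log sqrt m \<le> 4 sqrt m, which leaves
  the sum of m^(-3/2); beyond m = 1 it is dominated by the telescoping sum of 2/sqrt(m-1) - 2/sqrt
  m.\<close>

lemma squares_mangoldt_bounded: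
  "\<exists>C. \<forall>X. (\<Sum>m=1..X. mangoldt (m^2) / real (m^2)) \<le> C"
proof -
  have tel: "(\<Sum>m=1..X. sqrt (real m) / real (m^2)) \<le> 3 - 2 / sqrt (real X)" if "X > 0" for X
    using that
  proof (induction X rule: nat_induct_non_zero)
    case (Suc n)
    define a b where "a = sqrt (real n)" and "b = sqrt (real (Suc n))"
    have ab: "0 < a" "a \<le> b" "0 < b" "b * b - a * a = 1" using Suc by (auto simp: a_def b_def)
    have "(b - a) * (b + a) = 1" using ab(4) by (simp add: algebra_simps)
    have "2 / a - 2 / b = 2 * (b - a) / (a * b)" using ab by (simp add: field_simps)
    also have "\<dots> = 2 * (b - a) * (b + a) / (a * b * (b + a))" using ab by simp
    also have "\<dots> = 2 / (a * b * (b + a))" using \<open>(b - a) * (b + a) = 1\<close> by (simp only: mult.assoc mult_1_right)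
    also have "\<dots> \<ge> 2 / (b * b * (b + b))"
      using ab by (intro divide_left_mono mult_mono add_mono mult_pos_pos) auto
    also have "2 / (b * b * (b + b)) = 1 / (b * b * b)" using ab(3) by simp
    finally have "1 / (b * b * b) \<le> 2 / a - 2 / b" .
    moreover have "sqrt (real (Suc n)) / real ((Suc n)^2) = 1 / (b * b * b)"
    proof -
      have "b * b = real (Suc n)" by (simp add: b_def del: of_nat_Suc)
      then have "real ((Suc n)^2) = (b * b) * (b * b)" by (simp only: power2_eq_square of_nat_mult)
      then show ?thesis using ab(3) unfolding b_def[symmetric] by (simp only:) simp
    qed
    moreover have "(\<Sum>m=1..Suc n. sqrt (real m) / real (m^2)) =
        (\<Sum>m=1..n. sqrt (real m) / real (m^2)) + sqrt (real (Suc n)) / real ((Suc n)^2)"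
      by (subst sum.nat_ivl_Suc') (simp_all only: add.commute le_add1 Suc_eq_plus1)
    ultimately show ?case using Suc.IH unfolding a_def[symmetric] b_def[symmetric] by linarith
  qed simp
  have "(\<Sum>m=1..X. mangoldt (m^2) / real (m^2)) \<le> 12" for X
  proof -
    have "(\<Sum>m=1..X. mangoldt (m^2) / real (m^2)) \<le> (\<Sum>m=1..X. 4 * (sqrt (real m) / real (m^2)))"
    proof (rule sum_mono)
      fix m assume m: "m \<in> {1..X}"
      have "mangoldt (m^2) \<le> ln (real (m^2))" using m by (intro mangoldt_le) auto
      also have "\<dots> = 4 * ln (sqrt (real m))" using m by (simp add: ln_realpow ln_sqrt)
      also have "\<dots> \<le> 4 * sqrt (real m)" using m ln_le_minus_one[of "sqrt (real m)"] by simp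
      finally have "mangoldt (m^2) / real (m^2) \<le> 4 * sqrt (real m) / real (m^2)"
        by (intro divide_right_mono) auto
      then show "mangoldt (m^2) / real (m^2) \<le> 4 * (sqrt (real m) / real (m^2))" by simp
    qed
    also have "\<dots> = 4 * (\<Sum>m=1..X. sqrt (real m) / real (m^2))" by (simp add: sum_distrib_left)
    also have "\<dots> \<le> 12"
    proof (cases "X = 0")
      case False
      moreover have "0 \<le> 2 / sqrt (real X)" by simp
      ultimately show ?thesis using tel[of X] by linarith
    qed simp
    finally show ?thesis .
  qed
  then show ?thesis by blast
qed

text \<open>Expanding \<open>\<Prod>\<^sub>i (1 + \<epsilon>\<^sub>i \<chi>\<^sub>i)\<close> shows that the sum of \<open>\<Lambda>(n)/n\<close> over the \<open>n\<close> with
  \<open>\<chi>\<^sub>i n = \<epsilon>\<^sub>i\<close> for all \<open>i\<close> diverges; squares and powers of the prime factors of \<open>M\<close> contribute a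
  bounded amount, and every other prime power in the sum is an odd power of a suitable prime.\<close>
theorem prime_with_prescribed_characters:
  fixes \<chi> :: "'i \<Rightarrow> nat \<Rightarrow> real" and \<epsilon> :: "'i \<Rightarrow> real"
  assumes fin: "finite I" and M: "M > 0"
    and chars: "\<And>J. J \<subseteq> I \<Longrightarrow> J \<noteq> {} \<Longrightarrow> real_character (\<lambda>n. \<Prod>i\<in>J. \<chi> i n) N"
    and nz: "\<And>i n. i \<in> I \<Longrightarrow> coprime n M \<Longrightarrow> \<chi> i n \<noteq> 0"
    and eps: "\<And>i. i \<in> I \<Longrightarrow> \<epsilon> i \<in> {-1, 1}"
  shows "\<exists>p. prime p \<and> \<not> p dvd M \<and> (\<forall>i\<in>I. \<chi> i p = \<epsilon> i)"
proof (rule ccontr)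
  assume no: "\<not> ?thesis"
  have char1: "real_character (\<chi> i) N" if "i \<in> I" for i
    using chars[of "{i}"] that by simp
  \<comment> \<open>Each factor is 2, 0 or 1 according as \<open>\<chi> i n\<close> is
    \<open>\<epsilon> i\<close>, its negative, or 0.\<close>
  define w where "w n = (\<Prod>i\<in>I. \<epsilon> i * \<chi> i n + 1)" for n
  have factor: "0 \<le> \<epsilon> i * \<chi> i n + 1 \<and> \<epsilon> i * \<chi> i n + 1 \<le> 2" if "i \<in> I" for i n
    using real_character.range[OF char1[OF that], of n] eps[OF that] by auto
  have w: "0 \<le> w n" "w n \<le> 2 ^ card I" for n
    unfolding w_def using factor prod_mono[of I "\<lambda>i. \<epsilon> i * \<chi> i n + 1" "\<lambda>_. 2"]
    by (auto intro!: prod_nonneg)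
  have expand: "w n = (\<Sum>J\<in>Pow I. (\<Prod>i\<in>J. \<epsilon> i) * (\<Prod>i\<in>J. \<chi> i n))" for n
    unfolding w_def prod_add[OF fin] by (simp add: prod.distrib)
  have "\<forall>J\<in>Pow I - {{}}. \<exists>C. \<forall>X. \<bar>\<Sum>n=1..X. (\<Prod>i\<in>J. \<chi> i n) * mangoldt n / real n\<bar> \<le> C"
    using chars real_character.chi_mangoldt_bounded by blast
  then obtain C where C: "\<And>J X. J \<in> Pow I - {{}} \<Longrightarrow> \<bar>\<Sum>n=1..X. (\<Prod>i\<in>J. \<chi> i n) * mangoldt n / real n\<bar> \<le> C J"
    by metis
  define CC where "CC = (\<Sum>J\<in>Pow I - {{}}. C J)"
  have lower: "(\<Sum>n=1..X. w n * mangoldt n / real n) \<ge> ln (real X) - 1 - CC" if "X > 0" for X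
  proof -
    define H where "H J = (\<Sum>n=1..X. (\<Prod>i\<in>J. \<chi> i n) * mangoldt n / real n)" for J
    have "(\<Sum>n=1..X. w n * mangoldt n / real n)
        = (\<Sum>n=1..X. \<Sum>J\<in>Pow I. (\<Prod>i\<in>J. \<epsilon> i) * ((\<Prod>i\<in>J. \<chi> i n) * mangoldt n / real n))"
      unfolding expand by (simp add: sum_distrib_right sum_divide_distrib mult.assoc)
    also have "\<dots> = (\<Sum>J\<in>Pow I. (\<Prod>i\<in>J. \<epsilon> i) * H J)"
      unfolding H_def sum_distrib_left by (rule sum.swap)
    \<comment> \<open>The empty subset is the principal term and carries the logarithm from the
      Mertens bound; the other subsets give nonprincipal real characters and stay bounded.\<close>
    also have "\<dots> = H {} + (\<Sum>J\<in>Pow I - {{}}. (\<Prod>i\<in>J. \<epsilon> i) * H J)"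
      using fin by (subst sum.remove[of _ "{}"]) auto
    finally have eq: "(\<Sum>n=1..X. w n * mangoldt n / real n) = \<dots>" .
    have "\<bar>\<Sum>J\<in>Pow I - {{}}. (\<Prod>i\<in>J. \<epsilon> i) * H J\<bar> \<le> CC"
      unfolding CC_def
    proof (rule order_trans[OF sum_abs], rule sum_mono)
      fix J assume J: "J \<in> Pow I - {{}}"
      have "\<bar>\<Prod>i\<in>J. \<epsilon> i\<bar> = (\<Prod>i\<in>J. \<bar>\<epsilon> i\<bar>)" by (rule abs_prod)
      also have "\<dots> = (\<Prod>i\<in>J. 1)" by (rule prod.cong) (use eps J in fastforce)+
      finally have "\<bar>\<Prod>i\<in>J. \<epsilon> i\<bar> = 1" by simp
      then show "\<bar>(\<Prod>i\<in>J. \<epsilon> i) * H J\<bar> \<le> C J" using C[OF J, of X] by (simp add: abs_mult H_def)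
    qed
    moreover have "H {} \<ge> ln (real X) - 1" using mertens_lower[OF that] by (simp add: H_def)
    ultimately show ?thesis unfolding eq by linarith
  qed
  define P where "P = prime_factors M"
  obtain C2 where C2: "\<And>X. (\<Sum>m=1..X. mangoldt (m^2) / real (m^2)) \<le> (C2::real)"
    using squares_mangoldt_bounded by blast
  have upper: "(\<Sum>n=1..X. w n * mangoldt n / real n) \<le> 2 ^ card I * (C2 + (\<Sum>p\<in>P. ln (real p)))" for X
  proof -
    define B1 where "B1 n = (\<Sum>m=1..X. if n = m^2 then mangoldt (m^2) / real (m^2) else (0::real))" for n
    define B2 where "B2 n = (\<Sum>p\<in>P. \<Sum>k=1..X. if n = p ^ k then ln (real p) / real (p ^ k) else 0)" for n
    have B1nn: "0 \<le> B1 n" for n unfolding B1_def by (intro sum_nonneg) (auto simp: mangoldt_nonneg)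
    have Pp: "prime p" if "p \<in> P" for p using that by (auto simp: P_def)
    have lnp: "0 \<le> ln (real p)" if "p \<in> P" for p
      using prime_gt_0_nat[OF Pp[OF that]] by simp
    have B2nn: "0 \<le> B2 n" for n unfolding B2_def by (intro sum_nonneg) (auto simp: lnp)
    have pointwise: "w n * mangoldt n / real n \<le> 2 ^ card I * (B1 n + B2 n)" if n: "n \<in> {1..X}" for n
    proof -
      have main: "w n * mangoldt n / real n = 0 \<or> mangoldt n / real n \<le> B1 n + B2 n"
      proof (cases "primepow n")
        case True
        then obtain p k where pk: "prime p" "n = p ^ k" "k > 0" unfolding primepow_def by auto
        have kX: "k \<le> X"
        proof -
          have "k < 2 ^ k" by (rule less_exp)
          also have "2 ^ k \<le> p ^ k" using pk by (simp add: power_mono prime_ge_2_nat)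
          finally have "k < p ^ k" .
          then show ?thesis using pk n by auto
        qed
        have lam: "mangoldt n = ln (real p)" using pk by simp
        show ?thesis
        proof (cases "p dvd M")
          case True
          then have pP: "p \<in> P" using pk M by (auto simp: P_def prime_factors_dvd)
          have "ln (real p) / real (p ^ k) \<le> (\<Sum>k'=1..X. if n = p ^ k' then ln (real p) / real (p ^ k') else 0)"
            using member_le_sum[of k "{1..X}" "\<lambda>k'. if n = p ^ k' then ln (real p) / real (p ^ k') else 0"]
              pk kX lnp[OF pP] by auto
          also have "\<dots> \<le> B2 n"
            unfolding B2_def
            by (rule member_le_sum[OF pP]) (use lnp in \<open>auto simp: P_def intro!: sum_nonneg\<close>)
          finally show ?thesis using B1nn[of n] lam pk by simp
        next
          case False
          show ?thesis
          proof (cases "even k")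
            case True
            then obtain h where h: "k = 2 * h" by blast
            define m where "m = p ^ h"
            have m: "n = m^2" using pk h by (simp add: m_def power_mult[symmetric] mult.commute)
            have "m \<in> {1..X}" using n pk(1) m self_le_power[of m 2]
              by (auto simp: Suc_le_eq m_def prime_gt_0_nat)
            then have "mangoldt n / real n \<le> B1 n"
              unfolding B1_def
              using member_le_sum[of m "{1..X}" "\<lambda>m. if n = m^2 then mangoldt (m^2) / real (m^2) else 0"] m
              by (auto simp: mangoldt_nonneg)
            then show ?thesis using B2nn[of n] by simp
          next
            case odd: False
            \<comment> \<open>If no suitable prime exists, p has the wrong sign at some i; an odd
              power of p keeps that sign, so the weight \<open>w n\<close> vanishes.\<close>
            obtain i where i: "i \<in> I" "\<chi> i p \<noteq> \<epsilon> i" using no pk False by blast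
            interpret real_character "\<chi> i" N by (rule char1[OF i(1)])
            have "coprime p M" using pk False by (simp add: prime_imp_coprime)
            then have "\<chi> i p = - \<epsilon> i" using i nz[OF i(1)] eps[OF i(1)] range[of p] by auto
            then have "\<epsilon> i * \<chi> i n + 1 = 0"
              using eps[OF i(1)] odd by (auto simp: pk(2) chi_power)
            then have "w n = 0" unfolding w_def using i(1) fin by (auto simp: prod_zero_iff)
            then show ?thesis by simp
          qed
        qed
      qed (auto simp: mangoldt_def)
      then show ?thesis
      proof
        assume "mangoldt n / real n \<le> B1 n + B2 n"
        then have "w n * (mangoldt n / real n) \<le> 2 ^ card I * (B1 n + B2 n)"
          using w B1nn[of n] B2nn[of n] by (intro mult_mono) (auto simp: mangoldt_nonneg)
        then show ?thesis by simp
      qed (use B1nn[of n] B2nn[of n] in auto)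
    qed
    have "(\<Sum>n=1..X. w n * mangoldt n / real n) \<le> (\<Sum>n=1..X. 2 ^ card I * (B1 n + B2 n))"
      by (rule sum_mono) (rule pointwise)
    also have "\<dots> = 2 ^ card I * ((\<Sum>n=1..X. B1 n) + (\<Sum>n=1..X. B2 n))"
      by (simp only: sum_distrib_left[symmetric] sum.distrib)
    also have "(\<Sum>n=1..X. B1 n) \<le> C2"
    proof -
      have "(\<Sum>n=1..X. B1 n) = (\<Sum>m=1..X. \<Sum>n=1..X. if n = m^2 then mangoldt (m^2) / real (m^2) else (0::real))"
        unfolding B1_def by (rule sum.swap)
      also have "\<dots> \<le> (\<Sum>m=1..X. mangoldt (m^2) / real (m^2))"
        by (intro sum_mono) (auto simp: sum.delta mangoldt_nonneg)
      also have "\<dots> \<le> C2" by (rule C2)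
      finally show ?thesis .
    qed
    also have "(\<Sum>n=1..X. B2 n) \<le> (\<Sum>p\<in>P. ln (real p))"
    proof -
      have "(\<Sum>n=1..X. B2 n) = (\<Sum>p\<in>P. \<Sum>k=1..X. \<Sum>n=1..X. if n = p ^ k then ln (real p) / real (p ^ k) else 0)"
        unfolding B2_def by (subst sum.swap, rule sum.cong, simp, rule sum.swap)
      also have "\<dots> \<le> (\<Sum>p\<in>P. ln (real p))"
      proof (rule sum_mono)
        fix p assume p: "p \<in> P"
        have p2: "2 \<le> real p" using prime_ge_2_nat[OF Pp[OF p]] by simp
        have "(\<Sum>k=1..X. \<Sum>n=1..X. if n = p ^ k then ln (real p) / real (p ^ k) else 0)
            \<le> (\<Sum>k=1..X. ln (real p) * (1/2) ^ k)"
        proof (rule sum_mono)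
          fix k
          have "ln (real p) / real (p ^ k) \<le> ln (real p) / 2 ^ k"
            using p2 lnp[OF p] by (intro divide_left_mono) (auto simp: power_mono)
          then show "(\<Sum>n=1..X. if n = p ^ k then ln (real p) / real (p ^ k) else 0) \<le> ln (real p) * (1/2) ^ k"
            using lnp[OF p] by (auto simp: sum.delta power_one_over)
        qed
        also have "\<dots> = ln (real p) * (\<Sum>k=1..X. (1/2) ^ k)" by (simp add: sum_distrib_left)
        also have "\<dots> \<le> ln (real p) * 1"
          by (intro mult_left_mono lnp p) (simp add: sum_gp)
        finally show "(\<Sum>k=1..X. \<Sum>n=1..X. if n = p ^ k then ln (real p) / real (p ^ k) else 0) \<le> ln (real p)"
          by simp
      qed
      finally show ?thesis .
    qed
    finally show ?thesis by simp
  qed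
  define K where "K = 1 + CC + 2 ^ card I * (C2 + (\<Sum>p\<in>P. ln (real p)))"
  obtain X :: nat where X: "real X > exp K" using reals_Archimedean2 by blast
  have "real X > 0" using X exp_gt_zero[of K] by linarith
  then have "ln (real X) > K" using X by (metis exp_ln exp_less_cancel_iff)
  then show False using lower[of X] upper[of X] \<open>real X > 0\<close> by (simp add: K_def)
qed

section \<open>Hilbert symbols over the rationals\<close>

lemma prime_not_dvd_1: "prime p \<Longrightarrow> \<not> int p dvd 1"
  by (metis int_dvd_int_iff nat_dvd_1_iff_1 not_prime_1 of_nat_1)

lemma Legendre_cong: "[a = b] (mod p) \<Longrightarrow> Legendre a p = Legendre b p"
  by (simp add: Legendre_def QuadRes_def cong_def)

lemma Legendre_eq_0: "Legendre a p = 0 \<longleftrightarrow> p dvd a"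
  by (auto simp: Legendre_def cong_0_iff)

lemma Legendre_cases: "\<not> p dvd a \<Longrightarrow> Legendre a p = 1 \<or> Legendre a p = -1"
  by (auto simp: Legendre_def cong_0_iff)

lemma Legendre_range: "Legendre a p \<in> {-1, 0, 1}"
  by (auto simp: Legendre_def)

lemma Legendre_square: "\<not> p dvd a \<Longrightarrow> Legendre (a^2) p = 1" if "prime (p::int)" for a p
  using that by (auto simp: Legendre_def QuadRes_def cong_0_iff prime_dvd_power_iff intro: exI[of _ a])

text \<open>Serves to upgrade congruences between symbol values modulo an odd prime to equalities,
  since such values differ by at most 2.\<close>

lemma small_dvd_eq: "(d::int) dvd x - y \<Longrightarrow> \<bar>x - y\<bar> < d \<Longrightarrow> x = y"
  using dvd_imp_le_int[of "x - y" d] by (cases "x = y") auto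

lemma Legendre_mult:
  assumes "prime p" "p \<noteq> 2"
  shows "Legendre (a * b) (int p) = Legendre a (int p) * Legendre b (int p)"
proof -
  have p2: "p > 2" using assms prime_gt_1_nat[of p] by linarith
  have "[Legendre (a * b) (int p) = (a * b) ^ ((p - 1) div 2)] (mod int p)"
    using euler_criterion assms p2 by blast
  moreover have "[Legendre a (int p) * Legendre b (int p) = a ^ ((p - 1) div 2) * b ^ ((p - 1) div 2)] (mod int p)"
    using euler_criterion assms p2 cong_mult by blast
  ultimately have c: "[Legendre (a * b) (int p) = Legendre a (int p) * Legendre b (int p)] (mod int p)"
    by (metis cong_sym cong_trans power_mult_distrib)
  have "\<bar>Legendre (a * b) (int p) - Legendre a (int p) * Legendre b (int p)\<bar> \<le> 2"
    using Legendre_range[of "a * b" "int p"] Legendre_range[of a "int p"] Legendre_range[of b "int p"] by auto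
  then have "\<bar>Legendre (a * b) (int p) - Legendre a (int p) * Legendre b (int p)\<bar> < int p" using p2 by linarith
  moreover have "int p dvd Legendre (a * b) (int p) - Legendre a (int p) * Legendre b (int p)"
    using c by (simp add: cong_iff_dvd_diff)
  ultimately show ?thesis using small_dvd_eq by blast
qed

lemma Legendre_1: "prime p \<Longrightarrow> Legendre 1 (int p) = 1"
  by (auto simp: Legendre_def QuadRes_def cong_0_iff intro: exI[of _ 1] dest: prime_gt_1_nat)

lemma Legendre_minus_1:
  assumes "prime p" "p \<noteq> 2"
  shows "Legendre (-1) (int p) = (if int p mod 4 = 3 then -1 else 1)"
proof -
  have "int p mod 4 = 3 \<longleftrightarrow> p mod 4 = 3" by presburger
  moreover have "Legendre (-1) (int p) = (if p mod 4 = 3 then -1 else 1)"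
  proof -
    have p2: "p > 2" using assms prime_gt_1_nat[of p] by linarith
    have "odd p" using assms p2 prime_odd_nat by blast
    have "[Legendre (-1) (int p) = (-1) ^ ((p - 1) div 2)] (mod int p)"
      using euler_criterion assms p2 by blast
    also have "(-1::int) ^ ((p - 1) div 2) = (if p mod 4 = 3 then -1 else 1)"
    proof -
      have "even ((p - 1) div 2) \<longleftrightarrow> p mod 4 \<noteq> 3" using \<open>odd p\<close> by presburger
      then show ?thesis by auto
    qed
    finally have "int p dvd Legendre (-1) (int p) - (if p mod 4 = 3 then -1 else 1)"
      by (simp add: cong_iff_dvd_diff)
    moreover have "\<bar>Legendre (-1) (int p) - (if p mod 4 = 3 then -1 else 1)\<bar> < int p"
      using Legendre_range[of "-1" "int p"] p2 by auto
    ultimately show ?thesis using small_dvd_eq by blast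
  qed
  ultimately show ?thesis by simp
qed

text \<open>The values of \<open>chi4\<close> and \<open>chi8\<close> together determine the class
  of an odd number modulo 8; \<open>chi8\<close> is the Kronecker symbol (2/a).\<close>

definition chi4 :: "int \<Rightarrow> int" where
  "chi4 a = (if a mod 4 = 1 then 1 else if a mod 4 = 3 then -1 else 0)"

definition chi8 :: "int \<Rightarrow> int" where
  "chi8 a = (if a mod 8 \<in> {1, 7} then 1 else if a mod 8 \<in> {3, 5} then -1 else 0)"

lemma odd_mod_8: "odd (a::int) \<Longrightarrow> a mod 8 \<in> {1, 3, 5, 7}"
  by simp presburger

lemma odd_mod_4: "odd (a::int) \<Longrightarrow> a mod 4 = 1 \<or> a mod 4 = 3"
  by presburger

lemma chi4_mult: "chi4 (a * b) = chi4 a * chi4 b"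
proof -
  have "a mod 4 \<in> {0,1,2,3}" "b mod 4 \<in> {0,1,2,3}" by auto
  moreover have "a * b mod 4 = (a mod 4) * (b mod 4) mod 4" by (simp add: mod_mult_eq)
  ultimately show ?thesis unfolding chi4_def by (elim insertE emptyE) simp_all
qed

lemma chi8_mult: "chi8 (a * b) = chi8 a * chi8 b"
proof -
  have "a mod 8 \<in> {0,1,2,3,4,5,6,7}" "b mod 8 \<in> {0,1,2,3,4,5,6,7}" by auto
  moreover have "a * b mod 8 = (a mod 8) * (b mod 8) mod 8" by (simp add: mod_mult_eq)
  ultimately show ?thesis unfolding chi8_def by (elim insertE emptyE) simp_all
qed

lemma chi8_odd: "odd a \<Longrightarrow> chi8 a = 1 \<or> chi8 a = -1"
  using odd_mod_8[of a] by (auto simp: chi8_def)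

lemma chi4_odd: "odd a \<Longrightarrow> chi4 a = 1 \<or> chi4 a = -1"
  using odd_mod_4[of a] by (auto simp: chi4_def)

text \<open>Gauss's lemma: with m = (p-1)/2, the multiples 2x with x \<le> m that exceed m are those
  with x > m div 2, and the parity of their number depends on p modulo 8.\<close>

lemma Legendre_2:
  assumes "prime p" "p \<noteq> 2"
  shows "Legendre 2 (int p) = chi8 (int p)"
proof -
  have p2: "p > 2" using assms prime_gt_1_nat[of p] by linarith
  have odd: "odd p" using assms p2 prime_odd_nat by blast
  have "\<not> int p dvd 2" using p2 by (auto dest: zdvd_imp_le)
  then interpret GAUSS p 2 using assms p2 by unfold_locales (auto simp: cong_0_iff)
  define m where "m = (int p - 1) div 2"
  have m: "int p = 2 * m + 1" "m > 0" using p_eq2 p2 by (auto simp: m_def)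
  have "C = (\<lambda>x. 2 * x) ` {0<..m}"
    unfolding C_def B_def A_def image_image m_def[symmetric]
    by (rule image_cong) (use m in \<open>auto simp: mult.commute\<close>)
  then have "E = (\<lambda>x. 2 * x) ` {m div 2 <.. m}"
    unfolding E_def m_def[symmetric] by auto
  then have "card E = nat (m - m div 2)"
    by (simp add: card_image inj_on_def)
  then have "Legendre 2 (int p) = (-1) ^ nat (m - m div 2)" using gauss_lemma by simp
  moreover have "even (nat (m - m div 2)) \<longleftrightarrow> int p mod 8 = 1 \<or> int p mod 8 = 7"
  proof -
    have "0 \<le> m - m div 2" using m by linarith
    then have "even (nat (m - m div 2)) \<longleftrightarrow> even (m - m div 2)" by (simp add: even_nat_iff)
    also have "\<dots> \<longleftrightarrow> (2 * m + 1) mod 8 = 1 \<or> (2 * m + 1) mod 8 = 7" by presburger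
    finally show ?thesis using m(1) by simp
  qed
  moreover have "int p mod 8 \<in> {1, 3, 5, 7}" using odd_mod_8[of "int p"] odd by simp
  ultimately show ?thesis unfolding chi8_def by auto
qed

section \<open>Valuations, unit parts and the explicit Hilbert symbol\<close>

definition vp :: "nat \<Rightarrow> int \<Rightarrow> nat" where "vp p a = multiplicity (int p) a"
definition upart :: "nat \<Rightarrow> int \<Rightarrow> int" where "upart p a = a div int p ^ vp p a"

lemma vp_upart:
  assumes "prime p" "a \<noteq> 0"
  shows "a = int p ^ vp p a * upart p a" "\<not> int p dvd upart p a"
proof -
  have p: "prime (int p)" using assms by simp
  show "a = int p ^ vp p a * upart p a" by (simp add: upart_def vp_def multiplicity_dvd)
  show "\<not> int p dvd upart p a"
    unfolding upart_def vp_def using multiplicity_decompose[of a "int p"] assms p not_prime_unit by blast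
qed

lemma vp_eqI:
  assumes "prime p" "a = int p ^ k * u" "\<not> int p dvd u"
  shows "vp p a = k" "upart p a = u"
proof -
  have p: "prime (int p)" using assms by simp
  then have nu: "\<not> is_unit (int p)" "int p \<noteq> 0" using not_prime_unit by (blast, auto)
  show v: "vp p a = k" unfolding vp_def assms(2)
  proof (rule multiplicity_eqI)
    show "\<not> int p ^ Suc k dvd int p ^ k * u"
      using nu assms(3) by (metis dvd_times_left_cancel_iff power_Suc2 power_not_zero)
  qed simp
  show "upart p a = u" unfolding upart_def v unfolding assms(2) using nu by simp
qed

lemma vp_mult:
  assumes "prime p" "a \<noteq> 0" "b \<noteq> 0"
  shows "vp p (a * b) = vp p a + vp p b" "upart p (a * b) = upart p a * upart p b"
proof -
  have "a * b = int p ^ (vp p a + vp p b) * (upart p a * upart p b)"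
    using vp_upart(1)[OF assms(1,2)] vp_upart(1)[OF assms(1,3)] by (metis mult.assoc mult.left_commute power_add)
  moreover have "\<not> int p dvd upart p a * upart p b"
    using assms vp_upart(2) by (auto simp: prime_dvd_mult_iff)
  ultimately show "vp p (a * b) = vp p a + vp p b" "upart p (a * b) = upart p a * upart p b"
    using vp_eqI[OF assms(1)] by blast+
qed

lemma vp_unit: "prime p \<Longrightarrow> \<not> int p dvd a \<Longrightarrow> vp p a = 0 \<and> upart p a = a"
  using vp_eqI[of p a 0 a] by simp

text \<open>For odd u and v this is the reciprocity sign, -1 raised to the product of (u-1)/2 and
  (v-1)/2.\<close>

definition eps4 :: "int \<Rightarrow> int \<Rightarrow> int" where
  "eps4 u v = (if u mod 4 = 3 \<and> v mod 4 = 3 then -1 else 1)"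

lemma eps4_mult: "odd u \<Longrightarrow> odd u' \<Longrightarrow> eps4 (u * u') v = eps4 u v * eps4 u' v"
proof -
  assume "odd u" "odd u'"
  then have "u mod 4 = 1 \<or> u mod 4 = 3" "u' mod 4 = 1 \<or> u' mod 4 = 3" using odd_mod_4 by auto
  moreover have "u * u' mod 4 = (u mod 4) * (u' mod 4) mod 4" by (simp add: mod_mult_eq)
  ultimately show ?thesis unfolding eps4_def by (elim disjE) simp_all
qed

text \<open>The Hilbert symbol of \<open>\<rat>\<^sub>p\<close>, given by its explicit formula.\<close>
definition hilb :: "nat \<Rightarrow> int \<Rightarrow> int \<Rightarrow> int" where
  "hilb p a b = (if p = 2
     then eps4 (upart 2 a) (upart 2 b) * chi8 (upart 2 a) ^ vp 2 b * chi8 (upart 2 b) ^ vp 2 a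
     else Legendre (-1) (int p) ^ (vp p a * vp p b) * Legendre (upart p a) (int p) ^ vp p b
            * Legendre (upart p b) (int p) ^ vp p a)"

definition hilb_inf :: "int \<Rightarrow> int \<Rightarrow> int" where
  "hilb_inf a b = (if a < 0 \<and> b < 0 then -1 else 1)"

lemma hilb_sym: "hilb p a b = hilb p b a"
  unfolding hilb_def eps4_def by (simp only: mult_ac conj_commute)

lemma hilb_mult:
  assumes "prime p" "a \<noteq> 0" "a' \<noteq> 0" "b \<noteq> 0"
  shows "hilb p (a * a') b = hilb p a b * hilb p a' b"
proof (cases "p = 2")
  case True
  have "odd (upart 2 a)" "odd (upart 2 a')" using vp_upart(2)[of 2] assms True by auto
  then show ?thesis unfolding hilb_def using True vp_mult[OF assms(1-3)]
    by (simp add: eps4_mult chi8_mult power_add power_mult_distrib)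
next
  case False
  then show ?thesis unfolding hilb_def using vp_mult[OF assms(1-3)]
    by (simp add: Legendre_mult assms(1) power_add power_mult_distrib add_mult_distrib)
qed

lemma hilb_mult_right:
  assumes "prime p" "a \<noteq> 0" "b \<noteq> 0" "b' \<noteq> 0"
  shows "hilb p a (b * b') = hilb p a b * hilb p a b'"
  using hilb_mult[OF assms(1,3,4,2)] by (simp only: hilb_sym[of p a])

lemma hilb_values:
  assumes "prime p" "a \<noteq> 0" "b \<noteq> 0"
  shows "hilb p a b = 1 \<or> hilb p a b = -1"
proof -
  have pm: "x = 1 \<or> x = -1 \<Longrightarrow> x ^ k = 1 \<or> x ^ k = -1" for x :: int and k
    by (metis power_one neg_one_even_power neg_one_odd_power)
  have pm2: "x = 1 \<or> x = -1 \<Longrightarrow> y = 1 \<or> y = -1 \<Longrightarrow> x * y = 1 \<or> x * y = -1" for x y :: int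
    by auto
  show ?thesis
  proof (cases "p = 2")
    case True
    have o: "odd (upart 2 a)" "odd (upart 2 b)" using vp_upart(2)[of 2] assms True by auto
    have eq: "hilb p a b = eps4 (upart 2 a) (upart 2 b) * chi8 (upart 2 a) ^ vp 2 b * chi8 (upart 2 b) ^ vp 2 a"
      using True by (simp add: hilb_def)
    show ?thesis unfolding eq by (intro pm2 pm chi8_odd) (use o in \<open>auto simp: eps4_def\<close>)
  next
    case False
    have "\<not> int p dvd 1" using assms(1) prime_gt_1_nat by fastforce
    then have m1: "\<not> int p dvd -1" by simp
    have eq: "hilb p a b = Legendre (-1) (int p) ^ (vp p a * vp p b) * Legendre (upart p a) (int p) ^ vp p b
            * Legendre (upart p b) (int p) ^ vp p a"
      using False by (simp add: hilb_def)
    show ?thesis unfolding eq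
      by (intro pm2 pm Legendre_cases m1 vp_upart(2) assms)
  qed
qed

lemma hilb_units:
  assumes "prime p" "p \<noteq> 2" "\<not> int p dvd a" "\<not> int p dvd b"
  shows "hilb p a b = 1"
  using assms(2) vp_unit[OF assms(1,3)] vp_unit[OF assms(1,4)] by (simp add: hilb_def)

lemma hilb_unit_prime:
  assumes "prime p" "p \<noteq> 2" "\<not> int p dvd a"
  shows "hilb p a (int p) = Legendre a (int p)"
proof -
  have "\<not> int p dvd 1" using assms(1) prime_gt_1_nat by fastforce
  then have "vp p (int p) = 1" "upart p (int p) = 1" using vp_eqI[OF assms(1), of "int p" 1 1] by simp_all
  then show ?thesis using assms(2) vp_unit[OF assms(1,3)] by (simp add: hilb_def Legendre_1 assms(1))
qed

text \<open>The finite set A stands for all primes: as soon as it contains 2 and every prime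
  dividing one of the arguments, all omitted symbols are 1.\<close>

definition hprod :: "nat set \<Rightarrow> int \<Rightarrow> int \<Rightarrow> int" where
  "hprod A a b = (\<Prod>p\<in>A. hilb p a b) * hilb_inf a b"

lemma hprod_sym: "hprod A a b = hprod A b a"
  unfolding hprod_def hilb_inf_def by (simp only: hilb_sym[of _ a b] conj_commute)

lemma hprod_mult:
  assumes "\<And>p. p \<in> A \<Longrightarrow> prime p" "a \<noteq> 0" "a' \<noteq> 0" "b \<noteq> 0"
  shows "hprod A (a * a') b = hprod A a b * hprod A a' b"
proof -
  have "(\<Prod>p\<in>A. hilb p (a * a') b) = (\<Prod>p\<in>A. hilb p a b * hilb p a' b)"
    by (intro prod.cong refl hilb_mult assms)
  moreover have "hilb_inf (a * a') b = hilb_inf a b * hilb_inf a' b"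
    using assms unfolding hilb_inf_def by (auto simp: mult_less_0_iff)
  ultimately show ?thesis unfolding hprod_def by (simp add: prod.distrib)
qed

lemma hprod_support:
  assumes "finite A" "B \<subseteq> A" "2 \<in> B" "\<And>p. p \<in> A \<Longrightarrow> prime p"
    and "\<And>p. p \<in> A - B \<Longrightarrow> \<not> int p dvd a \<and> \<not> int p dvd b"
  shows "hprod A a b = (\<Prod>p\<in>B. hilb p a b) * hilb_inf a b"
proof -
  have "(\<Prod>p\<in>A. hilb p a b) = (\<Prod>p\<in>B. hilb p a b)"
  proof (rule prod.mono_neutral_right)
    show "\<forall>p\<in>A - B. hilb p a b = 1"
    proof
      fix p assume p: "p \<in> A - B"
      then have "p \<noteq> 2" using assms(3) by auto
      then show "hilb p a b = 1" using hilb_units assms(4,5) p by blast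
    qed
  qed (use assms in auto)
  then show ?thesis by (simp add: hprod_def)
qed

section \<open>The product formula on the generators -1 and p\<close>

lemma prime_not_dvd_prime: "prime p \<Longrightarrow> prime q \<Longrightarrow> p \<noteq> q \<Longrightarrow> \<not> int p dvd int q"
  by (simp add: primes_dvd_imp_eq) (metis primes_dvd_imp_eq)

lemma vp_prime: "prime p \<Longrightarrow> vp p (int p) = 1 \<and> upart p (int p) = 1"
  using vp_eqI[of p "int p" 1 1] prime_not_dvd_1 by simp

lemma vp_2_odd: "odd a \<Longrightarrow> vp 2 a = 0 \<and> upart 2 a = a"
  using vp_unit[of 2 a] by simp

lemma vp_2_2: "vp 2 2 = 1 \<and> upart 2 2 = 1"
  using vp_prime[of 2] by simp

lemma eps4_reciprocity:
  assumes "prime p" "prime q" "p \<noteq> 2" "q \<noteq> 2" "p \<noteq> q"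
  shows "Legendre (int p) (int q) * Legendre (int q) (int p) = eps4 (int p) (int q)"
proof -
  have gt: "2 < p" "2 < q" using assms prime_gt_1_nat[of p] prime_gt_1_nat[of q] by linarith+
  have odd: "odd p" "odd q" using assms gt prime_odd_nat by blast+
  have "Legendre (int p) (int q) * Legendre (int q) (int p) = (-1::int) ^ ((p - 1) div 2 * ((q - 1) div 2))"
    using Quadratic_Reciprocity[of p q] assms gt by simp
  moreover have "odd ((p - 1) div 2) \<longleftrightarrow> int p mod 4 = 3" "odd ((q - 1) div 2) \<longleftrightarrow> int q mod 4 = 3"
    using odd gt by presburger+
  ultimately show ?thesis unfolding eps4_def by (auto simp: minus_one_power_iff)
qed

text \<open>Distinct odd primes give quadratic reciprocity; for 2 and an odd prime p the value (2/p)
  occurs at both places; for q = r odd the symbol at q is (-1/q), which the first supplement matches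
  with the symbol at 2.\<close>

lemma hprod_prime_prime:
  assumes A: "finite A" "\<And>p. p \<in> A \<Longrightarrow> prime p" "2 \<in> A"
    and q: "q \<in> A" "r \<in> A"
  shows "hprod A (int q) (int r) = 1"
proof -
  have pq: "prime q" "prime r" using A q by auto
  have "hprod A (int q) (int r) = (\<Prod>p\<in>{2, q, r}. hilb p (int q) (int r)) * hilb_inf (int q) (int r)"
    by (rule hprod_support) (use A q prime_not_dvd_prime pq in auto)
  also have "\<dots> = (\<Prod>p\<in>{2, q, r}. hilb p (int q) (int r))" by (simp add: hilb_inf_def)
  also have "\<dots> = 1"
  proof -
    have oddI: "odd (int x)" if "prime x" "x \<noteq> 2" for x
      using that prime_odd_nat[of x] prime_gt_1_nat[of x] by simp
    have h2: "hilb 2 (int x) (int y) = eps4 (int x) (int y)" if "prime x" "x \<noteq> 2" "prime y" "y \<noteq> 2" for x y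
      using vp_2_odd[OF oddI[OF that(1,2)]] vp_2_odd[OF oddI[OF that(3,4)]] by (simp add: hilb_def)
    have h22: "hilb 2 2 (int y) = chi8 (int y)" if "prime y" "y \<noteq> 2" for y
      using vp_2_odd[OF oddI[OF that]] vp_2_2 by (simp add: hilb_def eps4_def)
    have hy2: "hilb y 2 (int y) = chi8 (int y)" if "prime y" "y \<noteq> 2" for y
      using hilb_unit_prime[OF that, of 2] prime_not_dvd_prime[of y 2] Legendre_2[OF that] that by simp
    have c8: "chi8 (int y) * chi8 (int y) = 1" if "prime y" "y \<noteq> 2" for y
      using chi8_odd[OF oddI[OF that]] by auto
    consider "q = 2" "r = 2" | "q = 2" "r \<noteq> 2" | "q \<noteq> 2" "r = 2" | "q \<noteq> 2" "r \<noteq> 2" "q = r" | "q \<noteq> 2" "r \<noteq> 2" "q \<noteq> r"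
      by blast
    then show ?thesis
    proof cases
      case 1
      then show ?thesis using vp_2_2 by (simp add: hilb_def eps4_def chi8_def)
    next
      case 2
      then show ?thesis using h22[OF pq(2)] hy2[OF pq(2)] c8[OF pq(2)] by simp
    next
      case 3
      have "hilb 2 (int q) 2 = chi8 (int q)" "hilb q (int q) 2 = chi8 (int q)"
        using h22[OF pq(1)] hy2[OF pq(1)] 3 by (simp_all add: hilb_sym)
      then show ?thesis using c8[OF pq(1)] 3 by (simp add: insert_commute)
    next
      case 4
      have "hilb q (int q) (int q) = Legendre (-1) (int q)"
        using vp_prime[OF pq(1)] 4 by (simp add: hilb_def Legendre_1 pq)
      then show ?thesis using h2[OF pq(1) 4(1) pq(1) 4(1)] 4 Legendre_minus_1[OF pq(1) 4(1)]
        by (auto simp: eps4_def)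
    next
      case 5
      have "hilb q (int q) (int r) = Legendre (int r) (int q)"
        using hilb_unit_prime[OF pq(1) 5(1), of "int r"] prime_not_dvd_prime[OF pq 5(3)] by (simp add: hilb_sym)
      moreover have "hilb r (int q) (int r) = Legendre (int q) (int r)"
        using hilb_unit_prime[OF pq(2) 5(2), of "int q"] prime_not_dvd_prime[OF pq(2,1)] 5(3) by simp
      moreover have "eps4 (int q) (int r) * eps4 (int q) (int r) = 1" by (simp add: eps4_def)
      ultimately show ?thesis using eps4_reciprocity[OF pq 5] h2[OF pq(1) 5(1) pq(2) 5(2)] 5
        by (simp add: mult_ac)
    qed
  qed
  finally show ?thesis .
qed

lemma hprod_minus_prime:
  assumes A: "finite A" "\<And>p. p \<in> A \<Longrightarrow> prime p" "2 \<in> A" and q: "q \<in> A"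
  shows "hprod A (-1) (int q) = 1"
proof -
  have pq: "prime q" using A q by auto
  have "hprod A (-1) (int q) = (\<Prod>p\<in>{2, q}. hilb p (-1) (int q)) * hilb_inf (-1) (int q)"
    by (rule hprod_support) (use A q prime_not_dvd_prime prime_not_dvd_1 pq in auto)
  also have "\<dots> = (\<Prod>p\<in>{2, q}. hilb p (-1) (int q))" by (simp add: hilb_inf_def)
  also have "\<dots> = 1"
  proof (cases "q = 2")
    case True
    then show ?thesis using vp_2_2 vp_2_odd[of "-1"] by (simp add: hilb_def eps4_def chi8_def)
  next
    case False
    have odd: "odd (int q)" using pq False prime_odd_nat[of q] prime_gt_1_nat[of q] by simp
    have "hilb 2 (-1) (int q) = eps4 (-1) (int q)"
      using vp_2_odd[of "-1"] vp_2_odd[OF odd] by (simp add: hilb_def)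
    moreover have "hilb q (-1) (int q) = Legendre (-1) (int q)"
      using hilb_unit_prime[OF pq False, of "-1"] prime_not_dvd_1[OF pq] by simp
    ultimately show ?thesis using Legendre_minus_1[OF pq False] False
      by (auto simp: eps4_def)
  qed
  finally show ?thesis .
qed

text \<open>Only the places 2 and infinity contribute, each with the sign -1.\<close>

lemma hprod_minus_minus:
  assumes A: "finite A" "\<And>p. p \<in> A \<Longrightarrow> prime p" "2 \<in> A"
  shows "hprod A (-1) (-1) = 1"
proof -
  have "hprod A (-1) (-1) = (\<Prod>p\<in>{2}. hilb p (-1) (-1)) * hilb_inf (-1) (-1)"
    by (rule hprod_support) (use A prime_not_dvd_1 in auto)
  also have "\<dots> = 1" using vp_2_odd[of "-1"] by (simp add: hilb_def eps4_def hilb_inf_def)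
  finally show ?thesis .
qed

lemma hprod_one:
  assumes A: "\<And>p. p \<in> A \<Longrightarrow> prime p" and "b \<noteq> 0"
  shows "hprod A 1 b = 1"
proof -
  have "hilb p 1 b = 1" if "p \<in> A" for p
    using hilb_mult[of p 1 1 b] hilb_values[of p 1 b] A[OF that] assms(2) by auto
  then show ?thesis by (simp add: hprod_def hilb_inf_def)
qed

text \<open>Induction on the prime factorization. Applied in one argument with the other held fixed,
  it reduces the bilinear product formula to pairs of generators.\<close>

lemma multiplicative_generators:
  fixes Q :: "int \<Rightarrow> int"
  assumes "\<And>a a'. a \<noteq> 0 \<Longrightarrow> a' \<noteq> 0 \<Longrightarrow> Q (a * a') = Q a * Q a'"
    and "Q 1 = 1" "Q (-1) = 1" "\<And>q. q \<in> A \<Longrightarrow> Q (int q) = 1"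
    and "a \<noteq> 0" "\<And>q. prime q \<Longrightarrow> int q dvd a \<Longrightarrow> q \<in> A"
  shows "Q a = 1"
  using assms(5,6)
proof (induction a rule: prime_divisors_induct)
  case (unit x)
  then show ?case using assms(2,3) by (auto simp: zdvd1_eq abs_if split: if_splits)
next
  case (factor p x)
  then have "prime (nat p)" "p = int (nat p)" using prime_ge_0_int by auto
  then have "Q p = 1" using assms(4) factor by (metis dvd_triv_left)
  moreover have "Q x = 1" using factor by auto
  ultimately show ?case using assms(1)[of p x] factor by auto
qed simp

theorem hilbert_product_formula:
  assumes A: "finite A" "\<And>p. p \<in> A \<Longrightarrow> prime p" "2 \<in> A" and ab: "a \<noteq> 0" "b \<noteq> 0"
    and sup: "\<And>q. prime q \<Longrightarrow> int q dvd a * b \<Longrightarrow> q \<in> A"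
  shows "hprod A a b = 1"
proof -
  have right: "hprod A c b = 1" if c: "c = -1 \<or> (\<exists>q\<in>A. c = int q)" for c
  proof (rule multiplicative_generators[where Q = "hprod A c"])
    have c0: "c \<noteq> 0" using c A(2)[of 0] by auto
    show "hprod A c (x * y) = hprod A c x * hprod A c y" if "x \<noteq> 0" "y \<noteq> 0" for x y
      unfolding hprod_sym[of A c] by (rule hprod_mult) (use A that c0 in auto)
    show "hprod A c 1 = 1" unfolding hprod_sym[of A c] by (rule hprod_one) (use A c0 in auto)
    show "hprod A c (-1) = 1" using c hprod_minus_prime[OF A] hprod_minus_minus[OF A] by (auto simp: hprod_sym)
    show "hprod A c (int q) = 1" if "q \<in> A" for q
      using c that hprod_minus_prime[OF A] hprod_prime_prime[OF A] by auto
  qed (use ab sup in auto)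
  show ?thesis
  proof (rule multiplicative_generators[where Q = "\<lambda>x. hprod A x b"])
    show "hprod A (x * y) b = hprod A x b * hprod A y b" if "x \<noteq> 0" "y \<noteq> 0" for x y
      by (rule hprod_mult) (use A that ab in auto)
    show "hprod A 1 b = 1" by (rule hprod_one) (use A ab in auto)
    show "q \<in> A" if "prime q" "int q dvd a" for q using sup that by simp
  qed (use ab right in auto)
qed

text \<open>Were every unit a residue, squaring would be onto and hence injective on the residues 1,
  ..., q-1, but 1 and q-1 have the same square.\<close>

lemma exists_nonresidue:
  assumes "prime q" "q \<noteq> 2"
  shows "\<exists>x. Legendre (int x) (int q) = -1"
proof (rule ccontr)
  assume no: "\<not> ?thesis"
  have q2: "q > 2" using assms prime_gt_1_nat[of q] by linarith
  let ?f = "\<lambda>x. x^2 mod q"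
  have surj: "{1..<q} \<subseteq> ?f ` {1..<q}"
  proof
    fix y assume y: "y \<in> {1..<q}"
    then have "\<not> q dvd y" by (auto dest: dvd_imp_le)
    then have nd: "\<not> int q dvd int y" by simp
    then have "Legendre (int y) (int q) = 1" using no Legendre_cases by blast
    then obtain z where z: "[z^2 = int y] (mod int q)"
      unfolding Legendre_def QuadRes_def by (auto split: if_splits)
    define w where "w = nat (z mod int q)"
    have w: "int w = z mod int q" using q2 by (simp add: w_def)
    have "[int w ^ 2 = int y] (mod int q)"
      unfolding w using z by (simp add: cong_def power_mod)
    then have wy: "[w^2 = y] (mod q)" by (simp add: cong_int_iff[symmetric])
    then have "w^2 mod q = y" using y by (simp add: cong_def)
    moreover have "w < q" using w q2 by (metis of_nat_less_iff of_nat_0_less_iff pos_mod_bound zero_less_numeral order.strict_trans)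
    moreover have "w \<noteq> 0" using \<open>w^2 mod q = y\<close> y by (auto intro!: Nat.gr0I)
    ultimately show "y \<in> ?f ` {1..<q}" by (intro image_eqI[of _ _ w]) auto
  qed
  have "card (?f ` {1..<q}) \<ge> card {1..<q}" using surj by (intro card_mono) auto
  then have "inj_on ?f {1..<q}" by (intro eq_card_imp_inj_on le_antisym card_image_le) auto
  moreover have "?f 1 = ?f (q - 1)"
  proof -
    have "int q dvd (int q - 1)^2 - 1^2" by (simp add: power2_eq_square algebra_simps)
    then have "[int (q - 1) ^ 2 = int 1 ^ 2] (mod int q)" using q2 by (simp add: cong_iff_dvd_diff of_nat_diff)
    then have "[(q - 1)^2 = 1^2] (mod q)" by (simp add: cong_int_iff[symmetric])
    then show ?thesis by (simp add: cong_def)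
  qed
  moreover have "1 \<in> {1..<q}" "q - 1 \<in> {1..<q}" "1 \<noteq> q - 1" using q2 by auto
  ultimately show False by (meson inj_onD)
qed

text \<open>The characters \<open>chi4\<close>, \<open>chi8\<close> and the Legendre symbols at Q
  are independent: for a nonempty set J of them the Chinese remainder theorem gives a residue class
  with value -1 at one member of J and 1 at the others. Hence every product over J is nonprincipal,
  as the theorem on prescribed characters requires.\<close>

lemma prime_with_residues:
  fixes Q :: "nat set" and e :: "nat \<Rightarrow> int" and u :: int
  assumes Q: "finite Q" "\<And>q. q \<in> Q \<Longrightarrow> prime q \<and> q \<noteq> 2"
    and e: "\<And>q. q \<in> Q \<Longrightarrow> e q \<in> {-1, 1}" and u: "odd u" and M: "M > 0"
  shows "\<exists>l. prime l \<and> \<not> l dvd M \<and> int l mod 8 = u mod 8 \<and> (\<forall>q\<in>Q. Legendre (int l) (int q) = e q)"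
proof -
  have mod48: "x mod 4 = x mod 8 mod 4" for x :: int by (simp add: mod_mod_cancel)
  define N where "N = 8 * \<Prod>Q"
  \<comment> \<open>The numbers 4 and 8 label the two characters at 2; being composite, they cannot
    collide with elements of Q.\<close>
  define \<chi> where "\<chi> i n = (if i = 4 then chi4 (int n) else if i = 8 then chi8 (int n) else Legendre (int n) (int i))" for i n :: nat
  define \<epsilon> where "\<epsilon> i = (if i = 4 then chi4 u else if i = 8 then chi8 u else e i)" for i
  define I where "I = insert 4 (insert 8 Q)"
  have N: "N > 0" using Q by (auto simp: N_def prime_gt_0_nat intro!: prod_pos)
  have QN: "int q dvd int N" if "q \<in> Q" for q
    using that Q(1) by (simp add: N_def dvd_prodI)
  have n48: "4 \<notin> Q" "8 \<notin> Q"
  proof -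
    have "\<not> prime (4::nat)" "\<not> prime (8::nat)" using prime_odd_nat by auto
    then show "4 \<notin> Q" "8 \<notin> Q" using Q by blast+
  qed
  have mult: "\<chi> i (m * n) = \<chi> i m * \<chi> i n" if "i \<in> I" for i m n
    using that Q(2) n48 by (auto simp: \<chi>_def I_def chi4_mult chi8_mult Legendre_mult)
  have per: "\<chi> i (n + N) = \<chi> i n" if "i \<in> I" for i n
  proof -
    have 8: "int (n + N) mod 8 = int n mod 8" by (simp add: N_def)
    then have 4: "int (n + N) mod 4 = int n mod 4" by (metis mod48)
    have L: "Legendre (int (n + N)) (int i) = Legendre (int n) (int i)" if "i \<in> Q"
      by (rule Legendre_cong) (use QN[OF that] in \<open>simp add: cong_iff_dvd_diff\<close>)
    show ?thesis using \<open>i \<in> I\<close> 8 4 L unfolding \<chi>_def I_def chi4_def chi8_def by (simp only:) auto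
  qed
  have rng: "\<chi> i n \<in> {-1, 0, 1}" for i n
    using Legendre_range[of "int n" "int i"] by (auto simp: \<chi>_def chi4_def chi8_def)
  have crt: "\<exists>a. coprime a N \<and> a mod 8 = c \<and> (\<forall>q\<in>Q. [a = x q] (mod q))"
    if c: "c \<in> {1, 3, 5}" and x: "\<And>q. q \<in> Q \<Longrightarrow> \<not> q dvd x q" for c x
  proof -
    have "\<exists>a. \<forall>i\<in>insert 8 Q. [a = (if i = 8 then c else x i)] (mod i)"
    proof (rule chinese_remainder_nat)
      show "\<forall>i\<in>insert 8 Q. \<forall>j\<in>insert 8 Q. i \<noteq> j \<longrightarrow> coprime i j"
      proof (intro ballI impI)
        fix i j assume ij: "i \<in> insert 8 Q" "j \<in> insert 8 Q" "i \<noteq> j"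
        have c8: "coprime 8 q" if "q \<in> Q" for q
        proof -
          have "coprime 2 q" using Q(2)[OF that] primes_coprime[of 2 q] two_is_prime_nat by metis
          then have "coprime (2^3) q" by (simp only: coprime_power_left_iff) simp
          then show ?thesis by simp
        qed
        show "coprime i j" using ij c8 Q(2) primes_coprime[of i j] by (auto simp: coprime_commute)
      qed
    qed (use Q in auto)
    then obtain a where a: "[a = c] (mod 8)" "\<And>q. q \<in> Q \<Longrightarrow> [a = x q] (mod q)" using n48 by (metis insert_iff)
    have "coprime a q" if "q \<in> Q" for q
      using a(2)[OF that] x[OF that] Q(2)[OF that] by (metis cong_dvd_iff coprime_commute prime_imp_coprime)
    then have "coprime a (\<Prod>Q)" by (intro prod_coprime_right) auto
    moreover have a8: "a mod 8 = c" using a(1) c by (auto simp: cong_def)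
    moreover have "odd a" using a8 c by (auto; presburger)
    then have "coprime a (2^3)" by (simp only: coprime_power_right_iff coprime_right_2_iff_odd) simp
    then have "coprime a 8" by simp
    ultimately show ?thesis using a(2) by (auto simp: N_def)
  qed
  have chars: "real_character (\<lambda>n. \<Prod>i\<in>J. real_of_int (\<chi> i n)) N" if J: "J \<subseteq> I" "J \<noteq> {}" for J
  proof
    have finJ: "finite J" using J Q by (auto simp: I_def intro: finite_subset)
    show "N > 0" by (rule N)
    show "(\<Prod>i\<in>J. real_of_int (\<chi> i (m * n))) = (\<Prod>i\<in>J. real_of_int (\<chi> i m)) * (\<Prod>i\<in>J. real_of_int (\<chi> i n))" for m n
      unfolding prod.distrib[symmetric] using mult J by (intro prod.cong) auto
    show "(\<Prod>i\<in>J. real_of_int (\<chi> i (n + N))) = (\<Prod>i\<in>J. real_of_int (\<chi> i n))" for n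
      using per J by (intro prod.cong) auto
    show "(\<Prod>i\<in>J. real_of_int (\<chi> i n)) \<in> {-1, 0, 1}" for n
      using finJ
    proof (induction J rule: finite_induct)
      case (insert i J)
      then show ?case using rng[of i n] by auto
    qed auto
    show "\<exists>a. coprime a N \<and> (\<Prod>i\<in>J. real_of_int (\<chi> i a)) = -1"
    proof -
      have "\<exists>a j. coprime a N \<and> j \<in> J \<and> \<chi> j a = -1 \<and> (\<forall>i\<in>J - {j}. \<chi> i a = 1)"
      proof (cases "\<exists>q. q \<in> J \<inter> Q")
        case True
        then obtain q where q: "q \<in> J" "q \<in> Q" by auto
        obtain y where y: "Legendre (int y) (int q) = -1" using exists_nonresidue Q(2)[OF q(2)] by blast
        have ny: "\<not> q dvd y" using y Legendre_eq_0[of "int y" "int q"] by auto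
        obtain a where a: "coprime a N" "a mod 8 = 1" "\<And>r. r \<in> Q \<Longrightarrow> [a = (if r = q then y else 1)] (mod r)"
        proof -
          have "\<exists>a. coprime a N \<and> a mod 8 = 1 \<and> (\<forall>r\<in>Q. [a = (if r = q then y else 1)] (mod r))"
          proof (rule crt)
            show "\<not> r dvd (if r = q then y else 1)" if "r \<in> Q" for r
              using ny Q(2)[OF that] by auto
          qed simp
          then show ?thesis using that by blast
        qed
        have a8: "int a mod 8 = 1" using a(2) by (metis of_nat_mod of_nat_numeral of_nat_1)
        then have a4: "int a mod 4 = 1" using mod48[of "int a"] by simp
        have "\<chi> q a = -1"
        proof -
          have "[int a = int y] (mod int q)" using a(3)[OF q(2)] by (simp add: cong_int_iff)
          then show ?thesis using y Legendre_cong q n48 by (auto simp: \<chi>_def)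
        qed
        moreover have "\<chi> i a = 1" if "i \<in> J - {q}" for i
        proof (cases "i \<in> Q")
          case True
          then have "[int a = int 1] (mod int i)" using a(3)[OF True] that by (simp only: cong_int_iff) auto
          then have "Legendre (int a) (int i) = Legendre 1 (int i)" using Legendre_cong by fastforce
          then show ?thesis using Legendre_1 Q(2)[OF True] n48 True by (auto simp: \<chi>_def)
        next
          case False
          then have "i = 4 \<or> i = 8" using that J by (auto simp: I_def)
          then show ?thesis using a8 a4 by (auto simp: \<chi>_def chi4_def chi8_def)
        qed
        ultimately show ?thesis using a(1) q(1) by blast
      next
        case False
        then have J48: "J \<subseteq> {4, 8}" using J by (auto simp: I_def)
        show ?thesis
        proof (cases "8 \<in> J")
          case True
          \<comment> \<open>The class 5 modulo 8 separates the two characters: \<open>chi8\<close>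
            is -1 there and \<open>chi4\<close> is 1.\<close>
          obtain a where a: "coprime a N" "a mod 8 = 5"
          proof -
            have "\<exists>a. coprime a N \<and> a mod 8 = 5 \<and> (\<forall>r\<in>Q. [a = 1] (mod r))"
            proof (rule crt)
              show "\<not> r dvd 1" if "r \<in> Q" for r using Q(2)[OF that] by auto
            qed simp
            then show ?thesis using that by blast
          qed
          have a8: "int a mod 8 = 5" using a(2) by (metis of_nat_mod of_nat_numeral of_nat_1)
          then have a4: "int a mod 4 = 1" using mod48[of "int a"] by simp
          have "\<chi> 8 a = -1" "\<chi> 4 a = 1" using a8 a4 by (auto simp: \<chi>_def chi4_def chi8_def)
          then show ?thesis using a(1) J48 True by blast
        next
          case False
          then have J4: "J = {4}" using J48 J by auto
          obtain a where a: "coprime a N" "a mod 8 = 3"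
          proof -
            have "\<exists>a. coprime a N \<and> a mod 8 = 3 \<and> (\<forall>r\<in>Q. [a = 1] (mod r))"
            proof (rule crt)
              show "\<not> r dvd 1" if "r \<in> Q" for r using Q(2)[OF that] by auto
            qed simp
            then show ?thesis using that by blast
          qed
          have "int a mod 8 = 3" using a(2) by (metis of_nat_mod of_nat_numeral of_nat_1)
          then have "int a mod 4 = 3" using mod48[of "int a"] by simp
          then have "\<chi> 4 a = -1" by (auto simp: \<chi>_def chi4_def)
          then show ?thesis using a(1) J4 by blast
        qed
      qed
      then obtain a j where aj: "coprime a N" "j \<in> J" "\<chi> j a = -1" "\<And>i. i \<in> J - {j} \<Longrightarrow> \<chi> i a = 1" by blast
      then have "(\<Prod>i\<in>J. real_of_int (\<chi> i a)) = -1" using finJ by (simp add: prod.remove[of J j])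
      then show ?thesis using aj(1) by blast
    qed
  qed
  have "\<exists>p. prime p \<and> \<not> p dvd M * N \<and> (\<forall>i\<in>I. real_of_int (\<chi> i p) = real_of_int (\<epsilon> i))"
  proof (rule prime_with_prescribed_characters[where N = N])
    show "finite I" using Q by (simp add: I_def)
    show "M * N > 0" using M N by simp
    show "real_of_int (\<chi> i n) \<noteq> 0" if "i \<in> I" "coprime n (M * N)" for i n
    proof -
      have cop: "coprime n N" using that by simp
      have "2 dvd N" by (simp add: N_def)
      then have "coprime n 2" using coprime_divisors[OF dvd_refl _ cop] by blast
      then have "odd (int n)" by (simp add: coprime_right_2_iff_odd)
      moreover have "\<not> int i dvd int n" if "i \<in> Q"
      proof
        assume "int i dvd int n"
        then have "i dvd n" by simp
        moreover have "i dvd N" using QN[OF that] by simp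
        ultimately have "i = 1" using cop by (metis coprime_common_divisor_nat)
        then show False using Q(2)[OF that] by simp
      qed
      ultimately show ?thesis using \<open>i \<in> I\<close> n48 chi4_odd[of "int n"] chi8_odd[of "int n"]
        by (auto simp: \<chi>_def I_def Legendre_eq_0)
    qed
    show "real_of_int (\<epsilon> i) \<in> {-1, 1}" if "i \<in> I" for i
    proof -
      have "\<epsilon> i = -1 \<or> \<epsilon> i = 1"
        using that e n48 chi4_odd[OF u] chi8_odd[OF u] by (auto simp: \<epsilon>_def I_def)
      then show ?thesis by auto
    qed
  qed (use chars in auto)
  then obtain l where l: "prime l" "\<not> l dvd M * N" "\<And>i. i \<in> I \<Longrightarrow> \<chi> i l = \<epsilon> i" by auto
  have "\<forall>q\<in>Q. Legendre (int l) (int q) = e q"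
  proof
    fix q assume q: "q \<in> Q"
    then have "q \<noteq> 4" "q \<noteq> 8" using n48 by auto
    then show "Legendre (int l) (int q) = e q" using l(3)[of q] q by (simp add: I_def \<chi>_def \<epsilon>_def)
  qed
  moreover have "int l mod 8 = u mod 8"
  proof -
    have 1: "chi4 (int l) = chi4 u" "chi8 (int l) = chi8 u"
      using l(3)[of 4] l(3)[of 8] by (auto simp: I_def \<chi>_def \<epsilon>_def)
    have "l \<noteq> 2" using l(2) by (auto simp: N_def)
    then have "odd (int l)" using l(1) prime_odd_nat[of l] prime_gt_1_nat[of l] by simp
    define a b where "a = int l mod 8" and "b = u mod 8"
    have m: "a \<in> {1,3,5,7}" "b \<in> {1,3,5,7}" using odd_mod_8 u \<open>odd (int l)\<close> by (simp_all only: a_def b_def)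
    have e: "int l mod 4 = a mod 4" "u mod 4 = b mod 4" "int l mod 8 = a" "u mod 8 = b"
      by (simp_all add: a_def b_def mod_mod_cancel)
    show ?thesis using m 1 unfolding chi4_def chi8_def e by (elim insertE emptyE) simp_all
  qed
  ultimately show ?thesis using l by auto
qed

section \<open>Local solvability of conics\<close>

lemma inverse_mod_prime:
  assumes "prime p" "\<not> int p dvd a"
  shows "\<exists>b. [a * b = 1] (mod int p)"
proof -
  have "coprime (int p) a" using assms by (simp add: prime_imp_coprime)
  then show ?thesis using cong_solve_coprime_int[of a "int p"] by (simp add: coprime_commute)
qed

text \<open>Newton's step: the root y is a unit modulo p and p is odd, so 2y is invertible and one
  linear congruence for the correction s raises the precision by one power of p.\<close>

lemma square_lift_odd:
  assumes p: "prime p" "p \<noteq> 2" and a: "\<not> int p dvd a" and x: "[x^2 = a] (mod int p)"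
  shows "\<exists>y. int p ^ k dvd y^2 - a"
proof -
  have "\<exists>y. int p ^ Suc k dvd y^2 - a" for k
  proof (induction k)
    case 0
    then show ?case using x by (auto simp: cong_iff_dvd_diff)
  next
    case (Suc k)
    then obtain y m where m: "y^2 - a = int p ^ Suc k * m" by (auto elim: dvdE)
    have "\<not> int p dvd y"
    proof
      assume "int p dvd y"
      then have "int p dvd y^2 - (y^2 - a)"
        unfolding m by (intro dvd_diff) (auto simp: power2_eq_square)
      then show False using a by simp
    qed
    moreover have "\<not> int p dvd 2" using p by (metis dvd_refl int_dvd_int_iff of_nat_numeral primes_dvd_imp_eq two_is_prime_nat)
    ultimately have "\<not> int p dvd 2 * y" using p by (simp add: prime_dvd_mult_iff)
    then obtain b where b: "[2 * y * b = 1] (mod int p)" using inverse_mod_prime p by blast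
    define s where "s = - (b * m)"
    have "int p dvd m * (1 - 2 * y * b)" using b by (simp add: cong_iff_dvd_diff dvd_diff_commute)
    then have d: "int p dvd m + 2 * y * s" by (simp add: s_def algebra_simps)
    have "(y + int p ^ Suc k * s)^2 - a = int p ^ Suc k * (m + 2 * y * s) + int p ^ Suc k * (int p ^ Suc k * s^2)"
      using m by (simp add: power2_eq_square algebra_simps)
    moreover have "int p ^ Suc (Suc k) dvd int p ^ Suc k * (m + 2 * y * s)"
      using d by (metis mult_dvd_mono dvd_refl power_Suc2)
    moreover have "int p ^ Suc (Suc k) dvd int p ^ Suc k * (int p ^ Suc k * s^2)"
      by (metis dvd_triv_left mult_dvd_mono dvd_refl power_Suc power_Suc2 mult.assoc)
    ultimately show ?case by (metis dvd_add)
  qed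
  then show ?thesis by (metis dvd_trans le_imp_power_dvd lessI less_imp_le)
qed

text \<open>The derivative 2y is not a unit at 2, so the induction starts modulo 8: adding 2^(k+2)
  to y changes y^2 by 2^(k+3) y up to a multiple of 2^(k+4), which corrects an odd error.\<close>

lemma square_lift_2:
  assumes "a mod 8 = 1"
  shows "\<exists>y. 2 ^ k dvd y^2 - (a::int)"
proof -
  have "\<exists>y. odd y \<and> 2 ^ (k + 3) dvd y^2 - a" for k
  proof (induction k)
    case 0
    have "8 dvd 1 - a" using assms by (simp add: mod_eq_dvd_iff[symmetric])
    then show ?case by (intro exI[of _ 1]) auto
  next
    case (Suc k)
    then obtain y m where y: "odd y" and m: "y^2 - a = 2 ^ (k + 3) * m" by (auto elim: dvdE)
    show ?case
    proof (cases "even m")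
      case True
      then obtain n where "m = 2 * n" by blast
      then have "y^2 - a = 2 ^ (Suc k + 3) * n" using m by (simp add: power_add)
      then show ?thesis using y by auto
    next
      case False
      define z where "z = y + 2 ^ (k + 2)"
      have "z^2 - a = 2 ^ (k + 3) * (m + y) + 2 ^ (k + 2) * 2 ^ (k + 2)"
        using m by (simp add: z_def power2_eq_square algebra_simps power_add)
      moreover have "2 ^ (Suc k + 3) dvd 2 ^ (k + 3) * (m + y)"
      proof -
        have "even (m + y)" using False y by simp
        then have "2 ^ (k + 3) * 2 dvd 2 ^ (k + 3) * (m + y)" by (intro mult_dvd_mono) auto
        then show ?thesis by (simp only: add_Suc power_Suc2)
      qed
      moreover have "2 ^ (Suc k + 3) dvd (2::int) ^ (k + 2) * 2 ^ (k + 2)"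
        unfolding power_add[symmetric] by (rule le_imp_power_dvd) simp
      ultimately have "2 ^ (Suc k + 3) dvd z^2 - a" by (metis dvd_add)
      moreover have "odd z" using y by (simp add: z_def)
      ultimately show ?thesis by blast
    qed
  qed
  then show ?thesis by (metis dvd_trans le_imp_power_dvd le_add1)
qed

definition tern :: "int \<Rightarrow> int \<Rightarrow> int \<Rightarrow> int \<Rightarrow> int \<Rightarrow> int" where
  "tern u v x y z = x^2 - u * y^2 - v * z^2"

text \<open>Solvability of x^2 = u y^2 + v z^2 over the p-adic numbers, phrased by primitive integer
  solutions modulo all powers of p, so that the comparison with the Hilbert symbol is arithmetic of
  integers.\<close>

definition conic_iso :: "nat \<Rightarrow> int \<Rightarrow> int \<Rightarrow> bool" where
  "conic_iso p u v \<longleftrightarrow> (\<forall>k. \<exists>x y z. \<not> (int p dvd x \<and> int p dvd y \<and> int p dvd z) \<and>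
      int p ^ k dvd tern u v x y z)"

text \<open>Common factors p of the coordinates can be divided out, each at the cost of p^2 in the
  value, and fewer than c divisions occur. This allows substitutions that are invertible only over
  the rationals.\<close>

lemma conic_isoI:
  assumes p: "prime p"
    and sol: "\<And>k. \<exists>x y z. \<not> (int p ^ c dvd x \<and> int p ^ c dvd y \<and> int p ^ c dvd z) \<and> int p ^ k dvd tern u v x y z"
  shows "conic_iso p u v"
proof -
  have red: "\<exists>x y z. \<not> (int p dvd x \<and> int p dvd y \<and> int p dvd z) \<and> int p ^ k dvd tern u v x y z"
    if "\<not> (int p ^ c dvd x \<and> int p ^ c dvd y \<and> int p ^ c dvd z)" "int p ^ (k + 2 * c) dvd tern u v x y z" for c k x y z
    using that
  proof (induction c arbitrary: x y z)
    case (Suc c)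
    show ?case
    proof (cases "int p dvd x \<and> int p dvd y \<and> int p dvd z")
      case True
      then obtain x' y' z' where e: "x = int p * x'" "y = int p * y'" "z = int p * z'" by (auto elim!: dvdE)
      have "tern u v x y z = int p ^ 2 * tern u v x' y' z'"
        by (simp add: tern_def e power2_eq_square algebra_simps)
      moreover have "int p ^ (k + 2 * Suc c) = int p ^ 2 * int p ^ (k + 2 * c)" by (simp add: power_add[symmetric])
      ultimately have "int p ^ (k + 2 * c) dvd tern u v x' y' z'"
        using Suc.prems(2) p by (simp only: dvd_mult_cancel_left) (auto simp: prime_gt_0_nat)
      moreover have "\<not> (int p ^ c dvd x' \<and> int p ^ c dvd y' \<and> int p ^ c dvd z')"
        using Suc.prems(1) e by auto
      ultimately show ?thesis using Suc.IH by blast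
    next
      case False
      then show ?thesis using Suc.prems(2) by (meson dvd_trans le_imp_power_dvd le_add1)
    qed
  qed simp
  show ?thesis unfolding conic_iso_def
  proof
    fix k
    show "\<exists>x y z. \<not> (int p dvd x \<and> int p dvd y \<and> int p dvd z) \<and> int p ^ k dvd tern u v x y z"
      using sol[of "k + 2 * c"] red by blast
  qed
qed

lemma conic_iso_sym: "conic_iso p u v \<longleftrightarrow> conic_iso p v u"
proof -
  have "conic_iso p v u" if "conic_iso p u v" for u v
    unfolding conic_iso_def
  proof
    fix k
    obtain x y z where "\<not> (int p dvd x \<and> int p dvd y \<and> int p dvd z)" "int p ^ k dvd tern u v x y z"
      using \<open>conic_iso p u v\<close> unfolding conic_iso_def by blast
    moreover have "tern u v x y z = tern v u x z y" by (simp add: tern_def)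
    ultimately show "\<exists>x y z. \<not> (int p dvd x \<and> int p dvd y \<and> int p dvd z) \<and> int p ^ k dvd tern v u x y z"
      by metis
  qed
  then show ?thesis by blast
qed

lemma dvd_mult_vp:
  assumes "prime p" "c \<noteq> 0" "int p ^ Suc (vp p c) dvd c * x"
  shows "int p dvd x"
proof -
  have "int p ^ vp p c * int p dvd int p ^ vp p c * (upart p c * x)"
    using assms vp_upart(1)[OF assms(1,2)] by (metis mult.assoc power_Suc2)
  then have "int p dvd upart p c * x" using assms(1) by (simp add: prime_gt_0_nat)
  then show ?thesis using vp_upart(2)[OF assms(1,2)] assms(1) by (simp add: prime_dvd_mult_iff)
qed

lemma conic_iso_square:
  assumes p: "prime p" and c: "c \<noteq> 0"
  shows "conic_iso p (c^2 * u) v \<longleftrightarrow> conic_iso p u v"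
proof
  have d1: "int p dvd x" if "int p ^ Suc (vp p c) dvd x" for x
    using that by (metis dvd_trans dvd_triv_left power_Suc)
  assume a: "conic_iso p (c^2 * u) v"
  show "conic_iso p u v"
  proof (rule conic_isoI[OF p, where c = "Suc (vp p c)"])
    fix k
    obtain x y z where xyz: "\<not> (int p dvd x \<and> int p dvd y \<and> int p dvd z)" "int p ^ k dvd tern (c^2 * u) v x y z"
      using a unfolding conic_iso_def by blast
    have "tern (c^2 * u) v x y z = tern u v x (c * y) z" by (simp add: tern_def power2_eq_square algebra_simps)
    then show "\<exists>x y z. \<not> (int p ^ Suc (vp p c) dvd x \<and> int p ^ Suc (vp p c) dvd y \<and> int p ^ Suc (vp p c) dvd z) \<and> int p ^ k dvd tern u v x y z"
      using xyz d1 dvd_mult_vp[OF p c] by metis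
  qed
next
  have d1: "int p dvd x" if "int p ^ Suc (vp p c) dvd x" for x
    using that by (metis dvd_trans dvd_triv_left power_Suc)
  assume a: "conic_iso p u v"
  show "conic_iso p (c^2 * u) v"
  proof (rule conic_isoI[OF p, where c = "Suc (vp p c)"])
    fix k
    obtain x y z where xyz: "\<not> (int p dvd x \<and> int p dvd y \<and> int p dvd z)" "int p ^ k dvd tern u v x y z"
      using a unfolding conic_iso_def by blast
    have "tern (c^2 * u) v (c * x) y (c * z) = c^2 * tern u v x y z" by (simp add: tern_def power2_eq_square algebra_simps)
    then have "int p ^ k dvd tern (c^2 * u) v (c * x) y (c * z)" using xyz by simp
    then show "\<exists>x y z. \<not> (int p ^ Suc (vp p c) dvd x \<and> int p ^ Suc (vp p c) dvd y \<and> int p ^ Suc (vp p c) dvd z) \<and> int p ^ k dvd tern (c^2 * u) v x y z"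
      using xyz(1) d1 dvd_mult_vp[OF p c] by metis
  qed
qed

text \<open>Multiplying x^2 - u y^2 - v z^2 by -u gives (uy)^2 - u x^2 + uv z^2. When p divides both
  arguments exactly once, this trades one of them for p^2 times a unit.\<close>

lemma conic_iso_twist:
  assumes p: "prime p" and u: "u \<noteq> 0"
  shows "conic_iso p u (- (u * v)) \<longleftrightarrow> conic_iso p u v"
proof -
  have imp: "conic_iso p u (- (u * v))" if a: "conic_iso p u v" for v
  proof (rule conic_isoI[OF p, where c = "Suc (vp p u)"])
    fix k
    have d1: "int p dvd x" if "int p ^ Suc (vp p u) dvd x" for x
      using that by (metis dvd_trans dvd_triv_left power_Suc)
    obtain x y z where xyz: "\<not> (int p dvd x \<and> int p dvd y \<and> int p dvd z)" "int p ^ k dvd tern u v x y z"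
      using a unfolding conic_iso_def by blast
    have "tern u (- (u * v)) (u * y) x z = - u * tern u v x y z" by (simp add: tern_def power2_eq_square algebra_simps)
    then have "int p ^ k dvd tern u (- (u * v)) (u * y) x z" using xyz by simp
    then show "\<exists>x y z. \<not> (int p ^ Suc (vp p u) dvd x \<and> int p ^ Suc (vp p u) dvd y \<and> int p ^ Suc (vp p u) dvd z) \<and> int p ^ k dvd tern u (- (u * v)) x y z"
      using xyz(1) d1 dvd_mult_vp[OF p u] by metis
  qed
  have "conic_iso p u v" if "conic_iso p u (- (u * v))"
  proof -
    have "conic_iso p u (u^2 * v)" using imp[OF that] by (simp add: power2_eq_square mult_ac)
    then show ?thesis using conic_iso_square[OF p u, of v u] conic_iso_sym by blast
  qed
  then show ?thesis using imp by blast
qed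

lemma hilb_square:
  assumes "prime p" "c \<noteq> 0" "u \<noteq> 0" "v \<noteq> 0"
  shows "hilb p (c^2 * u) v = hilb p u v"
  using hilb_mult[OF assms(1), of "c * c" u v] hilb_mult[OF assms(1), of c c v] hilb_values[OF assms(1,2,4)] assms
  by (auto simp: power2_eq_square)

lemma vp_uminus: "prime p \<Longrightarrow> u \<noteq> 0 \<Longrightarrow> vp p (-u) = vp p u \<and> upart p (-u) = - upart p u"
  using vp_upart[of p u] vp_eqI[of p "-u" "vp p u" "- upart p u"] by simp

text \<open>At odd p the symbol (-1/p) occurs with exponent k^2 + k, which is even, and the symbol
  of the unit part occurs twice with exponent k. At 2 the unit parts w and -w are never both 3
  modulo 4, and \<open>chi8\<close> is even.\<close>

lemma hilb_minus_self:
  assumes "prime p" "u \<noteq> 0"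
  shows "hilb p u (-u) = 1"
proof (cases "p = 2")
  case True
  define w where "w = upart 2 u"
  have w: "odd w" using vp_upart(2)[of 2 u] assms by (auto simp: w_def True)
  have "eps4 w (- w) = 1"
  proof -
    have "\<not> (w mod 4 = 3 \<and> (- w) mod 4 = 3)" by presburger
    then show ?thesis by (simp add: eps4_def)
  qed
  moreover have "chi8 (- w) = chi8 w"
    using chi8_mult[of "-1" w] by (simp add: chi8_def[of "-1"])
  moreover have "chi8 w ^ k * chi8 w ^ k = 1" for k
    using chi8_odd[OF w] by (auto simp: power_mult_distrib[symmetric])
  ultimately show ?thesis
    unfolding hilb_def using vp_uminus[of 2 u] assms True by (simp add: w_def[symmetric])
next
  case False
  define w k where "w = upart p u" and "k = vp p u"
  have w: "\<not> int p dvd w" using vp_upart(2)[OF assms] by (simp add: w_def)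
  have "Legendre (- w) (int p) = Legendre (-1) (int p) * Legendre w (int p)"
    using Legendre_mult[OF assms(1) False, of "-1" w] by simp
  moreover have "Legendre w (int p) ^ k * Legendre w (int p) ^ k = 1"
    using Legendre_cases[OF w] by (auto simp: power_mult_distrib[symmetric])
  moreover have "Legendre (-1) (int p) ^ (k * k) * Legendre (-1) (int p) ^ k = 1"
  proof -
    have "Legendre (-1) (int p) = 1 \<or> Legendre (-1) (int p) = -1" using Legendre_minus_1[OF assms(1) False] by auto
    moreover have "even (k * k + k)" by simp
    then have "(-1::int) ^ (k * k + k) = 1" by (rule neg_one_even_power)
    ultimately show ?thesis unfolding power_add[symmetric] by (metis power_one)
  qed
  moreover have "hilb p u (-u) = Legendre (-1) (int p) ^ (k * k) * Legendre w (int p) ^ k * Legendre (- w) (int p) ^ k"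
    using False vp_uminus[OF assms] by (simp add: hilb_def w_def k_def)
  ultimately show ?thesis
    by (simp add: power_mult_distrib mult_ac)
qed

text \<open>The counterpart of \<open>conic_iso_twist\<close> for symbols, by bilinearity and (u,
  -u) = 1.\<close>

lemma hilb_twist:
  assumes "prime p" "u \<noteq> 0" "v \<noteq> 0"
  shows "hilb p u (- (u * v)) = hilb p u v"
  using hilb_mult_right[of p u "-u" v] hilb_minus_self[OF assms(1,2)] assms by simp

text \<open>Pigeonhole: for arguments 0, ..., (p-1)/2 the numbers x^2 and w y^2 + t take (p+1)/2
  distinct residues each, too many to be disjoint.\<close>

lemma quadratic_congruence_solvable:
  assumes p: "prime p" "p \<noteq> 2" and w: "\<not> int p dvd w"
  shows "\<exists>x y. int p dvd x^2 - w * y^2 - t"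
proof -
  define m where "m = (p - 1) div 2"
  have pm: "p = 2 * m + 1" using p prime_odd_nat[of p] prime_gt_1_nat[of p] by (auto simp: m_def elim!: oddE)
  define f g where "f x = x^2 mod int p" and "g y = (w * y^2 + t) mod int p" for x y :: int
  have sq: "x = y" if "x \<in> {0..int m}" "y \<in> {0..int m}" "int p dvd x^2 - y^2" for x y
  proof -
    have "int p dvd (x - y) * (x + y)" using that(3) by (simp add: power2_eq_square algebra_simps)
    then have "int p dvd x - y \<or> int p dvd x + y" using p by (simp add: prime_dvd_mult_iff)
    then show ?thesis
    proof
      assume "int p dvd x - y"
      then show ?thesis using that pm by (intro small_dvd_eq[of "int p"]) auto
    next
      assume d: "int p dvd x + y"
      have "x + y < int p" "0 \<le> x + y" using that pm by auto
      then have "x + y = 0" using d zdvd_not_zless[of "x + y" "int p"] by linarith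
      then show ?thesis using that by auto
    qed
  qed
  have injf: "inj_on f {0..int m}"
  proof (rule inj_onI)
    fix x y assume "x \<in> {0..int m}" "y \<in> {0..int m}" "f x = f y"
    then show "x = y" using sq by (simp add: f_def mod_eq_dvd_iff)
  qed
  have injg: "inj_on g {0..int m}"
  proof (rule inj_onI)
    fix x y assume xy: "x \<in> {0..int m}" "y \<in> {0..int m}" "g x = g y"
    then have "int p dvd (w * x^2 + t) - (w * y^2 + t)" by (simp add: g_def mod_eq_dvd_iff)
    then have "int p dvd w * (x^2 - y^2)" by (simp add: algebra_simps)
    then show "x = y" using sq xy w p by (simp add: prime_dvd_mult_iff)
  qed
  have "f ` {0..int m} \<inter> g ` {0..int m} \<noteq> {}"
  proof
    assume "f ` {0..int m} \<inter> g ` {0..int m} = {}"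
    then have "card (f ` {0..int m} \<union> g ` {0..int m}) = (m + 1) + (m + 1)"
      by (subst card_Un_disjoint) (auto simp: card_image injf injg)
    moreover have "card (f ` {0..int m} \<union> g ` {0..int m}) \<le> card {0..<int p}"
      by (rule card_mono) (use p in \<open>auto simp: f_def g_def prime_gt_0_nat\<close>)
    ultimately show False using pm by simp
  qed
  then obtain x y where "f x = g y" by blast
  then have "int p dvd x^2 - (w * y^2 + t)" by (simp add: f_def g_def mod_eq_dvd_iff)
  then show ?thesis by (metis diff_diff_eq)
qed

text \<open>A solution modulo p with z = 1 exists by pigeonhole. As t is a unit, x or y is a unit,
  and the corresponding square is lifted while the other coordinate is kept.\<close>

lemma conic_iso_units_odd:
  assumes p: "prime p" "p \<noteq> 2" and w: "\<not> int p dvd w" and t: "\<not> int p dvd t"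
  shows "conic_iso p w t"
  unfolding conic_iso_def
proof
  fix k
  obtain x y where xy: "int p dvd x^2 - w * y^2 - t" using quadratic_congruence_solvable[OF p w] by blast
  show "\<exists>x y z. \<not> (int p dvd x \<and> int p dvd y \<and> int p dvd z) \<and> int p ^ k dvd tern w t x y z"
  proof (cases "int p dvd x")
    case False
    define a where "a = w * y^2 + t"
    have c: "[x^2 = a] (mod int p)" using xy by (simp add: a_def cong_iff_dvd_diff diff_diff_eq)
    have "\<not> int p dvd a" using c False p by (metis cong_dvd_iff prime_dvd_power prime_nat_int_transfer)
    then obtain X where "int p ^ k dvd X^2 - a" using square_lift_odd[OF p _ c] by blast
    moreover have "tern w t X y 1 = X^2 - a" by (simp add: tern_def a_def)
    ultimately show ?thesis using p(1) prime_gt_1_nat[of p] by (metis zdvd1_eq abs_of_nat of_nat_1 of_nat_eq_iff less_irrefl)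
  next
    case True
    obtain b where b: "[w * b = 1] (mod int p ^ k)"
    proof -
      have "coprime w (int p ^ k)" using w p by (metis coprime_commute coprime_power_right_iff prime_imp_coprime prime_nat_int_transfer)
      then show ?thesis using cong_solve_coprime_int that by blast
    qed
    show ?thesis
    proof (cases "k = 0")
      case True
      then show ?thesis using w by (intro exI[of _ 1] exI[of _ 0]) (use p prime_gt_1_nat in fastforce)
    next
      case False
      then have b1: "[w * b = 1] (mod int p)" using b by (metis cong_dvd_modulus dvd_power not_gr_zero)
      define a where "a = b * (x^2 - t)"
      have c: "[y^2 = a] (mod int p)"
      proof -
        have "int p dvd b * (x^2 - w * y^2 - t) + y^2 * (w * b - 1)"
          using xy b1 by (intro dvd_add) (auto simp: cong_iff_dvd_diff)
        then have "int p dvd a - y^2" by (simp add: a_def algebra_simps)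
        then show ?thesis by (simp add: cong_iff_dvd_diff dvd_diff_commute)
      qed
      have "\<not> int p dvd a"
      proof
        assume "int p dvd a"
        then have "int p dvd b \<or> int p dvd x^2 - t" using p by (simp add: a_def prime_dvd_mult_iff)
        moreover have "\<not> int p dvd b"
        proof
          assume "int p dvd b"
          then have "int p dvd w * b - (w * b - 1)" using b1 by (rule_tac dvd_diff) (auto simp: cong_iff_dvd_diff)
          then have "int p dvd 1" by (simp only: diff_diff_eq2 add_diff_cancel_left')
          then show False using p prime_not_dvd_1 by blast
        qed
        moreover have "\<not> int p dvd x^2 - t"
        proof
          assume "int p dvd x^2 - t"
          then have "int p dvd x^2 - (x^2 - t)" using True by (rule_tac dvd_diff) (auto simp: power2_eq_square)
          then show False using t by simp
        qed
        ultimately show False by blast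
      qed
      then obtain Y where Y: "int p ^ k dvd Y^2 - a" using square_lift_odd[OF p _ c] by blast
      have "tern w t x Y 1 = - w * (Y^2 - a) - (x^2 - t) * (w * b - 1)" by (simp add: tern_def a_def algebra_simps)
      moreover have "int p ^ k dvd - w * (Y^2 - a) - (x^2 - t) * (w * b - 1)"
        using Y b by (intro dvd_diff) (auto simp: cong_iff_dvd_diff)
      ultimately have "int p ^ k dvd tern w t x Y 1" by simp
      moreover have "\<not> int p dvd 1" using p prime_not_dvd_1 by simp
      ultimately show ?thesis by blast
    qed
  qed
qed

text \<open>A primitive zero modulo p^2 has z prime to p, for otherwise p would divide x and then y;
  reduction modulo p shows t z^2 to be a square. Conversely a root of t gives a zero with y =
  0.\<close>

lemma conic_iso_prime_unit_odd:
  assumes p: "prime p" "p \<noteq> 2" and w: "\<not> int p dvd w" and t: "\<not> int p dvd t"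
  shows "conic_iso p (int p * w) t \<longleftrightarrow> Legendre t (int p) = 1"
proof
  assume L: "Legendre t (int p) = 1"
  then obtain x where x: "[x^2 = t] (mod int p)" unfolding Legendre_def QuadRes_def by (auto split: if_splits)
  show "conic_iso p (int p * w) t" unfolding conic_iso_def
  proof
    fix k
    obtain X where "int p ^ k dvd X^2 - t" using square_lift_odd[OF p t x] by blast
    then have "int p ^ k dvd tern (int p * w) t X 0 1" by (simp add: tern_def)
    then show "\<exists>x y z. \<not> (int p dvd x \<and> int p dvd y \<and> int p dvd z) \<and> int p ^ k dvd tern (int p * w) t x y z"
      using prime_not_dvd_1[OF p(1)] by blast
  qed
next
  assume "conic_iso p (int p * w) t"
  then obtain x y z where xyz: "\<not> (int p dvd x \<and> int p dvd y \<and> int p dvd z)" "int p ^ 2 dvd tern (int p * w) t x y z"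
    unfolding conic_iso_def by blast
  have pp: "prime (int p)" using p by simp
  have d1: "int p dvd tern (int p * w) t x y z" using xyz(2) by (meson dvd_power dvd_trans zero_less_numeral)
  have "int p dvd tern (int p * w) t x y z + int p * (w * y^2)" using d1 by simp
  then have d: "int p dvd x^2 - t * z^2" by (simp add: tern_def algebra_simps)
  have z: "\<not> int p dvd z"
  proof
    assume z: "int p dvd z"
    then have "int p dvd (x^2 - t * z^2) + t * z^2" using d by (intro dvd_add) (auto simp: power2_eq_square)
    then have x: "int p dvd x" using pp by (simp add: prime_dvd_power_iff)
    have "int p ^ 2 dvd x^2" "int p ^ 2 dvd t * z^2" using x z by (auto simp: dvd_power_same)
    then have "int p ^ 2 dvd x^2 - t * z^2 - tern (int p * w) t x y z" using xyz(2) by (intro dvd_diff)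
    moreover have "x^2 - t * z^2 - tern (int p * w) t x y z = int p * (w * y^2)" by (simp add: tern_def)
    ultimately have "int p * int p dvd int p * (w * y^2)" by (simp add: power2_eq_square)
    then have "int p dvd w * y^2" using p by (simp add: prime_gt_0_nat)
    then have "int p dvd y" using w pp by (simp add: prime_dvd_mult_iff prime_dvd_power_iff)
    then show False using x z xyz(1) by blast
  qed
  have "Legendre (x^2) (int p) = Legendre (t * z^2) (int p)" by (rule Legendre_cong) (use d in \<open>simp add: cong_iff_dvd_diff\<close>)
  also have "\<dots> = Legendre t (int p)" using Legendre_mult[OF p] Legendre_square[OF pp z] by simp
  finally have "Legendre t (int p) = Legendre (x^2) (int p)" ..
  moreover have "\<not> int p dvd x"
  proof
    assume "int p dvd x"
    then have "Legendre (x^2) (int p) = 0" by (simp add: Legendre_eq_0 power2_eq_square)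
    then have "Legendre t (int p) = 0" using calculation by (simp only:)
    then show False using t Legendre_eq_0 by blast
  qed
  ultimately show "Legendre t (int p) = 1" using Legendre_square[OF pp] by simp
qed

section \<open>Conics over the 2-adic numbers\<close>

lemma odd_square_mod_8: "odd (x::int) \<Longrightarrow> x^2 mod 8 = 1"
proof -
  assume "odd x"
  then have "x mod 8 \<in> {1,3,5,7}" by (rule odd_mod_8)
  moreover have "x^2 mod 8 = (x mod 8)^2 mod 8" by (simp add: power_mod)
  ultimately show ?thesis by (elim insertE) auto
qed

text \<open>With z = 1 the task is to extract a 2-adic square root of t + u y^2.\<close>

lemma conic_iso_2_aux:
  assumes "(t + u * y^2) mod 8 = 1"
  shows "conic_iso 2 u t"
  unfolding conic_iso_def
proof
  fix k
  obtain X where "2 ^ k dvd X^2 - (t + u * y^2)" using square_lift_2[OF assms] by blast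
  moreover have "tern u t X y 1 = X^2 - (t + u * y^2)" by (simp add: tern_def)
  ultimately have "2 ^ k dvd tern u t X y 1" by simp
  then show "\<exists>x y z. \<not> (int 2 dvd x \<and> int 2 dvd y \<and> int 2 dvd z) \<and> int 2 ^ k dvd tern u t x y z"
    by (metis odd_one of_nat_numeral)
qed

text \<open>If t is 1 modulo 4, then y = 0 or y = 2 makes t + w y^2 congruent to 1 modulo 8; the
  roles of w and t are symmetric. If both are 3 modulo 4, the form is x^2 + y^2 + z^2 modulo 4,
  whose zeros have all coordinates even.\<close>

lemma conic_iso_units_2:
  assumes w: "odd w" and t: "odd t"
  shows "conic_iso 2 w t \<longleftrightarrow> \<not> (w mod 4 = 3 \<and> t mod 4 = 3)"
proof
  have one: "conic_iso 2 w t" if "odd w" "t mod 4 = 1" for w t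
  proof -
    have "t mod 8 = 1 \<or> t mod 8 = 5" using that by presburger
    then show ?thesis
    proof
      assume "t mod 8 = 1"
      then show ?thesis using conic_iso_2_aux[of t w 0] by simp
    next
      assume "t mod 8 = 5"
      then have "(t + w * 2^2) mod 8 = 1" using that(1) by simp presburger
      then show ?thesis by (rule conic_iso_2_aux)
    qed
  qed
  assume "\<not> (w mod 4 = 3 \<and> t mod 4 = 3)"
  then have "w mod 4 = 1 \<or> t mod 4 = 1" using odd_mod_4[OF w] odd_mod_4[OF t] by auto
  then show "conic_iso 2 w t" using one[OF w, of t] one[OF t, of w] conic_iso_sym by blast
next
  assume iso: "conic_iso 2 w t"
  show "\<not> (w mod 4 = 3 \<and> t mod 4 = 3)"
  proof
    assume wt: "w mod 4 = 3 \<and> t mod 4 = 3"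
    obtain x y z :: int where xyz: "\<not> (even x \<and> even y \<and> even z)" "2 ^ 2 dvd tern w t x y z"
      using iso unfolding conic_iso_def by (metis of_nat_numeral)
    have "4 dvd w + 1" "4 dvd t + 1" using wt by presburger+
    then have "4 dvd tern w t x y z + (w + 1) * y^2 + (t + 1) * z^2" using xyz(2) by (intro dvd_add) auto
    moreover have "tern w t x y z + (w + 1) * y^2 + (t + 1) * z^2 = x^2 + y^2 + z^2" by (simp add: tern_def algebra_simps)
    ultimately have d: "4 dvd x^2 + y^2 + z^2" by simp
    have sq: "x^2 mod 4 = (if even x then 0 else 1)" for x :: int
    proof (cases "even x")
      case True
      then show ?thesis by (auto elim!: evenE simp: power2_eq_square)
    next
      case False
      then have "x^2 mod 8 = 1" by (rule odd_square_mod_8)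
      then have "x^2 mod 4 = 1" by presburger
      then show ?thesis using False by simp
    qed
    have "(a + b + c) mod 4 = (a mod 4 + b mod 4 + c mod 4) mod 4" for a b c :: int by (metis mod_add_eq mod_add_left_eq)
    from this[of "x^2" "y^2" "z^2"] have "(x^2 mod 4 + y^2 mod 4 + z^2 mod 4) mod 4 = 0"
      using d by (simp only: dvd_eq_mod_eq_0)
    then show False using xyz(1) unfolding sq by (auto split: if_splits)
  qed
qed

text \<open>A primitive zero modulo 8 has x and z odd; then t is 1 modulo 8 if y is even, and t + 2w
  is 1 modulo 8 if y is odd. A check of residues modulo 8 identifies these two cases with the
  symbol.\<close>

lemma conic_iso_prime_unit_2:
  assumes w: "odd w" and t: "odd t"
  shows "conic_iso 2 (2 * w) t \<longleftrightarrow> eps4 w t * chi8 t = 1"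
proof -
  have eq: "eps4 w t * chi8 t = 1 \<longleftrightarrow> t mod 8 = 1 \<or> (t + 2 * w) mod 8 = 1"
  proof -
    define a b where "a = w mod 8" and "b = t mod 8"
    have m: "a \<in> {1,3,5,7}" "b \<in> {1,3,5,7}" using odd_mod_8 w t by (simp_all only: a_def b_def)
    obtain T W where TW: "t = 8 * T + b" "w = 8 * W + a" unfolding a_def b_def by (metis mult_div_mod_eq)
    have "t + 2 * w = (b + 2 * a) + 8 * (T + 2 * W)" by (subst TW(1), subst TW(2)) (simp add: algebra_simps)
    then have e8: "(t + 2 * w) mod 8 = (b + 2 * a) mod 8" by (simp only: mod_mult_self2)
    have e: "w mod 4 = a mod 4" "t mod 4 = b mod 4" "t mod 8 = b"
      by (simp_all add: a_def b_def mod_mod_cancel)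
    show ?thesis using m unfolding eps4_def chi8_def e e8 by (elim insertE emptyE) simp_all
  qed
  have "conic_iso 2 (2 * w) t \<longleftrightarrow> t mod 8 = 1 \<or> (t + 2 * w) mod 8 = 1"
  proof
    assume "t mod 8 = 1 \<or> (t + 2 * w) mod 8 = 1"
    then show "conic_iso 2 (2 * w) t" using conic_iso_2_aux[of t "2 * w" 0] conic_iso_2_aux[of t "2 * w" 1] by auto
  next
    assume iso: "conic_iso 2 (2 * w) t"
    obtain x y z :: int where xyz: "\<not> (even x \<and> even y \<and> even z)" "2 ^ 3 dvd tern (2 * w) t x y z"
      using iso unfolding conic_iso_def by (metis of_nat_numeral)
    then obtain m where m: "x^2 - 2 * w * y^2 - t * z^2 = 8 * m" unfolding tern_def by (auto elim: dvdE)
    have z: "odd z"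
    proof
      assume z: "even z"
      have "x^2 = 2 * (4 * m + w * y^2) + t * z^2" using m by (simp add: algebra_simps)
      then have "even (x^2)" using z by simp
      then have x: "even x" by simp
      obtain x' z' where "x = 2 * x'" "z = 2 * z'" using x z by blast
      then have "4 * x'^2 - 2 * (w * y^2) - 4 * (t * z'^2) = 8 * m" using m by (simp add: power2_eq_square algebra_simps)
      then have "w * y^2 = 2 * (x'^2 - t * z'^2 - 2 * m)" by (simp add: algebra_simps)
      then have "even (w * y^2)" by simp
      then show False using w x z xyz(1) by auto
    qed
    have "x^2 = 2 * (4 * m + w * y^2) + t * z^2" using m by (simp add: algebra_simps)
    then have "odd (x^2)" using z t by simp
    then have x: "odd x" by simp
    have x8: "x^2 mod 8 = 1" "z^2 mod 8 = 1" using x z odd_square_mod_8 by auto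
    obtain Z where Z: "z^2 = 8 * Z + 1" using x8(2) by (metis mult_div_mod_eq)
    show "t mod 8 = 1 \<or> (t + 2 * w) mod 8 = 1"
    proof (cases "even y")
      case True
      then obtain y' where "y = 2 * y'" by blast
      then have e: "x^2 = t * z^2 + 8 * (m + w * y'^2)" using m by (simp add: power2_eq_square algebra_simps)
      also have "\<dots> = t + 8 * (m + w * y'^2 + t * Z)" by (subst Z) (simp add: algebra_simps)
      finally have "x^2 mod 8 = t mod 8" by (simp only: mod_mult_self2)
      then show ?thesis using x8 by simp
    next
      case False
      then have "y^2 mod 8 = 1" by (rule odd_square_mod_8)
      then obtain Y where Y: "y^2 = 8 * Y + 1" by (metis mult_div_mod_eq)
      have "x^2 = 2 * w * y^2 + t * z^2 + 8 * m" using m by (simp add: algebra_simps)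
      also have "\<dots> = (t + 2 * w) + 8 * (m + 2 * w * Y + t * Z)" by (subst Y, subst Z) (simp add: algebra_simps)
      finally have "x^2 mod 8 = (t + 2 * w) mod 8" by (simp only: mod_mult_self2)
      then show ?thesis using x8 by simp
    qed
  qed
  then show ?thesis using eq by blast
qed

text \<open>Both sides depend on the arguments only up to squares, which leaves units and p times
  units. Two arguments divisible by p are reduced by the twist to one such argument and a
  unit.\<close>

theorem conic_iso_iff_hilb:
  assumes p: "prime p" and u: "u \<noteq> 0" and v: "v \<noteq> 0"
  shows "conic_iso p u v \<longleftrightarrow> hilb p u v = 1"
proof -
  have unit_unit: "conic_iso p w t \<longleftrightarrow> hilb p w t = 1" if "\<not> int p dvd w" "\<not> int p dvd t" for w t
  proof (cases "p = 2")
    case True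
    then have "hilb p w t = eps4 w t" using that vp_unit[OF p that(1)] vp_unit[OF p that(2)] by (simp add: hilb_def)
    then show ?thesis using conic_iso_units_2[of w t] that True by (auto simp: eps4_def)
  next
    case False
    then show ?thesis using conic_iso_units_odd[OF p False that] hilb_units[OF p False that] by simp
  qed
  have prime_unit: "conic_iso p (int p * w) t \<longleftrightarrow> hilb p (int p * w) t = 1" if "\<not> int p dvd w" "\<not> int p dvd t" for w t
  proof -
    have v: "vp p (int p * w) = 1" "upart p (int p * w) = w" using vp_eqI[OF p, of "int p * w" 1 w] that by simp_all
    show ?thesis
    proof (cases "p = 2")
      case True
      then have "hilb p (int p * w) t = eps4 w t * chi8 t" using v vp_unit[OF p that(2)] by (simp add: hilb_def)
      then show ?thesis using conic_iso_prime_unit_2[of w t] that True by simp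
    next
      case False
      then have "hilb p (int p * w) t = Legendre t (int p)" using v vp_unit[OF p that(2)] by (simp add: hilb_def)
      then show ?thesis using conic_iso_prime_unit_odd[OF p False that] by simp
    qed
  qed
  have nz: "w \<noteq> 0" if "\<not> int p dvd w" for w using that by auto
  have p0: "int p \<noteq> 0" using p by auto
  have prime_prime: "conic_iso p (int p * w) (int p * t) \<longleftrightarrow> hilb p (int p * w) (int p * t) = 1" if wt: "\<not> int p dvd w" "\<not> int p dvd t" for w t
  proof -
    have e: "- ((int p * w) * (int p * t)) = int p ^ 2 * (- (w * t))" by (simp add: power2_eq_square algebra_simps)
    have u: "\<not> int p dvd - (w * t)" using wt p by (simp add: prime_dvd_mult_iff)
    have "conic_iso p (int p * w) (int p * t) \<longleftrightarrow> conic_iso p (int p ^ 2 * (- (w * t))) (int p * w)"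
      using conic_iso_twist[OF p, of "int p * w" "int p * t"] p0 nz[OF wt(1)] e conic_iso_sym by auto
    also have "\<dots> \<longleftrightarrow> conic_iso p (int p * w) (- (w * t))"
      using conic_iso_square[OF p p0] conic_iso_sym by blast
    also have "\<dots> \<longleftrightarrow> hilb p (int p * w) (- (w * t)) = 1" by (rule prime_unit[OF wt(1) u])
    also have "hilb p (int p * w) (- (w * t)) = hilb p (int p ^ 2 * (- (w * t))) (int p * w)"
      using hilb_square[OF p p0 nz[OF u], of "int p * w"] p0 nz[OF wt(1)] by (simp add: hilb_sym)
    also have "\<dots> = hilb p (int p * w) (- ((int p * w) * (int p * t)))" unfolding e by (rule hilb_sym)
    also have "\<dots> = hilb p (int p * w) (int p * t)"
      by (rule hilb_twist) (use p p0 nz wt in auto)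
    finally show ?thesis .
  qed
  \<comment> \<open>A representative of the square class: even powers of p are removed, so p divides
    it at most once.\<close>
  define nf where "nf a = (if even (vp p a) then upart p a else int p * upart p a)" for a
  have nf: "a = (int p ^ (vp p a div 2))^2 * nf a" if "a \<noteq> 0" for a
  proof (cases "even (vp p a)")
    case True
    then have "int p ^ vp p a = (int p ^ (vp p a div 2))^2" by (simp add: power_mult[symmetric])
    then show ?thesis using vp_upart(1)[OF p that] True by (simp add: nf_def)
  next
    case False
    then have "int p ^ vp p a = (int p ^ (vp p a div 2))^2 * int p"
      by (metis odd_two_times_div_two_succ power_add power_mult power_one_right mult.commute)
    then show ?thesis using vp_upart(1)[OF p that] False by (simp add: nf_def mult.assoc)
  qed
  have nf0: "nf a \<noteq> 0" if "a \<noteq> 0" for a using nf[OF that] that by auto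
  have main: "conic_iso p (nf u) (nf v) \<longleftrightarrow> hilb p (nf u) (nf v) = 1"
  proof -
    have uu: "\<not> int p dvd upart p u" "\<not> int p dvd upart p v" using vp_upart(2)[OF p] u v by auto
    show ?thesis unfolding nf_def
      using unit_unit[OF uu] prime_unit[OF uu] prime_unit[OF uu(2,1)] prime_prime[OF uu]
      by (auto simp: conic_iso_sym[of p _ "int p * upart p v"] hilb_sym[of p _ "int p * upart p v"])
  qed
  have pk: "int p ^ k \<noteq> 0" for k using p0 by simp
  have "conic_iso p u v \<longleftrightarrow> conic_iso p (nf u) (nf v)"
    using nf[OF u] nf[OF v] conic_iso_square[OF p pk] conic_iso_sym by metis
  moreover have "hilb p u v = hilb p (nf u) (nf v)"
    using nf[OF u] nf[OF v] hilb_square[OF p pk] hilb_sym nf0 u v by metis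
  ultimately show ?thesis using main by simp
qed

section \<open>The p-adic integers as coherent integer sequences\<close>

text \<open>\<open>pdv p k x\<close> says that \<open>x \<in> p\<^sup>k \<int>\<^bsub>(p)\<^esub>\<close>.\<close>
definition pdv :: "nat \<Rightarrow> nat \<Rightarrow> rat \<Rightarrow> bool" where
  "pdv p k x \<longleftrightarrow> (\<exists>a b::int. \<not> int p dvd b \<and> x = of_int (int p ^ k * a) / of_int b)"

lemma pdv_int:
  assumes "prime p"
  shows "pdv p k (of_int m) \<longleftrightarrow> int p ^ k dvd m"
proof
  assume "pdv p k (of_int m)"
  then obtain a b where ab: "\<not> int p dvd b" "(of_int m :: rat) = of_int (int p ^ k * a) / of_int b"
    unfolding pdv_def by blast
  have "b \<noteq> 0" using ab(1) by auto
  then have "(of_int (m * b) :: rat) = of_int (int p ^ k * a)" using ab(2) by (simp add: field_simps)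
  then have "m * b = int p ^ k * a" by (simp only: of_int_eq_iff)
  then have "int p ^ k dvd m * b" by simp
  moreover have "coprime (int p ^ k) b" using ab(1) assms by (simp add: prime_imp_coprime)
  ultimately show "int p ^ k dvd m" by (simp add: coprime_dvd_mult_left_iff)
next
  assume "int p ^ k dvd m"
  moreover have "\<not> int p dvd 1" using assms prime_gt_1_nat by (simp add: prime_nat_iff)
  ultimately show "pdv p k (of_int m)" unfolding pdv_def by (intro exI[of _ "m div int p ^ k"] exI[of _ 1]) auto
qed

lemma pdv_0: "prime p \<Longrightarrow> pdv p k 0"
  using pdv_int[of p k 0] by simp

lemma pdv_add:
  assumes "prime p" "pdv p k x" "pdv p k y"
  shows "pdv p k (x + y)"
proof -
  obtain a b c d where e: "\<not> int p dvd b" "x = of_int (int p ^ k * a) / of_int b"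
    "\<not> int p dvd d" "y = of_int (int p ^ k * c) / of_int d" using assms(2,3) unfolding pdv_def by blast
  have "b \<noteq> 0" "d \<noteq> 0" using e by auto
  then have "x + y = of_int (int p ^ k * (a * d + c * b)) / of_int (b * d)"
    by (simp add: e(2,4) add_frac_eq distrib_left mult_ac)
  moreover have "\<not> int p dvd b * d" using e assms(1) by (simp add: prime_dvd_mult_iff)
  ultimately show ?thesis unfolding pdv_def by blast
qed

lemma pdv_mult:
  assumes "prime p" "pdv p k x" "pdv p l y"
  shows "pdv p (k + l) (x * y)"
proof -
  obtain a b c d where e: "\<not> int p dvd b" "x = of_int (int p ^ k * a) / of_int b"
    "\<not> int p dvd d" "y = of_int (int p ^ l * c) / of_int d" using assms(2,3) unfolding pdv_def by blast
  have "x * y = of_int (int p ^ (k + l) * (a * c)) / of_int (b * d)"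
    by (simp add: e(2,4) power_add mult_ac)
  moreover have "\<not> int p dvd b * d" using e assms(1) by (simp add: prime_dvd_mult_iff)
  ultimately show ?thesis unfolding pdv_def by blast
qed

lemma pdv_uminus: "pdv p k x \<Longrightarrow> pdv p k (- x)"
  unfolding pdv_def by (metis minus_divide_left mult_minus_right of_int_minus)

lemma pdv_diff: "prime p \<Longrightarrow> pdv p k x \<Longrightarrow> pdv p k y \<Longrightarrow> pdv p k (x - y)"
  using pdv_add[of p k x "- y"] pdv_uminus by simp

lemma pdv_mono: "pdv p k x \<Longrightarrow> l \<le> k \<Longrightarrow> pdv p l x"
  unfolding pdv_def by (metis le_add_diff_inverse mult.assoc power_add)

lemma pdv_cancel:
  assumes "prime p"
  shows "pdv p (k + j) (of_int (int p ^ j) * x) \<longleftrightarrow> pdv p k x"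
proof
  assume "pdv p (k + j) (of_int (int p ^ j) * x)"
  then obtain a b where ab: "\<not> int p dvd b" "of_int (int p ^ j) * x = of_int (int p ^ (k + j) * a) / of_int b"
    unfolding pdv_def by blast
  have p0: "(of_int (int p ^ j) :: rat) \<noteq> 0" using assms by (auto simp: prime_gt_0_nat)
  have "of_int (int p ^ j) * x = of_int (int p ^ j) * (of_int (int p ^ k * a) / of_int b)"
    unfolding ab(2) by (simp add: power_add mult_ac)
  then have "x = of_int (int p ^ k * a) / of_int b" using p0 by (simp only: mult_cancel_left) simp
  then show "pdv p k x" using ab(1) unfolding pdv_def by blast
next
  assume "pdv p k x"
  moreover have "pdv p j (of_int (int p ^ j))" by (simp only: pdv_int[OF assms] dvd_refl)
  ultimately show "pdv p (k + j) (of_int (int p ^ j) * x)" using pdv_mult[OF assms] by (metis add.commute)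
qed

lemma pdv_denominator:
  assumes "prime p"
  shows "\<exists>j. pdv p 0 (of_int (int p ^ j) * x)"
proof -
  obtain n d where nd: "x = of_int n / of_int d" "d \<noteq> 0"
    by (metis quotient_of_div quotient_of_denom_pos' surj_pair less_irrefl snd_conv)
  define j where "j = multiplicity (int p) d"
  obtain b where b: "d = int p ^ j * b" "\<not> int p dvd b"
    using multiplicity_decompose'[of d "int p"] nd(2) assms unfolding j_def
    by (metis not_prime_unit prime_nat_int_transfer)
  have "of_int (int p ^ j) * x = of_int (int p ^ 0 * n) / of_int b"
    using nd b assms by (simp add: prime_gt_0_nat)
  then show ?thesis using b(2) unfolding pdv_def by blast
qed

text \<open>The denominator is invertible modulo p^k, so multiplication by an inverse replaces the
  division.\<close>

lemma pdv_approx: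
  assumes "prime p" "pdv p 0 x"
  shows "\<exists>m. pdv p k (x - of_int m)"
proof -
  obtain a b where ab: "\<not> int p dvd b" "x = of_int a / of_int b" using assms(2) unfolding pdv_def by auto
  have "coprime (int p) b" using ab(1) assms by (simp add: prime_imp_coprime)
  then have "coprime b (int p ^ k)" by (simp add: coprime_commute)
  then obtain c where "[b * c = 1] (mod int p ^ k)" using cong_solve_coprime_int by blast
  then obtain t where t: "b * c - 1 = int p ^ k * t" by (auto simp: cong_iff_dvd_diff elim: dvdE)
  have "b \<noteq> 0" using ab by auto
  have "x - of_int (a * c) = of_int (a - a * c * b) / of_int b"
    using \<open>b \<noteq> 0\<close> by (simp add: ab(2) field_simps)
  also have "a - a * c * b = int p ^ k * (- (t * a))"
    using arg_cong[OF t, of "\<lambda>v. - (a * v)"] by (simp add: algebra_simps)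
  finally show ?thesis using ab(1) unfolding pdv_def by blast
qed

text \<open>Translates the real-valued absolute value into divisibility, so that convergence becomes
  a matter of congruences. Numerator and denominator are coprime, hence a nonnegative valuation
  means that p does not divide the denominator.\<close>

lemma padic_abs_le:
  assumes p: "prime p"
  shows "padic_abs p x \<le> real p powi (- int k) \<longleftrightarrow> pdv p k x"
proof (cases "x = 0")
  case True
  then show ?thesis using p by (simp add: padic_abs_def pdv_0)
next
  case False
  obtain n d where nd: "quotient_of x = (n, d)" by (cases "quotient_of x")
  have d: "d > 0" "coprime n d" "x = of_int n / of_int d"
    using quotient_of_denom_pos[OF nd] quotient_of_coprime[OF nd] quotient_of_div[OF nd] by auto
  have n0: "n \<noteq> 0" using False d(3) by auto
  have pp: "prime (int p)" using p by simp
  have nu: "\<not> is_unit (int p)" using pp not_prime_unit by blast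
  have p1: "real p > 1" using p prime_gt_1_nat by simp
  have val: "padic_val p x = int (multiplicity (int p) n) - int (multiplicity (int p) d)"
    by (simp add: padic_val_def nd)
  have iff: "padic_abs p x \<le> real p powi (- int k) \<longleftrightarrow> int k \<le> padic_val p x"
  proof
    assume a: "padic_abs p x \<le> real p powi (- int k)"
    show "int k \<le> padic_val p x"
    proof (rule ccontr)
      assume "\<not> int k \<le> padic_val p x"
      then have "real p powi (- int k) < real p powi (- padic_val p x)" using p1 by (intro power_int_strict_increasing) auto
      then show False using a False by (simp add: padic_abs_def)
    qed
  next
    assume "int k \<le> padic_val p x"
    then show "padic_abs p x \<le> real p powi (- int k)"
      using False p1 by (simp add: padic_abs_def power_int_increasing)
  qed
  have "int k \<le> padic_val p x \<longleftrightarrow> pdv p k x"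
  proof
    assume v: "int k \<le> padic_val p x"
    have "\<not> int p dvd d"
    proof
      assume pd: "int p dvd d"
      then have "\<not> int p dvd n" using d(2) nu by (meson coprime_common_divisor)
      then have "multiplicity (int p) n = 0" by (simp add: not_dvd_imp_multiplicity_0)
      moreover have "multiplicity (int p) d > 0" using pd d(1) nu by (simp add: multiplicity_gt_zero_iff)
      ultimately show False using v val by simp
    qed
    moreover have "int p ^ k dvd n"
      using v val by (intro multiplicity_dvd') simp
    ultimately show "pdv p k x" unfolding pdv_def d(3) by (elim dvdE) blast
  next
    assume "pdv p k x"
    then obtain a b where ab: "\<not> int p dvd b" "x = of_int (int p ^ k * a) / of_int b" unfolding pdv_def by blast
    have b0: "b \<noteq> 0" using ab by auto
    have a0: "a \<noteq> 0" using False ab by auto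
    have "(of_int (n * b) :: rat) = of_int (int p ^ k * a * d)" using ab(2) d(1,3) b0 by (simp add: field_simps)
    then have "n * b = int p ^ k * a * d" by (simp only: of_int_eq_iff)
    then have "multiplicity (int p) (n * b) = multiplicity (int p) (int p ^ k * a * d)" by simp
    moreover have "multiplicity (int p) (n * b) = multiplicity (int p) n"
      using pp n0 b0 ab(1) by (simp add: prime_elem_multiplicity_mult_distrib not_dvd_imp_multiplicity_0)
    moreover have "multiplicity (int p) (int p ^ k * a * d) = k + multiplicity (int p) a + multiplicity (int p) d"
      using pp a0 d(1) p by (simp add: prime_elem_multiplicity_mult_distrib prime_gt_0_nat)
    ultimately show "int k \<le> padic_val p x" using val by simp
  qed
  then show ?thesis using iff by simp
qed

lemma padic_abs_nonneg: "padic_abs p x \<ge> 0"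
  by (simp add: padic_abs_def)

lemma padic_small:
  assumes "prime p" "e > 0"
  shows "\<exists>k. real p powi (- int k) < e"
proof -
  have "1 / real p < 1" using prime_gt_1_nat[OF assms(1)] by simp
  then obtain k where "(1 / real p) ^ k < e" using real_arch_pow_inv[OF assms(2)] by blast
  then show ?thesis by (intro exI[of _ k]) (simp add: power_int_minus power_one_over inverse_eq_divide)
qed

lemma padic_cauchy_iff:
  assumes p: "prime p"
  shows "padic_cauchy p x \<longleftrightarrow> (\<forall>k. \<exists>N. \<forall>i\<ge>N. \<forall>j\<ge>N. pdv p k (x i - x j))"
proof
  assume c: "padic_cauchy p x"
  show "\<forall>k. \<exists>N. \<forall>i\<ge>N. \<forall>j\<ge>N. pdv p k (x i - x j)"
  proof
    fix k
    have "real p powi (- int k) > 0" using p by (simp add: prime_gt_0_nat)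
    then show "\<exists>N. \<forall>i\<ge>N. \<forall>j\<ge>N. pdv p k (x i - x j)"
      using c padic_abs_le[OF p] unfolding padic_cauchy_def by (meson less_imp_le)
  qed
next
  assume c: "\<forall>k. \<exists>N. \<forall>i\<ge>N. \<forall>j\<ge>N. pdv p k (x i - x j)"
  show "padic_cauchy p x" unfolding padic_cauchy_def
  proof (intro allI impI)
    fix e :: real assume "e > 0"
    then obtain k where "real p powi (- int k) < e" using padic_small[OF p] by blast
    then show "\<exists>N. \<forall>i\<ge>N. \<forall>j\<ge>N. padic_abs p (x i - x j) < e"
      using c padic_abs_le[OF p, of _ k] by (meson le_less_trans)
  qed
qed

lemma null_ideal_iff:
  assumes p: "prime p"
  shows "x \<in> null_ideal p \<longleftrightarrow> (\<forall>k. \<exists>N. \<forall>i\<ge>N. pdv p k (x i))"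
proof
  assume c: "x \<in> null_ideal p"
  show "\<forall>k. \<exists>N. \<forall>i\<ge>N. pdv p k (x i)"
  proof
    fix k
    have "real p powi (- int k) > 0" using p by (simp add: prime_gt_0_nat)
    then obtain N where "\<forall>i\<ge>N. norm (padic_abs p (x i) - 0) < real p powi (- int k)"
      using c unfolding null_ideal_def LIMSEQ_iff by blast
    then show "\<exists>N. \<forall>i\<ge>N. pdv p k (x i)"
      using padic_abs_le[OF p] padic_abs_nonneg by (auto intro!: exI[of _ N] less_imp_le)
  qed
next
  assume c: "\<forall>k. \<exists>N. \<forall>i\<ge>N. pdv p k (x i)"
  show "x \<in> null_ideal p" unfolding null_ideal_def LIMSEQ_iff
  proof (intro CollectI allI impI)
    fix e :: real assume "e > 0"
    then obtain k where k: "real p powi (- int k) < e" using padic_small[OF p] by blast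
    obtain N where "\<forall>i\<ge>N. pdv p k (x i)" using c by blast
    then show "\<exists>N. \<forall>i\<ge>N. norm (padic_abs p (x i) - 0) < e"
      using k padic_abs_le[OF p, of _ k] padic_abs_nonneg by (intro exI[of _ N]) (auto intro: le_less_trans)
  qed
qed

lemma padic_abs_le_1: "prime p \<Longrightarrow> padic_abs p x \<le> 1 \<longleftrightarrow> pdv p 0 x"
  using padic_abs_le[of p x 0] by simp

section \<open>The quotient ring of Cauchy sequences modulo null sequences\<close>

lemma cauchy_carrier: "x \<in> carrier (cauchy_ring p) \<longleftrightarrow> padic_cauchy p x"
  by (simp add: cauchy_ring_def)

text \<open>From some index on the terms differ from one fixed term by p-integral amounts, so a
  power of p clearing the denominator of that term serves for all of them. This controls
  products.\<close>

lemma cauchy_bounded: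
  assumes p: "prime p" and x: "padic_cauchy p x"
  shows "\<exists>j N. \<forall>i\<ge>N. pdv p 0 (of_int (int p ^ j) * x i)"
proof -
  obtain N where N: "\<forall>i\<ge>N. \<forall>j\<ge>N. pdv p 0 (x i - x j)" using x padic_cauchy_iff[OF p] by blast
  obtain j where j: "pdv p 0 (of_int (int p ^ j) * x N)" using pdv_denominator[OF p] by blast
  have "pdv p 0 (of_int (int p ^ j) * x i)" if "i \<ge> N" for i
  proof -
    have "pdv p 0 (of_int (int p ^ j))" by (simp only: pdv_int[OF p] power_0 one_dvd)
    then have "pdv p (0 + 0) (of_int (int p ^ j) * (x i - x N))" using pdv_mult[OF p] N that by blast
    then have "pdv p 0 (of_int (int p ^ j) * (x i - x N) + of_int (int p ^ j) * x N)"
      using pdv_add[OF p] j by simp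
    then show ?thesis by (simp add: right_diff_distrib)
  qed
  then show ?thesis by blast
qed

lemma pdv_mult_bounded:
  assumes p: "prime p" and "pdv p 0 (of_int (int p ^ j) * x)" "pdv p (k + j) y"
  shows "pdv p k (x * y)"
proof -
  have "pdv p (0 + (k + j)) ((of_int (int p ^ j) * x) * y)" using pdv_mult[OF p assms(2,3)] .
  then show ?thesis using pdv_cancel[OF p, of k j "x * y"] by (simp add: mult.assoc)
qed

lemma cauchy_add:
  assumes p: "prime p" and x: "padic_cauchy p x" and y: "padic_cauchy p y"
  shows "padic_cauchy p (\<lambda>k. x k + y k)"
  unfolding padic_cauchy_iff[OF p]
proof
  fix k
  obtain N where N: "\<forall>i\<ge>N. \<forall>j\<ge>N. pdv p k (x i - x j)" using x padic_cauchy_iff[OF p] by blast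
  obtain M where M: "\<forall>i\<ge>M. \<forall>j\<ge>M. pdv p k (y i - y j)" using y padic_cauchy_iff[OF p] by blast
  have "pdv p k ((x i - x j) + (y i - y j))" if "i \<ge> max N M" "j \<ge> max N M" for i j
    using that N M pdv_add[OF p, of k "x i - x j" "y i - y j"] by simp
  then have "pdv p k (x i + y i - (x j + y j))" if "i \<ge> max N M" "j \<ge> max N M" for i j
    using that by (simp only: add_diff_add)
  then show "\<exists>N. \<forall>i\<ge>N. \<forall>j\<ge>N. pdv p k (x i + y i - (x j + y j))" by blast
qed

lemma cauchy_uminus:
  assumes p: "prime p" and x: "padic_cauchy p x"
  shows "padic_cauchy p (\<lambda>k. - x k)"
  unfolding padic_cauchy_iff[OF p]
proof
  fix k
  obtain N where "\<forall>i\<ge>N. \<forall>j\<ge>N. pdv p k (x i - x j)" using x padic_cauchy_iff[OF p] by blast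
  then have "\<forall>i\<ge>N. \<forall>j\<ge>N. pdv p k (- (x i - x j))" using pdv_uminus by blast
  then show "\<exists>N. \<forall>i\<ge>N. \<forall>j\<ge>N. pdv p k (- x i - - x j)" by (metis minus_diff_minus)
qed

lemma cauchy_mult:
  assumes p: "prime p" and x: "padic_cauchy p x" and y: "padic_cauchy p y"
  shows "padic_cauchy p (\<lambda>k. x k * y k)"
  unfolding padic_cauchy_iff[OF p]
proof
  fix k
  obtain j1 N1 where b1: "\<forall>i\<ge>N1. pdv p 0 (of_int (int p ^ j1) * x i)" using cauchy_bounded[OF p x] by blast
  obtain j2 N2 where b2: "\<forall>i\<ge>N2. pdv p 0 (of_int (int p ^ j2) * y i)" using cauchy_bounded[OF p y] by blast
  obtain N3 where c1: "\<forall>i\<ge>N3. \<forall>j\<ge>N3. pdv p (k + j2) (x i - x j)" using x padic_cauchy_iff[OF p] by blast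
  obtain N4 where c2: "\<forall>i\<ge>N4. \<forall>j\<ge>N4. pdv p (k + j1) (y i - y j)" using y padic_cauchy_iff[OF p] by blast
  define N where "N = max (max N1 N2) (max N3 N4)"
  have "pdv p k (x i * y i - x j * y j)" if "i \<ge> N" "j \<ge> N" for i j
  proof -
    have "pdv p k (x i * (y i - y j))" by (rule pdv_mult_bounded[OF p]) (use that b1 c2 in \<open>auto simp: N_def\<close>)
    moreover have "pdv p k (y j * (x i - x j))" by (rule pdv_mult_bounded[OF p]) (use that b2 c1 in \<open>auto simp: N_def\<close>)
    ultimately have "pdv p k (x i * (y i - y j) + y j * (x i - x j))" using pdv_add[OF p] by blast
    moreover have "x i * (y i - y j) + y j * (x i - x j) = x i * y i - x j * y j" by (simp add: algebra_simps)
    ultimately show ?thesis by simp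
  qed
  then show "\<exists>N. \<forall>i\<ge>N. \<forall>j\<ge>N. pdv p k (x i * y i - x j * y j)" by blast
qed

lemma cauchy_const: "prime p \<Longrightarrow> padic_cauchy p (\<lambda>_. c)"
  by (simp add: padic_cauchy_iff pdv_0)

lemma cauchy_cring:
  assumes p: "prime p"
  shows "cring (cauchy_ring p)"
proof (rule cringI)
  show "abelian_group (cauchy_ring p)"
  proof (rule abelian_groupI)
    fix x assume "x \<in> carrier (cauchy_ring p)"
    then have "(\<lambda>k. - x k) \<in> carrier (cauchy_ring p)" using cauchy_uminus[OF p] by (simp add: cauchy_carrier)
    then show "\<exists>y\<in>carrier (cauchy_ring p). y \<oplus>\<^bsub>cauchy_ring p\<^esub> x = \<zero>\<^bsub>cauchy_ring p\<^esub>"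
      by (intro bexI[of _ "\<lambda>k. - x k"]) (auto simp: cauchy_ring_def)
  qed (use p in \<open>auto simp: cauchy_ring_def cauchy_add cauchy_const add_ac\<close>)
  show "Group.comm_monoid (cauchy_ring p)"
    by (rule comm_monoidI) (use p in \<open>auto simp: cauchy_ring_def cauchy_mult cauchy_const mult_ac\<close>)
qed (auto simp: cauchy_ring_def algebra_simps)

lemma null_add:
  assumes p: "prime p" and x: "x \<in> null_ideal p" and y: "y \<in> null_ideal p"
  shows "(\<lambda>k. x k + y k) \<in> null_ideal p"
  unfolding null_ideal_iff[OF p]
proof
  fix k
  obtain N where N: "\<forall>i\<ge>N. pdv p k (x i)" using x null_ideal_iff[OF p] by blast
  obtain M where M: "\<forall>i\<ge>M. pdv p k (y i)" using y null_ideal_iff[OF p] by blast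
  have "pdv p k (x i + y i)" if "i \<ge> max N M" for i using that N M pdv_add[OF p] by simp
  then show "\<exists>N. \<forall>i\<ge>N. pdv p k (x i + y i)" by blast
qed

lemma null_uminus: "prime p \<Longrightarrow> x \<in> null_ideal p \<Longrightarrow> (\<lambda>k. - x k) \<in> null_ideal p"
  unfolding null_ideal_iff by (meson pdv_uminus)

lemma null_zero: "prime p \<Longrightarrow> (\<lambda>k. 0) \<in> null_ideal p"
  by (simp add: null_ideal_iff pdv_0)

lemma null_cauchy:
  assumes p: "prime p" and x: "x \<in> null_ideal p"
  shows "padic_cauchy p x"
  unfolding padic_cauchy_iff[OF p]
proof
  fix k
  obtain N where "\<forall>i\<ge>N. pdv p k (x i)" using x null_ideal_iff[OF p] by blast
  then have "pdv p k (x i - x j)" if "i \<ge> N" "j \<ge> N" for i j using that pdv_diff[OF p] by simp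
  then show "\<exists>N. \<forall>i\<ge>N. \<forall>j\<ge>N. pdv p k (x i - x j)" by blast
qed

lemma null_mult:
  assumes p: "prime p" and x: "padic_cauchy p x" and y: "y \<in> null_ideal p"
  shows "(\<lambda>k. x k * y k) \<in> null_ideal p"
  unfolding null_ideal_iff[OF p]
proof
  fix k
  obtain j N1 where b1: "\<forall>i\<ge>N1. pdv p 0 (of_int (int p ^ j) * x i)" using cauchy_bounded[OF p x] by blast
  obtain N2 where b2: "\<forall>i\<ge>N2. pdv p (k + j) (y i)" using y null_ideal_iff[OF p] by blast
  show "\<exists>N. \<forall>i\<ge>N. pdv p k (x i * y i)"
    using b1 b2 pdv_mult_bounded[OF p] by (intro exI[of _ "max N1 N2"]) auto
qed

lemma null_ideal_ideal:
  assumes p: "prime p"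
  shows "ideal (null_ideal p) (cauchy_ring p)"
proof (rule idealI)
  interpret cring "cauchy_ring p" by (rule cauchy_cring[OF p])
  show "ring (cauchy_ring p)" by (rule ring_axioms)
  show "subgroup (null_ideal p) (add_monoid (cauchy_ring p))"
  proof (rule add.subgroupI)
    show "null_ideal p \<subseteq> carrier (cauchy_ring p)" using null_cauchy[OF p] by (auto simp: cauchy_carrier)
    show "null_ideal p \<noteq> {}" using null_zero[OF p] by blast
    show "\<ominus>\<^bsub>cauchy_ring p\<^esub> x \<in> null_ideal p" if "x \<in> null_ideal p" for x
    proof -
      have "\<ominus>\<^bsub>cauchy_ring p\<^esub> x = (\<lambda>k. - x k)"
        by (rule minus_equality) (use that null_cauchy[OF p] null_uminus[OF p] in \<open>auto simp: cauchy_ring_def\<close>)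
      then show ?thesis using null_uminus[OF p that] by simp
    qed
    show "x \<oplus>\<^bsub>cauchy_ring p\<^esub> y \<in> null_ideal p" if "x \<in> null_ideal p" "y \<in> null_ideal p" for x y
      using null_add[OF p that] by (simp add: cauchy_ring_def)
  qed
  fix a x assume ax: "a \<in> null_ideal p" "x \<in> carrier (cauchy_ring p)"
  then have "(\<lambda>k. x k * a k) \<in> null_ideal p" using null_mult[OF p] by (simp add: cauchy_carrier)
  then show "x \<otimes>\<^bsub>cauchy_ring p\<^esub> a \<in> null_ideal p" "a \<otimes>\<^bsub>cauchy_ring p\<^esub> x \<in> null_ideal p"
    by (simp_all add: cauchy_ring_def mult.commute)
qed

definition cls :: "nat \<Rightarrow> (nat \<Rightarrow> rat) \<Rightarrow> padic" where
  "cls p x = null_ideal p +>\<^bsub>cauchy_ring p\<^esub> x"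

lemma mem_cls: "y \<in> cls p x \<longleftrightarrow> (\<lambda>k. y k - x k) \<in> null_ideal p"
proof
  assume "y \<in> cls p x"
  then show "(\<lambda>k. y k - x k) \<in> null_ideal p" unfolding cls_def a_r_coset_def' by (auto simp: cauchy_ring_def)
next
  assume a: "(\<lambda>k. y k - x k) \<in> null_ideal p"
  show "y \<in> cls p x" unfolding cls_def a_r_coset_def'
    by (rule UN_I[OF a]) (simp add: cauchy_ring_def)
qed

lemma cls_eq_iff:
  assumes p: "prime p"
  shows "cls p x = cls p y \<longleftrightarrow> (\<lambda>k. x k - y k) \<in> null_ideal p"
proof
  assume e: "cls p x = cls p y"
  have "x \<in> cls p x" using null_zero[OF p] by (simp add: mem_cls)
  then show "(\<lambda>k. x k - y k) \<in> null_ideal p" using e mem_cls by simp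
next
  assume a: "(\<lambda>k. x k - y k) \<in> null_ideal p"
  have b: "(\<lambda>k. - (x k - y k)) \<in> null_ideal p" using null_uminus[OF p a] .
  show "cls p x = cls p y"
  proof (rule Set.set_eqI)
    fix z
    have "(\<lambda>k. (z k - x k) + (x k - y k)) \<in> null_ideal p" if "(\<lambda>k. z k - x k) \<in> null_ideal p"
      using null_add[OF p that a] .
    moreover have "(\<lambda>k. (z k - y k) + - (x k - y k)) \<in> null_ideal p" if "(\<lambda>k. z k - y k) \<in> null_ideal p"
      using null_add[OF p that b] .
    ultimately show "z \<in> cls p x \<longleftrightarrow> z \<in> cls p y" unfolding mem_cls by auto
  qed
qed

lemma Qp_cring: "prime p \<Longrightarrow> cring (Qp p)"
  unfolding Qp_def using ideal.quotient_is_cring[OF null_ideal_ideal cauchy_cring] .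

lemma Qp_carrier: "carrier (Qp p) = cls p ` {x. padic_cauchy p x}"
  by (auto simp: Qp_def FactRing_def A_RCOSETS_def' cls_def cauchy_ring_def)

lemma cls_hom:
  assumes p: "prime p" and x: "padic_cauchy p x" and y: "padic_cauchy p y"
  shows "cls p x \<oplus>\<^bsub>Qp p\<^esub> cls p y = cls p (\<lambda>k. x k + y k)"
    and "cls p x \<otimes>\<^bsub>Qp p\<^esub> cls p y = cls p (\<lambda>k. x k * y k)"
proof -
  have h: "((+>\<^bsub>cauchy_ring p\<^esub>) (null_ideal p)) \<in> ring_hom (cauchy_ring p) (Qp p)"
    unfolding Qp_def by (rule ideal.rcos_ring_hom[OF null_ideal_ideal[OF p]])
  have xy: "x \<in> carrier (cauchy_ring p)" "y \<in> carrier (cauchy_ring p)" using x y by (auto simp: cauchy_carrier)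
  show "cls p x \<oplus>\<^bsub>Qp p\<^esub> cls p y = cls p (\<lambda>k. x k + y k)"
    using ring_hom_add[OF h xy] by (simp add: cls_def cauchy_ring_def)
  show "cls p x \<otimes>\<^bsub>Qp p\<^esub> cls p y = cls p (\<lambda>k. x k * y k)"
    using ring_hom_mult[OF h xy] by (simp add: cls_def cauchy_ring_def)
qed

lemma Qp_zero: "prime p \<Longrightarrow> \<zero>\<^bsub>Qp p\<^esub> = cls p (\<lambda>k. 0)"
  by (auto simp: Qp_def FactRing_def mem_cls set_eq_iff)

lemma Qp_one: "\<one>\<^bsub>Qp p\<^esub> = cls p (\<lambda>k. 1)"
  by (simp add: Qp_def FactRing_def cls_def cauchy_ring_def)

text \<open>A point of the inverse limit of the integers modulo p^k, with \<open>z k\<close>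
  standing for its residue class modulo p^k. In this encoding elements of \<open>Zp p\<close> are
  handled by integers alone.\<close>

definition coh :: "nat \<Rightarrow> (nat \<Rightarrow> int) \<Rightarrow> bool" where
  "coh p z \<longleftrightarrow> (\<forall>k. int p ^ k dvd z (Suc k) - z k)"

lemma coh_le:
  assumes "coh p z" "k \<le> l"
  shows "int p ^ k dvd z l - z k"
  using assms(2)
proof (induction l rule: dec_induct)
  case (step l)
  have "int p ^ l dvd z (Suc l) - z l" using assms(1) by (simp add: coh_def)
  then have "int p ^ k dvd z (Suc l) - z l" using step by (meson dvd_trans le_imp_power_dvd less_imp_le)
  then have "int p ^ k dvd (z (Suc l) - z l) + (z l - z k)" using step by (intro dvd_add) auto
  then show ?case by simp
qed simp

definition zc :: "nat \<Rightarrow> (nat \<Rightarrow> int) \<Rightarrow> padic" where "zc p z = cls p (\<lambda>k. of_int (z k))"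

lemma coh_cauchy:
  assumes p: "prime p" and z: "coh p z"
  shows "padic_cauchy p (\<lambda>k. of_int (z k))"
  unfolding padic_cauchy_iff[OF p]
proof
  fix k
  have "pdv p k (of_int (z i) - of_int (z j))" if "i \<ge> k" "j \<ge> k" for i j
  proof -
    have "int p ^ k dvd (z i - z k) - (z j - z k)" by (rule dvd_diff) (use coh_le[OF z] that in auto)
    then have "pdv p k (of_int (z i - z j))" by (simp only: pdv_int[OF p]) simp
    then show ?thesis by simp
  qed
  then show "\<exists>N. \<forall>i\<ge>N. \<forall>j\<ge>N. pdv p k (of_int (z i) - of_int (z j))" by blast
qed

lemma coh_null_iff:
  assumes p: "prime p" and z: "coh p z"
  shows "(\<lambda>k. of_int (z k)) \<in> null_ideal p \<longleftrightarrow> (\<forall>k. int p ^ k dvd z k)"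
proof
  assume "(\<lambda>k. of_int (z k)) \<in> null_ideal p"
  then have n: "\<forall>k. \<exists>N. \<forall>i\<ge>N. int p ^ k dvd z i" by (simp add: null_ideal_iff[OF p] pdv_int[OF p])
  show "\<forall>k. int p ^ k dvd z k"
  proof
    fix k
    obtain N where "\<forall>i\<ge>N. int p ^ k dvd z i" using n by blast
    then have "int p ^ k dvd z (max N k)" by simp
    moreover have "int p ^ k dvd z (max N k) - z k" by (rule coh_le[OF z]) simp
    ultimately show "int p ^ k dvd z k" by (metis dvd_diff_right_iff dvd_diff_commute)
  qed
next
  assume a: "\<forall>k. int p ^ k dvd z k"
  have "\<forall>i\<ge>k. int p ^ k dvd z i" for k using a by (meson dvd_trans le_imp_power_dvd)
  then show "(\<lambda>k. of_int (z k)) \<in> null_ideal p" by (auto simp: null_ideal_iff[OF p] pdv_int[OF p])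
qed

lemma coh_diff: "coh p z \<Longrightarrow> coh p w \<Longrightarrow> coh p (\<lambda>k. z k - w k)"
proof -
  assume "coh p z" "coh p w"
  then have "int p ^ k dvd (z (Suc k) - z k) - (w (Suc k) - w k)" for k unfolding coh_def by (rule_tac dvd_diff) auto
  then show ?thesis unfolding coh_def by (simp add: algebra_simps)
qed

lemma coh_add: "coh p z \<Longrightarrow> coh p w \<Longrightarrow> coh p (\<lambda>k. z k + w k)"
proof -
  assume "coh p z" "coh p w"
  then have "int p ^ k dvd (z (Suc k) - z k) + (w (Suc k) - w k)" for k unfolding coh_def by (intro dvd_add) auto
  then show ?thesis unfolding coh_def by (simp add: algebra_simps)
qed

lemma coh_mult: "coh p z \<Longrightarrow> coh p w \<Longrightarrow> coh p (\<lambda>k. z k * w k)"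
proof -
  assume "coh p z" "coh p w"
  then have "int p ^ k dvd (z (Suc k) - z k) * w (Suc k) + z k * (w (Suc k) - w k)" for k
    unfolding coh_def by (intro dvd_add) auto
  then show ?thesis unfolding coh_def by (simp add: algebra_simps)
qed

lemma coh_const: "coh p (\<lambda>k. c)"
  by (simp add: coh_def)

lemma zc_eq_iff:
  assumes p: "prime p" and "coh p z" "coh p w"
  shows "zc p z = zc p w \<longleftrightarrow> (\<forall>k. int p ^ k dvd z k - w k)"
  unfolding zc_def cls_eq_iff[OF p] using coh_null_iff[OF p coh_diff[OF assms(2,3)]] by simp

text \<open>A p-integral Cauchy sequence is rounded to an integer with precision p^k at an index
  beyond which it is constant up to p^k; the rounded values are coherent and differ from it by a
  null sequence.\<close>

lemma Zp_carrier:
  assumes p: "prime p"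
  shows "carrier (Zp p) = zc p ` {z. coh p z}"
proof
  have i: "pdv p 0 (of_int m)" for m by (simp only: pdv_int[OF p] power_0 one_dvd)
  show "zc p ` {z. coh p z} \<subseteq> carrier (Zp p)"
  proof
    fix X assume "X \<in> zc p ` {z. coh p z}"
    then obtain z where z: "coh p z" "X = cls p (\<lambda>k. of_int (z k))" by (auto simp: zc_def)
    have "(\<lambda>k. of_int (z k)) \<in> X" using z null_zero[OF p] by (simp add: mem_cls)
    then have "\<exists>x\<in>X. \<forall>k. padic_abs p (x k) \<le> 1"
      by (rule bexI[rotated]) (simp add: padic_abs_le_1[OF p] i)
    moreover have "X \<in> carrier (Qp p)" using z coh_cauchy[OF p] by (auto simp: Qp_carrier)
    ultimately show "X \<in> carrier (Zp p)" by (simp add: Zp_def)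
  qed
next
  show "carrier (Zp p) \<subseteq> zc p ` {z. coh p z}"
  proof
    fix X assume "X \<in> carrier (Zp p)"
    then obtain y x where y: "padic_cauchy p y" "X = cls p y" and x: "x \<in> X" "\<forall>k. pdv p 0 (x k)"
      unfolding Zp_def Qp_carrier using padic_abs_le_1[OF p] by auto
    have n: "(\<lambda>k. x k - y k) \<in> null_ideal p" using x y mem_cls by simp
    have X: "X = cls p x" using n y(2) cls_eq_iff[OF p, of x y] by metis
    have "padic_cauchy p (\<lambda>k. (x k - y k) + y k)" using cauchy_add[OF p null_cauchy[OF p n] y(1)] .
    then have xc: "padic_cauchy p x" by simp
    obtain N where N: "\<And>k i j. i \<ge> N k \<Longrightarrow> j \<ge> N k \<Longrightarrow> pdv p k (x i - x j)"
      using xc padic_cauchy_iff[OF p] by metis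
    have "\<exists>m. pdv p k (x (N k) - of_int m)" for k using pdv_approx[OF p] x(2) by blast
    then obtain z where z: "\<And>k. pdv p k (x (N k) - of_int (z k))" by metis
    have zN: "pdv p k (x i - of_int (z k))" if "i \<ge> N k" for i k
      using pdv_add[OF p N[of k i "N k"] z[of k]] that by simp
    have c: "coh p z" unfolding coh_def
    proof
      fix k
      define M where "M = max (N k) (N (Suc k))"
      have "pdv p k (x M - of_int (z k))" "pdv p k (x M - of_int (z (Suc k)))"
        using zN[of k M] pdv_mono[OF zN[of "Suc k" M]] by (auto simp: M_def)
      then have "pdv p k ((x M - of_int (z k)) - (x M - of_int (z (Suc k))))" using pdv_diff[OF p] by blast
      then have "pdv p k (of_int (z (Suc k) - z k))" by simp
      then show "int p ^ k dvd z (Suc k) - z k" by (simp only: pdv_int[OF p])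
    qed
    have "(\<lambda>k. x k - of_int (z k)) \<in> null_ideal p" unfolding null_ideal_iff[OF p]
    proof
      fix k
      have "pdv p k (x i - of_int (z i))" if i: "i \<ge> max (N k) k" for i
      proof -
        have "pdv p k (of_int (z i - z k))" unfolding pdv_int[OF p] using coh_le[OF c, of k i] i by simp
        then have "pdv p k ((x i - of_int (z k)) - of_int (z i - z k))"
          using pdv_diff[OF p zN[of k i]] i by (simp only: max.bounded_iff)
        then show ?thesis by simp
      qed
      then show "\<exists>N. \<forall>i\<ge>N. pdv p k (x i - of_int (z i))" by blast
    qed
    then have "X = zc p z" using X cls_eq_iff[OF p, of x "\<lambda>k. of_int (z k)"] by (simp add: zc_def)
    then show "X \<in> zc p ` {z. coh p z}" using c by blast
  qed
qed

lemma zc_hom: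
  assumes p: "prime p" and "coh p z" "coh p w"
  shows "zc p z \<oplus>\<^bsub>Qp p\<^esub> zc p w = zc p (\<lambda>k. z k + w k)"
    and "zc p z \<otimes>\<^bsub>Qp p\<^esub> zc p w = zc p (\<lambda>k. z k * w k)"
  unfolding zc_def using cls_hom[OF p coh_cauchy[OF p assms(2)] coh_cauchy[OF p assms(3)]] by simp_all

lemma Zp_subset: "carrier (Zp p) \<subseteq> carrier (Qp p)"
  by (auto simp: Zp_def)

lemma Zp_simps: "\<zero>\<^bsub>Zp p\<^esub> = \<zero>\<^bsub>Qp p\<^esub>" "\<one>\<^bsub>Zp p\<^esub> = \<one>\<^bsub>Qp p\<^esub>" "(\<oplus>\<^bsub>Zp p\<^esub>) = (\<oplus>\<^bsub>Qp p\<^esub>)" "(\<otimes>\<^bsub>Zp p\<^esub>) = (\<otimes>\<^bsub>Qp p\<^esub>)"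
  by (simp_all add: Zp_def)

lemma Zp_cring:
  assumes p: "prime p"
  shows "cring (Zp p)"
proof -
  interpret cring "Qp p" by (rule Qp_cring[OF p])
  define H where "H = carrier (Zp p)"
  have H: "H = zc p ` {z. coh p z}" by (simp add: H_def Zp_carrier[OF p])
  have one: "\<one>\<^bsub>Qp p\<^esub> = zc p (\<lambda>_. 1)" by (simp add: Qp_one zc_def)
  have zero: "\<zero>\<^bsub>Qp p\<^esub> = zc p (\<lambda>_. 0)" by (simp add: Qp_zero[OF p] zc_def)
  have "subring H (Qp p)"
  proof (rule subringI)
    show "H \<subseteq> carrier (Qp p)" by (simp add: H_def Zp_subset)
    show "\<one>\<^bsub>Qp p\<^esub> \<in> H" unfolding one H using coh_const by blast
    show "\<ominus>\<^bsub>Qp p\<^esub> h \<in> H" if hH: "h \<in> H" for h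
    proof -
      obtain z where z: "coh p z" "h = zc p z" using hH unfolding H by blast
      have c: "coh p (\<lambda>k. - z k)" using coh_diff[OF coh_const[of p 0] z(1)] by simp
      have "zc p (\<lambda>k. - z k) \<oplus>\<^bsub>Qp p\<^esub> h = \<zero>\<^bsub>Qp p\<^esub>" using zc_hom(1)[OF p c z(1)] z zero by simp
      moreover have "zc p (\<lambda>k. - z k) \<in> carrier (Qp p)" "h \<in> carrier (Qp p)"
        using c hH Zp_subset H H_def by blast+
      ultimately have "\<ominus>\<^bsub>Qp p\<^esub> h = zc p (\<lambda>k. - z k)" using minus_equality by blast
      then show ?thesis using c H by blast
    qed
    show "h1 \<otimes>\<^bsub>Qp p\<^esub> h2 \<in> H" if "h1 \<in> H" "h2 \<in> H" for h1 h2
      using that zc_hom(2)[OF p] coh_mult unfolding H by auto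
    show "h1 \<oplus>\<^bsub>Qp p\<^esub> h2 \<in> H" if "h1 \<in> H" "h2 \<in> H" for h1 h2
      using that zc_hom(1)[OF p] coh_add unfolding H by auto
  qed
  then have "subcring H (Qp p)" by (rule subcringI')
  then have "cring ((Qp p)\<lparr>carrier := H\<rparr>)" using subcring_iff Zp_subset H_def by blast
  moreover have "(Qp p)\<lparr>carrier := H\<rparr> = Zp p" by (simp add: H_def Zp_def)
  ultimately show ?thesis by simp
qed

section \<open>Integral quadratic forms and their p-adic zeros\<close>

text \<open>Type-class counterparts of \<open>qeval\<close> and the polar form: identities are
  proved once by ring algebra for integers, rationals and reals, and transferred to the
  carrier-based rings afterwards.\<close>

definition qe :: "nat \<Rightarrow> (nat \<Rightarrow> nat \<Rightarrow> 'a::comm_ring_1) \<Rightarrow> (nat \<Rightarrow> 'a) \<Rightarrow> 'a" where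
  "qe n f x = (\<Sum>j<n. \<Sum>i\<le>j. f i j * x i * x j)"

definition qb :: "nat \<Rightarrow> (nat \<Rightarrow> nat \<Rightarrow> 'a::comm_ring_1) \<Rightarrow> (nat \<Rightarrow> 'a) \<Rightarrow> (nat \<Rightarrow> 'a) \<Rightarrow> 'a" where
  "qb n f x y = (\<Sum>j<n. \<Sum>i\<le>j. f i j * (x i * y j + y i * x j))"

lemma qe_add: "qe n f (\<lambda>i. x i + y i) = qe n f x + qe n f y + qb n f x y"
  by (simp add: qe_def qb_def sum.distrib[symmetric] algebra_simps)

lemma qe_scale: "qe n f (\<lambda>i. c * x i) = c^2 * qe n f x"
  by (simp add: qe_def sum_distrib_left power2_eq_square algebra_simps)

lemma qb_sym: "qb n f x y = qb n f y x"
  by (simp add: qb_def add.commute)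

lemma qb_add: "qb n f x (\<lambda>i. y i + z i) = qb n f x y + qb n f x z"
  by (simp add: qb_def sum.distrib[symmetric] algebra_simps)

lemma qb_scale: "qb n f x (\<lambda>i. c * y i) = c * qb n f x y"
  by (simp add: qb_def sum_distrib_left algebra_simps)

lemma qe_cong: "(\<And>i. i < n \<Longrightarrow> x i = y i) \<Longrightarrow> (\<And>i j. i \<le> j \<Longrightarrow> j < n \<Longrightarrow> f i j = g i j) \<Longrightarrow> qe n f x = qe n g y"
  unfolding qe_def by (intro sum.cong) auto

lemma qe_dvd_cong:
  fixes m :: int
  assumes "\<And>i. i < n \<Longrightarrow> m dvd x i - y i" "\<And>i j. i \<le> j \<Longrightarrow> j < n \<Longrightarrow> m dvd f i j - g i j"
  shows "m dvd qe n f x - qe n g y"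
  unfolding qe_def sum_subtractf[symmetric]
proof (intro dvd_sum)
  fix j i assume ij: "j \<in> {..<n}" "i \<in> {..j}"
  have "f i j * x i * x j - g i j * y i * y j =
    (f i j - g i j) * (x i * x j) + (x i - y i) * (g i j * x j) + (x j - y j) * (g i j * y i)"
    by (simp add: algebra_simps)
  also have "m dvd \<dots>" using ij assms by (intro dvd_add dvd_mult2) auto
  finally show "m dvd f i j * x i * x j - g i j * y i * y j" .
qed

lemma qb_dvd_cong:
  fixes m :: int
  assumes "\<And>i. i < n \<Longrightarrow> m dvd x i - x' i" "\<And>i. i < n \<Longrightarrow> m dvd y i - y' i"
    "\<And>i j. i \<le> j \<Longrightarrow> j < n \<Longrightarrow> m dvd f i j - g i j"
  shows "m dvd qb n f x y - qb n g x' y'"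
  unfolding qb_def sum_subtractf[symmetric]
proof (intro dvd_sum)
  fix j i assume ij: "j \<in> {..<n}" "i \<in> {..j}"
  have "f i j * (x i * y j + y i * x j) - g i j * (x' i * y' j + y' i * x' j) =
    (f i j - g i j) * (x i * y j + y i * x j) + (x i - x' i) * (g i j * y j) + (y j - y' j) * (g i j * x' i)
      + (y i - y' i) * (g i j * x j) + (x j - x' j) * (g i j * y' i)"
    by (simp add: algebra_simps)
  also have "m dvd \<dots>" using ij assms by (intro dvd_add dvd_mult2) auto
  finally show "m dvd f i j * (x i * y j + y i * x j) - g i j * (x' i * y' j + y' i * x' j)" .
qed

text \<open>Here c sends a sequence to the element it represents. The three instances are coherent
  sequences for \<open>Zp p\<close>, Cauchy sequences for \<open>Qp p\<close>, and evaluation at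
  index 0 for the reals.\<close>

locale seq_hom = cring R for R (structure) +
  fixes C :: "(nat \<Rightarrow> 's::comm_ring_1) set" and c :: "(nat \<Rightarrow> 's) \<Rightarrow> 'a"
  assumes c_closed: "x \<in> C \<Longrightarrow> c x \<in> carrier R"
    and C_add: "x \<in> C \<Longrightarrow> y \<in> C \<Longrightarrow> (\<lambda>k. x k + y k) \<in> C"
    and c_add: "x \<in> C \<Longrightarrow> y \<in> C \<Longrightarrow> c (\<lambda>k. x k + y k) = c x \<oplus> c y"
    and C_mult: "x \<in> C \<Longrightarrow> y \<in> C \<Longrightarrow> (\<lambda>k. x k * y k) \<in> C"
    and c_mult: "x \<in> C \<Longrightarrow> y \<in> C \<Longrightarrow> c (\<lambda>k. x k * y k) = c x \<otimes> c y"
    and C_uminus: "x \<in> C \<Longrightarrow> (\<lambda>k. - x k) \<in> C"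
    and C_one: "(\<lambda>k. 1) \<in> C" and c_one: "c (\<lambda>k. 1) = \<one>"
    and c_zero: "c (\<lambda>k. 0) = \<zero>"
begin

lemma C_zero: "(\<lambda>k. 0) \<in> C"
  using C_add[OF C_one C_uminus[OF C_one]] by simp

lemma c_uminus:
  assumes "x \<in> C"
  shows "\<ominus> c x = c (\<lambda>k. - x k)"
proof (rule minus_equality)
  show "c (\<lambda>k. - x k) \<oplus> c x = \<zero>" using c_add[OF C_uminus[OF assms] assms] c_zero by simp
qed (use assms c_closed C_uminus in auto)

lemma C_diff: "x \<in> C \<Longrightarrow> y \<in> C \<Longrightarrow> (\<lambda>k. x k - y k) \<in> C"
  using C_add[OF _ C_uminus, of x y] by simp

lemma c_diff: "x \<in> C \<Longrightarrow> y \<in> C \<Longrightarrow> c x \<ominus> c y = c (\<lambda>k. x k - y k)"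
  using c_add[OF _ C_uminus, of x y] by (simp add: a_minus_def c_uminus)

lemma sum_hom:
  assumes "finite A" "\<And>i. i \<in> A \<Longrightarrow> g i \<in> C"
  shows "(\<lambda>k. \<Sum>i\<in>A. g i k) \<in> C \<and> finsum R (\<lambda>i. c (g i)) A = c (\<lambda>k. \<Sum>i\<in>A. g i k)"
  using assms
proof (induction A rule: finite_induct)
  case empty
  then show ?case using C_zero c_zero by simp
next
  case (insert a A)
  then have "g a \<in> C" "(\<lambda>k. \<Sum>i\<in>A. g i k) \<in> C" "finsum R (\<lambda>i. c (g i)) A = c (\<lambda>k. \<Sum>i\<in>A. g i k)" by auto
  moreover have "finsum R (\<lambda>i. c (g i)) (insert a A) = c (g a) \<oplus> finsum R (\<lambda>i. c (g i)) A"
    by (rule finsum_insert) (use insert c_closed in auto)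
  ultimately show ?case using insert(1,2) C_add c_add by simp
qed

lemma finsum_hom:
  assumes "finite A" "\<And>i. i \<in> A \<Longrightarrow> g i \<in> C" "\<And>i. i \<in> A \<Longrightarrow> G i = c (g i)"
  shows "(\<lambda>k. \<Sum>i\<in>A. g i k) \<in> C" "finsum R G A = c (\<lambda>k. \<Sum>i\<in>A. g i k)"
proof -
  show "(\<lambda>k. \<Sum>i\<in>A. g i k) \<in> C" using sum_hom assms by blast
  have "finsum R G A = finsum R (\<lambda>i. c (g i)) A"
    by (rule finsum_cong') (use assms c_closed in auto)
  then show "finsum R G A = c (\<lambda>k. \<Sum>i\<in>A. g i k)" using sum_hom[OF assms(1,2)] by simp
qed

lemma qeval_hom:
  assumes F: "\<And>i j. i \<le> j \<Longrightarrow> j < n \<Longrightarrow> F i j = c (f i j) \<and> f i j \<in> C"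
    and X: "\<And>i. i < n \<Longrightarrow> X i = c (x i) \<and> x i \<in> C"
  shows "(\<lambda>k. qe n (\<lambda>i j. f i j k) (\<lambda>i. x i k)) \<in> C"
    "qeval R n F X = c (\<lambda>k. qe n (\<lambda>i j. f i j k) (\<lambda>i. x i k))"
proof -
  have m: "(\<lambda>k. f i j k * x i k * x j k) \<in> C \<and> F i j \<otimes> X i \<otimes> X j = c (\<lambda>k. f i j k * x i k * x j k)"
    if "i \<le> j" "j < n" for i j
    using F[OF that] X[of i] X[of j] that C_mult c_mult by simp
  have inner: "(\<lambda>k. \<Sum>i\<in>{..j}. f i j k * x i k * x j k) \<in> C"
    "(\<Oplus>i\<in>{..j}. F i j \<otimes> X i \<otimes> X j) = c (\<lambda>k. \<Sum>i\<in>{..j}. f i j k * x i k * x j k)" if "j < n" for j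
    by (rule finsum_hom; use m that in auto)+
  show "(\<lambda>k. qe n (\<lambda>i j. f i j k) (\<lambda>i. x i k)) \<in> C" unfolding qe_def
    by (rule finsum_hom(1)) (use inner in auto)
  show "qeval R n F X = c (\<lambda>k. qe n (\<lambda>i j. f i j k) (\<lambda>i. x i k))" unfolding qe_def qeval_def
    by (rule finsum_hom(2)) (use inner in auto)
qed

lemma qpolar_hom:
  assumes F: "\<And>i j. i \<le> j \<Longrightarrow> j < n \<Longrightarrow> F i j = c (f i j) \<and> f i j \<in> C"
    and X: "\<And>i. i < n \<Longrightarrow> X i = c (x i) \<and> x i \<in> C" and Y: "\<And>i. i < n \<Longrightarrow> Y i = c (y i) \<and> y i \<in> C"
  shows "qpolar R n F X Y = c (\<lambda>k. qb n (\<lambda>i j. f i j k) (\<lambda>i. x i k) (\<lambda>i. y i k))"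
proof -
  define Z where "Z = X \<oplus>\<^bsub>coord_mod R n\<^esub> Y"
  have Z: "Z i = c (\<lambda>k. x i k + y i k) \<and> (\<lambda>k. x i k + y i k) \<in> C" if "i < n" for i
    using X[OF that] Y[OF that] that by (simp add: Z_def coord_mod_def c_add C_add)
  have e: "qeval R n F Z = c (\<lambda>k. qe n (\<lambda>i j. f i j k) (\<lambda>i. x i k + y i k))"
    and ec: "(\<lambda>k. qe n (\<lambda>i j. f i j k) (\<lambda>i. x i k + y i k)) \<in> C"
    using qeval_hom[of n F f Z "\<lambda>i k. x i k + y i k", OF F Z] by auto
  have x: "(\<lambda>k. qe n (\<lambda>i j. f i j k) (\<lambda>i. x i k)) \<in> C"
    "qeval R n F X = c (\<lambda>k. qe n (\<lambda>i j. f i j k) (\<lambda>i. x i k))"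
    by (rule qeval_hom; use F X in blast)+
  have y: "(\<lambda>k. qe n (\<lambda>i j. f i j k) (\<lambda>i. y i k)) \<in> C"
    "qeval R n F Y = c (\<lambda>k. qe n (\<lambda>i j. f i j k) (\<lambda>i. y i k))"
    by (rule qeval_hom; use F Y in blast)+
  have "qpolar R n F X Y = c (\<lambda>k. qe n (\<lambda>i j. f i j k) (\<lambda>i. x i k + y i k)) \<ominus> c (\<lambda>k. qe n (\<lambda>i j. f i j k) (\<lambda>i. x i k))
      \<ominus> c (\<lambda>k. qe n (\<lambda>i j. f i j k) (\<lambda>i. y i k))"
    unfolding qpolar_def Z_def[symmetric] e x(2) y(2) ..
  also have "\<dots> = c (\<lambda>k. qe n (\<lambda>i j. f i j k) (\<lambda>i. x i k + y i k) - qe n (\<lambda>i j. f i j k) (\<lambda>i. x i k)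
      - qe n (\<lambda>i j. f i j k) (\<lambda>i. y i k))"
    unfolding c_diff[OF ec x(1)] by (rule c_diff[OF C_diff[OF ec x(1)] y(1)])
  finally show ?thesis by (simp add: qe_add)
qed

lemma int_embed: "[(m::int)] \<cdot> \<one> = c (\<lambda>_. of_int m) \<and> (\<lambda>_. of_int m) \<in> C"
proof -
  have nat: "[(k::nat)] \<cdot> \<one> = c (\<lambda>_. of_nat k) \<and> (\<lambda>_. of_nat k) \<in> C" for k
  proof (induction k)
    case (Suc k)
    then show ?case using c_add[OF C_one, of "\<lambda>_. of_nat k"] C_add[OF C_one, of "\<lambda>_. of_nat k"]
      by (simp add: c_one add.nat_pow_Suc add.commute a_comm c_closed)
  qed (use C_zero c_zero in simp)
  show ?thesis
  proof (cases "m \<ge> 0")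
    case True
    then show ?thesis using nat[of "nat m"] by (simp add: add_pow_int_ge)
  next
    case False
    then show ?thesis using nat[of "nat (- m)"] c_uminus[of "\<lambda>_. of_nat (nat (- m))"] C_uminus[of "\<lambda>_. of_nat (nat (- m))"]
      by (simp add: add_pow_int_lt)
  qed
qed

end

lemma Qp_hom: "prime p \<Longrightarrow> seq_hom (Qp p) {x. padic_cauchy p x} (cls p)"
  by (intro seq_hom.intro seq_hom_axioms.intro)
    (auto simp: Qp_cring Qp_carrier cauchy_add cls_hom cauchy_mult cauchy_uminus cauchy_const Qp_one Qp_zero)

lemma Zp_hom:
  assumes p: "prime p"
  shows "seq_hom (Zp p) {z. coh p z} (zc p)"
proof (intro seq_hom.intro seq_hom_axioms.intro)
  show "cring (Zp p)" by (rule Zp_cring[OF p])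
  show "(\<lambda>k. - x k) \<in> {z. coh p z}" if "x \<in> {z. coh p z}" for x
    using coh_diff[OF coh_const[of p 0], of x] that by simp
qed (use p in \<open>auto simp: Zp_carrier coh_add zc_hom coh_mult coh_const Zp_simps Qp_one Qp_zero zc_def[of p "\<lambda>_. _"]\<close>)

section \<open>Zeros over the p-adic integers as zeros modulo all powers of p\<close>

definition pvec :: "nat \<Rightarrow> nat \<Rightarrow> (nat \<Rightarrow> nat \<Rightarrow> int) \<Rightarrow> nat \<Rightarrow> padic" where
  "pvec p n x = (\<lambda>i\<in>{..<n}. zc p (x i))"

lemma pvec_carrier:
  assumes p: "prime p"
  shows "carrier (coord_mod (Zp p) n) = pvec p n ` {x. \<forall>i. coh p (x i)}"
proof
  show "pvec p n ` {x. \<forall>i. coh p (x i)} \<subseteq> carrier (coord_mod (Zp p) n)"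
    by (auto simp: coord_mod_def pvec_def Zp_carrier[OF p])
next
  show "carrier (coord_mod (Zp p) n) \<subseteq> pvec p n ` {x. \<forall>i. coh p (x i)}"
  proof
    fix X assume X: "X \<in> carrier (coord_mod (Zp p) n)"
    have "\<exists>z. coh p z \<and> (i < n \<longrightarrow> X i = zc p z)" for i
    proof (cases "i < n")
      case True
      then have "X i \<in> carrier (Zp p)" using X by (auto simp: coord_mod_def)
      then show ?thesis by (auto simp: Zp_carrier[OF p])
    qed (use coh_const in blast)
    then obtain x where x: "\<And>i. coh p (x i) \<and> (i < n \<longrightarrow> X i = zc p (x i))" by metis
    have "X = pvec p n x"
    proof
      fix i show "X i = pvec p n x i"
        using X x by (cases "i < n") (auto simp: coord_mod_def pvec_def PiE_def extensional_def)
    qed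
    then show "X \<in> pvec p n ` {x. \<forall>i. coh p (x i)}" using x by blast
  qed
qed

lemma pvec_zero: "prime p \<Longrightarrow> \<zero>\<^bsub>coord_mod (Zp p) n\<^esub> = pvec p n (\<lambda>_ _. 0)"
  by (simp add: coord_mod_def pvec_def Zp_simps Qp_zero zc_def)

lemma pvec_eq_iff:
  assumes p: "prime p" and "\<And>i. coh p (x i)" "\<And>i. coh p (y i)"
  shows "pvec p n x = pvec p n y \<longleftrightarrow> (\<forall>i<n. \<forall>k. int p ^ k dvd x i k - y i k)"
proof -
  have "pvec p n x = pvec p n y \<longleftrightarrow> (\<forall>i<n. zc p (x i) = zc p (y i))"
  proof
    assume "pvec p n x = pvec p n y"
    then have "pvec p n x i = pvec p n y i" for i by simp
    then show "\<forall>i<n. zc p (x i) = zc p (y i)" unfolding pvec_def by (metis lessThan_iff restrict_apply')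
  qed (auto simp: pvec_def intro!: restrict_ext)
  then show ?thesis using zc_eq_iff[OF p assms(2) assms(3)] by simp
qed

lemma qeval_pvec:
  assumes p: "prime p" and F: "\<And>i j. i \<le> j \<Longrightarrow> j < n \<Longrightarrow> F i j = zc p (G i j) \<and> coh p (G i j)"
    and x: "\<And>i. coh p (x i)"
  shows "qeval (Zp p) n F (pvec p n x) = zc p (\<lambda>k. qe n (\<lambda>i j. G i j k) (\<lambda>i. x i k))"
    "coh p (\<lambda>k. qe n (\<lambda>i j. G i j k) (\<lambda>i. x i k))"
  using seq_hom.qeval_hom[OF Zp_hom[OF p], of n F G "pvec p n x" x] F x by (auto simp: pvec_def)

lemma base_change_Zp: "prime p \<Longrightarrow> base_change (Zp p) f i j = zc p (\<lambda>_. f i j)"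
  using seq_hom.int_embed[OF Zp_hom, of p "f i j"] by (simp add: base_change_def)

lemma qform_rep:
  assumes p: "prime p" and "qform (Zp p) n F"
  shows "\<exists>G. (\<forall>i j. coh p (G i j)) \<and> (\<forall>i j. i \<le> j \<and> j < n \<longrightarrow> F i j = zc p (G i j))"
proof -
  have "\<exists>z. coh p z \<and> (i \<le> j \<and> j < n \<longrightarrow> F i j = zc p z)" for i j
    using assms(2) coh_const[of p 0] unfolding qform_def Zp_carrier[OF p] by (cases "i \<le> j \<and> j < n") blast+
  then show ?thesis by metis
qed

lemma prime_power_dvd_Suc: "int p ^ Suc k dvd x \<Longrightarrow> int p ^ k dvd x"
  by (metis dvd_trans dvd_triv_right power_Suc)

text \<open>Koenig's lemma on the tree of solutions modulo \<open>p\<^sup>k\<close>.\<close>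
lemma padic_compactness:
  fixes P :: "nat \<Rightarrow> ('i \<Rightarrow> int) \<Rightarrow> bool"
  assumes p: "prime p" and I: "finite I"
    and cong: "\<And>k x y. P k x \<Longrightarrow> (\<And>i. i \<in> I \<Longrightarrow> int p ^ k dvd x i - y i) \<Longrightarrow> P k y"
    and mono: "\<And>k x. P (Suc k) x \<Longrightarrow> P k x"
    and ex: "\<And>k. \<exists>x. P k x"
  shows "\<exists>X. (\<forall>i. coh p (X i)) \<and> (\<forall>k. P k (\<lambda>i. X i k))"
proof -
  define good where "good k x \<longleftrightarrow> (\<forall>l\<ge>k. \<exists>y. P l y \<and> (\<forall>i\<in>I. int p ^ k dvd y i - x i))" for k x
  have mono': "P k x" if "P l x" "k \<le> l" for k l x
    using that(2,1) by (induction rule: dec_induct) (use mono in auto)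
  have step: "\<exists>x'. good (Suc k) x' \<and> (\<forall>i. int p ^ k dvd x' i - x i)" if g: "good k x" for k x
  proof -
    have "\<forall>l. \<exists>y. l \<ge> k \<longrightarrow> P l y \<and> (\<forall>i\<in>I. int p ^ k dvd y i - x i)" using g unfolding good_def by blast
    then obtain y where y: "\<And>l. l \<ge> k \<Longrightarrow> P l (y l) \<and> (\<forall>i\<in>I. int p ^ k dvd y l i - x i)" by metis
    \<comment> \<open>Only finitely many residue vectors modulo p^(k+1) exist, so one of them is
      shared by solutions of unboundedly high level; it extends the branch.\<close>
    define r where "r l = (\<lambda>i\<in>I. y l i mod int p ^ Suc k)" for l
    have "r ` {k..} \<subseteq> I \<rightarrow>\<^sub>E {0..<int p ^ Suc k}" using p by (auto simp: r_def prime_gt_0_nat)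
    then have "finite (r ` {k..})" using I by (meson finite_PiE finite_atLeastLessThan_int finite_subset)
    then obtain a where a: "a \<in> {k..}" "infinite {b \<in> {k..}. r b = r a}"
      using pigeonhole_infinite[of "{k..}" r] infinite_Ici by blast
    define x' where "x' i = (if i \<in> I then r a i else x i)" for i
    have m: "int p ^ Suc k dvd y b i - r a i" if "r b = r a" "i \<in> I" for b i
    proof -
      have "r a i = y b i mod int p ^ Suc k" using that by (metis r_def restrict_apply')
      then show ?thesis by (simp add: mod_eq_dvd_iff[symmetric])
    qed
    have "good (Suc k) x'" unfolding good_def
    proof (intro allI impI)
      fix l assume "Suc k \<le> l"
      obtain b where b: "b \<in> {b \<in> {k..}. r b = r a}" "b \<ge> l"
        using a(2) by (metis (no_types, lifting) infinite_nat_iff_unbounded_le)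
      then have "P l (y b)" using y[of b] mono' by auto
      moreover have "\<forall>i\<in>I. int p ^ Suc k dvd y b i - x' i" using m b by (simp add: x'_def)
      ultimately show "\<exists>y. P l y \<and> (\<forall>i\<in>I. int p ^ Suc k dvd y i - x' i)" by blast
    qed
    moreover have "int p ^ k dvd x' i - x i" for i
    proof (cases "i \<in> I")
      case True
      have "int p ^ k dvd y a i - r a i" using prime_power_dvd_Suc[OF m[OF refl True]] .
      moreover have "int p ^ k dvd y a i - x i" using y[of a] a True by auto
      ultimately have "int p ^ k dvd (y a i - x i) - (y a i - r a i)" by (rule dvd_diff[rotated])
      then show ?thesis using True by (simp add: x'_def)
    qed (simp add: x'_def)
    ultimately show ?thesis by blast
  qed
  have "good 0 (\<lambda>_. 0)" unfolding good_def using ex by simp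
  then have "\<exists>x. good 0 x" by (intro exI[of _ "\<lambda>_. 0"])
  then obtain f where f: "\<And>k. good k (f k) \<and> (\<forall>i. int p ^ k dvd f (Suc k) i - f k i)"
    using dependent_nat_choice[of good "\<lambda>k x x'. \<forall>i. int p ^ k dvd x' i - x i"] step by metis
  have "P k (f k)" for k
  proof -
    obtain y where "P k y" "\<forall>i\<in>I. int p ^ k dvd y i - f k i" using f unfolding good_def by blast
    then show ?thesis using cong by blast
  qed
  moreover have "coh p (\<lambda>k. f k i)" for i using f by (simp add: coh_def)
  ultimately show ?thesis by (intro exI[of _ "\<lambda>i k. f k i"]) simp
qed

text \<open>Dividing all coordinates by p lowers the value by p^2, and this can happen fewer than c
  times.\<close>

lemma primitive_reduce:
  assumes p: "prime p" and "\<not> (\<forall>i<n. int p ^ c dvd x i)" "int p ^ (k + 2 * c) dvd qe n g x"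
  shows "\<exists>x. (\<exists>i<n. \<not> int p dvd x i) \<and> int p ^ k dvd qe n g x"
  using assms(2,3)
proof (induction c arbitrary: x)
  case (Suc c)
  show ?case
  proof (cases "\<forall>i<n. int p dvd x i")
    case True
    define x' where "x' i = x i div int p" for i
    have e: "x i = int p * x' i" if "i < n" for i using True that by (simp add: x'_def)
    have "qe n g x = qe n g (\<lambda>i. int p * x' i)" by (rule qe_cong) (use e in auto)
    then have "qe n g x = int p ^ 2 * qe n g x'" by (simp add: qe_scale)
    moreover have "int p ^ (k + 2 * Suc c) = int p ^ 2 * int p ^ (k + 2 * c)" by (simp add: power2_eq_square)
    ultimately have "int p ^ (k + 2 * c) dvd qe n g x'"
      using Suc.prems(2) p by (simp only: dvd_mult_cancel_left) (auto simp: prime_gt_0_nat)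
    moreover have "\<not> (\<forall>i<n. int p ^ c dvd x' i)" using Suc.prems(1) e by auto
    ultimately show ?thesis using Suc.IH by blast
  next
    case False
    then show ?thesis using Suc.prems(2) by (meson dvd_trans le_imp_power_dvd le_add1)
  qed
qed simp

lemma isotropicI:
  assumes p: "prime p" and F: "\<And>i j. i \<le> j \<Longrightarrow> j < n \<Longrightarrow> F i j = zc p (G i j) \<and> coh p (G i j)"
    and sol: "\<And>k. \<exists>x. (\<exists>i<n. \<not> int p dvd x i) \<and> int p ^ k dvd qe n (\<lambda>i j. G i j k) x"
  shows "isotropic (Zp p) n F"
proof -
  \<comment> \<open>A predicate at level 0 must be invariant under every change of x, so primitivity
    is imposed only from level 1 on, where it is visible modulo p^k.\<close>
  define P where "P k x \<longleftrightarrow> k = 0 \<or> (\<exists>i<n. \<not> int p dvd x i) \<and> int p ^ k dvd qe n (\<lambda>i j. G i j k) x" for k x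
  have "\<exists>X. (\<forall>i. coh p (X i)) \<and> (\<forall>k. P k (\<lambda>i. X i k))"
  proof (rule padic_compactness[OF p, where I = "{..<n}"])
    fix k x y assume P: "P k x" and c: "\<And>i. i \<in> {..<n} \<Longrightarrow> int p ^ k dvd x i - y i"
    show "P k y"
    proof (cases "k = 0")
      case False
      then obtain i where i: "i < n" "\<not> int p dvd x i" using P unfolding P_def by blast
      have "int p dvd x i - y i" using c[of i] i False by (metis dvd_power dvd_trans lessThan_iff not_gr_zero)
      then have "\<not> int p dvd y i" using i(2) by (metis dvd_diff_left_iff diff_add_cancel dvd_add)
      moreover have "int p ^ k dvd qe n (\<lambda>i j. G i j k) x - qe n (\<lambda>i j. G i j k) y"
        by (rule qe_dvd_cong) (use c in auto)
      then have "int p ^ k dvd qe n (\<lambda>i j. G i j k) y"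
        using P False unfolding P_def by (metis dvd_diff_right_iff)
      ultimately show ?thesis unfolding P_def using i(1) by blast
    qed (simp add: P_def)
  next
    fix k x assume P: "P (Suc k) x"
    have "int p ^ k dvd qe n (\<lambda>i j. G i j (Suc k)) x - qe n (\<lambda>i j. G i j k) x"
      by (rule qe_dvd_cong) (use F in \<open>auto simp: coh_def\<close>)
    moreover have "int p ^ k dvd qe n (\<lambda>i j. G i j (Suc k)) x" using P prime_power_dvd_Suc unfolding P_def by blast
    ultimately show "P k x" using P unfolding P_def by (metis dvd_diff_right_iff nat.distinct(1))
  next
    show "\<exists>x. P k x" for k using sol[of k] unfolding P_def by blast
  qed simp
  then obtain X where X: "\<And>i. coh p (X i)" "\<And>k. P k (\<lambda>i. X i k)" by blast
  have ev: "qeval (Zp p) n F (pvec p n X) = zc p (\<lambda>k. qe n (\<lambda>i j. G i j k) (\<lambda>i. X i k))"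
    and c: "coh p (\<lambda>k. qe n (\<lambda>i j. G i j k) (\<lambda>i. X i k))"
    by (rule qeval_pvec[OF p]; use F X(1) in blast)+
  have "zc p (\<lambda>k. qe n (\<lambda>i j. G i j k) (\<lambda>i. X i k)) = zc p (\<lambda>_. 0)"
    unfolding zc_eq_iff[OF p c coh_const]
  proof
    fix k show "int p ^ k dvd qe n (\<lambda>i j. G i j k) (\<lambda>i. X i k) - 0"
      using X(2)[of k] unfolding P_def by (cases "k = 0") auto
  qed
  then have "qeval (Zp p) n F (pvec p n X) = \<zero>\<^bsub>Zp p\<^esub>" using ev by (simp add: Zp_simps Qp_zero[OF p] zc_def)
  moreover have "pvec p n X \<noteq> \<zero>\<^bsub>coord_mod (Zp p) n\<^esub>"
  proof -
    obtain i where "i < n" "\<not> int p dvd X i 1" using X(2)[of 1] unfolding P_def by auto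
    then show ?thesis unfolding pvec_zero[OF p] pvec_eq_iff[OF p X(1) coh_const]
      by (metis diff_zero power_one_right)
  qed
  moreover have "pvec p n X \<in> carrier (coord_mod (Zp p) n)" using X(1) pvec_carrier[OF p] by blast
  ultimately show ?thesis unfolding isotropic_def by blast
qed

text \<open>A nonzero coordinate is not divisible by some p^c; at level k + 2c the common powers of
  p can be divided out, and the result still vanishes modulo p^k.\<close>

lemma isotropicD:
  assumes p: "prime p" and F: "\<And>i j. i \<le> j \<Longrightarrow> j < n \<Longrightarrow> F i j = zc p (G i j) \<and> coh p (G i j)"
    and iso: "isotropic (Zp p) n F"
  shows "\<exists>x. (\<exists>i<n. \<not> int p dvd x i) \<and> int p ^ k dvd qe n (\<lambda>i j. G i j k) x"
proof -
  obtain X where X: "\<And>i. coh p (X i)" "pvec p n X \<noteq> \<zero>\<^bsub>coord_mod (Zp p) n\<^esub>" "qeval (Zp p) n F (pvec p n X) = \<zero>\<^bsub>Zp p\<^esub>"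
    using iso unfolding isotropic_def pvec_carrier[OF p] by blast
  have ev: "qeval (Zp p) n F (pvec p n X) = zc p (\<lambda>k. qe n (\<lambda>i j. G i j k) (\<lambda>i. X i k))"
    and c: "coh p (\<lambda>k. qe n (\<lambda>i j. G i j k) (\<lambda>i. X i k))"
    by (rule qeval_pvec[OF p]; use F X(1) in blast)+
  have "zc p (\<lambda>k. qe n (\<lambda>i j. G i j k) (\<lambda>i. X i k)) = zc p (\<lambda>_. 0)"
    using X(3) ev by (simp add: Zp_simps Qp_zero[OF p] zc_def)
  then have z: "int p ^ k dvd qe n (\<lambda>i j. G i j k) (\<lambda>i. X i k)" for k
    unfolding zc_eq_iff[OF p c coh_const] by simp
  obtain i c where i: "i < n" "\<not> int p ^ c dvd X i c"
    using X(2) unfolding pvec_zero[OF p] pvec_eq_iff[OF p X(1) coh_const] by auto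
  define K where "K = k + 2 * c"
  have "\<not> int p ^ c dvd X i K"
  proof
    assume "int p ^ c dvd X i K"
    moreover have "int p ^ c dvd X i K - X i c" by (rule coh_le[OF X(1)]) (simp add: K_def)
    ultimately show False using i by (metis dvd_diff_right_iff dvd_diff_commute)
  qed
  then have "\<not> (\<forall>i<n. int p ^ c dvd X i K)" using i by blast
  moreover have "int p ^ (k + 2 * c) dvd qe n (\<lambda>i j. G i j K) (\<lambda>i. X i K)" using z[of K] by (simp add: K_def)
  ultimately obtain x where x: "\<exists>i<n. \<not> int p dvd x i" "int p ^ k dvd qe n (\<lambda>i j. G i j K) x"
    using primitive_reduce[OF p, of n c "\<lambda>i. X i K" k "\<lambda>i j. G i j K"] by blast
  have "int p ^ k dvd qe n (\<lambda>i j. G i j K) x - qe n (\<lambda>i j. G i j k) x"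
    by (rule qe_dvd_cong) (use F coh_le K_def in auto)
  then show ?thesis using x by (metis dvd_diff_right_iff)
qed

section \<open>Hensel lifting of nonsingular zeros\<close>

lemma qb_self: "qb n f v v = 2 * qe n f v"
  by (simp add: qb_def qe_def sum_distrib_left algebra_simps)

lemma qe_combination: "qe n f (\<lambda>i. x i + c * y i) = qe n f x + c * qb n f x y + c^2 * qe n f y"
  using qe_add[of n f x "\<lambda>i. c * y i"] by (simp add: qe_scale qb_scale)

lemma qb_combination: "qb n f (\<lambda>i. x i + c * y i) z = qb n f x z + c * qb n f y z"
  using qb_add[of n f z x "\<lambda>i. c * y i"] by (simp add: qb_scale qb_sym[of n f z])

text \<open>Newton's step along w: replacing x by x + p^(k+1) s w changes the value by p^(k+1) s
  B(x, w) to first order, and B(x, w) is a unit, so s solves a linear congruence.\<close>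

lemma smooth_lift:
  assumes p: "prime p" and v: "int p dvd qe n f v - a" and w: "\<not> int p dvd qb n f v w"
  shows "\<exists>x. (\<forall>i. int p dvd x i - v i) \<and> int p ^ Suc k dvd qe n f x - a"
proof (induction k)
  case 0
  then show ?case using v by (intro exI[of _ v]) auto
next
  case (Suc k)
  then obtain x where x: "\<forall>i. int p dvd x i - v i" "int p ^ Suc k dvd qe n f x - a" by blast
  then obtain m where m: "qe n f x - a = int p ^ Suc k * m" by (auto elim: dvdE)
  have "int p dvd qb n f x w - qb n f v w" by (rule qb_dvd_cong) (use x in auto)
  then have "\<not> int p dvd qb n f x w" using w by (metis dvd_diff_right_iff)
  then have "coprime (qb n f x w) (int p)" using p by (metis coprime_commute prime_imp_coprime prime_nat_int_transfer)
  then obtain b where b: "[qb n f x w * b = 1] (mod int p)" using cong_solve_coprime_int by blast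
  define s where "s = - (b * m)"
  have "int p dvd m * (1 - qb n f x w * b)" using b by (simp add: cong_iff_dvd_diff dvd_diff_commute)
  then have d: "int p dvd m + s * qb n f x w" by (simp add: s_def algebra_simps)
  define y where "y i = x i + (int p ^ Suc k * s) * w i" for i
  have "qe n f y = qe n f x + (int p ^ Suc k * s) * qb n f x w + (int p ^ Suc k * s)^2 * qe n f w"
    unfolding y_def by (rule qe_combination)
  then have "qe n f y - a = int p ^ Suc k * (m + s * qb n f x w) + int p ^ Suc k * (int p ^ Suc k * (s^2 * qe n f w))"
    using m by (simp add: power2_eq_square algebra_simps)
  moreover have "int p ^ Suc (Suc k) dvd int p ^ Suc k * (m + s * qb n f x w)"
    unfolding power_Suc2[of "int p" "Suc k"] by (rule mult_dvd_mono[OF dvd_refl d])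
  moreover have "int p ^ Suc (Suc k) dvd int p ^ Suc k * (int p ^ Suc k * (s^2 * qe n f w))"
    unfolding power_Suc2[of "int p" "Suc k"] by (rule mult_dvd_mono[OF dvd_refl]) simp
  ultimately have "int p ^ Suc (Suc k) dvd qe n f y - a" by (simp only: dvd_add)
  moreover have "int p dvd y i - v i" for i
  proof -
    have "int p dvd (x i - v i) + (int p ^ Suc k * s) * w i" using x(1) by (intro dvd_add) auto
    then show ?thesis by (simp add: y_def algebra_simps)
  qed
  ultimately show ?case by blast
qed

text \<open>A nonsingular zero modulo \<open>p\<close>; by Hensel lifting it makes the form isotropic and universal
  over \<open>\<int>\<^sub>p\<close>.\<close>
definition smooth_zero :: "nat \<Rightarrow> nat \<Rightarrow> (nat \<Rightarrow> nat \<Rightarrow> int) \<Rightarrow> bool" where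
  "smooth_zero p n f \<longleftrightarrow> (\<exists>v w. int p dvd qe n f v \<and> \<not> int p dvd qb n f v w)"

text \<open>Subtracting a multiple of v from w makes w isotropic modulo p as well, so the two span a
  hyperbolic plane. There v + t w' takes the value t B(v, w) modulo p, an arbitrary residue, at a
  nonsingular point that can be lifted.\<close>

lemma smooth_zero_represents:
  assumes p: "prime p" and "smooth_zero p n f"
  shows "\<exists>x. int p ^ k dvd qe n f x - a"
proof -
  obtain v w where v: "int p dvd qe n f v" and w: "\<not> int p dvd qb n f v w" using assms(2) unfolding smooth_zero_def by blast
  define B where "B = qb n f v w"
  have "coprime (int p) B" using p w by (simp add: B_def prime_imp_coprime)
  then have "coprime B (int p)" by (simp add: coprime_commute)
  then obtain b where "[B * b = 1] (mod int p)" using cong_solve_coprime_int[of B "int p"] by blast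
  then have b: "int p dvd B * b - 1" by (simp add: cong_iff_dvd_diff)
  define w' where "w' i = w i + (- (b * qe n f w)) * v i" for i
  have "qe n f w' = qe n f w + (- (b * qe n f w)) * B + (- (b * qe n f w))^2 * qe n f v"
    unfolding w'_def B_def qe_combination by (simp add: qb_sym)
  also have "\<dots> = - qe n f w * (B * b - 1) + (b * qe n f w)^2 * qe n f v" by (simp add: algebra_simps)
  finally have fw: "int p dvd qe n f w'" using b v by simp
  have "qb n f v w' = B + (- (b * qe n f w)) * (2 * qe n f v)"
    unfolding qb_sym[of n f v w'] unfolding w'_def qb_combination by (simp add: B_def qb_self qb_sym[of n f w v])
  then have Bw: "int p dvd qb n f v w' - B" using v by simp
  define t where "t = a * b"
  define u where "u i = v i + t * w' i" for i
  have "qe n f u - a = qe n f v + t * (qb n f v w' - B) + t^2 * qe n f w' + a * (B * b - 1)"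
    unfolding u_def qe_combination t_def by (simp add: algebra_simps)
  then have 1: "int p dvd qe n f u - a" using v Bw fw b by simp
  have "qb n f u w' - B = (qb n f v w' - B) + t * (2 * qe n f w')"
    unfolding u_def qb_combination by (simp add: qb_self)
  moreover have "int p dvd (qb n f v w' - B) + t * (2 * qe n f w')" using Bw fw by (intro dvd_add dvd_mult)
  ultimately have "int p dvd qb n f u w' - B" by (simp only:)
  then have 2: "\<not> int p dvd qb n f u w'" using w by (metis B_def dvd_diff_right_iff)
  show ?thesis using smooth_lift[OF p 1 2, of k] prime_power_dvd_Suc by blast
qed

lemma smooth_zero_universal:
  assumes p: "prime p" and s: "smooth_zero p n f"
  shows "universal (Zp p) n (base_change (Zp p) f)"
  unfolding universal_def
proof (intro ballI impI)
  fix a assume "a \<in> carrier (Zp p)"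
  then obtain \<alpha> where a: "coh p \<alpha>" "a = zc p \<alpha>" by (auto simp: Zp_carrier[OF p])
  define P where "P k x \<longleftrightarrow> int p ^ k dvd qe n f x - \<alpha> k" for k x
  have "\<exists>X. (\<forall>i. coh p (X i)) \<and> (\<forall>k. P k (\<lambda>i. X i k))"
  proof (rule padic_compactness[OF p, where I = "{..<n}"])
    fix k x y assume P: "P k x" and c: "\<And>i. i \<in> {..<n} \<Longrightarrow> int p ^ k dvd x i - y i"
    have "int p ^ k dvd qe n f x - qe n f y" by (rule qe_dvd_cong) (use c in auto)
    then have "int p ^ k dvd (qe n f x - \<alpha> k) - (qe n f x - qe n f y)" using P unfolding P_def by (rule_tac dvd_diff)
    then show "P k y" by (simp add: P_def)
  next
    fix k x assume P: "P (Suc k) x"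
    have "int p ^ k dvd qe n f x - \<alpha> (Suc k)" using P prime_power_dvd_Suc unfolding P_def by blast
    moreover have "int p ^ k dvd \<alpha> (Suc k) - \<alpha> k" using a(1) by (simp add: coh_def)
    ultimately have "int p ^ k dvd (qe n f x - \<alpha> (Suc k)) + (\<alpha> (Suc k) - \<alpha> k)" by (rule dvd_add)
    then show "P k x" by (simp add: P_def)
  next
    show "\<exists>x. P k x" for k using smooth_zero_represents[OF p s] unfolding P_def by blast
  qed simp
  then obtain X where X: "\<And>i. coh p (X i)" "\<And>k. P k (\<lambda>i. X i k)" by blast
  have F: "base_change (Zp p) f i j = zc p (\<lambda>_. f i j) \<and> coh p (\<lambda>_. f i j)" for i j
    using base_change_Zp[OF p] coh_const by blast
  have "qeval (Zp p) n (base_change (Zp p) f) (pvec p n X) = zc p (\<lambda>k. qe n f (\<lambda>i. X i k))"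
    and c: "coh p (\<lambda>k. qe n f (\<lambda>i. X i k))"
    using qeval_pvec[OF p, of n "base_change (Zp p) f" "\<lambda>i j _. f i j" X] F X(1) by simp_all
  moreover have "zc p (\<lambda>k. qe n f (\<lambda>i. X i k)) = a" unfolding a(2) zc_eq_iff[OF p c a(1)]
    using X(2) unfolding P_def by blast
  ultimately have "qeval (Zp p) n (base_change (Zp p) f) (pvec p n X) = a" by simp
  then show "\<exists>x\<in>carrier (coord_mod (Zp p) n). qeval (Zp p) n (base_change (Zp p) f) x = a"
    using X(1) pvec_carrier[OF p] by blast
qed

lemma base_isotropic_iff:
  assumes p: "prime p"
  shows "isotropic (Zp p) n (base_change (Zp p) f) \<longleftrightarrow>
    (\<forall>k. \<exists>x. (\<exists>i<n. \<not> int p dvd x i) \<and> int p ^ k dvd qe n f x)"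
proof -
  have F: "base_change (Zp p) f i j = zc p (\<lambda>_. f i j) \<and> coh p (\<lambda>_. f i j)" for i j
    using base_change_Zp[OF p] coh_const by blast
  show ?thesis
  proof
    assume iso: "isotropic (Zp p) n (base_change (Zp p) f)"
    show "\<forall>k. \<exists>x. (\<exists>i<n. \<not> int p dvd x i) \<and> int p ^ k dvd qe n f x"
      using isotropicD[OF p, of n "base_change (Zp p) f" "\<lambda>i j _. f i j", OF _ iso] F by simp
  next
    assume "\<forall>k. \<exists>x. (\<exists>i<n. \<not> int p dvd x i) \<and> int p ^ k dvd qe n f x"
    then show "isotropic (Zp p) n (base_change (Zp p) f)"
      using isotropicI[OF p, of n "base_change (Zp p) f" "\<lambda>i j _. f i j"] F by simp
  qed
qed

lemma smooth_zero_isotropic: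
  assumes p: "prime p" and s: "smooth_zero p n f"
  shows "isotropic (Zp p) n (base_change (Zp p) f)"
  unfolding base_isotropic_iff[OF p]
proof
  fix k
  obtain v w where v: "int p dvd qe n f v" and w: "\<not> int p dvd qb n f v w" using s unfolding smooth_zero_def by blast
  obtain x where x: "\<forall>i. int p dvd x i - v i" "int p ^ Suc k dvd qe n f x"
    using smooth_lift[OF p, of n f v 0 w k] v w by auto
  have "\<exists>i<n. \<not> int p dvd x i"
  proof (rule ccontr)
    assume "\<not> ?thesis"
    then have "int p dvd v i - 0" if "i < n" for i using x(1) that by (metis diff_zero dvd_diff_right_iff)
    then have "int p dvd qb n f v w - qb n f (\<lambda>_. 0) w" by (intro qb_dvd_cong) auto
    moreover have "qb n f (\<lambda>_. 0) w = 0" by (simp add: qb_def)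
    ultimately show False using w by simp
  qed
  then show "\<exists>x. (\<exists>i<n. \<not> int p dvd x i) \<and> int p ^ k dvd qe n f x" using x(2) prime_power_dvd_Suc by blast
qed

section \<open>Isometry of p-adically close forms\<close>

definition mv :: "nat \<Rightarrow> (nat \<Rightarrow> nat \<Rightarrow> 'a::comm_ring_1) \<Rightarrow> (nat \<Rightarrow> 'a) \<Rightarrow> nat \<Rightarrow> 'a" where
  "mv n U x i = (\<Sum>j<n. U i j * x j)"

definition mm :: "nat \<Rightarrow> (nat \<Rightarrow> nat \<Rightarrow> 'a::comm_ring_1) \<Rightarrow> (nat \<Rightarrow> nat \<Rightarrow> 'a) \<Rightarrow> nat \<Rightarrow> nat \<Rightarrow> 'a" where
  "mm n U V i j = (\<Sum>k<n. U i k * V k j)"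

text \<open>Kronecker delta, serving both as the standard basis vectors \<open>ev i\<close> and as
  the identity matrix.\<close>

definition ev :: "nat \<Rightarrow> nat \<Rightarrow> 'a::comm_ring_1" where "ev i j = (if i = j then 1 else 0)"

lemma ev_same: "ev i i = 1"
  by (simp add: ev_def)

lemma ev_other: "i \<noteq> j \<Longrightarrow> ev i j = 0"
  by (simp add: ev_def)

lemma mv_mm: "mv n (mm n U V) x i = mv n U (mv n V x) i"
proof -
  have "mv n (mm n U V) x i = (\<Sum>j<n. \<Sum>k<n. U i k * V k j * x j)" by (simp add: mv_def mm_def sum_distrib_right)
  also have "\<dots> = (\<Sum>k<n. \<Sum>j<n. U i k * V k j * x j)" by (rule sum.swap)
  also have "\<dots> = mv n U (mv n V x) i" by (simp add: mv_def sum_distrib_left mult.assoc)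
  finally show ?thesis .
qed

lemma mv_ev: "i < n \<Longrightarrow> mv n ev x i = x i"
  by (simp add: mv_def ev_def if_distrib[of "\<lambda>c. c * _"] cong: if_cong)

lemma mv_add: "mv n U (\<lambda>j. x j + y j) i = mv n U x i + mv n U y i"
  by (simp add: mv_def algebra_simps sum.distrib)

lemma mv_diff: "mv n U (\<lambda>j. x j - y j) i = mv n U x i - mv n U y i"
  by (simp add: mv_def algebra_simps sum_subtractf)

lemma mv_scale: "mv n U (\<lambda>j. c * x j) i = c * mv n U x i"
  by (simp add: mv_def sum_distrib_left mult_ac)

lemma mv_dvd:
  fixes U :: "nat \<Rightarrow> nat \<Rightarrow> int"
  shows "(\<And>j. j < n \<Longrightarrow> m dvd x j) \<Longrightarrow> m dvd mv n U x i"
  unfolding mv_def by (intro dvd_sum) auto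

lemma mv_dvd_cong:
  fixes U :: "nat \<Rightarrow> nat \<Rightarrow> int"
  assumes "\<And>j. j < n \<Longrightarrow> m dvd U i j - U' i j" "\<And>j. j < n \<Longrightarrow> m dvd x j - y j"
  shows "m dvd mv n U x i - mv n U' y i"
  unfolding mv_def sum_subtractf[symmetric]
proof (rule dvd_sum)
  fix j assume "j \<in> {..<n}"
  moreover have "U i j * x j - U' i j * y j = (U i j - U' i j) * x j + U' i j * (x j - y j)" by (simp add: algebra_simps)
  ultimately show "m dvd U i j * x j - U' i j * y j" using assms by simp
qed

text \<open>Invertibility is expressed by the action on all integer vectors, so that no determinants
  enter.\<close>

definition inv_mod :: "int \<Rightarrow> nat \<Rightarrow> (nat \<Rightarrow> nat \<Rightarrow> int) \<Rightarrow> (nat \<Rightarrow> nat \<Rightarrow> int) \<Rightarrow> bool" where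
  "inv_mod m n U V \<longleftrightarrow> (\<forall>x. \<forall>i<n. m dvd mv n U (mv n V x) i - x i \<and> m dvd mv n V (mv n U x) i - x i)"

lemma inv_mod_mm:
  assumes "inv_mod m n U V" "inv_mod m n U' V'"
  shows "inv_mod m n (mm n U U') (mm n V' V)"
  unfolding inv_mod_def
proof (intro allI impI)
  have gen: "m dvd mv n (mm n A A') (mv n (mm n B' B) x) i - x i"
    if "inv_mod m n A B" "inv_mod m n A' B'" "i < n" for A A' B B' x i
  proof -
    have "m dvd mv n A (mv n A' (mv n B' (mv n B x))) i - mv n A (mv n B x) i"
      by (rule mv_dvd_cong) (use that in \<open>auto simp: inv_mod_def\<close>)
    moreover have "m dvd mv n A (mv n B x) i - x i" using that by (auto simp: inv_mod_def)
    ultimately have "m dvd (mv n A (mv n A' (mv n B' (mv n B x))) i - mv n A (mv n B x) i) + (mv n A (mv n B x) i - x i)"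
      by (rule dvd_add)
    moreover have "mv n (mm n B' B) x = mv n B' (mv n B x)" by (rule ext) (rule mv_mm)
    ultimately show ?thesis by (simp add: mv_mm)
  qed
  have sym: "inv_mod m n B A" if "inv_mod m n A B" for A B using that by (auto simp: inv_mod_def)
  fix x i assume "i < n"
  then show "m dvd mv n (mm n U U') (mv n (mm n V' V) x) i - x i \<and> m dvd mv n (mm n V' V) (mv n (mm n U U') x) i - x i"
    using gen[OF assms] gen[OF sym[OF assms(2)] sym[OF assms(1)]] by blast
qed

lemma near_identity_mv: "i < n \<Longrightarrow> mv n (\<lambda>i l. ev i l + c * X i l) x i = x i + c * mv n X x i"
proof -
  assume "i < n"
  have "mv n (\<lambda>i l. ev i l + c * X i l) x i = mv n ev x i + c * mv n X x i"
    by (simp add: mv_def algebra_simps sum.distrib sum_distrib_left)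
  then show ?thesis using \<open>i < n\<close> by (simp add: mv_ev)
qed

text \<open>The geometric series of cX: passing from V to 1 + cXV multiplies the error by c, hence
  gains one power of p.\<close>

lemma near_identity_inverse:
  fixes X :: "nat \<Rightarrow> nat \<Rightarrow> int"
  assumes "int p dvd c"
  shows "\<exists>V. inv_mod (int p ^ K) n (\<lambda>i l. ev i l + (- c) * X i l) V"
proof (induction K)
  case 0
  then show ?case by (auto simp: inv_mod_def)
next
  case (Suc K)
  define A where "A = (\<lambda>i l. ev i l + (- c) * X i l)"
  obtain V where V: "inv_mod (int p ^ K) n A V" using Suc unfolding A_def by blast
  define V' where "V' i l = ev i l + c * mm n X V i l" for i l
  have A: "mv n A x i = x i + (- c) * mv n X x i" if "i < n" for x i unfolding A_def by (rule near_identity_mv[OF that])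
  have V': "mv n V' x i = x i + c * mv n X (mv n V x) i" if "i < n" for x i
    unfolding V'_def using near_identity_mv[OF that, of c "mm n X V"] by (simp add: mv_mm)
  have big: "int p ^ Suc K dvd c * mv n X y i" if "\<And>j. j < n \<Longrightarrow> int p ^ K dvd y j" for y i
    using mult_dvd_mono[OF assms mv_dvd[OF that]] by simp
  have "int p ^ Suc K dvd mv n A (mv n V' x) i - x i \<and> int p ^ Suc K dvd mv n V' (mv n A x) i - x i" if i: "i < n" for x i
  proof
    have eq1: "mv n X (mv n V' x) i = mv n X (\<lambda>j. x j + c * mv n X (mv n V x) j) i"
      by (simp add: mv_def[of n X] V')
    have "mv n A (mv n V' x) i - x i = c * mv n X (mv n V x) i - c * mv n X (mv n V' x) i"
      using A[OF i, of "mv n V' x"] V'[OF i] by simp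
    also have "\<dots> = c * mv n X (\<lambda>j. (mv n V x j + (- c) * mv n X (mv n V x) j) - x j) i"
      unfolding eq1 by (simp add: mv_add mv_diff mv_scale[of n X "-c", simplified] mv_scale algebra_simps)
    finally have "mv n A (mv n V' x) i - x i = c * mv n X (\<lambda>j. (mv n V x j + (- c) * mv n X (mv n V x) j) - x j) i" .
    moreover have "int p ^ K dvd (mv n V x j + (- c) * mv n X (mv n V x) j) - x j" if "j < n" for j
      using V A[OF that, of "mv n V x"] that unfolding inv_mod_def by metis
    ultimately show "int p ^ Suc K dvd mv n A (mv n V' x) i - x i" using big by simp
  next
    have "mv n V' (mv n A x) i - x i = c * mv n X (mv n V (mv n A x)) i - c * mv n X x i"
      using V'[OF i, of "mv n A x"] A[OF i] by simp
    also have "\<dots> = c * mv n X (\<lambda>j. mv n V (mv n A x) j - x j) i" by (simp add: mv_diff algebra_simps)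
    finally show "int p ^ Suc K dvd mv n V' (mv n A x) i - x i"
      using big[of "\<lambda>j. mv n V (mv n A x) j - x j"] V unfolding inv_mod_def by simp
  qed
  then show ?case unfolding A_def[symmetric] inv_mod_def by blast
qed

section \<open>Pullbacks and coefficients of quadratic forms\<close>

lemma qb_sum: "finite A \<Longrightarrow> qb n f (\<lambda>k. \<Sum>i\<in>A. x i * w i k) z = (\<Sum>i\<in>A. x i * qb n f (w i) z)"
proof (induction A rule: finite_induct)
  case empty
  then show ?case by (simp add: qb_def)
next
  case (insert a A)
  then show ?case using qb_combination[of n f "\<lambda>k. \<Sum>i\<in>A. x i * w i k" "x a" "w a" z] by (simp add: add.commute)
qed

lemma qb_cong: "(\<And>i. i < n \<Longrightarrow> x i = x' i) \<Longrightarrow> (\<And>i. i < n \<Longrightarrow> y i = y' i) \<Longrightarrow> qb n f x y = qb n f x' y'"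
  unfolding qb_def by (intro sum.cong) auto

lemma vec_expand: "i < n \<Longrightarrow> (\<Sum>j<n. y j * ev j i) = y i"
  by (simp add: ev_def if_distrib[of "\<lambda>c. _ * c"] cong: if_cong)

lemma qb_expand: "qb n f x y = (\<Sum>j<n. y j * qb n f x (ev j))"
proof -
  have "qb n f x y = qb n f x (\<lambda>k. \<Sum>j<n. y j * ev j k)" by (rule qb_cong) (auto simp: vec_expand)
  also have "\<dots> = qb n f (\<lambda>k. \<Sum>j<n. y j * ev j k) x" by (rule qb_sym)
  also have "\<dots> = (\<Sum>j<n. y j * qb n f (ev j) x)" by (rule qb_sum) simp
  finally show ?thesis by (simp add: qb_sym)
qed

lemma qe_Suc: "qe (Suc m) h x = qe m h x + (\<Sum>i<m. h i m * x i) * x m + h m m * (x m)^2"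
  by (simp add: qe_def lessThan_Suc_atMost[symmetric] power2_eq_square sum_distrib_left mult_ac)

lemma qe_pullback:
  "qe n f (\<lambda>k. \<Sum>i<m. x i * w i k) = qe m (\<lambda>i j. if i = j then qe n f (w i) else qb n f (w i) (w j)) x"
proof (induction m)
  case 0
  then show ?case by (simp add: qe_def)
next
  case (Suc m)
  have "qe n f (\<lambda>k. \<Sum>i<Suc m. x i * w i k) = qe n f (\<lambda>k. (\<Sum>i<m. x i * w i k) + x m * w m k)" by simp
  also have "\<dots> = qe n f (\<lambda>k. \<Sum>i<m. x i * w i k) + x m * (\<Sum>i<m. x i * qb n f (w i) (w m)) + (x m)^2 * qe n f (w m)"
    unfolding qe_combination by (simp add: qb_sum)
  also have "\<dots> = qe (Suc m) (\<lambda>i j. if i = j then qe n f (w i) else qb n f (w i) (w j)) x"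
    unfolding qe_Suc Suc by (simp add: sum_distrib_left sum_distrib_right mult_ac)
  finally show ?case .
qed

lemma qe_mv: "\<exists>h. \<forall>x. qe n f (mv n W x) = qe n h x"
proof (intro exI allI)
  fix x
  have "qe n f (mv n W x) = qe n f (\<lambda>k. \<Sum>i<n. x i * W k i)"
    by (rule qe_cong) (auto simp: mv_def mult.commute)
  also have "\<dots> = qe n (\<lambda>i j. if i = j then qe n f (\<lambda>k. W k i) else qb n f (\<lambda>k. W k i) (\<lambda>k. W k j)) x"
    by (rule qe_pullback)
  finally show "qe n f (mv n W x) = \<dots>" .
qed

lemma qe_ev: "i < n \<Longrightarrow> qe n e (ev i) = e i i"
proof (induction n)
  case (Suc n)
  show ?case
  proof (cases "i = n")
    case True
    have "qe n e (ev n) = qe n e (\<lambda>_. 0)" by (rule qe_cong) (auto simp: ev_def)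
    also have "\<dots> = 0" by (simp add: qe_def)
    finally show ?thesis using True by (simp add: qe_Suc ev_same ev_other)
  next
    case False
    then show ?thesis using Suc by (simp add: qe_Suc ev_other)
  qed
qed simp

lemma qb_ev: "i < j \<Longrightarrow> j < n \<Longrightarrow> qb n e (ev i) (ev j) = e i j"
proof -
  assume ij: "i < j" "j < n"
  have "qb n e (ev i) (ev j) = (\<Sum>l<n. \<Sum>k\<le>l. if l = j \<and> k = i then e i j else 0)"
    unfolding qb_def using ij by (intro sum.cong refl) (auto simp: ev_def)
  also have "\<dots> = (\<Sum>l<n. if l = j then e i j else 0)"
    using ij by (intro sum.cong refl) (auto simp: if_distrib sum.delta cong: if_cong)
  also have "\<dots> = e i j" using ij by simp
  finally show ?thesis .
qed

text \<open>The coefficients are recovered, without division by 2, from the values at the basis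
  vectors and at their pairwise sums.\<close>

lemma qe_coeff_dvd:
  fixes M :: int
  assumes "\<And>x. M dvd qe n e x" "i \<le> j" "j < n"
  shows "M dvd e i j"
proof (cases "i = j")
  case True
  then show ?thesis using assms(1)[of "ev i"] qe_ev[of i n e] assms(3) by metis
next
  case False
  have "qe n e (\<lambda>k. ev i k + ev j k) = qe n e (ev i) + qe n e (ev j) + e i j"
    unfolding qe_add using qb_ev[of i j n e] False assms by simp
  then have "e i j = qe n e (\<lambda>k. ev i k + ev j k) - (qe n e (ev i) + qe n e (ev j))" by simp
  then show ?thesis using assms(1) by simp
qed

lemma qe_lin: "qe n (\<lambda>i j. f i j + c * g i j) x = qe n f x + c * qe n g x"
  by (simp add: qe_def sum_distrib_left sum.distrib[symmetric] algebra_simps)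

text \<open>The upper triangular matrix of coefficients takes the place of the symmetric Gram
  matrix, which would involve halves.\<close>

lemma qe_inner: "qe n e x = (\<Sum>i<n. x i * mv n (\<lambda>i j. if i \<le> j then e i j else 0) x i)"
proof -
  have "(\<Sum>i<n. x i * mv n (\<lambda>i j. if i \<le> j then e i j else 0) x i)
      = (\<Sum>i<n. \<Sum>j<n. if i \<le> j then e i j * x i * x j else 0)"
    unfolding mv_def sum_distrib_left by (intro sum.cong refl) (auto simp: mult_ac)
  also have "\<dots> = (\<Sum>j<n. \<Sum>i<n. if i \<le> j then e i j * x i * x j else 0)" by (rule sum.swap)
  also have "\<dots> = (\<Sum>j<n. \<Sum>i\<le>j. e i j * x i * x j)"
  proof (rule sum.cong[OF refl])
    fix j assume j: "j \<in> {..<n}"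
    have "(\<Sum>i<n. if i \<le> j then e i j * x i * x j else 0) = (\<Sum>i\<in>{i\<in>{..<n}. i \<le> j}. e i j * x i * x j)"
      by (subst sum.inter_filter) auto
    also have "{i\<in>{..<n}. i \<le> j} = {..j}" using j by auto
    finally show "(\<Sum>i<n. if i \<le> j then e i j * x i * x j else 0) = (\<Sum>i\<le>j. e i j * x i * x j)" .
  qed
  finally show ?thesis by (simp add: qe_def)
qed

text \<open>Newton iteration \<open>W \<mapsto> W (1 - p\<^sup>j X)\<close> with \<open>X = C E\<close>, where the current error is
  \<open>p\<^bsup>v+j\<^esup> x\<^sup>t E x\<close> and \<open>C\<close> inverts the polar form of \<open>g\<close> up to \<open>p\<^sup>v\<close>.\<close>
lemma newton_isometry:
  fixes f g :: "nat \<Rightarrow> nat \<Rightarrow> int"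
  assumes p: "prime p"
    and C: "\<And>x y. int p ^ K dvd qb n g x (mv n C y) - int p ^ v * (\<Sum>i<n. x i * y i)"
    and W0: "inv_mod (int p ^ K) n W0 V0"
    and start: "\<And>x. int p ^ (2 * v + 1) dvd qe n f (mv n W0 x) - qe n g x"
  shows "\<exists>W V. inv_mod (int p ^ K) n W V \<and> (\<forall>x. int p ^ K dvd qe n f (mv n W x) - qe n g x)"
proof (cases "K \<le> 2 * v + 1")
  case True
  then have "int p ^ K dvd qe n f (mv n W0 x) - qe n g x" for x using start by (meson dvd_trans le_imp_power_dvd)
  then show ?thesis using W0 by blast
next
  case False
  have "\<exists>W V. inv_mod (int p ^ K) n W V \<and> (\<forall>x. int p ^ m dvd qe n f (mv n W x) - qe n g x)"
    if "2 * v + 1 \<le> m" "m \<le> K" for m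
    using that
  proof (induction m rule: dec_induct)
    case base
    then show ?case using W0 start by blast
  next
    case (step m)
    then obtain W V where W: "inv_mod (int p ^ K) n W V" "\<And>x. int p ^ m dvd qe n f (mv n W x) - qe n g x" by auto
    obtain h where h: "\<And>x. qe n f (mv n W x) = qe n h x" using qe_mv by blast
    define e where "e i j = (h i j - g i j) div int p ^ m" for i j
    have "int p ^ m dvd qe n (\<lambda>i j. h i j + (-1) * g i j) x" for x using W(2)[of x] h unfolding qe_lin by simp
    then have "int p ^ m dvd h i j - g i j" if "i \<le> j" "j < n" for i j using qe_coeff_dvd[OF _ that] by fastforce
    then have he: "h i j = g i j + int p ^ m * e i j" if "i \<le> j" "j < n" for i j using that by (simp add: e_def)
    have hge: "qe n h x = qe n g x + int p ^ m * qe n e x" for x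
      using qe_cong[of n x x h "\<lambda>i j. g i j + int p ^ m * e i j"] he by (simp add: qe_lin)
    define E where "E i j = (if i \<le> j then e i j else 0)" for i j
    define X where "X = mm n C E"
    \<comment> \<open>The correction has size p^j because inverting the polar form costs p^v. The
      quadratic terms disappear modulo p^(m+1) when 2(m-v) \<ge> m+1, which is why the starting
      precision is 2v+1.\<close>
    define j where "j = m - v"
    have jv: "j + v = m" "j \<ge> 1" "2 * j \<ge> m + 1" using step by (auto simp: j_def)
    define c where "c = int p ^ j"
    have pm: "int p ^ m = c * int p ^ v" using jv(1) by (simp add: c_def power_add[symmetric])
    define A where "A = (\<lambda>i l. ev i l + (- c) * X i l)"
    have "int p dvd c" using jv(2) by (simp add: c_def dvd_power)
    then obtain V1 where V1: "inv_mod (int p ^ K) n A V1"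
      unfolding A_def using near_identity_inverse by blast
    have key: "int p ^ Suc m dvd qe n f (mv n (mm n W A) x) - qe n g x" for x
    proof -
      define Xx where "Xx = mv n X x"
      have "qe n f (mv n (mm n W A) x) = qe n h (mv n A x)" using h by (simp add: mv_mm qe_cong[of n "mv n (mm n W A) x" "mv n W (mv n A x)" f f])
      also have "\<dots> = qe n h (\<lambda>i. x i + (- c) * Xx i)"
        by (rule qe_cong) (auto simp only: A_def near_identity_mv Xx_def)
      also have "\<dots> = qe n g (\<lambda>i. x i + (- c) * Xx i) + int p ^ m * qe n e (\<lambda>i. x i + (- c) * Xx i)" by (rule hge)
      also have "\<dots> = qe n g x - c * qb n g x Xx + c^2 * qe n g Xx
          + int p ^ m * (qe n e x - c * qb n e x Xx + c^2 * qe n e Xx)"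
        unfolding qe_combination by simp
      finally have fin: "qe n f (mv n (mm n W A) x) = qe n g x - c * qb n g x Xx + c^2 * qe n g Xx
          + int p ^ m * (qe n e x - c * qb n e x Xx + c^2 * qe n e Xx)" .
      have alg: "(g0 - c*B + c^2*g1 + c*P*(e0 - c*b + c^2*e1)) - g0 = - (c*(B - P*e0)) + c^2*g1 + c*P*c*(- b + c*e1)"
        for g0 g1 B e0 e1 b P c :: int by (simp add: algebra_simps power2_eq_square)
      have eq: "qe n f (mv n (mm n W A) x) - qe n g x = - (c * (qb n g x Xx - int p ^ v * qe n e x))
          + c^2 * qe n g Xx + c * int p ^ v * c * (- qb n e x Xx + c * qe n e Xx)"
        unfolding fin pm by (rule alg)
      have "qb n g x Xx = qb n g x (mv n C (mv n E x))" by (rule qb_cong) (auto simp: Xx_def X_def mv_mm)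
      moreover have "qe n e x = (\<Sum>i<n. x i * mv n E x i)" unfolding E_def by (rule qe_inner)
      ultimately have "int p ^ K dvd qb n g x Xx - int p ^ v * qe n e x" using C by simp
      then have "int p ^ Suc m dvd qb n g x Xx - int p ^ v * qe n e x" using step by (meson dvd_trans le_imp_power_dvd)
      then have 1: "int p ^ Suc m dvd - (c * (qb n g x Xx - int p ^ v * qe n e x))" by simp
      have "int p ^ Suc m dvd c^2" unfolding c_def power_mult[symmetric] using jv(3) by (intro le_imp_power_dvd) auto
      then have 2: "int p ^ Suc m dvd c^2 * qe n g Xx" by simp
      have "int p ^ Suc m dvd int p ^ m * c" unfolding c_def power_add[symmetric] using jv(2) by (intro le_imp_power_dvd) auto
      then have 3: "int p ^ Suc m dvd c * int p ^ v * c * (- qb n e x Xx + c * qe n e Xx)"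
        unfolding pm by (rule dvd_mult2)
      show ?thesis unfolding eq by (intro dvd_add 1 2 3)
    qed
    then show ?case using inv_mod_mm[OF W(1) V1] by blast
  qed
  then show ?thesis using False by auto
qed

text \<open>Induction on the number of equations: two solutions of the first m, the second vanishing
  at a coordinate where the first does not, are combined over the integers so as to satisfy the last
  one.\<close>

lemma underdetermined_system:
  fixes A :: "nat \<Rightarrow> 'j \<Rightarrow> int"
  shows "finite J \<Longrightarrow> m < card J \<Longrightarrow> \<exists>x. (\<exists>j\<in>J. x j \<noteq> 0) \<and> (\<forall>i<m. (\<Sum>j\<in>J. A i j * x j) = 0)"
proof (induction m arbitrary: J)
  case 0
  then have "J \<noteq> {}" by auto
  then show ?case by (intro exI[of _ "\<lambda>_. 1"]) auto
next
  case (Suc m)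
  obtain x where x: "\<exists>j\<in>J. x j \<noteq> 0" "\<forall>i<m. (\<Sum>j\<in>J. A i j * x j) = 0" using Suc.IH[of J] Suc.prems by auto
  obtain j1 where j1: "j1 \<in> J" "x j1 \<noteq> 0" using x by blast
  have "m < card (J - {j1})" using Suc.prems j1 by simp
  then obtain y0 where y0: "\<exists>j\<in>J - {j1}. y0 j \<noteq> 0" "\<forall>i<m. (\<Sum>j\<in>J - {j1}. A i j * y0 j) = 0"
    using Suc.IH[of "J - {j1}"] Suc.prems by auto
  define y where "y j = (if j = j1 then 0 else y0 j)" for j
  have ysum: "(\<Sum>j\<in>J. A i j * y j) = (\<Sum>j\<in>J - {j1}. A i j * y0 j)" for i
    using Suc.prems(1) j1 by (simp add: sum.remove[of J j1] y_def)
  define a b where "a = (\<Sum>j\<in>J. A m j * x j)" and "b = (\<Sum>j\<in>J. A m j * y j)"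
  have all: "(\<forall>i<Suc m. P i) \<longleftrightarrow> (\<forall>i<m. P i) \<and> P m" for P by (auto simp: less_Suc_eq)
  show ?case
  proof (cases "b = 0")
    case True
    then show ?thesis using y0 ysum unfolding all b_def by (intro exI[of _ y]) (auto simp: y_def)
  next
    case False
    define z where "z j = b * x j - a * y j" for j
    have zs: "(\<Sum>j\<in>J. A i j * z j) = b * (\<Sum>j\<in>J. A i j * x j) - a * (\<Sum>j\<in>J. A i j * y j)" for i
      by (simp add: z_def sum_distrib_left sum_subtractf[symmetric] algebra_simps)
    have "z j1 \<noteq> 0" using False j1 by (simp add: z_def y_def)
    then show ?thesis using zs x y0 ysum j1 unfolding all a_def b_def by (intro exI[of _ z]) auto
  qed
qed

lemma primitive_multiple:
  fixes x :: "'j \<Rightarrow> int"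
  assumes p: "prime p" and J: "finite J" and nz: "\<exists>j\<in>J. x j \<noteq> 0"
  shows "\<exists>y c. c \<noteq> 0 \<and> (\<forall>j\<in>J. x j = c * y j) \<and> (\<exists>j\<in>J. \<not> int p dvd y j)"
  using nz
proof (induction "\<Sum>j\<in>J. nat \<bar>x j\<bar>" arbitrary: x rule: less_induct)
  case less
  show ?case
  proof (cases "\<forall>j\<in>J. int p dvd x j")
    case False
    then show ?thesis by (intro exI[of _ x] exI[of _ 1]) auto
  next
    case True
    define y where "y j = x j div int p" for j
    have xy: "x j = int p * y j" if "j \<in> J" for j using True that by (simp add: y_def)
    have p2: "p \<ge> 2" using p prime_ge_2_nat by blast
    have le: "nat \<bar>y j\<bar> \<le> nat \<bar>x j\<bar>" if "j \<in> J" for j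
      using xy[OF that] p2 by (simp add: abs_mult nat_mult_distrib)
    obtain j where j: "j \<in> J" "x j \<noteq> 0" using less.prems by blast
    have "nat \<bar>y j\<bar> < nat \<bar>x j\<bar>" using xy[OF j(1)] j(2) p2 by (simp add: abs_mult nat_mult_distrib)
    then have "(\<Sum>j\<in>J. nat \<bar>y j\<bar>) < (\<Sum>j\<in>J. nat \<bar>x j\<bar>)" using le j J by (intro sum_strict_mono_ex1) auto
    moreover have "\<exists>j\<in>J. y j \<noteq> 0" using j xy by fastforce
    ultimately obtain z c where z: "c \<noteq> 0" "\<forall>j\<in>J. y j = c * z j" "\<exists>j\<in>J. \<not> int p dvd z j" using less.hyps by blast
    then show ?thesis using xy p2 by (intro exI[of _ z] exI[of _ "int p * c"]) auto
  qed
qed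

text \<open>For each l the system B(y, e_i) = t times the Kronecker delta of i and l has n equations
  in the n+1 unknowns y and t, hence an integral solution not divisible by p. If p^v divided t, the
  hypothesis would make y, and so the whole solution, divisible by p. Thus t has valuation below v,
  and y can be rescaled to turn t into p^v up to p^K.\<close>

lemma dual_matrix:
  fixes g :: "nat \<Rightarrow> nat \<Rightarrow> int"
  assumes p: "prime p" and v: "v \<ge> 1"
    and H: "\<And>x. (\<And>y. int p ^ v dvd qb n g x y) \<Longrightarrow> (\<forall>i<n. int p dvd x i)"
  shows "\<exists>C. \<forall>x y. int p ^ K dvd qb n g x (mv n C y) - int p ^ v * (\<Sum>i<n. x i * y i)"
proof -
  have "\<exists>c. \<forall>x. int p ^ K dvd qb n g x c - int p ^ v * x l" if l: "l < n" for l
  proof -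
    define A where "A i j = (if j = n then - ev i l else qb n g (ev j) (ev i))" for i j
    obtain x where x: "\<exists>j\<in>{..n}. x j \<noteq> 0" "\<forall>i<n. (\<Sum>j\<in>{..n}. A i j * x j) = 0"
      using underdetermined_system[of "{..n}" n A] by auto
    obtain y c where y: "c \<noteq> 0" "\<forall>j\<in>{..n}. x j = c * y j" "\<exists>j\<in>{..n}. \<not> int p dvd y j"
      using primitive_multiple[OF p _ x(1)] by auto
    define t where "t = y n"
    have row: "qb n g y (ev i) = t * ev i l" if "i < n" for i
    proof -
      have "(\<Sum>j\<in>{..n}. A i j * x j) = c * (\<Sum>j\<in>{..n}. A i j * y j)"
        unfolding sum_distrib_left using y(2) by (intro sum.cong) auto
      then have "(\<Sum>j\<in>{..n}. A i j * y j) = 0" using x(2) that y(1) by simp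
      moreover have "(\<Sum>j\<in>{..n}. A i j * y j) = (\<Sum>j<n. y j * qb n g (ev j) (ev i)) - t * ev i l"
        by (simp add: lessThan_Suc_atMost[symmetric] A_def t_def mult.commute)
      moreover have "(\<Sum>j<n. y j * qb n g (ev j) (ev i)) = qb n g y (ev i)"
        unfolding qb_sym[of n g y "ev i"] qb_expand[of n g "ev i" y] by (simp add: qb_sym[of n g "ev i"])
      ultimately show ?thesis by simp
    qed
    have qy: "qb n g y z = t * z l" for z
    proof -
      have "qb n g y z = (\<Sum>i<n. z i * (t * ev i l))" unfolding qb_expand[of n g y z] by (intro sum.cong) (auto simp: row)
      also have "\<dots> = t * (\<Sum>i<n. z i * ev i l)" by (simp add: sum_distrib_left mult_ac)
      finally show ?thesis using vec_expand[OF l, of z] by simp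
    qed
    have nt: "\<not> int p ^ v dvd t"
    proof
      assume a: "int p ^ v dvd t"
      then have "\<forall>i<n. int p dvd y i" using H qy by simp
      moreover have "int p dvd t" using a v by (metis dvd_power dvd_trans less_le_trans zero_less_one)
      ultimately show False using y(3) by (auto simp: t_def le_less)
    qed
    have t0: "t \<noteq> 0" using nt by auto
    define e where "e = multiplicity (int p) t"
    have pp: "\<not> is_unit (int p)" using p by (metis not_prime_unit prime_nat_int_transfer)
    obtain u where u: "t = int p ^ e * u" "\<not> int p dvd u"
      using multiplicity_decompose'[OF t0 pp] unfolding e_def by metis
    have ev: "e < v" using nt u(1) by (metis dvd_mult2 le_imp_power_dvd not_le)
    have "coprime (int p) u" using p u(2) by (simp add: prime_imp_coprime)
    then have "coprime u (int p ^ K)" by (simp add: coprime_commute)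
    then obtain w where w: "[u * w = 1] (mod int p ^ K)" using cong_solve_coprime_int by blast
    define b where "b = int p ^ (v - e) * w"
    have "qb n g x (\<lambda>i. b * y i) - int p ^ v * x l = int p ^ v * x l * (u * w - 1)" for x
    proof -
      have bt: "b * t = int p ^ v * (u * w)"
      proof -
        have "b * t = int p ^ (v - e) * int p ^ e * (u * w)" by (simp add: b_def u(1) mult_ac)
        then show ?thesis using ev by (simp add: power_add[symmetric])
      qed
      have "qb n g x (\<lambda>i. b * y i) = (b * t) * x l" by (simp add: qb_scale qb_sym[of n g x y] qy)
      then show ?thesis unfolding bt by (simp add: algebra_simps)
    qed
    then show ?thesis using w by (intro exI[of _ "\<lambda>i. b * y i"]) (auto simp: cong_iff_dvd_diff)
  qed
  then obtain c where c: "\<And>l x. l < n \<Longrightarrow> int p ^ K dvd qb n g x (c l) - int p ^ v * x l" by metis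
  define C where "C i l = c l i" for i l
  have "int p ^ K dvd qb n g x (mv n C y) - int p ^ v * (\<Sum>i<n. x i * y i)" for x y
  proof -
    have "qb n g x (mv n C y) = qb n g (\<lambda>k. \<Sum>l<n. y l * c l k) x"
      unfolding qb_sym[of n g x] by (rule qb_cong) (auto simp: mv_def C_def mult.commute)
    also have "\<dots> = (\<Sum>l<n. y l * qb n g x (c l))" by (simp add: qb_sum qb_sym[of n g x])
    finally have "qb n g x (mv n C y) - int p ^ v * (\<Sum>i<n. x i * y i) = (\<Sum>l<n. y l * (qb n g x (c l) - int p ^ v * x l))"
      by (simp add: sum_distrib_left sum_subtractf[symmetric] algebra_simps)
    also have "int p ^ K dvd \<dots>" using c by (intro dvd_sum) auto
    finally show ?thesis .
  qed
  then show ?thesis by blast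
qed

text \<open>Otherwise, for every v a vector not divisible by p would be orthogonal to everything
  modulo p^v, and compactness would produce a nonzero vector in the radical.\<close>

lemma nondegenerate_bound:
  assumes p: "prime p" and G: "\<And>i j. coh p (G i j)" "\<And>i j. i \<le> j \<Longrightarrow> j < n \<Longrightarrow> F i j = zc p (G i j)"
    and nd: "nondegenerate (Zp p) n F"
  shows "\<exists>v\<ge>1. \<forall>x. (\<forall>y. int p ^ v dvd qb n (\<lambda>i j. G i j v) x y) \<longrightarrow> (\<forall>i<n. int p dvd x i)"
proof (rule ccontr)
  assume no: "\<not> ?thesis"
  define P where "P k x \<longleftrightarrow> k = 0 \<or> (\<forall>y. int p ^ k dvd qb n (\<lambda>i j. G i j k) x y) \<and> (\<exists>i<n. \<not> int p dvd x i)" for k x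
  have "\<exists>X. (\<forall>i. coh p (X i)) \<and> (\<forall>k. P k (\<lambda>i. X i k))"
  proof (rule padic_compactness[OF p, where I = "{..<n}"])
    fix k x y assume P: "P k x" and c: "\<And>i. i \<in> {..<n} \<Longrightarrow> int p ^ k dvd x i - y i"
    show "P k y"
    proof (cases "k = 0")
      case False
      then obtain i where i: "i < n" "\<not> int p dvd x i" using P unfolding P_def by blast
      have "int p dvd x i - y i" using c[of i] i False by (metis dvd_power dvd_trans lessThan_iff not_gr_zero)
      then have "\<not> int p dvd y i" using i(2) by (metis dvd_diff_left_iff diff_add_cancel dvd_add)
      moreover have "int p ^ k dvd qb n (\<lambda>i j. G i j k) y z" for z
      proof -
        have "int p ^ k dvd qb n (\<lambda>i j. G i j k) x z - qb n (\<lambda>i j. G i j k) y z"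
          by (rule qb_dvd_cong) (use c in auto)
        then show ?thesis using P False unfolding P_def by (metis dvd_diff_right_iff)
      qed
      ultimately show ?thesis unfolding P_def using i(1) by blast
    qed (simp add: P_def)
  next
    fix k x assume P: "P (Suc k) x"
    have "int p ^ k dvd qb n (\<lambda>i j. G i j k) x y" for y
    proof -
      have "int p ^ k dvd qb n (\<lambda>i j. G i j (Suc k)) x y - qb n (\<lambda>i j. G i j k) x y"
        by (rule qb_dvd_cong) (use G in \<open>auto simp: coh_def\<close>)
      moreover have "int p ^ k dvd qb n (\<lambda>i j. G i j (Suc k)) x y" using P prime_power_dvd_Suc unfolding P_def by blast
      ultimately show ?thesis by (metis dvd_diff_right_iff)
    qed
    then show "P k x" using P unfolding P_def by blast
  next
    show "\<exists>x. P k x" for k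
    proof (cases "k = 0")
      case False
      then have "k \<ge> 1" by simp
      then show ?thesis using no unfolding P_def by blast
    qed (simp add: P_def)
  qed simp
  then obtain X where X: "\<And>i. coh p (X i)" "\<And>k. P k (\<lambda>i. X i k)" by blast
  have "qpolar (Zp p) n F (pvec p n X) Y = \<zero>\<^bsub>Zp p\<^esub>" if Y: "Y \<in> carrier (coord_mod (Zp p) n)" for Y
  proof -
    obtain y where y: "Y = pvec p n y" "\<And>i. coh p (y i)" using Y pvec_carrier[OF p] by blast
    have "qpolar (Zp p) n F (pvec p n X) Y = zc p (\<lambda>k. qb n (\<lambda>i j. G i j k) (\<lambda>i. X i k) (\<lambda>i. y i k))"
      by (rule seq_hom.qpolar_hom[OF Zp_hom[OF p]]) (use G X(1) y in \<open>auto simp: pvec_def\<close>)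
    moreover have c: "coh p (\<lambda>k. qb n (\<lambda>i j. G i j k) (\<lambda>i. X i k) (\<lambda>i. y i k))"
      unfolding coh_def by (intro allI qb_dvd_cong) (use G X(1) y in \<open>auto simp: coh_def\<close>)
    have "zc p (\<lambda>k. qb n (\<lambda>i j. G i j k) (\<lambda>i. X i k) (\<lambda>i. y i k)) = zc p (\<lambda>_. 0)"
      unfolding zc_eq_iff[OF p c coh_const]
    proof
      fix k show "int p ^ k dvd qb n (\<lambda>i j. G i j k) (\<lambda>i. X i k) (\<lambda>i. y i k) - 0"
        using X(2)[of k] unfolding P_def by (cases "k = 0") auto
    qed
    ultimately show ?thesis by (simp add: Zp_simps Qp_zero[OF p] zc_def)
  qed
  moreover have "pvec p n X \<in> carrier (coord_mod (Zp p) n)" using X(1) pvec_carrier[OF p] by blast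
  ultimately have "pvec p n X = \<zero>\<^bsub>coord_mod (Zp p) n\<^esub>" using nd unfolding nondegenerate_def by blast
  moreover obtain i where "i < n" "\<not> int p dvd X i 1" using X(2)[of 1] unfolding P_def by auto
  ultimately show False unfolding pvec_zero[OF p] pvec_eq_iff[OF p X(1) coh_const]
    by (metis diff_zero power_one_right)
qed

section \<open>Linear maps given by coherent integer matrices\<close>

definition act :: "nat \<Rightarrow> nat \<Rightarrow> (nat \<Rightarrow> nat \<Rightarrow> nat \<Rightarrow> int) \<Rightarrow> (nat \<Rightarrow> padic) \<Rightarrow> nat \<Rightarrow> padic" where
  "act p n U X = (\<lambda>i\<in>{..<n}. \<Oplus>\<^bsub>Zp p\<^esub>j\<in>{..<n}. zc p (U i j) \<otimes>\<^bsub>Zp p\<^esub> X j)"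

lemma act_pvec:
  assumes p: "prime p" and U: "\<forall>i j. coh p (U i j)" and x: "\<forall>i. coh p (x i)"
  shows "act p n U (pvec p n x) = pvec p n (\<lambda>i k. mv n (\<lambda>i j. U i j k) (\<lambda>j. x j k) i)"
    "\<forall>i. coh p (\<lambda>k. mv n (\<lambda>i j. U i j k) (\<lambda>j. x j k) i)"
proof -
  interpret Z: seq_hom "Zp p" "{z. coh p z}" "zc p" by (rule Zp_hom[OF p])
  have tm: "zc p (U i j) \<otimes>\<^bsub>Zp p\<^esub> pvec p n x j = zc p (\<lambda>k. U i j k * x j k) \<and> coh p (\<lambda>k. U i j k * x j k)" if "j < n" for i j
    using that Z.c_mult[of "U i j" "x j"] Z.C_mult[of "U i j" "x j"] U x by (simp add: pvec_def)
  have s: "(\<lambda>k. \<Sum>j<n. U i j k * x j k) \<in> {z. coh p z}"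
    "(\<Oplus>\<^bsub>Zp p\<^esub>j\<in>{..<n}. zc p (U i j) \<otimes>\<^bsub>Zp p\<^esub> pvec p n x j) = zc p (\<lambda>k. \<Sum>j<n. U i j k * x j k)" for i
    by (rule Z.finsum_hom; use tm in auto)+
  show "act p n U (pvec p n x) = pvec p n (\<lambda>i k. mv n (\<lambda>i j. U i j k) (\<lambda>j. x j k) i)"
    unfolding act_def s(2) by (simp add: pvec_def mv_def)
  show "\<forall>i. coh p (\<lambda>k. mv n (\<lambda>i j. U i j k) (\<lambda>j. x j k) i)" using s(1) by (simp add: mv_def)
qed

lemma pvec_add:
  assumes p: "prime p" and "\<forall>i. coh p (x i)" "\<forall>i. coh p (y i)"
  shows "pvec p n x \<oplus>\<^bsub>coord_mod (Zp p) n\<^esub> pvec p n y = pvec p n (\<lambda>i k. x i k + y i k)"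
proof -
  interpret Z: seq_hom "Zp p" "{z. coh p z}" "zc p" by (rule Zp_hom[OF p])
  show ?thesis using Z.c_add[of "x _" "y _"] assms by (auto simp: coord_mod_def pvec_def intro!: restrict_ext)
qed

lemma pvec_smult:
  assumes p: "prime p" and "coh p \<alpha>" "\<forall>i. coh p (x i)"
  shows "zc p \<alpha> \<odot>\<^bsub>coord_mod (Zp p) n\<^esub> pvec p n x = pvec p n (\<lambda>i k. \<alpha> k * x i k)"
proof -
  interpret Z: seq_hom "Zp p" "{z. coh p z}" "zc p" by (rule Zp_hom[OF p])
  show ?thesis using Z.c_mult[of \<alpha> "x _"] assms by (auto simp: coord_mod_def pvec_def intro!: restrict_ext)
qed

text \<open>The matrix W maps the lattice of the target to that of f, whereas
  \<open>isometric\<close> asks for a map starting at f; hence the isometry is given by the inverse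
  V.\<close>

lemma isometricI:
  assumes p: "prime p" and F: "\<And>i j. i \<le> j \<Longrightarrow> j < n \<Longrightarrow> F i j = zc p (G i j) \<and> coh p (G i j)"
    and W: "\<forall>i j. coh p (W i j)" and V: "\<forall>i j. coh p (V i j)"
    and inv: "\<And>k. inv_mod (int p ^ k) n (\<lambda>i j. W i j k) (\<lambda>i j. V i j k)"
    and eq: "\<And>k x. int p ^ k dvd qe n f (mv n (\<lambda>i j. W i j k) x) - qe n (\<lambda>i j. G i j k) x"
  shows "isometric (Zp p) n (base_change (Zp p) f) F"
proof -
  let ?M = "coord_mod (Zp p) n"
  have carr: "carrier ?M = pvec p n ` {x. \<forall>i. coh p (x i)}" by (rule pvec_carrier[OF p])
  have closed: "act p n U X \<in> carrier ?M" if "X \<in> carrier ?M" "\<forall>i j. coh p (U i j)" for U X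
    using that act_pvec[OF p that(2)] unfolding carr by auto
  have comp: "act p n U' (act p n U X) = X"
    if "X \<in> carrier ?M" and U: "\<forall>i j. coh p (U i j)" and U': "\<forall>i j. coh p (U' i j)"
      and i: "\<And>k x i. i < n \<Longrightarrow> int p ^ k dvd mv n (\<lambda>i j. U' i j k) (mv n (\<lambda>i j. U i j k) x) i - x i" for U U' X
  proof -
    obtain x where x: "X = pvec p n x" "\<forall>i. coh p (x i)" using \<open>X \<in> _\<close> unfolding carr by auto
    note a = act_pvec[OF p U x(2)]
    have "act p n U' (act p n U X) = pvec p n (\<lambda>i k. mv n (\<lambda>i j. U' i j k) (\<lambda>j. mv n (\<lambda>i j. U i j k) (\<lambda>j. x j k) j) i)"
      unfolding x(1) a(1) by (rule act_pvec(1)[OF p U' a(2)])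
    also have "\<dots> = pvec p n x"
      by (subst pvec_eq_iff[OF p]) (use act_pvec(2)[OF p U' a(2)] x(2) i in auto)
    finally show ?thesis using x(1) by simp
  qed
  define \<phi> where "\<phi> = act p n V"
  have bij: "bij_betw \<phi> (carrier ?M) (carrier ?M)"
  proof (rule bij_betw_byWitness[where f' = "act p n W"])
    show "\<forall>X\<in>carrier ?M. act p n W (\<phi> X) = X"
      unfolding \<phi>_def using comp[OF _ V W] inv unfolding inv_mod_def by blast
    show "\<forall>X\<in>carrier ?M. \<phi> (act p n W X) = X"
      unfolding \<phi>_def using comp[OF _ W V] inv unfolding inv_mod_def by blast
    show "\<phi> ` carrier ?M \<subseteq> carrier ?M" unfolding \<phi>_def using closed V by blast
    show "act p n W ` carrier ?M \<subseteq> carrier ?M" using closed W by blast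
  qed
  have hom: "\<phi> (X \<oplus>\<^bsub>?M\<^esub> Y) = \<phi> X \<oplus>\<^bsub>?M\<^esub> \<phi> Y" if XY: "X \<in> carrier ?M" "Y \<in> carrier ?M" for X Y
  proof -
    obtain x y where xy: "X = pvec p n x" "\<forall>i. coh p (x i)" "Y = pvec p n y" "\<forall>i. coh p (y i)" using XY unfolding carr by auto
    have c: "\<forall>i. coh p (\<lambda>k. x i k + y i k)" using coh_add xy(2,4) by blast
    show ?thesis unfolding \<phi>_def xy(1,3) pvec_add[OF p xy(2,4)] act_pvec(1)[OF p V xy(2)] act_pvec(1)[OF p V xy(4)]
        pvec_add[OF p act_pvec(2)[OF p V xy(2)] act_pvec(2)[OF p V xy(4)]]
      using act_pvec(1)[OF p V c] by (simp add: mv_add)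
  qed
  have smult: "\<phi> (a \<odot>\<^bsub>?M\<^esub> X) = a \<odot>\<^bsub>?M\<^esub> \<phi> X" if aX: "a \<in> carrier (Zp p)" "X \<in> carrier ?M" for a X
  proof -
    obtain \<alpha> x where x: "a = zc p \<alpha>" "coh p \<alpha>" "X = pvec p n x" "\<forall>i. coh p (x i)"
      using aX unfolding carr Zp_carrier[OF p] by auto
    have c: "\<forall>i. coh p (\<lambda>k. \<alpha> k * x i k)" using coh_mult x(2,4) by blast
    show ?thesis unfolding \<phi>_def x(1,3) pvec_smult[OF p x(2,4)] act_pvec(1)[OF p V x(4)]
        pvec_smult[OF p x(2) act_pvec(2)[OF p V x(4)]]
      using act_pvec(1)[OF p V c] by (simp add: mv_scale)
  qed
  have ev: "qeval (Zp p) n F (\<phi> X) = qeval (Zp p) n (base_change (Zp p) f) X" if X: "X \<in> carrier ?M" for X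
  proof -
    obtain x where x: "X = pvec p n x" "\<forall>i. coh p (x i)" using X unfolding carr by auto
    define y where "y i k = mv n (\<lambda>i j. V i j k) (\<lambda>j. x j k) i" for i k
    have y: "\<phi> X = pvec p n y" "\<forall>i. coh p (y i)" using act_pvec[OF p V x(2)] by (simp_all add: \<phi>_def x(1) y_def[abs_def])
    have 1: "qeval (Zp p) n F (\<phi> X) = zc p (\<lambda>k. qe n (\<lambda>i j. G i j k) (\<lambda>i. y i k))"
      "coh p (\<lambda>k. qe n (\<lambda>i j. G i j k) (\<lambda>i. y i k))"
      unfolding y(1) by (rule qeval_pvec[OF p]; use F y(2) in blast)+
    have 2: "qeval (Zp p) n (base_change (Zp p) f) X = zc p (\<lambda>k. qe n f (\<lambda>i. x i k))"
      "coh p (\<lambda>k. qe n f (\<lambda>i. x i k))"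
      using qeval_pvec[OF p, of n "base_change (Zp p) f" "\<lambda>i j _. f i j" x] base_change_Zp[OF p] coh_const x by simp_all
    have "int p ^ k dvd qe n (\<lambda>i j. G i j k) (\<lambda>i. y i k) - qe n f (\<lambda>i. x i k)" for k
    proof -
      have "int p ^ k dvd qe n f (mv n (\<lambda>i j. W i j k) (\<lambda>i. y i k)) - qe n (\<lambda>i j. G i j k) (\<lambda>i. y i k)" by (rule eq)
      moreover have "int p ^ k dvd qe n f (mv n (\<lambda>i j. W i j k) (\<lambda>i. y i k)) - qe n f (\<lambda>i. x i k)"
        by (rule qe_dvd_cong) (use inv[of k] in \<open>auto simp: inv_mod_def y_def\<close>)
      ultimately have "int p ^ k dvd (qe n f (mv n (\<lambda>i j. W i j k) (\<lambda>i. y i k)) - qe n f (\<lambda>i. x i k))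
        - (qe n f (mv n (\<lambda>i j. W i j k) (\<lambda>i. y i k)) - qe n (\<lambda>i j. G i j k) (\<lambda>i. y i k))" by (rule dvd_diff[rotated])
      then show ?thesis by simp
    qed
    then show ?thesis using 1 2 zc_eq_iff[OF p 1(2) 2(2)] by simp
  qed
  have "\<phi> \<in> iso (add_monoid ?M) (add_monoid ?M)"
    using bij hom unfolding iso_def hom_def by (auto simp: bij_betw_def)
  then show ?thesis unfolding isometric_def using smult ev by blast
qed

theorem padic_isometry_threshold:
  assumes p: "prime p" and F: "qform (Zp p) n F" "nondegenerate (Zp p) n F"
  shows "\<exists>k0 g. k0 \<ge> 1 \<and> (\<forall>f. (\<forall>K. \<exists>W V. inv_mod (int p ^ K) n W V \<and>
      (\<forall>x. int p ^ k0 dvd qe n f (mv n W x) - qe n g x)) \<longrightarrow> isometric (Zp p) n (base_change (Zp p) f) F)"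
proof -
  obtain G where G: "\<And>i j. coh p (G i j)" "\<And>i j. i \<le> j \<Longrightarrow> j < n \<Longrightarrow> F i j = zc p (G i j)"
    using qform_rep[OF p F(1)] by blast
  obtain v where v: "v \<ge> 1" "\<And>x. (\<And>y. int p ^ v dvd qb n (\<lambda>i j. G i j v) x y) \<Longrightarrow> (\<forall>i<n. int p dvd x i)"
    using nondegenerate_bound[OF p G F(2)] by blast
  define k0 where "k0 = 2 * v + 1"
  define g where "g i j = G i j k0" for i j
  have "isometric (Zp p) n (base_change (Zp p) f) F"
    if W0: "\<forall>K. \<exists>W V. inv_mod (int p ^ K) n W V \<and> (\<forall>x. int p ^ k0 dvd qe n f (mv n W x) - qe n g x)" for f
  proof -
    have level: "\<exists>W V. inv_mod (int p ^ K) n W V \<and> (\<forall>x. int p ^ K dvd qe n f (mv n W x) - qe n (\<lambda>i j. G i j K) x)"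
      if K: "K \<ge> k0" for K
    proof -
      obtain W V where WV: "inv_mod (int p ^ K) n W V" "\<And>x. int p ^ k0 dvd qe n f (mv n W x) - qe n g x" using W0 by blast
      have H: "\<forall>i<n. int p dvd x i" if a: "\<And>y. int p ^ v dvd qb n (\<lambda>i j. G i j K) x y" for x
      proof (rule v(2))
        fix y
        have "int p ^ v dvd qb n (\<lambda>i j. G i j K) x y - qb n (\<lambda>i j. G i j v) x y"
          by (rule qb_dvd_cong) (use coh_le[OF G(1)] K in \<open>auto simp: k0_def\<close>)
        then show "int p ^ v dvd qb n (\<lambda>i j. G i j v) x y" using a by (metis dvd_diff_right_iff)
      qed
      obtain C where C: "\<And>x y. int p ^ K dvd qb n (\<lambda>i j. G i j K) x (mv n C y) - int p ^ v * (\<Sum>i<n. x i * y i)"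
        using dual_matrix[OF p v(1) H, where K = K] by blast
      have "int p ^ (2 * v + 1) dvd qe n f (mv n W x) - qe n (\<lambda>i j. G i j K) x" for x
      proof -
        have "int p ^ k0 dvd qe n (\<lambda>i j. G i j K) x - qe n g x"
          by (rule qe_dvd_cong) (use coh_le[OF G(1)] K in \<open>auto simp: g_def\<close>)
        then have "int p ^ k0 dvd (qe n f (mv n W x) - qe n g x) - (qe n (\<lambda>i j. G i j K) x - qe n g x)"
          using WV(2) by (rule_tac dvd_diff)
        then show ?thesis by (simp add: k0_def)
      qed
      then show ?thesis using newton_isometry[OF p C WV(1)] by blast
    qed
    \<comment> \<open>The matrix and its inverse are packed into one family indexed by (i, j, b), so
      that compactness gives coherent limits of both at once.\<close>
    define P where "P k z \<longleftrightarrow> inv_mod (int p ^ k) n (\<lambda>i j. z (i, j, True)) (\<lambda>i j. z (i, j, False)) \<and>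
      (\<forall>x. int p ^ k dvd qe n f (mv n (\<lambda>i j. z (i, j, True)) x) - qe n (\<lambda>i j. G i j k) x)" for k and z :: "nat \<times> nat \<times> bool \<Rightarrow> int"
    have mono: "P k z" if "P l z" "k \<le> l" for k l z
    proof -
      have d: "int p ^ k dvd int p ^ l" using that(2) by (rule le_imp_power_dvd)
      have "int p ^ k dvd qe n f (mv n (\<lambda>i j. z (i, j, True)) x) - qe n (\<lambda>i j. G i j k) x" for x
      proof -
        have "int p ^ k dvd qe n (\<lambda>i j. G i j l) x - qe n (\<lambda>i j. G i j k) x"
          by (rule qe_dvd_cong) (use coh_le[OF G(1) that(2)] in auto)
        moreover have "int p ^ k dvd qe n f (mv n (\<lambda>i j. z (i, j, True)) x) - qe n (\<lambda>i j. G i j l) x"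
          using that(1) d unfolding P_def by (meson dvd_trans)
        ultimately have "int p ^ k dvd (qe n f (mv n (\<lambda>i j. z (i, j, True)) x) - qe n (\<lambda>i j. G i j l) x)
          + (qe n (\<lambda>i j. G i j l) x - qe n (\<lambda>i j. G i j k) x)" by (rule dvd_add[rotated])
        then show ?thesis by simp
      qed
      then show ?thesis using that(1) d unfolding P_def inv_mod_def by (meson dvd_trans)
    qed
    have "\<exists>Z. (\<forall>i. coh p (Z i)) \<and> (\<forall>k. P k (\<lambda>i. Z i k))"
    proof (rule padic_compactness[OF p, where I = "{..<n} \<times> {..<n} \<times> UNIV"])
      fix k y z assume P: "P k y" and c: "\<And>i. i \<in> {..<n} \<times> {..<n} \<times> UNIV \<Longrightarrow> int p ^ k dvd y i - z i"
      have c1: "int p ^ k dvd mv n (\<lambda>i j. y (i, j, b)) x i - mv n (\<lambda>i j. z (i, j, b)) x' i"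
        if "i < n" "\<And>j. j < n \<Longrightarrow> int p ^ k dvd x j - x' j" for b i x x'
        by (rule mv_dvd_cong) (use c that in auto)
      have "int p ^ k dvd mv n (\<lambda>i j. z (i, j, b)) (mv n (\<lambda>i j. z (i, j, \<not> b)) x) i - x i" if "i < n" for b x i
      proof -
        have "int p ^ k dvd mv n (\<lambda>i j. y (i, j, b)) (mv n (\<lambda>i j. y (i, j, \<not> b)) x) i
            - mv n (\<lambda>i j. z (i, j, b)) (mv n (\<lambda>i j. z (i, j, \<not> b)) x) i"
          by (intro c1 that) auto
        moreover have "int p ^ k dvd mv n (\<lambda>i j. y (i, j, b)) (mv n (\<lambda>i j. y (i, j, \<not> b)) x) i - x i"
          using P that unfolding P_def inv_mod_def by (cases b) auto
        ultimately have "int p ^ k dvd (mv n (\<lambda>i j. y (i, j, b)) (mv n (\<lambda>i j. y (i, j, \<not> b)) x) i - x i)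
          - (mv n (\<lambda>i j. y (i, j, b)) (mv n (\<lambda>i j. y (i, j, \<not> b)) x) i
            - mv n (\<lambda>i j. z (i, j, b)) (mv n (\<lambda>i j. z (i, j, \<not> b)) x) i)" by (rule dvd_diff[rotated])
        then show ?thesis by simp
      qed
      from this[where b = True] this[where b = False]
      have i: "inv_mod (int p ^ k) n (\<lambda>i j. z (i, j, True)) (\<lambda>i j. z (i, j, False))" unfolding inv_mod_def by simp
      have "int p ^ k dvd qe n f (mv n (\<lambda>i j. z (i, j, True)) x) - qe n (\<lambda>i j. G i j k) x" for x
      proof -
        have "int p ^ k dvd qe n f (mv n (\<lambda>i j. y (i, j, True)) x) - qe n f (mv n (\<lambda>i j. z (i, j, True)) x)"
          by (rule qe_dvd_cong) (use c1 in auto)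
        moreover have "int p ^ k dvd qe n f (mv n (\<lambda>i j. y (i, j, True)) x) - qe n (\<lambda>i j. G i j k) x"
          using P unfolding P_def by blast
        ultimately have "int p ^ k dvd (qe n f (mv n (\<lambda>i j. y (i, j, True)) x) - qe n (\<lambda>i j. G i j k) x)
          - (qe n f (mv n (\<lambda>i j. y (i, j, True)) x) - qe n f (mv n (\<lambda>i j. z (i, j, True)) x))" by (rule dvd_diff[rotated])
        then show ?thesis by simp
      qed
      then show "P k z" unfolding P_def using i by blast
    next
      show "\<exists>z. P k z" for k
      proof -
        obtain W V where "inv_mod (int p ^ max k k0) n W V \<and>
            (\<forall>x. int p ^ max k k0 dvd qe n f (mv n W x) - qe n (\<lambda>i j. G i j (max k k0)) x)"
          using level[of "max k k0"] by auto
        then have "P (max k k0) (\<lambda>(i, j, b). if b then W i j else V i j)" unfolding P_def by simp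
        then show ?thesis using mono[of "max k k0"] by (meson max.cobounded1)
      qed
    qed (use mono in auto)
    then obtain Z where Z: "\<And>i. coh p (Z i)" "\<And>k. P k (\<lambda>i. Z i k)" by blast
    show ?thesis
      by (rule isometricI[OF p, where G = G and W = "\<lambda>i j. Z (i, j, True)" and V = "\<lambda>i j. Z (i, j, False)"])
        (use G Z in \<open>auto simp: P_def\<close>)
  qed
  then show ?thesis by (intro exI[of _ k0] exI[of _ g]) (simp add: k0_def)
qed

section \<open>Real signature\<close>

lemma real_hom: "seq_hom real_ring UNIV (\<lambda>x. x (0::nat))"
proof (intro seq_hom.intro seq_hom_axioms.intro)
  show "cring real_ring"
  proof (rule cringI)
    show "abelian_group real_ring"
    proof (rule abelian_groupI)
      fix x assume "x \<in> carrier real_ring"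
      show "\<exists>y\<in>carrier real_ring. y \<oplus>\<^bsub>real_ring\<^esub> x = \<zero>\<^bsub>real_ring\<^esub>"
        by (intro bexI[of _ "- x"]) (auto simp: real_ring_def)
    qed (auto simp: real_ring_def)
    show "Group.comm_monoid real_ring" by (rule comm_monoidI) (auto simp: real_ring_def)
  qed (auto simp: real_ring_def algebra_simps)
qed (auto simp: real_ring_def)

lemma qeval_real: "qeval real_ring n f x = qe n f x"
  using seq_hom.qeval_hom(2)[OF real_hom, of n f "\<lambda>i j _. f i j" x "\<lambda>i _. x i"] by simp

lemma base_change_real: "base_change real_ring f = (\<lambda>i j. real_of_int (f i j))"
proof (intro ext)
  fix i j
  show "base_change real_ring f i j = real_of_int (f i j)"
    using seq_hom.int_embed[OF real_hom, of "f i j"] by (simp add: base_change_def real_ring_def)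
qed

text \<open>Diagonalization over the reals with the entries attached to positions: variables are
  adjoined one at a time, and each step appends one entry of e.\<close>

definition rsig :: "nat \<Rightarrow> (nat \<Rightarrow> nat \<Rightarrow> real) \<Rightarrow> (nat \<Rightarrow> real) \<Rightarrow> bool" where
  "rsig n f e \<longleftrightarrow> (\<exists>U V. (\<forall>x. \<forall>i<n. mv n U (mv n V x) i = x i \<and> mv n V (mv n U x) i = x i) \<and>
     (\<forall>x. qe n f x = (\<Sum>i<n. e i * (mv n U x i)^2)))"

lemma rsig_0: "rsig 0 f e"
  by (simp add: rsig_def qe_def)

lemma rsig_cong: "rsig n f e \<Longrightarrow> (\<And>i j. i \<le> j \<Longrightarrow> j < n \<Longrightarrow> f i j = g i j) \<Longrightarrow> (\<And>i. i < n \<Longrightarrow> e i = e' i) \<Longrightarrow> rsig n g e'"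
  unfolding rsig_def using qe_cong[of n _ _ g f] by (metis (no_types, lifting) lessThan_iff sum.cong)

lemma mv_cong: "(\<And>j. j < n \<Longrightarrow> x j = y j) \<Longrightarrow> mv n U x i = mv n U y i"
  by (simp add: mv_def)

text \<open>Completing the square: \<open>c\<close> splits off the last variable orthogonally.\<close>
lemma rsig_step:
  assumes r: "rsig n f e" and c: "\<And>x. qb n f x c = (\<Sum>i<n. f i n * x i)"
    and d: "s \<noteq> 0" "f n n - qe n f c = s^2 * \<epsilon>"
  shows "rsig (Suc n) f (e(n := \<epsilon>))"
proof -
  obtain U V where U: "\<And>x i. i < n \<Longrightarrow> mv n U (mv n V x) i = x i" "\<And>x i. i < n \<Longrightarrow> mv n V (mv n U x) i = x i"
    and eq: "\<And>x. qe n f x = (\<Sum>i<n. e i * (mv n U x i)^2)"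
    using r unfolding rsig_def by blast
  define U' where "U' i j = (if i < n then (if j < n then U i j else mv n U c i) else (if j < n then 0 else s))" for i j
  define V' where "V' i j = (if i < n then (if j < n then V i j else - c i / s) else (if j < n then 0 else 1 / s))" for i j
  have U'1: "mv (Suc n) U' x i = mv n U (\<lambda>j. x j + x n * c j) i" if "i < n" for x i
  proof -
    have "mv n U (\<lambda>j. x j + x n * c j) i = mv n U x i + x n * mv n U c i" by (simp add: mv_add mv_scale)
    then show ?thesis using that by (simp add: mv_def[of "Suc n"] mv_def[of n U x] U'_def)
  qed
  have U'2: "mv (Suc n) U' x n = s * x n" for x by (simp add: mv_def U'_def)
  have V'1: "mv (Suc n) V' x i = mv n V x i - c i * (x n / s)" if "i < n" for x i
    using that by (simp add: mv_def V'_def)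
  have V'2: "mv (Suc n) V' x n = x n / s" for x by (simp add: mv_def V'_def)
  have "mv (Suc n) U' (mv (Suc n) V' x) i = x i \<and> mv (Suc n) V' (mv (Suc n) U' x) i = x i" if "i < Suc n" for x i
  proof (cases "i = n")
    case True
    then show ?thesis using d(1) by (simp add: U'2 V'2)
  next
    case False
    then have i: "i < n" using that by simp
    have "mv (Suc n) U' (mv (Suc n) V' x) i = mv n U (mv n V x) i"
      unfolding U'1[OF i] by (rule mv_cong) (simp add: V'1 V'2)
    moreover have "mv (Suc n) V' (mv (Suc n) U' x) i = mv n V (\<lambda>k. mv n U (\<lambda>j. x j + x n * c j) k) i - c i * x n"
    proof -
      have "mv n V (mv (Suc n) U' x) i = mv n V (\<lambda>k. mv n U (\<lambda>j. x j + x n * c j) k) i"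
        by (rule mv_cong) (rule U'1)
      then show ?thesis unfolding V'1[OF i] using d(1) by (simp add: U'2)
    qed
    ultimately show ?thesis using U i by simp
  qed
  moreover have "qe (Suc n) f x = (\<Sum>i<Suc n. (e(n := \<epsilon>)) i * (mv (Suc n) U' x i)^2)" for x
  proof -
    have "qe n f (\<lambda>j. x j + x n * c j) = qe n f x + x n * (\<Sum>i<n. f i n * x i) + (x n)^2 * qe n f c"
      unfolding qe_combination c ..
    then have "qe (Suc n) f x = qe n f (\<lambda>j. x j + x n * c j) + (f n n - qe n f c) * (x n)^2"
      by (simp add: qe_Suc algebra_simps)
    also have "\<dots> = qe n f (\<lambda>j. x j + x n * c j) + s^2 * \<epsilon> * (x n)^2" by (simp only: d(2))
    also have "\<dots> = (\<Sum>i<n. e i * (mv (Suc n) U' x i)^2) + \<epsilon> * (mv (Suc n) U' x n)^2"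
      unfolding eq U'2 by (simp add: U'1 power_mult_distrib mult_ac)
    finally show ?thesis by simp
  qed
  ultimately show ?thesis unfolding rsig_def by blast
qed

lemma rsig_step_pos:
  assumes "rsig n f e" "\<And>x. qb n f x c = (\<Sum>i<n. f i n * x i)" "\<epsilon> \<in> {-1, 1}" "(f n n - qe n f c) * \<epsilon> > 0"
  shows "rsig (Suc n) f (e(n := \<epsilon>))"
proof (rule rsig_step[OF assms(1,2)])
  show "sqrt ((f n n - qe n f c) * \<epsilon>) \<noteq> 0" using assms(4) by (metis less_irrefl real_sqrt_eq_zero_cancel_iff)
  show "f n n - qe n f c = (sqrt ((f n n - qe n f c) * \<epsilon>))^2 * \<epsilon>" using assms(3,4) by auto
qed

text \<open>A nondegenerate form represents every linear functional by a vector; in diagonal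
  coordinates this means dividing by 2 e_i, and e_i is its own inverse.\<close>

lemma rsig_dual:
  assumes r: "rsig n f e" and e: "\<And>i. i < n \<Longrightarrow> e i \<in> {-1, 1}"
  shows "\<exists>c. \<forall>x. qb n f x c = (\<Sum>i<n. l i * x i)"
proof -
  obtain U V where U: "\<And>x i. i < n \<Longrightarrow> mv n U (mv n V x) i = x i" "\<And>x i. i < n \<Longrightarrow> mv n V (mv n U x) i = x i"
    and eq: "\<And>x. qe n f x = (\<Sum>i<n. e i * (mv n U x i)^2)"
    using r unfolding rsig_def by blast
  define m where "m i = (\<Sum>k<n. l k * V k i)" for i
  define c where "c = mv n V (\<lambda>i. e i * m i / 2)"
  have "qb n f x c = (\<Sum>i<n. l i * x i)" for x
  proof -
    have "qb n f x c = qe n f (\<lambda>i. x i + c i) - qe n f x - qe n f c" by (simp add: qe_add)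
    also have "\<dots> = (\<Sum>i<n. 2 * e i * mv n U x i * mv n U c i)"
      unfolding eq sum_subtractf[symmetric] mv_add by (intro sum.cong refl) (simp add: power2_eq_square algebra_simps)
    also have "\<dots> = (\<Sum>i<n. m i * mv n U x i)"
      using e by (intro sum.cong refl) (fastforce simp: c_def U)
    also have "\<dots> = (\<Sum>i<n. \<Sum>k<n. l k * V k i * mv n U x i)" by (simp add: m_def sum_distrib_right)
    also have "\<dots> = (\<Sum>k<n. \<Sum>i<n. l k * V k i * mv n U x i)" by (rule sum.swap)
    also have "\<dots> = (\<Sum>k<n. l k * mv n V (mv n U x) k)" by (simp add: mv_def[of n V] sum_distrib_left mult.assoc)
    also have "\<dots> = (\<Sum>k<n. l k * x k)" using U by simp
    finally show ?thesis .
  qed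
  then show ?thesis by blast
qed

lemma rsig_has_signature:
  assumes "rsig (r + s) (\<lambda>i j. real_of_int (f i j)) (\<lambda>i. if i < r then 1 else -1)"
  shows "has_signature (base_change real_ring f) r s"
proof -
  define n where "n = r + s"
  define e where "e i = (if i < r then 1 else -1 :: real)" for i
  obtain U V where U: "\<And>x i. i < n \<Longrightarrow> mv n U (mv n V x) i = x i" "\<And>x i. i < n \<Longrightarrow> mv n V (mv n U x) i = x i"
    and eq: "\<And>x. qe n (\<lambda>i j. real_of_int (f i j)) x = (\<Sum>i<n. e i * (mv n U x i)^2)"
    using assms unfolding rsig_def n_def[symmetric] e_def[symmetric, abs_def] by blast
  let ?M = "coord_mod real_ring n"
  have carr: "carrier ?M = extensional {..<n}" by (auto simp: coord_mod_def real_ring_def PiE_def)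
  define \<phi> where "\<phi> x = (\<lambda>i\<in>{..<n}. mv n U x i)" for x
  define \<psi> where "\<psi> x = (\<lambda>i\<in>{..<n}. mv n V x i)" for x
  have res: "mv n A (\<lambda>i\<in>{..<n}. y i) i = mv n A y i" for A y i by (rule mv_cong) simp
  have bij: "bij_betw \<phi> (carrier ?M) (carrier ?M)"
  proof (rule bij_betw_byWitness[where f' = \<psi>])
    have "\<psi> (\<phi> X) = restrict X {..<n}" "\<phi> (\<psi> X) = restrict X {..<n}" for X
      unfolding \<phi>_def \<psi>_def by (rule restrict_ext; simp add: res U)+
    then show "\<forall>X\<in>carrier ?M. \<psi> (\<phi> X) = X" "\<forall>X\<in>carrier ?M. \<phi> (\<psi> X) = X"
      unfolding carr by (simp_all add: extensional_restrict)
  qed (auto simp: carr \<phi>_def \<psi>_def)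
  have hom: "\<phi> (x \<oplus>\<^bsub>?M\<^esub> y) = \<phi> x \<oplus>\<^bsub>?M\<^esub> \<phi> y" for x y
    by (auto simp: \<phi>_def coord_mod_def real_ring_def res mv_add intro!: restrict_ext)
  have smult: "\<phi> (a \<odot>\<^bsub>?M\<^esub> x) = a \<odot>\<^bsub>?M\<^esub> \<phi> x" for a x
    by (auto simp: \<phi>_def coord_mod_def real_ring_def res mv_scale intro!: restrict_ext)
  have diag: "qe n (\<lambda>i j. if i \<noteq> j then 0 else if i < r then 1 else - 1) y = (\<Sum>i<n. e i * (y i)^2)" for y :: "nat \<Rightarrow> real"
    unfolding qe_def
  proof (rule sum.cong[OF refl])
    fix j assume "j \<in> {..<n}"
    have "(\<Sum>i\<le>j. (if i \<noteq> j then 0 else if i < r then 1 else - 1) * y i * y j) = (\<Sum>i\<le>j. if i = j then e j * (y j)^2 else 0)"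
      by (rule sum.cong[OF refl]) (auto simp: e_def power2_eq_square)
    then show "(\<Sum>i\<le>j. (if i \<noteq> j then 0 else if i < r then 1 else - 1) * y i * y j) = e j * (y j)^2" by simp
  qed
  have ev: "qeval real_ring n (\<lambda>i j. if i \<noteq> j then 0 else if i < r then 1 else - 1) (\<phi> x) = qeval real_ring n (base_change real_ring f) x" for x
    unfolding qeval_real base_change_real eq diag by (rule sum.cong) (auto simp: \<phi>_def)
  have "\<phi> \<in> iso (add_monoid ?M) (add_monoid ?M)"
    using bij hom unfolding iso_def hom_def by (auto simp: bij_betw_def)
  then show ?thesis unfolding has_signature_def isometric_def n_def[symmetric] using smult ev by blast
qed

section \<open>Maximality of ternary forms\<close>

lemma coord_mod_module:
  fixes R (structure)
  assumes "cring R"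
  shows "module R (coord_mod R n)"
proof -
  interpret cring R by fact
  let ?M = "coord_mod R n"
  have mem: "x i \<in> carrier R" if "x \<in> carrier ?M" "i < n" for x i using that by (auto simp: coord_mod_def)
  have eqI: "x = y" if "x \<in> carrier ?M" "y \<in> carrier ?M" "\<And>i. i < n \<Longrightarrow> x i = y i" for x y
    by (rule PiE_ext[of x "{..<n}" "\<lambda>_. carrier R" y]) (use that in \<open>auto simp: coord_mod_def\<close>)
  have add: "(x \<oplus>\<^bsub>?M\<^esub> y) i = x i \<oplus> y i" if "i < n" for x y i using that by (simp add: coord_mod_def)
  have smult: "(a \<odot>\<^bsub>?M\<^esub> x) i = a \<otimes> x i" if "i < n" for a x i using that by (simp add: coord_mod_def)
  have zero: "\<zero>\<^bsub>?M\<^esub> i = \<zero>" if "i < n" for i using that by (simp add: coord_mod_def)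
  have memI: "x \<in> carrier ?M" if "\<And>i. i < n \<Longrightarrow> x i \<in> carrier R" "x \<in> extensional {..<n}" for x
    using that by (auto simp: coord_mod_def PiE_def)
  have ext: "x \<oplus>\<^bsub>?M\<^esub> y \<in> extensional {..<n}" "a \<odot>\<^bsub>?M\<^esub> x \<in> extensional {..<n}" "\<zero>\<^bsub>?M\<^esub> \<in> extensional {..<n}" for x y a
    by (simp_all add: coord_mod_def)
  have addc: "x \<oplus>\<^bsub>?M\<^esub> y \<in> carrier ?M" if "x \<in> carrier ?M" "y \<in> carrier ?M" for x y
    by (rule memI[OF _ ext(1)]) (simp add: add mem that)
  have smultc: "a \<odot>\<^bsub>?M\<^esub> x \<in> carrier ?M" if "a \<in> carrier R" "x \<in> carrier ?M" for a x
    by (rule memI[OF _ ext(2)]) (simp add: smult mem that)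
  have zeroc: "\<zero>\<^bsub>?M\<^esub> \<in> carrier ?M" by (rule memI[OF _ ext(3)]) (simp add: zero)
  show ?thesis
  proof (rule moduleI)
    show "abelian_group ?M"
    proof (rule abelian_groupI)
      fix x assume x: "x \<in> carrier ?M"
      define y where "y = (\<lambda>i\<in>{..<n}. \<ominus> x i)"
      have y: "y \<in> carrier ?M" by (rule memI) (simp_all add: y_def mem x)
      have "y \<oplus>\<^bsub>?M\<^esub> x = \<zero>\<^bsub>?M\<^esub>"
        by (rule eqI[OF addc[OF y x] zeroc]) (simp add: add zero y_def l_neg mem x)
      then show "\<exists>y\<in>carrier ?M. y \<oplus>\<^bsub>?M\<^esub> x = \<zero>\<^bsub>?M\<^esub>" using y by blast
      show "\<zero>\<^bsub>?M\<^esub> \<oplus>\<^bsub>?M\<^esub> x = x"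
        by (rule eqI[OF addc[OF zeroc x] x]) (simp add: add zero mem x)
      fix y assume y: "y \<in> carrier ?M"
      show "x \<oplus>\<^bsub>?M\<^esub> y \<in> carrier ?M" by (rule addc[OF x y])
      show "x \<oplus>\<^bsub>?M\<^esub> y = y \<oplus>\<^bsub>?M\<^esub> x"
        by (rule eqI[OF addc[OF x y] addc[OF y x]]) (simp only: add, rule a_comm[OF mem[OF x] mem[OF y]])
      fix z assume z: "z \<in> carrier ?M"
      show "x \<oplus>\<^bsub>?M\<^esub> y \<oplus>\<^bsub>?M\<^esub> z = x \<oplus>\<^bsub>?M\<^esub> (y \<oplus>\<^bsub>?M\<^esub> z)"
        by (rule eqI) (simp_all add: add a_assoc mem x y z addc)
    qed (rule zeroc)
    fix a x assume ax: "a \<in> carrier R" "x \<in> carrier ?M"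
    show "a \<odot>\<^bsub>?M\<^esub> x \<in> carrier ?M" by (rule smultc[OF ax])
    fix y assume y: "y \<in> carrier ?M"
    show "a \<odot>\<^bsub>?M\<^esub> (x \<oplus>\<^bsub>?M\<^esub> y) = a \<odot>\<^bsub>?M\<^esub> x \<oplus>\<^bsub>?M\<^esub> a \<odot>\<^bsub>?M\<^esub> y"
      by (rule eqI) (simp_all add: smult add mem ax y smultc addc r_distr)
  next
    fix x assume x: "x \<in> carrier ?M"
    show "\<one> \<odot>\<^bsub>?M\<^esub> x = x" by (rule eqI) (simp_all add: smult mem x smultc)
  next
    fix a b x assume ax: "a \<in> carrier R" "b \<in> carrier R" "x \<in> carrier ?M"
    show "(a \<oplus> b) \<odot>\<^bsub>?M\<^esub> x = a \<odot>\<^bsub>?M\<^esub> x \<oplus>\<^bsub>?M\<^esub> b \<odot>\<^bsub>?M\<^esub> x"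
      by (rule eqI) (simp_all add: smult add mem ax smultc addc l_distr)
    show "a \<otimes> b \<odot>\<^bsub>?M\<^esub> x = a \<odot>\<^bsub>?M\<^esub> (b \<odot>\<^bsub>?M\<^esub> x)"
      by (rule eqI) (simp_all add: smult mem ax smultc m_assoc)
  qed (rule assms)
qed

lemma lin_span_closed:
  assumes p: "prime p" and B: "finite B" "B \<subseteq> carrier (coord_mod (Qp p) n)"
    and M: "M = lin_span (Zp p) (coord_mod (Qp p) n) B"
  shows "x \<in> M \<Longrightarrow> x \<in> carrier (coord_mod (Qp p) n)"
    and "x \<in> M \<Longrightarrow> y \<in> M \<Longrightarrow> x \<oplus>\<^bsub>coord_mod (Qp p) n\<^esub> y \<in> M"
    and "a \<in> carrier (Zp p) \<Longrightarrow> x \<in> M \<Longrightarrow> a \<odot>\<^bsub>coord_mod (Qp p) n\<^esub> x \<in> M"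
proof -
  let ?V = "coord_mod (Qp p) n"
  interpret V: module "Qp p" ?V by (rule coord_mod_module[OF Qp_cring[OF p]])
  interpret Z: cring "Zp p" by (rule Zp_cring[OF p])
  have Q: "c b \<in> carrier (Qp p)" if "c \<in> B \<rightarrow> carrier (Zp p)" "b \<in> B" for c b
    using that Zp_subset by blast
  have cl: "(\<lambda>b. c b \<odot>\<^bsub>?V\<^esub> b) \<in> B \<rightarrow> carrier ?V" if "c \<in> B \<rightarrow> carrier (Zp p)" for c
    using Q[OF that] B(2) V.smult_closed by auto
  show "x \<in> carrier ?V" if "x \<in> M"
    using that cl V.finsum_closed unfolding M lin_span_def by auto
  show "x \<oplus>\<^bsub>?V\<^esub> y \<in> M" if xy: "x \<in> M" "y \<in> M"
  proof -
    obtain c d where c: "x = (\<Oplus>\<^bsub>?V\<^esub>b\<in>B. c b \<odot>\<^bsub>?V\<^esub> b)" "c \<in> B \<rightarrow> carrier (Zp p)"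
      and d: "y = (\<Oplus>\<^bsub>?V\<^esub>b\<in>B. d b \<odot>\<^bsub>?V\<^esub> b)" "d \<in> B \<rightarrow> carrier (Zp p)"
      using xy unfolding M lin_span_def by auto
    have "x \<oplus>\<^bsub>?V\<^esub> y = (\<Oplus>\<^bsub>?V\<^esub>b\<in>B. c b \<odot>\<^bsub>?V\<^esub> b \<oplus>\<^bsub>?V\<^esub> d b \<odot>\<^bsub>?V\<^esub> b)"
      unfolding c d by (rule V.finsum_addf[symmetric]) (use cl c d in auto)
    also have "\<dots> = (\<Oplus>\<^bsub>?V\<^esub>b\<in>B. (c b \<oplus>\<^bsub>Zp p\<^esub> d b) \<odot>\<^bsub>?V\<^esub> b)"
    proof (rule V.finsum_cong')
      show "(\<lambda>b. (c b \<oplus>\<^bsub>Zp p\<^esub> d b) \<odot>\<^bsub>?V\<^esub> b) \<in> B \<rightarrow> carrier ?V"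
        by (rule cl) (use c d in auto)
      fix b assume b: "b \<in> B"
      show "c b \<odot>\<^bsub>?V\<^esub> b \<oplus>\<^bsub>?V\<^esub> d b \<odot>\<^bsub>?V\<^esub> b = (c b \<oplus>\<^bsub>Zp p\<^esub> d b) \<odot>\<^bsub>?V\<^esub> b"
        unfolding Zp_simps using V.smult_l_distr[OF Q[OF c(2) b] Q[OF d(2) b]] b B(2) by auto
    qed simp
    finally show ?thesis unfolding M lin_span_def using c d
      by (intro CollectI exI[of _ "\<lambda>b. c b \<oplus>\<^bsub>Zp p\<^esub> d b"]) auto
  qed
  show "a \<odot>\<^bsub>?V\<^esub> x \<in> M" if ax: "a \<in> carrier (Zp p)" "x \<in> M"
  proof -
    obtain c where c: "x = (\<Oplus>\<^bsub>?V\<^esub>b\<in>B. c b \<odot>\<^bsub>?V\<^esub> b)" "c \<in> B \<rightarrow> carrier (Zp p)"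
      using ax unfolding M lin_span_def by auto
    have a: "a \<in> carrier (Qp p)" using ax Zp_subset by blast
    have "a \<odot>\<^bsub>?V\<^esub> x = (\<Oplus>\<^bsub>?V\<^esub>b\<in>B. a \<odot>\<^bsub>?V\<^esub> (c b \<odot>\<^bsub>?V\<^esub> b))"
      unfolding c(1) by (rule V.finsum_smult_ldistr) (use B a cl c in auto)
    also have "\<dots> = (\<Oplus>\<^bsub>?V\<^esub>b\<in>B. (a \<otimes>\<^bsub>Zp p\<^esub> c b) \<odot>\<^bsub>?V\<^esub> b)"
    proof (rule V.finsum_cong')
      show "(\<lambda>b. (a \<otimes>\<^bsub>Zp p\<^esub> c b) \<odot>\<^bsub>?V\<^esub> b) \<in> B \<rightarrow> carrier ?V"
        by (rule cl) (use c ax in auto)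
      fix b assume b: "b \<in> B"
      show "a \<odot>\<^bsub>?V\<^esub> (c b \<odot>\<^bsub>?V\<^esub> b) = (a \<otimes>\<^bsub>Zp p\<^esub> c b) \<odot>\<^bsub>?V\<^esub> b"
        unfolding Zp_simps using V.smult_assoc1[OF a Q[OF c(2) b]] b B(2) by auto
    qed simp
    finally show ?thesis unfolding M lin_span_def using c ax
      by (intro CollectI exI[of _ "\<lambda>b. a \<otimes>\<^bsub>Zp p\<^esub> c b"]) auto
  qed
qed

section \<open>Overlattices and the ternary determinant\<close>

definition qvec :: "nat \<Rightarrow> nat \<Rightarrow> (nat \<Rightarrow> nat \<Rightarrow> rat) \<Rightarrow> nat \<Rightarrow> padic" where
  "qvec p n x = (\<lambda>i\<in>{..<n}. cls p (x i))"

text \<open>Finitely many terms can be changed within a class, so integrality may be tested from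
  some index on, although \<open>Zp\<close> asks for a representative that is integral
  throughout.\<close>

lemma cls_in_Zp:
  assumes p: "prime p" and x: "padic_cauchy p x"
  shows "cls p x \<in> carrier (Zp p) \<longleftrightarrow> (\<exists>N. \<forall>k\<ge>N. pdv p 0 (x k))"
proof
  assume "cls p x \<in> carrier (Zp p)"
  then obtain z where z: "coh p z" "cls p x = zc p z" by (auto simp: Zp_carrier[OF p])
  then obtain N where N: "\<forall>k\<ge>N. pdv p 0 (x k - of_int (z k))"
    unfolding zc_def cls_eq_iff[OF p] null_ideal_iff[OF p] by blast
  have "pdv p 0 (x k)" if "k \<ge> N" for k
  proof -
    have "pdv p 0 (of_int (z k))" by (simp only: pdv_int[OF p] power_0 one_dvd)
    then have "pdv p 0 ((x k - of_int (z k)) + of_int (z k))" using pdv_add[OF p] N that by blast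
    then show ?thesis by simp
  qed
  then show "\<exists>N. \<forall>k\<ge>N. pdv p 0 (x k)" by blast
next
  assume "\<exists>N. \<forall>k\<ge>N. pdv p 0 (x k)"
  then obtain N where N: "\<forall>k\<ge>N. pdv p 0 (x k)" by blast
  define y where "y k = x (max k N)" for k
  have "(\<lambda>k. y k - x k) \<in> null_ideal p"
    unfolding null_ideal_iff[OF p]
  proof
    fix m
    have "pdv p m (y i - x i)" if "i \<ge> N" for i using that pdv_0[OF p] by (simp add: y_def max_def)
    then show "\<exists>N. \<forall>i\<ge>N. pdv p m (y i - x i)" by blast
  qed
  then have "y \<in> cls p x" by (simp add: mem_cls)
  moreover have "\<forall>k. padic_abs p (y k) \<le> 1" using N padic_abs_le_1[OF p] by (simp add: y_def)
  moreover have "cls p x \<in> carrier (Qp p)" using x by (auto simp: Qp_carrier)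
  ultimately show "cls p x \<in> carrier (Zp p)" unfolding Zp_def by auto
qed

text \<open>With F the value at u = (x, y, z) and B0, B1, B2 its polar values on the basis, each of
  x^2 D, y^2 D, z^2 D is a combination of F and of products of two B's, hence divisible by p^2; and
  some coordinate of u is prime to p.\<close>

lemma disc3_dvd:
  fixes f :: "nat \<Rightarrow> nat \<Rightarrow> int"
  assumes p: "prime p" and u: "\<exists>i<3. \<not> int p dvd u i" and Q: "int p ^ 2 dvd qe 3 f u"
    and B: "\<And>i. i < 3 \<Longrightarrow> int p dvd qb 3 f u (ev i)"
  shows "int p ^ 2 dvd f 2 2 * (4 * f 0 0 * f 1 1 - (f 0 1)^2) + f 0 1 * f 0 2 * f 1 2 - f 0 0 * (f 1 2)^2 - f 1 1 * (f 0 2)^2"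
proof -
  define a b c r s t where "a = f 0 0" and "b = f 1 1" and "c = f 2 2" and "r = f 0 1" and "s = f 0 2" and "t = f 1 2"
  define x y z where "x = u 0" and "y = u 1" and "z = u 2"
  define D where "D = c * (4 * a * b - r^2) + r * s * t - a * t^2 - b * s^2"
  define F B0 B1 B2 where "F = qe 3 f u" and "B0 = qb 3 f u (ev 0)" and "B1 = qb 3 f u (ev 1)" and "B2 = qb 3 f u (ev 2)"
  have F: "F = a * x^2 + r * x * y + b * y^2 + s * x * z + t * y * z + c * z^2"
    by (simp add: F_def qe_def eval_nat_numeral a_def b_def c_def r_def s_def t_def x_def y_def z_def algebra_simps)
  have B0: "B0 = 2 * a * x + r * y + s * z" and B1: "B1 = r * x + 2 * b * y + t * z" and B2: "B2 = s * x + t * y + 2 * c * z"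
    by (simp_all add: B0_def B1_def B2_def qb_def ev_def eval_nat_numeral a_def b_def c_def r_def s_def t_def x_def y_def z_def algebra_simps)
  have dvd: "int p dvd B0" "int p dvd B1" "int p dvd B2" "int p ^ 2 dvd F" using B[of 0] B[of 1] B[of 2] Q by (auto simp: B0_def B1_def B2_def F_def)
  have prod: "int p ^ 2 dvd v * w" if "int p dvd v" "int p dvd w" for v w using mult_dvd_mono[OF that] by (simp add: power2_eq_square)
  have pz: "int p ^ 2 dvd z^2 * D"
  proof -
    have "z^2 * D = (4 * a * b - r^2) * F + r * (B0 * B1) - a * (B1 * B1) - b * (B0 * B0)"
      unfolding D_def F B0 B1 by (simp add: algebra_simps power2_eq_square)
    also have "int p ^ 2 dvd \<dots>" using dvd prod by (auto intro!: dvd_diff dvd_add)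
    finally show ?thesis .
  qed
  have py: "int p ^ 2 dvd y^2 * D"
  proof -
    have "y^2 * D = (4 * a * c - s^2) * F + s * (B0 * B2) - a * (B2 * B2) - c * (B0 * B0)"
      unfolding D_def F B0 B2 by (simp add: algebra_simps power2_eq_square)
    also have "int p ^ 2 dvd \<dots>" using dvd prod by (auto intro!: dvd_diff dvd_add)
    finally show ?thesis .
  qed
  have px: "int p ^ 2 dvd x^2 * D"
  proof -
    have "x^2 * D = (4 * b * c - t^2) * F + t * (B1 * B2) - b * (B2 * B2) - c * (B1 * B1)"
      unfolding D_def F B1 B2 by (simp add: algebra_simps power2_eq_square)
    also have "int p ^ 2 dvd \<dots>" using dvd prod by (auto intro!: dvd_diff dvd_add)
    finally show ?thesis .
  qed
  have fin: "int p ^ 2 dvd D" if "\<not> int p dvd w" "int p ^ 2 dvd w^2 * D" for w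
  proof -
    have "coprime (int p) w" using p that(1) by (simp add: prime_imp_coprime)
    then have "coprime (int p ^ 2) (w^2)" by simp
    then show ?thesis using that(2) by (simp add: coprime_dvd_mult_right_iff)
  qed
  obtain i where "i < 3" "\<not> int p dvd u i" using u by blast
  then have "\<not> int p dvd x \<or> \<not> int p dvd y \<or> \<not> int p dvd z" unfolding x_def y_def z_def
    by (metis One_nat_def less_2_cases_iff less_Suc_eq numeral_2_eq_2 numeral_3_eq_3)
  then have "int p ^ 2 dvd D" using fin px py pz by blast
  then show ?thesis by (simp add: D_def a_def b_def c_def r_def s_def t_def)
qed

text \<open>A vector of an overlattice outside the standard lattice, multiplied by p until just
  before it enters, is u/p with u primitive. Integrality at u/p and at u/p + e_l makes the value at
  u divisible by p^2 and every B(u, e_l) by p, so p^2 would divide the determinant.\<close>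

theorem maximal_form_3:
  assumes p: "prime p"
    and D: "\<not> int p ^ 2 dvd f 2 2 * (4 * f 0 0 * f 1 1 - (f 0 1)^2) + f 0 1 * f 0 2 * f 1 2 - f 0 0 * (f 1 2)^2 - f 1 1 * (f 0 2)^2"
  shows "maximal_form p 3 (base_change (Zp p) f)"
proof -
  let ?V = "coord_mod (Qp p) 3" and ?L = "carrier (coord_mod (Zp p) 3)" and ?f = "base_change (Zp p) f"
  interpret Q: seq_hom "Qp p" "{x. padic_cauchy p x}" "cls p" by (rule Qp_hom[OF p])
  have f: "?f i j = cls p (\<lambda>_. of_int (f i j)) \<and> (\<lambda>_. of_int (f i j)) \<in> {x. padic_cauchy p x}" for i j
    using base_change_Zp[OF p] cauchy_const[OF p] by (simp add: zc_def)
  have ev: "qeval (Qp p) 3 ?f (qvec p 3 x) = cls p (\<lambda>k. qe 3 (\<lambda>i j. of_int (f i j)) (\<lambda>i. x i k))"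
    "padic_cauchy p (\<lambda>k. qe 3 (\<lambda>i j. of_int (f i j)) (\<lambda>i. x i k))" if "\<And>i. padic_cauchy p (x i)" for x
    using Q.qeval_hom[of 3 ?f "\<lambda>i j _. of_int (f i j)" "qvec p 3 x" x] f that by (auto simp: qvec_def)
  have pvec_qvec: "pvec p n u = qvec p n (\<lambda>i k. of_int (u i k))" for n u by (simp add: pvec_def qvec_def zc_def)
  have intqe: "qe 3 (\<lambda>i j. of_int (f i j)) (\<lambda>i. of_int (w i)) = (of_int (qe 3 f w) :: rat)" for w by (simp add: qe_def)
  have i0: "pdv p 0 (of_int m)" for m by (simp only: pdv_int[OF p] power_0 one_dvd)
  have p0: "(of_int (int p) :: rat) \<noteq> 0" using p by (auto simp: prime_gt_0_nat)
  have "integral_on p 3 ?f ?L" unfolding integral_on_def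
  proof
    fix X assume "X \<in> ?L"
    then obtain u where u: "X = pvec p 3 u" "\<And>i. coh p (u i)" using pvec_carrier[OF p] by auto
    have c: "\<And>i. padic_cauchy p (\<lambda>k. of_int (u i k))" using coh_cauchy[OF p] u(2) by blast
    show "qeval (Qp p) 3 ?f X \<in> carrier (Zp p)"
      unfolding u(1) pvec_qvec ev(1)[OF c] using cls_in_Zp[OF p ev(2)[OF c]] i0 by (auto simp: intqe)
  qed
  moreover have False if M: "padic_lattice p 3 M" "?L \<subset> M" "integral_on p 3 ?f M" for M
  proof -
    obtain B where B: "finite B" "B \<subseteq> carrier ?V" "M = lin_span (Zp p) ?V B" using M(1) unfolding padic_lattice_def by blast
    note closed = lin_span_closed[OF p B]
    obtain Y where Y: "Y \<in> M" "Y \<notin> ?L" using M(2) by blast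
    have "\<exists>x. padic_cauchy p x \<and> (i < 3 \<longrightarrow> Y i = cls p x)" for i
    proof (cases "i < 3")
      case True
      then have "Y i \<in> carrier (Qp p)" using closed(1)[OF Y(1)] by (auto simp: coord_mod_def)
      then show ?thesis by (auto simp: Qp_carrier)
    qed (use cauchy_const[OF p] in blast)
    then obtain y where y: "\<And>i. padic_cauchy p (y i)" "\<And>i. i < 3 \<Longrightarrow> Y i = cls p (y i)" by metis
    have Yq: "Y = qvec p 3 y"
    proof
      fix i show "Y i = qvec p 3 y i"
        using closed(1)[OF Y(1)] y(2) by (cases "i < 3") (auto simp: coord_mod_def qvec_def PiE_def extensional_def)
    qed
    define T where "T j = qvec p 3 (\<lambda>i k. of_int (int p ^ j) * y i k)" for j
    have cy: "padic_cauchy p (\<lambda>k. of_int m * y i k)" for m i using cauchy_mult[OF p cauchy_const[OF p] y(1)] .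
    have TM: "T j \<in> M" for j
    proof -
      have a: "zc p (\<lambda>_. int p ^ j) \<in> carrier (Zp p)" using Zp_carrier[OF p] coh_const by blast
      have "zc p (\<lambda>_. int p ^ j) \<odot>\<^bsub>?V\<^esub> Y = T j"
        using Q.c_mult[of "\<lambda>_. of_int (int p ^ j)" "y _"] y(1) cauchy_const[OF p]
        by (auto simp: Yq T_def qvec_def coord_mod_def zc_def intro!: restrict_ext)
      then show ?thesis using closed(3)[OF a Y(1)] by simp
    qed
    have L: "qvec p 3 x \<in> ?L \<longleftrightarrow> (\<forall>i<3. cls p (x i) \<in> carrier (Zp p))" for x
      by (auto simp: qvec_def coord_mod_def)
    have "\<exists>j. T j \<in> ?L"
    proof -
      have "\<forall>i. \<exists>j N. \<forall>k\<ge>N. pdv p 0 (of_int (int p ^ j) * y i k)" using cauchy_bounded[OF p y(1)] by blast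
      then obtain j N where jN: "\<And>i k. k \<ge> N i \<Longrightarrow> pdv p 0 (of_int (int p ^ j i) * y i k)" by metis
      define J where "J = j 0 + j 1 + j 2"
      have "T J \<in> ?L" unfolding T_def L
      proof (intro allI impI)
        fix i :: nat assume "i < 3"
        then have "i = 0 \<or> i = 1 \<or> i = 2" by auto
        then have le: "j i \<le> J" by (auto simp: J_def)
        have "pdv p 0 (of_int (int p ^ J) * y i k)" if "k \<ge> N i" for k
        proof -
          have "pdv p (0 + 0) (of_int (int p ^ (J - j i)) * (of_int (int p ^ j i) * y i k))"
            by (rule pdv_mult[OF p i0 jN[OF that]])
          moreover have "of_int (int p ^ (J - j i)) * (of_int (int p ^ j i) * y i k) = of_int (int p ^ J) * y i k"
          proof -
            have "int p ^ (J - j i) * int p ^ j i = int p ^ J" using le by (simp add: power_add[symmetric])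
            then show ?thesis by (metis mult.assoc of_int_mult)
          qed
          ultimately show ?thesis by (simp only: add_0)
        qed
        then show "cls p (\<lambda>k. of_int (int p ^ J) * y i k) \<in> carrier (Zp p)"
          unfolding cls_in_Zp[OF p cy] by blast
      qed
      then show ?thesis by blast
    qed
    moreover have "T 0 \<notin> ?L" using Y(2) Yq by (simp add: T_def)
    ultimately have "\<exists>j. T j \<notin> ?L \<and> T (Suc j) \<in> ?L"
    proof (elim exE)
      fix J assume "T J \<in> ?L"
      then show ?thesis
      proof (induction J)
        case 0
        then show ?case using \<open>T 0 \<notin> ?L\<close> by blast
      next
        case (Suc J)
        then show ?case by blast
      qed
    qed
    then obtain j where j: "T j \<notin> ?L" "T (Suc j) \<in> ?L" by blast
    obtain u where u: "T (Suc j) = pvec p 3 u" "\<And>i. coh p (u i)" using j(2) pvec_carrier[OF p] by auto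
    define x where "x i k = of_int (u i k) / (of_int (int p) :: rat)" for i k
    have xc: "padic_cauchy p (x i)" for i
    proof -
      have "padic_cauchy p (\<lambda>k. (1 / of_int (int p)) * of_int (u i k))"
        by (rule cauchy_mult[OF p cauchy_const[OF p] coh_cauchy[OF p u(2)]])
      then show ?thesis by (simp add: x_def[abs_def])
    qed
    have Tx: "T j = qvec p 3 x"
    proof -
      have "cls p (\<lambda>k. of_int (int p ^ j) * y i k) = cls p (x i)" if "i < 3" for i
      proof -
        have "T (Suc j) i = pvec p 3 u i" using u(1) by simp
        then have "cls p (\<lambda>k. of_int (int p ^ Suc j) * y i k) = cls p (\<lambda>k. of_int (u i k))"
          using that by (simp add: T_def qvec_def pvec_def zc_def)
        then have "(\<lambda>k. of_int (int p ^ Suc j) * y i k - of_int (u i k)) \<in> null_ideal p" by (simp only: cls_eq_iff[OF p])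
        then have "(\<lambda>k. (1 / of_int (int p)) * (of_int (int p ^ Suc j) * y i k - of_int (u i k))) \<in> null_ideal p"
          by (rule null_mult[OF p cauchy_const[OF p]])
        moreover have "(1 / of_int (int p)) * (of_int (int p ^ Suc j) * y i k - of_int (u i k)) = of_int (int p ^ j) * y i k - x i k" for k
          using p0 by (simp add: x_def field_simps)
        ultimately show ?thesis by (simp only: cls_eq_iff[OF p])
      qed
      then show ?thesis unfolding T_def qvec_def by (auto intro!: restrict_ext)
    qed
    have XM: "qvec p 3 x \<in> M" using TM[of j] Tx by simp
    have XL: "qvec p 3 x \<notin> ?L" using j(1) Tx by simp
    have int1: "\<exists>N. \<forall>k\<ge>N. int p ^ 2 dvd qe 3 f (\<lambda>i. u i k + int p * w i)" if "w = (\<lambda>_. 0) \<or> (\<exists>l<3. w = ev l)" for w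
    proof -
      define x' where "x' i k = x i k + of_int (w i)" for i k
      have x'c: "padic_cauchy p (x' i)" for i using cauchy_add[OF p xc cauchy_const[OF p]] by (simp add: x'_def[abs_def])
      have "qvec p 3 x' \<in> M"
      proof -
        have "pvec p 3 (\<lambda>i _. w i) \<in> ?L" using pvec_carrier[OF p] coh_const by blast
        then have wM: "pvec p 3 (\<lambda>i _. w i) \<in> M" using M(2) by blast
        have "qvec p 3 x \<oplus>\<^bsub>?V\<^esub> pvec p 3 (\<lambda>i _. w i) = qvec p 3 x'"
          unfolding pvec_qvec using Q.c_add[of "x _" "\<lambda>_. of_int (w _)"] xc cauchy_const[OF p]
          by (auto simp: qvec_def coord_mod_def x'_def[abs_def] intro!: restrict_ext)
        then show ?thesis using closed(2)[OF XM wM] by simp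
      qed
      then have "cls p (\<lambda>k. qe 3 (\<lambda>i j. of_int (f i j)) (\<lambda>i. x' i k)) \<in> carrier (Zp p)"
        using M(3) ev(1)[of x', OF x'c] unfolding integral_on_def by metis
      then obtain N where N: "\<forall>k\<ge>N. pdv p 0 (qe 3 (\<lambda>i j. of_int (f i j)) (\<lambda>i. x' i k))"
        using cls_in_Zp[OF p ev(2)[of x', OF x'c]] by blast
      have "int p ^ 2 dvd qe 3 f (\<lambda>i. u i k + int p * w i)" if "k \<ge> N" for k
      proof -
        have "of_int (qe 3 f (\<lambda>i. u i k + int p * w i)) = qe 3 (\<lambda>i j. of_int (f i j)) (\<lambda>i. of_int (int p) * x' i k)"
          unfolding intqe[symmetric] by (rule qe_cong) (use p0 in \<open>simp_all add: x'_def x_def distrib_left\<close>)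
        also have "\<dots> = of_int (int p ^ 2) * qe 3 (\<lambda>i j. of_int (f i j)) (\<lambda>i. x' i k)"
          unfolding qe_scale by simp
        finally have "pdv p (0 + 2) (of_int (qe 3 f (\<lambda>i. u i k + int p * w i)))"
          using pdv_cancel[OF p, of 0 2] N that by metis
        then show ?thesis by (simp only: pdv_int[OF p] add_0)
      qed
      then show ?thesis by blast
    qed
    have prim: "\<exists>i<3. \<not> int p dvd u i 1"
    proof (rule ccontr)
      assume "\<not> ?thesis"
      then have d: "int p dvd u i 1" if "i < 3" for i using that by blast
      have "cls p (x i) \<in> carrier (Zp p)" if "i < 3" for i
      proof -
        have "pdv p 0 (x i k)" if "k \<ge> 1" for k
        proof -
          have "int p dvd u i k - u i 1" using coh_le[OF u(2) that] by simp
          then have "int p dvd (u i k - u i 1) + u i 1" using d[OF \<open>i < 3\<close>] by (rule dvd_add)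
          then obtain m where "u i k = int p * m" by (auto elim: dvdE)
          then have "x i k = of_int m" using p0 by (simp add: x_def)
          then show ?thesis using i0 by simp
        qed
        then show ?thesis unfolding cls_in_Zp[OF p xc] by blast
      qed
      then show False using XL L by blast
    qed
    obtain N0 where N0: "\<forall>k\<ge>N0. int p ^ 2 dvd qe 3 f (\<lambda>i. u i k)" using int1[of "\<lambda>_. 0"] by auto
    have "\<forall>l. \<exists>N. l < 3 \<longrightarrow> (\<forall>k\<ge>N. int p ^ 2 dvd qe 3 f (\<lambda>i. u i k + int p * ev l i))" using int1 by blast
    then obtain N1 where N1: "\<And>l k. l < 3 \<Longrightarrow> k \<ge> N1 l \<Longrightarrow> int p ^ 2 dvd qe 3 f (\<lambda>i. u i k + int p * ev l i)" by metis
    \<comment> \<open>At this index all four divisibilities hold simultaneously, and being at least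
      1 it sees the primitivity established modulo p.\<close>
    define k where "k = 1 + N0 + N1 0 + N1 1 + N1 2"
    have "int p ^ 2 dvd f 2 2 * (4 * f 0 0 * f 1 1 - (f 0 1)^2) + f 0 1 * f 0 2 * f 1 2 - f 0 0 * (f 1 2)^2 - f 1 1 * (f 0 2)^2"
    proof (rule disc3_dvd[OF p, where u = "\<lambda>i. u i k"])
      obtain i where i: "i < 3" "\<not> int p dvd u i 1" using prim by blast
      have "int p dvd u i k - u i 1" using coh_le[OF u(2), of 1 k i] by (simp add: k_def)
      then have "\<not> int p dvd u i k" using i(2) by (metis dvd_diff_right_iff)
      then show "\<exists>i<3. \<not> int p dvd u i k" using i(1) by blast
      show q: "int p ^ 2 dvd qe 3 f (\<lambda>i. u i k)" using N0 by (simp add: k_def)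
      show "int p dvd qb 3 f (\<lambda>i. u i k) (ev l)" if l: "l < 3" for l
      proof -
        have "l = 0 \<or> l = 1 \<or> l = 2" using l by auto
        then have "int p ^ 2 dvd qe 3 f (\<lambda>i. u i k + int p * ev l i)" using N1[OF l, of k] by (auto simp: k_def)
        then have "int p ^ 2 dvd qe 3 f (\<lambda>i. u i k) + int p * qb 3 f (\<lambda>i. u i k) (ev l) + (int p)^2 * qe 3 f (ev l)"
          unfolding qe_combination .
        then have "int p ^ 2 dvd qe 3 f (\<lambda>i. u i k) + int p * qb 3 f (\<lambda>i. u i k) (ev l)" by (metis dvd_add_left_iff dvd_triv_left)
        then have "int p ^ 2 dvd int p * qb 3 f (\<lambda>i. u i k) (ev l)" using q by (metis dvd_add_right_iff)
        then show ?thesis using p0 by (simp add: power2_eq_square)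
      qed
    qed
    then show False using D by blast
  qed
  ultimately show ?thesis unfolding maximal_form_def by blast
qed

section \<open>Construction of the global form\<close>

lemma crt_prime_powers:
  fixes c :: "nat \<Rightarrow> int"
  assumes "finite Q" "\<And>q. q \<in> Q \<Longrightarrow> prime q"
  shows "\<exists>y. \<forall>q\<in>Q. int q ^ k q dvd y - c q"
  using assms
proof (induction Q rule: finite_induct)
  case (insert q Q)
  then obtain y where y: "\<forall>q\<in>Q. int q ^ k q dvd y - c q" by auto
  define M where "M = (\<Prod>p\<in>Q. int p ^ k p)"
  have "coprime (int p ^ k p) (int q ^ k q)" if "p \<in> Q" for p
  proof -
    have "p \<noteq> q" using that insert by auto
    then have "coprime (int p) (int q)" using insert.prems that by (simp add: primes_coprime)
    then show ?thesis by simp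
  qed
  then have "coprime M (int q ^ k q)" unfolding M_def by (intro prod_coprime_left) auto
  then obtain x where x: "[x = y] (mod M)" "[x = c q] (mod int q ^ k q)" using binary_chinese_remainder_int by blast
  have "int p ^ k p dvd x - c p" if "p \<in> Q" for p
  proof -
    have "int p ^ k p dvd M" unfolding M_def using insert(1) that by (intro dvd_prodI) auto
    then have "int p ^ k p dvd x - y" using x(1) by (meson cong_iff_dvd_diff dvd_trans)
    then have "int p ^ k p dvd (x - y) + (y - c p)" using y that by (intro dvd_add) auto
    then show ?thesis by simp
  qed
  then show ?case using x(2) by (intro exI[of _ x]) (auto simp: cong_iff_dvd_diff)
qed simp

lemma crt_large:
  fixes c :: "nat \<Rightarrow> int" and E :: real
  assumes Q: "finite Q" "\<And>q. q \<in> Q \<Longrightarrow> prime q" and e: "e \<in> {-1, 1::int}"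
  shows "\<exists>y. (\<forall>q\<in>Q. int q ^ k q dvd y - c q) \<and> real_of_int (e * y) > E"
proof -
  obtain y where y: "\<forall>q\<in>Q. int q ^ k q dvd y - c q" using crt_prime_powers[of Q k c] Q by blast
  define L where "L = (\<Prod>p\<in>Q. int p ^ k p)"
  have L: "L \<ge> 1"
  proof -
    have "L > 0" unfolding L_def using Q(2) by (intro prod_pos) (auto simp: prime_gt_0_nat)
    then show ?thesis by simp
  qed
  obtain z :: int where z: "\<bar>E\<bar> < of_int z" using ex_less_of_int by blast
  have z0: "z > 0" using z by (smt (verit) of_int_le_0_iff)
  define N where "N = z + \<bar>y\<bar>"
  have N0: "N \<ge> 0" using z0 by (simp add: N_def)
  define x where "x = y + L * (e * N)"
  have dv: "int q ^ k q dvd x - c q" if "q \<in> Q" for q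
  proof -
    have "int q ^ k q dvd L" unfolding L_def using Q(1) that by (intro dvd_prodI) auto
    then have "int q ^ k q dvd (y - c q) + L * (e * N)" using y that by (intro dvd_add) auto
    then show ?thesis by (simp add: x_def algebra_simps)
  qed
  have "e * x = e * y + L * N" using e by (auto simp: x_def algebra_simps)
  moreover have "L * N \<ge> 1 * N" using L N0 by (intro mult_right_mono) auto
  moreover have "e * y \<ge> - \<bar>y\<bar>" using e by auto
  ultimately have ge: "e * x \<ge> z" by (simp add: N_def)
  have "real_of_int z \<le> real_of_int (e * x)" using ge by (rule of_int_le_iff[THEN iffD2])
  then have "E < real_of_int (e * x)" using z abs_ge_self[of E] by linarith
  then show ?thesis using dv by blast
qed

definition pdivs :: "int \<Rightarrow> nat set" where "pdivs a = {q. prime q \<and> int q dvd a}"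

lemma finite_pdivs: "a \<noteq> 0 \<Longrightarrow> finite (pdivs a)"
proof (rule finite_subset)
  assume "a \<noteq> 0"
  show "pdivs a \<subseteq> {..nat \<bar>a\<bar>}"
  proof
    fix q assume "q \<in> pdivs a"
    then have "int q \<le> \<bar>a\<bar>" using \<open>a \<noteq> 0\<close> dvd_imp_le_int[of a "int q"] by (auto simp: pdivs_def)
    then show "q \<in> {..nat \<bar>a\<bar>}" by simp
  qed
qed simp

text \<open>The condition on r concerns the prime factors of a, so a is fixed before r; b comes last
  and is taken so large that 4ab dominates r^2 and fixes the sign of the binary determinant.\<close>

lemma binary_part:
  fixes A R B :: "nat \<Rightarrow> int"
  assumes S: "finite S" "\<And>p. p \<in> S \<Longrightarrow> prime p" and e: "e0 \<in> {-1, 1::int}" "e1 \<in> {-1, 1::int}"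
  shows "\<exists>a r b. (\<forall>p\<in>S. int p ^ k p dvd a - A p \<and> int p ^ k p dvd r - R p \<and> int p ^ k p dvd b - B p) \<and>
    e0 * a > 0 \<and> e0 * e1 * (4 * a * b - r^2) > 0 \<and> (\<forall>q. prime q \<and> q \<notin> S \<and> int q dvd a \<longrightarrow> int q dvd r - 1)"
proof -
  obtain a where a: "\<forall>p\<in>S. int p ^ k p dvd a - A p" "real_of_int (e0 * a) > 0" using crt_large[OF S e(1), of k A 0] by blast
  have a0: "e0 * a > 0" using a(2) by (simp only: of_int_0_less_iff)
  have an: "a \<noteq> 0" using a0 by auto
  have SQ: "finite (S \<union> pdivs a)" "\<And>q. q \<in> S \<union> pdivs a \<Longrightarrow> prime q" using S finite_pdivs[OF an] by (auto simp: pdivs_def)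
  obtain r where r: "\<forall>q\<in>S \<union> pdivs a. int q ^ (if q \<in> S then k q else 1) dvd r - (if q \<in> S then R q else 1)"
    using crt_prime_powers[OF SQ, of "\<lambda>q. if q \<in> S then k q else 1" "\<lambda>q. if q \<in> S then R q else 1"] by (rule exE)
  obtain b where b: "\<forall>p\<in>S. int p ^ k p dvd b - B p" "real_of_int (e1 * b) > real_of_int (r^2)"
    using crt_large[OF S e(2), of k B "real_of_int (r^2)"] by blast
  have eb: "e1 * b > r^2" using b(2) by (simp only: of_int_less_iff)
  have "e0 * e1 * (4 * a * b - r^2) > 0"
  proof -
    define x y where "x = e0 * a" and "y = e1 * b"
    have xy: "x \<ge> 1" "y > r^2" using a0 eb by (auto simp: x_def y_def)
    have y0: "y > 0" using xy(2) by (meson le_less_trans zero_le_power2)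
    have "x * y \<ge> 1 * y" using xy(1) y0 by (intro mult_right_mono) auto
    moreover have "e0 * e1 * r^2 \<le> r^2" using e by auto
    ultimately have "4 * (x * y) - e0 * e1 * r^2 > 0" using xy y0 by linarith
    moreover have "4 * (x * y) - e0 * e1 * r^2 = e0 * e1 * (4 * a * b - r^2)" by (simp add: x_def y_def algebra_simps)
    ultimately show ?thesis by simp
  qed
  moreover have "\<forall>q. prime q \<and> q \<notin> S \<and> int q dvd a \<longrightarrow> int q dvd r - 1"
  proof (intro allI impI, elim conjE)
    fix q assume q: "prime q" "q \<notin> S" "int q dvd a"
    then have "q \<in> S \<union> pdivs a" by (simp add: pdivs_def)
    from bspec[OF r this] show "int q dvd r - 1" using q(2) by simp
  qed
  moreover have "\<forall>p\<in>S. int p ^ k p dvd r - R p"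
  proof
    fix p assume "p \<in> S"
    then show "int p ^ k p dvd r - R p" using bspec[OF r, of p] by simp
  qed
  ultimately show ?thesis using a(1) b(1) a0 by blast
qed

text \<open>Jacobi's criterion: the pivots are a and (4ab - r^2)/(4a).\<close>

lemma rsig_2:
  fixes f :: "nat \<Rightarrow> nat \<Rightarrow> int"
  assumes e: "\<And>i. e i \<in> {-1, 1::int}" and a: "e 0 * f 0 0 > 0" and d: "e 0 * e 1 * (4 * f 0 0 * f 1 1 - (f 0 1)^2) > 0"
  shows "rsig 2 (\<lambda>i j. real_of_int (f i j)) (\<lambda>i. real_of_int (e i))"
proof -
  define F where "F i j = real_of_int (f i j)" for i j
  have er: "real_of_int (e i) \<in> {-1, 1}" for i using e[of i] by auto
  have a': "real_of_int (e 0) * F 0 0 > 0" using a unfolding F_def by (metis of_int_0_less_iff of_int_mult)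
  have d': "real_of_int (e 0) * real_of_int (e 1) * (4 * F 0 0 * F 1 1 - (F 0 1)^2) > 0"
  proof -
    have "real_of_int (e 0 * e 1 * (4 * f 0 0 * f 1 1 - (f 0 1)^2)) > 0" using d by (simp only: of_int_0_less_iff)
    then show ?thesis by (simp add: F_def)
  qed
  have a0: "F 0 0 \<noteq> 0" using a' by auto
  have 1: "rsig (Suc 0) F ((\<lambda>_. 0)(0 := real_of_int (e 0)))"
    by (rule rsig_step_pos[where c = "\<lambda>_. 0"]) (use er[of 0] a' rsig_0 in \<open>auto simp: qb_def qe_def mult.commute\<close>)
  define c where "c = (\<lambda>_::nat. F 0 1 / (2 * F 0 0))"
  have q: "qe (Suc 0) F c = (F 0 1)^2 / (4 * F 0 0)" using a0 by (simp add: qe_def c_def power2_eq_square field_simps)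
  have "rsig (Suc (Suc 0)) F (((\<lambda>_. 0)(0 := real_of_int (e 0)))(Suc 0 := real_of_int (e 1)))"
  proof (rule rsig_step_pos[OF 1, where c = c])
    show "qb (Suc 0) F x c = (\<Sum>i<Suc 0. F i (Suc 0) * x i)" for x
      using a0 by (simp add: qb_def c_def field_simps)
    have "(F (Suc 0) (Suc 0) - qe (Suc 0) F c) * real_of_int (e 1) =
      (real_of_int (e 0) * real_of_int (e 1) * (4 * F 0 0 * F 1 1 - (F 0 1)^2)) / (4 * (real_of_int (e 0) * F 0 0))"
      unfolding q using a0 er[of 0] by (auto simp: field_simps)
    also have "\<dots> > 0" using a' d' by (intro divide_pos_pos) auto
    finally show "(F (Suc 0) (Suc 0) - qe (Suc 0) F c) * real_of_int (e 1) > 0" .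
  qed (use er in auto)
  then have "rsig 2 F (((\<lambda>_. 0)(0 := real_of_int (e 0)))(Suc 0 := real_of_int (e 1)))" by (simp add: numeral_2_eq_2)
  then show ?thesis unfolding F_def by (rule rsig_cong) (auto simp: less_2_cases_iff)
qed

definition with_column :: "(nat \<Rightarrow> nat \<Rightarrow> 'a) \<Rightarrow> nat \<Rightarrow> (nat \<Rightarrow> 'a) \<Rightarrow> 'a \<Rightarrow> nat \<Rightarrow> nat \<Rightarrow> 'a" where
  "with_column f m c d i j = (if j = m then (if i = m then d else c i) else f i j)"

text \<open>A real vector v represents the cross terms c through the polar form, so the new pivot is
  d minus the value at v; it gets the sign \<open>e m\<close> once \<open>e m * d\<close> is
  large.\<close>

lemma extend_column:
  fixes f :: "nat \<Rightarrow> nat \<Rightarrow> int"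
  assumes r: "rsig m (\<lambda>i j. real_of_int (f i j)) (\<lambda>i. real_of_int (e i))" and e: "\<And>i. e i \<in> {-1, 1::int}"
    and Q: "finite Q" "\<And>q. q \<in> Q \<Longrightarrow> prime q"
  shows "\<exists>d. (\<forall>q\<in>Q. int q ^ k q dvd d - t q) \<and> real_of_int (e m * d) > E \<and>
    rsig (Suc m) (\<lambda>i j. real_of_int (with_column f m c d i j)) (\<lambda>i. real_of_int (e i))"
proof -
  have er: "real_of_int (e i) \<in> {-1, 1}" for i using e[of i] by auto
  obtain v where v: "\<And>x. qb m (\<lambda>i j. real_of_int (f i j)) x v = (\<Sum>i<m. real_of_int (c i) * x i)"
    using rsig_dual[OF r er, of "\<lambda>i. real_of_int (c i)"] by blast
  define q where "q = qe m (\<lambda>i j. real_of_int (f i j)) v"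
  obtain d where d: "\<forall>q\<in>Q. int q ^ k q dvd d - t q" "real_of_int (e m * d) > max E (real_of_int (e m) * q)"
    using crt_large[OF Q e[of m], of k t "max E (real_of_int (e m) * q)"] by blast
  define F where "F i j = real_of_int (with_column f m c d i j)" for i j
  have FF: "F i j = real_of_int (f i j)" if "j < m" for i j using that by (simp add: F_def with_column_def)
  have rF: "rsig m F (\<lambda>i. real_of_int (e i))" using r by (rule rsig_cong) (auto simp: FF)
  have "rsig (Suc m) F ((\<lambda>i. real_of_int (e i))(m := real_of_int (e m)))"
  proof (rule rsig_step_pos[OF rF, where c = v])
    show "qb m F x v = (\<Sum>i<m. F i m * x i)" for x
    proof -
      have "qb m F x v = qb m (\<lambda>i j. real_of_int (f i j)) x v"
        unfolding qb_def by (intro sum.cong refl) (auto simp: FF)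
      then show ?thesis using v by (auto simp: F_def with_column_def intro!: sum.cong)
    qed
    have "qe m F v = q" unfolding q_def by (rule qe_cong) (auto simp: FF)
    then show "(F m m - qe m F v) * real_of_int (e m) > 0"
      using d(2) by (simp add: F_def with_column_def algebra_simps)
  qed (rule er)
  then have "rsig (Suc m) F (\<lambda>i. real_of_int (e i))" by (rule rsig_cong) auto
  then show ?thesis using d unfolding F_def by (intro exI[of _ d]) auto
qed

section \<open>Criteria for nonsingular zeros modulo q\<close>

lemma qe_3: "qe 3 f x = f 0 0 * (x 0)^2 + f 0 1 * x 0 * x 1 + f 1 1 * (x 1)^2 + f 0 2 * x 0 * x 2 + f 1 2 * x 1 * x 2 + f 2 2 * (x 2)^2"
  by (simp add: qe_def eval_nat_numeral algebra_simps)

lemma qb_3: "qb 3 f x y = (2 * f 0 0 * x 0 + f 0 1 * x 1 + f 0 2 * x 2) * y 0 + (f 0 1 * x 0 + 2 * f 1 1 * x 1 + f 1 2 * x 2) * y 1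
    + (f 0 2 * x 0 + f 1 2 * x 1 + 2 * f 2 2 * x 2) * y 2"
  by (simp add: qb_def eval_nat_numeral algebra_simps)

text \<open>Half the determinant of the polar Gram matrix; that determinant is always even, its half
  is the quantity that detects degeneracy at 2.\<close>

definition disc3 :: "(nat \<Rightarrow> nat \<Rightarrow> int) \<Rightarrow> int" where
  "disc3 f = f 2 2 * (4 * f 0 0 * f 1 1 - (f 0 1)^2) + f 0 1 * f 0 2 * f 1 2 - f 0 0 * (f 1 2)^2 - f 1 1 * (f 0 2)^2"

lemma smooth_zero_coeff:
  assumes "i < j" "j < n" "int q dvd f i i" "\<not> int q dvd f i j"
  shows "smooth_zero q n f"
  unfolding smooth_zero_def using assms qe_ev[of i n f] qb_ev[of i j n f]
  by (intro exI[of _ "ev i"] exI[of _ "ev j"]) auto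

lemma smooth_zero_pullback:
  assumes "smooth_zero q m (\<lambda>i j. if i = j then qe n f (w i) else qb n f (w i) (w j))"
  shows "smooth_zero q n f"
proof -
  let ?h = "\<lambda>i j. if i = j then qe n f (w i) else qb n f (w i) (w j)"
  let ?v = "\<lambda>x k. \<Sum>i<m. x i * w i k"
  obtain x y where xy: "int q dvd qe m ?h x" "\<not> int q dvd qb m ?h x y" using assms unfolding smooth_zero_def by blast
  have e: "qe n f (?v x) = qe m ?h x" for x by (rule qe_pullback)
  have "?v (\<lambda>i. x i + y i) = (\<lambda>k. ?v x k + ?v y k)" by (simp add: algebra_simps sum.distrib)
  then have "qb n f (?v x) (?v y) = qe n f (?v (\<lambda>i. x i + y i)) - qe n f (?v x) - qe n f (?v y)" by (simp add: qe_add)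
  also have "\<dots> = qb m ?h x y" unfolding e by (simp add: qe_add)
  finally show ?thesis unfolding smooth_zero_def
    by (intro exI[of _ "?v x"] exI[of _ "?v y"]) (simp only: e xy not_False_eq_True simp_thms)
qed

text \<open>Completing the square twice turns 4 a \<Delta> times the form into \<Delta> X^2 + Y^2 +
  4 a D Z^2. With Z = 1 a zero modulo q exists by pigeonhole, and X, Y are solved back for x and y
  because 2a and \<Delta> are units.\<close>

lemma smooth_zero_conic:
  assumes q: "prime q" "q \<noteq> 2" and a: "\<not> int q dvd f 0 0" and d: "\<not> int q dvd 4 * f 0 0 * f 1 1 - (f 0 1)^2" and D: "\<not> int q dvd disc3 f"
  shows "smooth_zero q 3 f"
proof -
  define a b c r s t where "a = f 0 0" and "b = f 1 1" and "c = f 2 2" and "r = f 0 1" and "s = f 0 2" and "t = f 1 2"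
  define \<Delta> m D where "\<Delta> = 4 * a * b - r^2" and "m = 2 * a * t - r * s" and "D = disc3 f"
  have Dd: "D = c * \<Delta> + r * s * t - a * t^2 - b * s^2" by (simp add: D_def disc3_def \<Delta>_def a_def b_def c_def r_def s_def t_def)
  have qq: "prime (int q)" using q by simp
  have q2: "\<not> int q dvd 2" using q by (metis int_dvd_int_iff of_nat_numeral primes_dvd_imp_eq two_is_prime_nat)
  have na: "\<not> int q dvd 2 * a" using a q2 qq by (simp add: a_def prime_dvd_mult_iff)
  have nd: "\<not> int q dvd \<Delta>" using d by (simp add: \<Delta>_def a_def b_def r_def)
  have "\<not> int q dvd - \<Delta>" using nd by simp
  then obtain Y X where YX: "int q dvd Y^2 - (- \<Delta>) * X^2 - (- (4 * a * D))"
    using quadratic_congruence_solvable[OF q, of "- \<Delta>" "- (4 * a * D)"] by blast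
  obtain i where i: "[\<Delta> * i = 1] (mod int q)" using inverse_mod_prime[OF q(1) nd] by blast
  obtain h where h: "[2 * a * h = 1] (mod int q)" using inverse_mod_prime[OF q(1) na] by blast
  define y where "y = i * (Y - m)"
  define x where "x = h * (X - r * y - s)"
  have y1: "int q dvd (\<Delta> * y + m) - Y"
  proof -
    have "int q dvd (\<Delta> * i - 1) * (Y - m)" using i by (simp add: cong_iff_dvd_diff)
    then show ?thesis by (simp add: y_def algebra_simps)
  qed
  have x1: "int q dvd (2 * a * x + r * y + s) - X"
  proof -
    have "int q dvd (2 * a * h - 1) * (X - r * y - s)" using h by (simp add: cong_iff_dvd_diff)
    then show ?thesis by (simp add: x_def algebra_simps)
  qed
  define v where "v k = (if k = 0 then x else if k = 1 then y else (1::int))" for k :: nat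
  have F: "qe 3 f v = a * x^2 + r * x * y + b * y^2 + s * x + t * y + c"
    by (simp add: qe_3 v_def a_def b_def c_def r_def s_def t_def)
  have sq: "int q dvd U^2 - V^2" if "int q dvd U - V" for U V
  proof -
    have "U^2 - V^2 = (U - V) * (U + V)" by (simp add: power2_eq_square algebra_simps)
    then show ?thesis using that by simp
  qed
  have "4 * a * \<Delta> * qe 3 f v = \<Delta> * (2 * a * x + r * y + s)^2 + (\<Delta> * y + m)^2 + 4 * a * D"
    unfolding F Dd unfolding \<Delta>_def m_def by (simp add: algebra_simps power2_eq_square)
  also have "\<dots> = \<Delta> * ((2 * a * x + r * y + s)^2 - X^2) + ((\<Delta> * y + m)^2 - Y^2) + (Y^2 - (- \<Delta>) * X^2 - (- (4 * a * D)))"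
    by (simp add: algebra_simps)
  also have "int q dvd \<dots>" using sq[OF x1] sq[OF y1] YX by (intro dvd_add dvd_mult)
  finally have "int q dvd 4 * a * \<Delta> * qe 3 f v" .
  then have "int q dvd (2 * a) * (2 * (\<Delta> * qe 3 f v))" by (simp add: mult_ac)
  then have 1: "int q dvd qe 3 f v" using na q2 nd qq by (simp only: prime_dvd_mult_iff) blast
  define w where "w k = (if k = 0 then r * m - s * \<Delta> else if k = 1 then - 2 * a * m else 2 * a * \<Delta>)" for k :: nat
  have "qb 3 f v w = 2 * (2 * a) * D"
    unfolding qb_3 Dd unfolding w_def v_def \<Delta>_def m_def a_def b_def c_def r_def s_def t_def
    by (simp add: algebra_simps power2_eq_square)
  then have "\<not> int q dvd qb 3 f v w" using na q2 D[folded D_def] qq by (simp only: prime_dvd_mult_iff) blast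
  then show ?thesis unfolding smooth_zero_def using 1 by blast
qed

lemma smooth_zero_add_variable:
  assumes "smooth_zero q m f" "m \<le> n" "\<And>i j. i \<le> j \<Longrightarrow> j < m \<Longrightarrow> g i j = f i j"
  shows "smooth_zero q n g"
proof (rule smooth_zero_pullback[where m = m and w = ev])
  let ?h = "\<lambda>i j. if i = j then qe n g (ev i) else qb n g (ev i) (ev j)"
  have h: "?h i j = f i j" if "i \<le> j" "j < m" for i j
    using that assms(2,3) qe_ev[of i n g] qb_ev[of i j n g] by auto
  obtain v w where vw: "int q dvd qe m f v" "\<not> int q dvd qb m f v w" using assms(1) unfolding smooth_zero_def by blast
  have e: "qe m ?h x = qe m f x" for x by (rule qe_cong) (use h in auto)
  have "qb m ?h v w = qb m f v w" using qe_add[of m ?h v w] qe_add[of m f v w] unfolding e by simp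
  then show "smooth_zero q m ?h" unfolding smooth_zero_def
    by (intro exI[of _ v] exI[of _ w]) (simp only: e vw not_False_eq_True simp_thms)
qed

section \<open>Forms in at least four variables\<close>

lemma extend_form:
  fixes f :: "nat \<Rightarrow> nat \<Rightarrow> int"
  assumes r: "rsig m (\<lambda>i j. real_of_int (f i j)) (\<lambda>i. real_of_int (e i))" and e: "\<And>i. e i \<in> {-1, 1::int}"
    and S: "finite S" "\<And>p. p \<in> S \<Longrightarrow> prime p"
    and f: "\<And>p i j. p \<in> S \<Longrightarrow> i \<le> j \<Longrightarrow> j < m \<Longrightarrow> int p ^ k p dvd f i j - g p i j"
  shows "\<exists>f'. (\<forall>i j. j < m \<longrightarrow> f' i j = f i j) \<and> rsig (m + l) (\<lambda>i j. real_of_int (f' i j)) (\<lambda>i. real_of_int (e i))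
    \<and> (\<forall>p\<in>S. \<forall>i j. i \<le> j \<longrightarrow> j < m + l \<longrightarrow> int p ^ k p dvd f' i j - g p i j)"
proof (induction l)
  case 0
  then show ?case using r f by (intro exI[of _ f]) auto
next
  case (Suc l)
  then obtain f' where f': "\<forall>i j. j < m \<longrightarrow> f' i j = f i j"
    "rsig (m + l) (\<lambda>i j. real_of_int (f' i j)) (\<lambda>i. real_of_int (e i))"
    "\<forall>p\<in>S. \<forall>i j. i \<le> j \<longrightarrow> j < m + l \<longrightarrow> int p ^ k p dvd f' i j - g p i j" by blast
  have "\<forall>i. \<exists>y. \<forall>p\<in>S. int p ^ k p dvd y - g p i (m + l)"
    using crt_prime_powers[of S k "\<lambda>p. g p _ (m + l)"] S by blast
  then obtain c where c: "\<And>i. \<forall>p\<in>S. int p ^ k p dvd c i - g p i (m + l)" by metis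
  obtain d where d: "\<forall>q\<in>S. int q ^ k q dvd d - g q (m + l) (m + l)"
    "rsig (Suc (m + l)) (\<lambda>i j. real_of_int (with_column f' (m + l) c d i j)) (\<lambda>i. real_of_int (e i))"
    using extend_column[OF f'(2) e S, of k "\<lambda>q. g q (m + l) (m + l)" 0 c] by blast
  have "int p ^ k p dvd with_column f' (m + l) c d i j - g p i j" if "p \<in> S" "i \<le> j" "j < m + Suc l" for p i j
    using that f'(3) c d(1) by (auto simp: with_column_def less_Suc_eq)
  then show ?case using f'(1) d(2) by (intro exI[of _ "with_column f' (m + l) c d"]) (auto simp: with_column_def)
qed

text \<open>At a prime \<open>q \<notin> S\<close>, the plane spanned by the first two variables yields a nonsingular zero if
  \<open>q\<close> divides \<open>a\<close>, the plane of variables 2 and 3 is made hyperbolic if \<open>q\<close> divides the binary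
  determinant, and otherwise a ternary section with determinant prime to \<open>q\<close> is isotropic.\<close>
lemma construct_ge4:
  fixes g :: "nat \<Rightarrow> nat \<Rightarrow> nat \<Rightarrow> int"
  assumes S: "finite S" "\<And>p. p \<in> S \<Longrightarrow> prime p" "2 \<in> S" and n: "n \<ge> 4" and e: "\<And>i. e i \<in> {-1, 1::int}"
  shows "\<exists>f. (\<forall>p\<in>S. \<forall>i j. i \<le> j \<longrightarrow> j < n \<longrightarrow> int p ^ k p dvd f i j - g p i j) \<and>
    rsig n (\<lambda>i j. real_of_int (f i j)) (\<lambda>i. real_of_int (e i)) \<and> (\<forall>q. prime q \<and> q \<notin> S \<longrightarrow> smooth_zero q n f)"
proof -
  obtain a r b where ab: "\<forall>p\<in>S. int p ^ k p dvd a - g p 0 0 \<and> int p ^ k p dvd r - g p 0 1 \<and> int p ^ k p dvd b - g p 1 1"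
    and a: "e 0 * a > 0" and d: "e 0 * e 1 * (4 * a * b - r^2) > 0"
    and ra: "\<forall>q. prime q \<and> q \<notin> S \<and> int q dvd a \<longrightarrow> int q dvd r - 1"
    using binary_part[OF S(1,2) e[of 0] e[of 1], of k "\<lambda>p. g p 0 0" "\<lambda>p. g p 0 1" "\<lambda>p. g p 1 1"] by blast
  define \<Delta> where "\<Delta> = 4 * a * b - r^2"
  have D0: "\<Delta> \<noteq> 0" using d by (auto simp: \<Delta>_def)
  define f2 where "f2 i j = (if j = 0 then a else if i = 0 then r else b)" for i j :: nat
  have r2: "rsig 2 (\<lambda>i j. real_of_int (f2 i j)) (\<lambda>i. real_of_int (e i))"
    by (rule rsig_2) (use e a d in \<open>auto simp: f2_def\<close>)
  obtain s where s: "\<forall>p\<in>S. int p ^ k p dvd s - g p 0 2" using crt_prime_powers[OF S(1,2), of k "\<lambda>p. g p 0 2"] by (rule exE)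
  obtain t where t: "\<forall>p\<in>S. int p ^ k p dvd t - g p 1 2" using crt_prime_powers[OF S(1,2), of k "\<lambda>p. g p 1 2"] by (rule exE)
  define Q2 where "Q2 = S \<union> pdivs \<Delta>"
  have Q2: "finite Q2" "\<And>q. q \<in> Q2 \<Longrightarrow> prime q" using S finite_pdivs[OF D0] by (auto simp: Q2_def pdivs_def)
  define k' where "k' q = (if q \<in> S then k q else 1)" for q
  define G where "G = - r * s * t + a * t^2 + b * s^2"
  define c2 where "c2 i = (if i = 0 then s else t)" for i :: nat
  \<comment> \<open>Divisibility of c by the primes outside S dividing \<Delta> makes the third
    basis vector isotropic there; the size of c keeps the ternary determinant nonzero, so that only
    finitely many primes divide it.\<close>
  obtain c where c: "\<forall>q\<in>Q2. int q ^ k' q dvd c - (if q \<in> S then g q 2 2 else 0)"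
    "real_of_int (e 2 * c) > real_of_int \<bar>G\<bar>"
    "rsig (Suc 2) (\<lambda>i j. real_of_int (with_column f2 2 c2 c i j)) (\<lambda>i. real_of_int (e i))"
    using extend_column[OF r2 e Q2, of k' "\<lambda>q. if q \<in> S then g q 2 2 else 0" "real_of_int \<bar>G\<bar>" c2] by blast
  define f3 where "f3 = with_column f2 2 c2 c"
  define D3 where "D3 = disc3 f3"
  have D3: "D3 = c * \<Delta> - G"
    by (simp add: D3_def disc3_def f3_def with_column_def f2_def c2_def \<Delta>_def G_def)
  have D3n: "D3 \<noteq> 0"
  proof
    assume "D3 = 0"
    then have G: "G = c * \<Delta>" using D3 by simp
    have "\<bar>c\<bar> > \<bar>G\<bar>" using c(2) e[of 2] by auto
    moreover have "\<bar>G\<bar> \<ge> \<bar>c\<bar> * 1" unfolding G abs_mult using D0 by (intro mult_left_mono) auto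
    ultimately show False by simp
  qed
  define Q3 where "Q3 = Q2 \<union> pdivs D3"
  have Q3: "finite Q3" "\<And>q. q \<in> Q3 \<Longrightarrow> prime q" using Q2 finite_pdivs[OF D3n] by (auto simp: Q3_def pdivs_def)
  \<comment> \<open>Modulo the primes outside S dividing \<Delta> or \<open>D3\<close>, the fourth
    column is (0, 0, 1, 1). Its third entry gives a nonsingular zero in the plane of the last two
    variables where c vanishes; the other entries give the section without the third variable a
    determinant congruent to \<Delta>.\<close>
  obtain u0 where u0: "\<forall>q\<in>Q3. int q ^ k' q dvd u0 - (if q \<in> S then g q 0 3 else 0)"
    using crt_prime_powers[OF Q3, of k' "\<lambda>q. if q \<in> S then g q 0 3 else 0"] by (rule exE)
  obtain u1 where u1: "\<forall>q\<in>Q3. int q ^ k' q dvd u1 - (if q \<in> S then g q 1 3 else 0)"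
    using crt_prime_powers[OF Q3, of k' "\<lambda>q. if q \<in> S then g q 1 3 else 0"] by (rule exE)
  obtain u2 where u2: "\<forall>q\<in>Q3. int q ^ k' q dvd u2 - (if q \<in> S then g q 2 3 else 1)"
    using crt_prime_powers[OF Q3, of k' "\<lambda>q. if q \<in> S then g q 2 3 else 1"] by (rule exE)
  define c3 where "c3 i = (if i = 0 then u0 else if i = 1 then u1 else u2)" for i :: nat
  obtain h where h: "\<forall>q\<in>Q3. int q ^ k' q dvd h - (if q \<in> S then g q 3 3 else 1)"
    "rsig (Suc (Suc 2)) (\<lambda>i j. real_of_int (with_column f3 (Suc 2) c3 h i j)) (\<lambda>i. real_of_int (e i))"
    using extend_column[OF c(3)[folded f3_def] e Q3, of k' "\<lambda>q. if q \<in> S then g q 3 3 else 1" 0 c3] by blast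
  define f4 where "f4 = with_column f3 (Suc 2) c3 h"
  have SQ: "q \<in> Q2" "q \<in> Q3" "k' q = k q" if "q \<in> S" for q using that by (auto simp: Q2_def Q3_def k'_def)
  have f4S: "int p ^ k p dvd f4 i j - g p i j" if p: "p \<in> S" "i \<le> j" "j < 4" for p i j
  proof -
    have "(j = 0 \<and> i = 0) \<or> (j = 1 \<and> i = 0) \<or> (j = 1 \<and> i = 1) \<or> (j = 2 \<and> i = 0) \<or> (j = 2 \<and> i = 1) \<or> (j = 2 \<and> i = 2)
        \<or> (j = 3 \<and> i = 0) \<or> (j = 3 \<and> i = 1) \<or> (j = 3 \<and> i = 2) \<or> (j = 3 \<and> i = 3)" using p(2,3) by arith
    moreover have "int p ^ k p dvd c - g p 2 2" using bspec[OF c(1) SQ(1)[OF p(1)]] p(1) SQ(3) by simp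
    moreover have "int p ^ k p dvd u0 - g p 0 3" using bspec[OF u0 SQ(2)[OF p(1)]] p(1) SQ(3) by simp
    moreover have "int p ^ k p dvd u1 - g p 1 3" using bspec[OF u1 SQ(2)[OF p(1)]] p(1) SQ(3) by simp
    moreover have "int p ^ k p dvd u2 - g p 2 3" using bspec[OF u2 SQ(2)[OF p(1)]] p(1) SQ(3) by simp
    moreover have "int p ^ k p dvd h - g p 3 3" using bspec[OF h(1) SQ(2)[OF p(1)]] p(1) SQ(3) by simp
    moreover note bspec[OF ab p(1)] bspec[OF s p(1)] bspec[OF t p(1)]
    ultimately show ?thesis
      by (elim disjE conjE) (simp_all add: f4_def f3_def f2_def with_column_def c2_def c3_def)
  qed
  have r4: "rsig 4 (\<lambda>i j. real_of_int (f4 i j)) (\<lambda>i. real_of_int (e i))" using h(2) by (simp add: f4_def eval_nat_numeral)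
  obtain f where f: "\<forall>i j. j < 4 \<longrightarrow> f i j = f4 i j" "rsig (4 + (n - 4)) (\<lambda>i j. real_of_int (f i j)) (\<lambda>i. real_of_int (e i))"
    "\<forall>p\<in>S. \<forall>i j. i \<le> j \<longrightarrow> j < 4 + (n - 4) \<longrightarrow> int p ^ k p dvd f i j - g p i j"
    using extend_form[where e=e and S=S and k=k and g=g and l="n-4", OF r4 e S(1,2) f4S] by blast
  have n4: "4 + (n - 4) = n" using n by simp
  have co: "f4 0 0 = a" "f4 0 1 = r" "f4 1 1 = b" "f4 0 2 = s" "f4 1 2 = t" "f4 2 2 = c"
    "f4 0 3 = u0" "f4 1 3 = u1" "f4 2 3 = u2" "f4 3 3 = h"
    by (simp_all add: f4_def f3_def f2_def with_column_def c2_def c3_def)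
  have sm: "smooth_zero q 4 f4" if q: "prime q" "q \<notin> S" for q
  proof -
    have qp: "prime (int q)" using q by simp
    have q2: "q \<noteq> 2" using q S by auto
    have k1: "k' q = 1" using q by (simp add: k'_def)
    show ?thesis
    proof (cases "int q dvd a")
      case True
      then have "int q dvd r - 1" using ra q by blast
      then have "\<not> int q dvd r" using qp by (metis dvd_diff_right_iff not_prime_unit)
      then show ?thesis using True co by (intro smooth_zero_coeff[of 0 1]) auto
    next
      case na: False
      show ?thesis
      proof (cases "int q dvd \<Delta>")
        case True
        then have qQ: "q \<in> Q2" "q \<in> Q3" using q by (auto simp: Q2_def Q3_def pdivs_def)
        have "int q dvd c" using bspec[OF c(1) qQ(1)] k1 q(2) by simp
        moreover have "int q dvd u2 - 1" using bspec[OF u2 qQ(2)] k1 q(2) by simp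
        then have "\<not> int q dvd u2" using qp by (metis dvd_diff_right_iff not_prime_unit)
        ultimately show ?thesis using co by (intro smooth_zero_coeff[of 2 3]) auto
      next
        case nd: False
        show ?thesis
        proof (cases "int q dvd D3")
          case False
          have "smooth_zero q 3 f4"
            by (rule smooth_zero_conic) (use q q2 na nd False co in \<open>auto simp: \<Delta>_def D3 G_def disc3_def algebra_simps\<close>)
          then show ?thesis by (rule smooth_zero_add_variable) auto
        next
          case True
          then have qQ: "q \<in> Q3" using q by (auto simp: Q3_def pdivs_def)
          have u: "int q dvd u0" "int q dvd u1" "int q dvd h - 1"
            using bspec[OF u0 qQ] bspec[OF u1 qQ] bspec[OF h(1) qQ] k1 q(2) by simp_all
          define w where "w i = (if i = 2 then ev 3 else ev i :: nat \<Rightarrow> int)" for i :: nat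
          show ?thesis
          proof (rule smooth_zero_pullback[where m = 3 and w = w], rule smooth_zero_conic)
            let ?h = "\<lambda>i j. if i = j then qe 4 f4 (w i) else qb 4 f4 (w i) (w j)"
            have hh: "?h 0 0 = a" "?h 0 1 = r" "?h 1 1 = b" "?h 0 2 = u0" "?h 1 2 = u1" "?h 2 2 = h"
              using co by (simp_all add: w_def qe_ev qb_ev)
            show "\<not> int q dvd ?h 0 0" using na hh by simp
            show "\<not> int q dvd 4 * ?h 0 0 * ?h 1 1 - (?h 0 1)^2" unfolding hh using nd by (simp add: \<Delta>_def)
            have "disc3 ?h = \<Delta> + ((h - 1) * \<Delta> + u0 * (r * u1 - b * u0) - u1 * (a * u1))"
              unfolding disc3_def hh \<Delta>_def by (simp add: algebra_simps power2_eq_square)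
            moreover have "int q dvd (h - 1) * \<Delta> + u0 * (r * u1 - b * u0) - u1 * (a * u1)"
              using u by (auto intro!: dvd_add dvd_diff)
            ultimately show "\<not> int q dvd disc3 ?h" using nd by (metis dvd_add_left_iff)
          qed (use q q2 in auto)
        qed
      qed
    qed
  qed
  have "smooth_zero q n f" if "prime q" "q \<notin> S" for q
    using sm[OF that] by (rule smooth_zero_add_variable) (use n f(1) in auto)
  then show ?thesis using f unfolding n4 by (intro exI[of _ f]) blast
qed

section \<open>Ternary forms with a prescribed determinant\<close>

lemma unit_square_ratio:
  assumes p: "prime p" and u: "\<not> int p dvd u" and w: "\<not> int p dvd w"
    and odd: "p \<noteq> 2 \<Longrightarrow> Legendre w (int p) = Legendre u (int p)" and two: "p = 2 \<Longrightarrow> w mod 8 = u mod 8"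
  shows "\<exists>\<epsilon>. \<not> int p dvd \<epsilon> \<and> int p ^ N dvd \<epsilon>^2 * u - w"
proof -
  \<comment> \<open>The witness will be a square root of w/u. The three extra powers make the
    inverse of u valid modulo 8 when p = 2, and modulo p when N = 0.\<close>
  define M where "M = N + 3"
  have pp: "prime (int p)" using p by simp
  have "coprime (int p) u" using pp u by (rule prime_imp_coprime)
  then have "coprime u (int p ^ M)" by (simp add: coprime_commute)
  then obtain v where "[u * v = 1] (mod int p ^ M)" using cong_solve_coprime_int by blast
  then have v: "int p ^ M dvd u * v - 1" by (simp add: cong_iff_dvd_diff)
  have pM: "int p dvd int p ^ M" by (simp add: M_def)
  have v1: "int p dvd u * v - 1" using v pM dvd_trans by blast
  have nv: "\<not> int p dvd v"
  proof
    assume "int p dvd v"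
    then have "int p dvd u * v" by simp
    then have "int p dvd u * v - (u * v - 1)" using v1 by (rule dvd_diff)
    then show False using pp by (simp add: not_prime_unit)
  qed
  have nwv: "\<not> int p dvd w * v" using nv w pp by (simp add: prime_dvd_mult_iff)
  have "\<exists>\<epsilon>. int p ^ M dvd \<epsilon>^2 - w * v"
  proof (cases "p = 2")
    case True
    have "2 ^ 3 dvd u * v - 1" using v True by (auto simp: M_def power_add elim: dvd_mult_right)
    then have "(8::int) dvd u * v - 1" by simp
    then have "(u * v) mod 8 = 1" by (simp add: mod_eq_dvd_iff[symmetric])
    moreover have "(w * v) mod 8 = (u * v) mod 8" using two[OF True] by (metis mod_mult_left_eq)
    ultimately show ?thesis using square_lift_2[of "w * v" M] True by simp
  next
    case False
    have "Legendre (w * v) (int p) = Legendre (u * v) (int p)" by (simp add: Legendre_mult[OF p False] odd[OF False])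
    also have "\<dots> = Legendre 1 (int p)" by (rule Legendre_cong) (use v1 in \<open>simp add: cong_iff_dvd_diff\<close>)
    also have "\<dots> = 1" by (rule Legendre_1[OF p])
    finally have "QuadRes (int p) (w * v)" unfolding Legendre_def by (simp split: if_splits)
    then obtain y where "[y^2 = w * v] (mod int p)" unfolding QuadRes_def by blast
    then show ?thesis using square_lift_odd[OF p False nwv] by blast
  qed
  then obtain \<epsilon> where e: "int p ^ M dvd \<epsilon>^2 - w * v" by blast
  have eu: "int p ^ M dvd \<epsilon>^2 * u - w"
  proof -
    have "\<epsilon>^2 * u - w = (\<epsilon>^2 - w * v) * u + w * (u * v - 1)" by (simp add: algebra_simps)
    then show ?thesis using e v by simp
  qed
  have "\<not> int p dvd \<epsilon>"
  proof
    assume "int p dvd \<epsilon>"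
    then have "int p dvd \<epsilon>^2 * u" by (simp add: power2_eq_square)
    moreover have "int p dvd \<epsilon>^2 * u - w" using eu pM dvd_trans by blast
    ultimately have "int p dvd w" by (metis dvd_diff_right_iff)
    then show False using w by blast
  qed
  moreover have "int p ^ N dvd \<epsilon>^2 * u - w" by (rule dvd_trans[OF _ eu]) (simp add: M_def power_add)
  ultimately show ?thesis by blast
qed

lemma hilb_unit_right:
  assumes "prime q" "q \<noteq> 2" "\<not> int q dvd v"
  shows "hilb q u v = Legendre v (int q) ^ vp q u"
  using assms vp_unit[OF assms(1,3)] by (simp add: hilb_def)

lemma dvd_by_prime_powers:
  assumes "x \<noteq> 0" and "\<And>q. prime q \<Longrightarrow> int q dvd x \<Longrightarrow> int q ^ vp q x dvd y"
  shows "x dvd (y::int)"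
proof (cases "y = 0")
  case False
  show ?thesis
  proof (rule multiplicity_le_imp_dvd[OF assms(1)])
    fix p :: int assume p: "prime p"
    define q where "q = nat p"
    have q: "p = int q" "prime q" using p prime_ge_0_int[OF p] by (auto simp: q_def)
    show "multiplicity p x \<le> multiplicity p y"
    proof (cases "p dvd x")
      case True
      then have "int q ^ vp q x dvd y" using assms(2) q by blast
      then show ?thesis using False p q(1) by (intro multiplicity_geI) (auto simp: vp_def)
    qed (simp add: not_dvd_imp_multiplicity_0)
  qed
qed simp

text \<open>The determinant is \<open>\<sigma> P l\<close> with \<open>P\<close> prescribed by the valuations at \<open>S\<close> and a single auxiliary prime \<open>l\<close>
  subject only to quadratic conditions.\<close>
lemma choose_determinant:
  fixes E B :: "nat \<Rightarrow> int"
  assumes S: "finite S" "\<And>p. p \<in> S \<Longrightarrow> prime p" "2 \<in> S" and E: "\<And>p. p \<in> S \<Longrightarrow> E p \<noteq> 0"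
    and \<sigma>: "\<sigma> \<in> {-1, 1::int}" and Q: "finite Q" "\<And>q. q \<in> Q \<Longrightarrow> prime q \<and> q \<notin> S \<and> \<not> int q dvd B q" and N: "N \<noteq> 0"
  shows "\<exists>l D. prime l \<and> l \<notin> S \<and> \<not> int l dvd N \<and> \<sigma> * D > 0 \<and> (\<forall>q. prime q \<and> q \<notin> S \<and> int q dvd D \<longrightarrow> q = l) \<and> vp l D = 1
    \<and> (\<forall>p\<in>S. \<forall>K. \<exists>\<epsilon>. \<not> int p dvd \<epsilon> \<and> int p ^ K dvd \<epsilon>^2 * E p - D)
    \<and> (\<forall>q\<in>Q. Legendre (- D) (int q) = Legendre (B q) (int q))"
proof -
  define P where "P = (\<Prod>p\<in>S. int p ^ vp p (E p))"
  define P' where "P' p = (\<Prod>q\<in>S - {p}. int q ^ vp q (E q))" for p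
  have PP: "P = int p ^ vp p (E p) * P' p" if "p \<in> S" for p
    unfolding P_def P'_def using S(1) that by (simp add: prod.remove)
  have nP: "\<not> int q dvd P" if q: "prime q" "q \<notin> S" for q
  proof
    assume "int q dvd P"
    then obtain p where p: "p \<in> S" "int q dvd int p ^ vp p (E p)"
      unfolding P_def using prime_dvd_prod_iff[OF S(1), of "int q"] q(1) by auto
    then have "int q dvd int p" using q(1) prime_dvd_power by (metis prime_nat_int_transfer)
    then show False using prime_not_dvd_prime[OF q(1) S(2)[OF p(1)]] q p(1) by blast
  qed
  have nP': "\<not> int p dvd P' p" if p: "p \<in> S" for p
  proof
    assume "int p dvd P' p"
    then obtain q where q: "q \<in> S" "q \<noteq> p" "int p dvd int q ^ vp q (E q)"
      unfolding P'_def using prime_dvd_prod_iff[of "S - {p}" "int p"] S p by auto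
    then have "int p dvd int q" using S(2)[OF p] prime_dvd_power by (metis prime_nat_int_transfer)
    then show False using prime_not_dvd_prime[OF S(2)[OF p] S(2)[OF q(1)]] q by blast
  qed
  have P0: "P > 0" unfolding P_def using S by (intro prod_pos) (auto simp: prime_gt_0_nat)
  \<comment> \<open>For the product of \<open>\<sigma>\<close>, \<open>P\<close> and l to differ
    from \<open>E p\<close> by a unit square at p, l must lie in the square class of this
    unit.\<close>
  define w where "w p = \<sigma> * P' p * upart p (E p)" for p
  have ns: "\<not> int p dvd \<sigma>" if "prime p" for p using \<sigma> that by (auto simp: not_prime_unit)
  have nw: "\<not> int p dvd w p" if "p \<in> S" for p
    using ns nP'[OF that] vp_upart(2)[OF S(2)[OF that] E[OF that]] S(2)[OF that] unfolding w_def
    by (simp add: prime_dvd_mult_iff)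
  \<comment> \<open>At the primes of Q the condition on the Legendre symbol of -D is solved for that
    of l; at the odd primes of S the value expresses the square class just described.\<close>
  define c where "c q = (if q \<in> S then Legendre (w q) (int q) else Legendre (- \<sigma> * P * B q) (int q))" for q
  have cpm: "c q \<in> {-1, 1}" if "q \<in> (S - {2}) \<union> Q" for q
  proof (cases "q \<in> S")
    case True
    then show ?thesis using Legendre_cases[OF nw[OF True]] by (auto simp: c_def)
  next
    case False
    then have q: "q \<in> Q" using that by blast
    then have n: "\<not> int q dvd - \<sigma> * P * B q" using Q(2)[OF q] ns nP by (simp add: prime_dvd_mult_iff)
    have "c q = Legendre (- \<sigma> * P * B q) (int q)" using False by (simp add: c_def)
    then show ?thesis using Legendre_cases[OF n] by (simp only: insert_iff) blast
  qed
  define M where "M = nat (\<bar>N\<bar> * P * (\<Prod>p\<in>S. int p))"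
  have Spos: "(\<Prod>p\<in>S. int p) > 0" using S by (intro prod_pos) (auto simp: prime_gt_0_nat)
  have Mi: "int M = \<bar>N\<bar> * P * (\<Prod>p\<in>S. int p)" using N P0 Spos by (simp add: M_def)
  have "int M > 0" unfolding Mi using N P0 Spos by simp
  then have M0: "M > 0" by simp
  have ow: "odd (w 2)" using nw[OF S(3)] by simp
  have Q': "finite ((S - {2}) \<union> Q)" "\<And>q. q \<in> (S - {2}) \<union> Q \<Longrightarrow> prime q \<and> q \<noteq> 2" using S Q by auto
  have "\<exists>l. prime l \<and> \<not> l dvd M \<and> int l mod 8 = w 2 mod 8 \<and> (\<forall>q\<in>(S - {2}) \<union> Q. Legendre (int l) (int q) = c q)"
    by (rule prime_with_residues) (fact Q' cpm ow M0)+
  then obtain l where l: "prime l" "\<not> l dvd M" "int l mod 8 = w 2 mod 8" "\<forall>q\<in>(S - {2}) \<union> Q. Legendre (int l) (int q) = c q"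
    by blast
  have lM: "\<not> int l dvd \<bar>N\<bar> * P * (\<Prod>p\<in>S. int p)" using l(2) unfolding Mi[symmetric] by simp
  have lS: "l \<notin> S"
  proof
    assume "l \<in> S"
    then have "int l dvd (\<Prod>p\<in>S. int p)" using S(1) by (intro dvd_prodI) auto
    then show False using lM by simp
  qed
  have lN: "\<not> int l dvd N" using lM by (metis dvd_abs_iff dvd_mult2)
  have lP: "\<not> int l dvd P" using lM by (metis dvd_mult dvd_mult2)
  define D where "D = \<sigma> * P * int l"
  have DS: "\<exists>\<epsilon>. \<not> int p dvd \<epsilon> \<and> int p ^ K dvd \<epsilon>^2 * E p - D" if p: "p \<in> S" for p K
  proof -
    define u x where "u = upart p (E p)" and "x = \<sigma> * P' p * int l"
    have pr: "prime p" using S p by blast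
    have nu: "\<not> int p dvd u" unfolding u_def by (rule vp_upart(2)[OF pr E[OF p]])
    have pl: "\<not> int p dvd int l" using prime_not_dvd_prime[OF pr l(1)] lS p by blast
    have nx: "\<not> int p dvd x" unfolding x_def using ns[OF pr] nP'[OF p] pl pr by (simp add: prime_dvd_mult_iff)
    define A where "A = \<sigma> * P' p"
    have nA: "\<not> int p dvd A" unfolding A_def using ns[OF pr] nP'[OF p] pr by (simp add: prime_dvd_mult_iff)
    have wA: "w p = A * u" "x = A * int l" by (simp_all add: w_def A_def u_def x_def)
    have "\<exists>\<epsilon>. \<not> int p dvd \<epsilon> \<and> int p ^ K dvd \<epsilon>^2 * u - x"
    proof (rule unit_square_ratio[OF pr nu nx])
      assume p2: "p \<noteq> 2"
      have "Legendre x (int p) = Legendre A (int p) * Legendre (int l) (int p)" unfolding wA by (rule Legendre_mult[OF pr p2])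
      also have "Legendre (int l) (int p) = Legendre (A * u) (int p)" using l(4) p p2 by (simp add: c_def wA(1)[symmetric])
      also have "Legendre A (int p) * \<dots> = Legendre (A^2) (int p) * Legendre u (int p)"
        by (simp add: Legendre_mult[OF pr p2] power2_eq_square)
      finally show "Legendre x (int p) = Legendre u (int p)" using Legendre_square[of "int p" A] nA pr by simp
    next
      assume p2: "p = 2"
      have "odd A" using nA p2 by simp
      then have "A mod 8 \<in> {1, 3, 5, 7}" by (rule odd_mod_8)
      then have "(A mod 8)^2 mod 8 = 1" by auto
      then have A1: "A^2 mod 8 = 1" by (simp only: power_mod)
      have "x mod 8 = (A * (int l mod 8)) mod 8" unfolding wA by (simp add: mod_mult_right_eq)
      also have "\<dots> = (A * (A * u)) mod 8" unfolding l(3) using wA(1) p2 by (simp add: mod_mult_right_eq)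
      also have "\<dots> = ((A^2 mod 8) * u) mod 8" by (simp add: mod_mult_left_eq power2_eq_square mult.assoc)
      finally show "x mod 8 = u mod 8" using A1 by simp
    qed
    then obtain \<epsilon> where e: "\<not> int p dvd \<epsilon>" "int p ^ K dvd \<epsilon>^2 * u - x" by blast
    have "\<epsilon>^2 * E p - D = int p ^ vp p (E p) * (\<epsilon>^2 * u - x)"
    proof -
      have "\<epsilon>^2 * E p - D = \<epsilon>^2 * (int p ^ vp p (E p) * u) - \<sigma> * (int p ^ vp p (E p) * P' p) * int l"
        using vp_upart(1)[OF pr E[OF p]] PP[OF p] by (simp add: D_def u_def)
      also have "\<dots> = int p ^ vp p (E p) * (\<epsilon>^2 * u - x)" by (simp add: x_def algebra_simps)
      finally show ?thesis .
    qed
    then show ?thesis using e by (metis dvd_mult)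
  qed
  have DQ: "Legendre (- D) (int q) = Legendre (B q) (int q)" if q: "q \<in> Q" for q
  proof -
    have pr: "prime q" "q \<noteq> 2" "q \<notin> S" using Q(2)[OF q] S(3) by auto
    define A where "A = - \<sigma> * P"
    have nA: "\<not> int q dvd A" using ns[OF pr(1)] nP[OF pr(1,3)] pr by (simp add: A_def prime_dvd_mult_iff)
    have "- D = A * int l" by (simp add: D_def A_def)
    then have "Legendre (- D) (int q) = Legendre A (int q) * Legendre (int l) (int q)" by (simp add: Legendre_mult[OF pr(1,2)])
    also have "Legendre (int l) (int q) = Legendre (A * B q) (int q)" using l(4) q pr by (simp add: c_def A_def)
    also have "Legendre A (int q) * \<dots> = Legendre (A^2) (int q) * Legendre (B q) (int q)"
      by (simp add: Legendre_mult[OF pr(1,2)] power2_eq_square)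
    finally show ?thesis using Legendre_square[of "int q" A] nA pr by simp
  qed
  have "\<sigma> * D > 0" using \<sigma> P0 prime_gt_0_nat[OF l(1)] by (auto simp: D_def)
  moreover have "q = l" if "prime q" "q \<notin> S" "int q dvd D" for q
    using that ns nP[OF that(1,2)] prime_not_dvd_prime[OF that(1) l(1)] unfolding D_def by (auto simp: prime_dvd_mult_iff)
  moreover have "vp l D = 1"
    by (rule vp_eqI[OF l(1), where u = "\<sigma> * P"]) (use ns[OF l(1)] lP l(1) in \<open>auto simp: D_def prime_dvd_mult_iff\<close>)
  ultimately show ?thesis using l(1) lS lN DS DQ by (intro exI[of _ l] exI[of _ D]) blast
qed

text \<open>Given s and t, the equation for D determines c, provided \<Delta> divides D + a t^2 - r
  s t + b s^2. At p in S the extra precision \<open>vp p \<Delta>\<close> ensures this divisibility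
  locally and survives division by \<Delta> as the required congruence for c. At the other primes
  dividing \<Delta> one takes s = 0 and a t^2 = -D to sufficient precision.\<close>

lemma complete_ternary:
  fixes S0 T0 C0 :: "nat \<Rightarrow> int"
  assumes S: "finite S" "\<And>p. p \<in> S \<Longrightarrow> prime p" and \<Delta>: "\<Delta> = 4 * a * b - r^2" "\<Delta> \<noteq> 0"
    and DS: "\<And>p K. p \<in> S \<Longrightarrow> \<exists>\<epsilon>. \<not> int p dvd \<epsilon> \<and>
      int p ^ K dvd \<epsilon>^2 * (C0 p * \<Delta> + r * S0 p * T0 p - a * (T0 p)^2 - b * (S0 p)^2) - D"
    and DQ: "\<And>q K. prime q \<Longrightarrow> q \<notin> S \<Longrightarrow> int q dvd \<Delta> \<Longrightarrow> \<exists>t. int q ^ K dvd a * t^2 + D"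
  shows "\<exists>s t c \<epsilon>. D = c * \<Delta> + r * s * t - a * t^2 - b * s^2 \<and> (\<forall>p\<in>S. \<not> int p dvd \<epsilon> p \<and> int p ^ k p dvd s - \<epsilon> p * S0 p \<and>
    int p ^ k p dvd t - \<epsilon> p * T0 p \<and> int p ^ k p dvd c - (\<epsilon> p)^2 * C0 p)"
proof -
  define K where "K p = k p + vp p \<Delta>" for p
  have "\<forall>p. \<exists>\<epsilon>. p \<in> S \<longrightarrow> \<not> int p dvd \<epsilon> \<and>
      int p ^ K p dvd \<epsilon>^2 * (C0 p * \<Delta> + r * S0 p * T0 p - a * (T0 p)^2 - b * (S0 p)^2) - D" using DS by blast
  then obtain \<epsilon> where \<epsilon>: "\<And>p. p \<in> S \<Longrightarrow> \<not> int p dvd \<epsilon> p"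
    "\<And>p. p \<in> S \<Longrightarrow> int p ^ K p dvd (\<epsilon> p)^2 * (C0 p * \<Delta> + r * S0 p * T0 p - a * (T0 p)^2 - b * (S0 p)^2) - D" by metis
  have "\<forall>q. \<exists>t. prime q \<and> q \<notin> S \<and> int q dvd \<Delta> \<longrightarrow> int q ^ K q dvd a * t^2 + D" using DQ by blast
  then obtain \<tau> where \<tau>: "\<And>q. prime q \<Longrightarrow> q \<notin> S \<Longrightarrow> int q dvd \<Delta> \<Longrightarrow> int q ^ K q dvd a * (\<tau> q)^2 + D" by metis
  define Q where "Q = S \<union> pdivs \<Delta>"
  have Q: "finite Q" "\<And>q. q \<in> Q \<Longrightarrow> prime q" using S finite_pdivs[OF \<Delta>(2)] by (auto simp: Q_def pdivs_def)
  obtain s where s: "\<forall>q\<in>Q. int q ^ K q dvd s - (if q \<in> S then \<epsilon> q * S0 q else 0)"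
    using crt_prime_powers[OF Q, of K "\<lambda>q. if q \<in> S then \<epsilon> q * S0 q else 0"] by (rule exE)
  obtain t where t: "\<forall>q\<in>Q. int q ^ K q dvd t - (if q \<in> S then \<epsilon> q * T0 q else \<tau> q)"
    using crt_prime_powers[OF Q, of K "\<lambda>q. if q \<in> S then \<epsilon> q * T0 q else \<tau> q"] by (rule exE)
  define N where "N = D + a * t^2 - r * s * t + b * s^2"
  have sS: "int p ^ K p dvd s - \<epsilon> p * S0 p" and tS: "int p ^ K p dvd t - \<epsilon> p * T0 p" if "p \<in> S" for p
    using bspec[OF s, of p] bspec[OF t, of p] that by (simp_all add: Q_def)
  have NS: "int p ^ K p dvd N - (\<epsilon> p)^2 * C0 p * \<Delta>" if p: "p \<in> S" for p
  proof -
    define x y where "x = s - \<epsilon> p * S0 p" and "y = t - \<epsilon> p * T0 p"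
    have st: "s = x + \<epsilon> p * S0 p" "t = y + \<epsilon> p * T0 p" by (simp_all add: x_def y_def)
    have "N - (\<epsilon> p)^2 * C0 p * \<Delta> = y * (a * y + 2 * a * (\<epsilon> p * T0 p) - r * s) + x * (b * x + 2 * b * (\<epsilon> p * S0 p) - r * (\<epsilon> p * T0 p))
        - ((\<epsilon> p)^2 * (C0 p * \<Delta> + r * S0 p * T0 p - a * (T0 p)^2 - b * (S0 p)^2) - D)"
      unfolding N_def st by (simp add: algebra_simps power2_eq_square)
    moreover have "int p ^ K p dvd x" "int p ^ K p dvd y" using sS[OF p] tS[OF p] by (simp_all add: x_def y_def)
    ultimately show ?thesis using \<epsilon>(2)[OF p] by (simp only:) (rule dvd_diff, rule dvd_add, simp_all)
  qed
  have "\<Delta> dvd N"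
  proof (rule dvd_by_prime_powers[OF \<Delta>(2)])
    fix q assume q: "prime q" "int q dvd \<Delta>"
    have d: "int q ^ vp q \<Delta> dvd int q ^ K q" by (simp add: K_def power_add)
    show "int q ^ vp q \<Delta> dvd N"
    proof (cases "q \<in> S")
      case True
      have "int q ^ vp q \<Delta> dvd N - (\<epsilon> q)^2 * C0 q * \<Delta>" using NS[OF True] d dvd_trans by blast
      moreover have "int q ^ vp q \<Delta> dvd (\<epsilon> q)^2 * C0 q * \<Delta>" by (simp add: vp_def multiplicity_dvd)
      ultimately show ?thesis by (metis dvd_diff_left_iff)
    next
      case False
      have qQ: "q \<in> Q" using q by (simp add: Q_def pdivs_def)
      have s1: "int q ^ K q dvd s" using bspec[OF s qQ] False by simp
      define y where "y = t - \<tau> q"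
      have t1: "int q ^ K q dvd y" using bspec[OF t qQ] False by (simp add: y_def)
      have ty: "t = y + \<tau> q" by (simp add: y_def)
      have "N = (a * (\<tau> q)^2 + D) + (y * (a * y + 2 * a * \<tau> q) + s * (b * s - r * t))"
        unfolding N_def ty by (simp add: algebra_simps power2_eq_square)
      moreover have "int q ^ K q dvd \<dots>" by (rule dvd_add[OF \<tau>[OF q(1) False q(2)] dvd_add[OF dvd_mult2[OF t1] dvd_mult2[OF s1]]])
      ultimately have "int q ^ K q dvd N" by simp
      then show ?thesis using d dvd_trans by blast
    qed
  qed
  then obtain c where c: "N = \<Delta> * c" by (rule dvdE)
  have kK: "int p ^ k p dvd int p ^ K p" for p by (simp add: K_def power_add)
  have "int p ^ k p dvd c - (\<epsilon> p)^2 * C0 p" if p: "p \<in> S" for p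
  proof -
    define x where "x = c - (\<epsilon> p)^2 * C0 p"
    have pr: "prime p" using S p by blast
    have "N - (\<epsilon> p)^2 * C0 p * \<Delta> = \<Delta> * x" unfolding c x_def by (simp add: algebra_simps)
    also have "\<dots> = int p ^ vp p \<Delta> * (upart p \<Delta> * x)" using vp_upart(1)[OF pr \<Delta>(2)] by (metis mult.assoc)
    finally have "int p ^ vp p \<Delta> * int p ^ k p dvd int p ^ vp p \<Delta> * (upart p \<Delta> * x)"
      using NS[OF p] by (simp add: K_def power_add mult.commute)
    then have "int p ^ k p dvd upart p \<Delta> * x" using pr by (simp add: prime_gt_0_nat)
    moreover have "coprime (int p ^ k p) (upart p \<Delta>)" using vp_upart(2)[OF pr \<Delta>(2)] pr by (simp add: prime_imp_coprime)
    ultimately show ?thesis unfolding x_def by (simp add: coprime_dvd_mult_right_iff)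
  qed
  moreover have "int p ^ k p dvd s - \<epsilon> p * S0 p" "int p ^ k p dvd t - \<epsilon> p * T0 p" if "p \<in> S" for p
    using sS[OF that] tS[OF that] kK dvd_trans by blast+
  moreover have "D = c * \<Delta> + r * s * t - a * t^2 - b * s^2" using c by (simp add: N_def algebra_simps)
  ultimately show ?thesis using \<epsilon>(1) by blast
qed

text \<open>A root x of a x^2 + r x + b modulo q gives the zero (x, 1, 0). Its derivative in the
  first direction is y, which settles a simple root; at a double root the third direction is used,
  where the derivative is (2at - rs)/(2a).\<close>

lemma smooth_zero_binary_root:
  assumes q: "prime q" "\<not> int q dvd 2 * f 0 0" and y: "int q dvd y^2 + (4 * f 0 0 * f 1 1 - (f 0 1)^2)"
    and nd: "\<not> int q dvd y \<or> int q dvd y \<and> \<not> int q dvd 2 * f 0 0 * f 1 2 - f 0 1 * f 0 2"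
  shows "smooth_zero q 3 f"
proof -
  define a b r s t where "a = f 0 0" and "b = f 1 1" and "r = f 0 1" and "s = f 0 2" and "t = f 1 2"
  have qq: "prime (int q)" using q by simp
  have na: "\<not> int q dvd 2 * a" using q(2) by (simp add: a_def)
  obtain h where h: "[2 * a * h = 1] (mod int q)" using inverse_mod_prime[OF q(1) na] by blast
  define x where "x = h * (y - r)"
  have x1: "int q dvd (2 * a * x + r) - y"
  proof -
    have "int q dvd (2 * a * h - 1) * (y - r)" using h by (simp add: cong_iff_dvd_diff)
    then show ?thesis by (simp add: x_def algebra_simps)
  qed
  define v where "v k = (if k = 0 then x else if k = 1 then 1 else (0::int))" for k :: nat
  have F: "qe 3 f v = a * x^2 + r * x + b" by (simp add: qe_3 v_def a_def b_def r_def)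
  have "(2 * a) * (2 * qe 3 f v) = ((2 * a * x + r) - y) * (2 * a * x + r + y) + (y^2 + (4 * a * b - r^2))"
    unfolding F by (simp add: algebra_simps power2_eq_square)
  also have "int q dvd \<dots>" by (rule dvd_add[OF dvd_mult2[OF x1] y[folded a_def b_def r_def]])
  finally have "int q dvd (2 * a) * (2 * qe 3 f v)" .
  moreover have "\<not> int q dvd 2" using na by (metis dvd_mult2)
  ultimately have 1: "int q dvd qe 3 f v" using na qq by (simp only: prime_dvd_mult_iff) blast
  have B0: "qb 3 f v (ev 0) = 2 * a * x + r" by (simp add: qb_3 v_def ev_def a_def r_def)
  have B2: "qb 3 f v (ev 2) = s * x + t" by (simp add: qb_3 v_def ev_def s_def t_def)
  show ?thesis
  proof (cases "int q dvd y")
    case False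
    then have "\<not> int q dvd qb 3 f v (ev 0)" unfolding B0 using x1 by (metis dvd_diff_right_iff)
    then show ?thesis unfolding smooth_zero_def using 1 by blast
  next
    case True
    then have m: "\<not> int q dvd 2 * a * t - r * s" using nd by (simp add: a_def t_def r_def s_def)
    have z: "int q dvd 2 * a * x + r" using x1 True by (metis dvd_diff_left_iff)
    have "\<not> int q dvd s * x + t"
    proof
      assume "int q dvd s * x + t"
      then have "int q dvd (2 * a) * (s * x + t)" by simp
      moreover have "int q dvd s * (2 * a * x + r)" using z by simp
      ultimately have "int q dvd (2 * a) * (s * x + t) - s * (2 * a * x + r)" by (rule dvd_diff)
      then show False using m by (simp add: algebra_simps)
    qed
    then show ?thesis unfolding smooth_zero_def B2[symmetric] using 1 by blast
  qed
qed

text \<open>The only prime outside \<open>S\<close> where isotropy is not forced by construction is the auxiliary prime \<open>l\<close>; there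
  it follows from the product formula for the Hilbert symbols.\<close>
lemma construct_3:
  fixes g :: "nat \<Rightarrow> nat \<Rightarrow> nat \<Rightarrow> int"
  assumes S: "finite S" "\<And>p. p \<in> S \<Longrightarrow> prime p" "2 \<in> S" and e: "\<And>i. e i \<in> {-1, 1::int}"
  shows "\<exists>f \<epsilon>. (\<forall>p\<in>S. \<not> int p dvd \<epsilon> p \<and> int p ^ k p dvd f 0 0 - g p 0 0 \<and> int p ^ k p dvd f 0 1 - g p 0 1 \<and>
      int p ^ k p dvd f 1 1 - g p 1 1 \<and> int p ^ k p dvd f 0 2 - \<epsilon> p * g p 0 2 \<and> int p ^ k p dvd f 1 2 - \<epsilon> p * g p 1 2 \<and>
      int p ^ k p dvd f 2 2 - (\<epsilon> p)^2 * g p 2 2) \<and>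
    rsig 3 (\<lambda>i j. real_of_int (f i j)) (\<lambda>i. real_of_int (e i)) \<and>
    f 0 0 \<noteq> 0 \<and> 4 * f 0 0 * f 1 1 - (f 0 1)^2 \<noteq> 0 \<and> disc3 f \<noteq> 0 \<and>
    (\<forall>q. prime q \<and> q \<notin> S \<longrightarrow> \<not> int q ^ 2 dvd disc3 f) \<and>
    ((\<Prod>p\<in>S. hilb p (- (4 * f 0 0 * f 1 1 - (f 0 1)^2)) (- (f 0 0 * disc3 f))) = (if e 0 = e 1 \<and> e 1 = e 2 then -1 else 1) \<longrightarrow>
      (\<forall>q. prime q \<and> q \<notin> S \<longrightarrow> smooth_zero q 3 f))"
proof -
  obtain a r b where ab: "\<forall>p\<in>S. int p ^ k p dvd a - g p 0 0 \<and> int p ^ k p dvd r - g p 0 1 \<and> int p ^ k p dvd b - g p 1 1"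
    and a: "e 0 * a > 0" and d: "e 0 * e 1 * (4 * a * b - r^2) > 0"
    and ra: "\<forall>q. prime q \<and> q \<notin> S \<and> int q dvd a \<longrightarrow> int q dvd r - 1"
    using binary_part[OF S(1,2) e[of 0] e[of 1], of k "\<lambda>p. g p 0 0" "\<lambda>p. g p 0 1" "\<lambda>p. g p 1 1"] by blast
  define \<Delta> where "\<Delta> = 4 * a * b - r^2"
  have a0: "a \<noteq> 0" using a by auto
  have D0: "\<Delta> \<noteq> 0" using d by (auto simp: \<Delta>_def)
  define Ep where "Ep p c = c * \<Delta> + r * g p 0 2 * g p 1 2 - a * (g p 1 2)^2 - b * (g p 0 2)^2" for p c
  \<comment> \<open>The prescribed data may have determinant 0; shifting the last coefficient by
    \<open>int p ^ k p\<close> respects the required congruence and moves the determinant by a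
    nonzero multiple of \<Delta>.\<close>
  define C0 where "C0 p = (if Ep p (g p 2 2) \<noteq> 0 then g p 2 2 else g p 2 2 + int p ^ k p)" for p
  have C0: "int p ^ k p dvd C0 p - g p 2 2" for p by (simp add: C0_def)
  have E0: "Ep p (C0 p) \<noteq> 0" if "p \<in> S" for p
  proof (cases "Ep p (g p 2 2) = 0")
    case True
    have "Ep p (C0 p) = Ep p (g p 2 2) + int p ^ k p * \<Delta>" using True by (simp add: C0_def Ep_def algebra_simps)
    then show ?thesis using True D0 S(2)[OF that] by (auto simp: prime_gt_0_nat)
  qed (simp add: C0_def)
  define Q where "Q = pdivs \<Delta> - S"
  have Qf: "finite Q" using finite_pdivs[OF D0] by (simp add: Q_def)
  have aD: "\<not> int q dvd \<Delta>" "int q dvd - \<Delta> - 1" if q: "prime q" "q \<notin> S" "int q dvd a" for q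
  proof -
    have r1: "int q dvd r - 1" using ra q by blast
    have "- \<Delta> - 1 = (r - 1) * (r + 1) - 4 * b * a" by (simp add: \<Delta>_def algebra_simps power2_eq_square)
    then show *: "int q dvd - \<Delta> - 1" using r1 q(3) by simp
    show "\<not> int q dvd \<Delta>"
    proof
      assume "int q dvd \<Delta>"
      then have "int q dvd - \<Delta>" by simp
      then have "int q dvd - \<Delta> - (- \<Delta> - 1)" using * by (rule dvd_diff)
      then show False using q(1) by (simp add: not_prime_unit)
    qed
  qed
  have Qp: "prime q \<and> q \<notin> S \<and> \<not> int q dvd a" if "q \<in> Q" for q using that aD by (auto simp: Q_def pdivs_def)
  \<comment> \<open>The last pivot will be D/\<Delta>, and \<Delta> has the sign
    \<open>e 0 * e 1\<close>; so the signature forces this sign on D.\<close>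
  define \<sigma> where "\<sigma> = e 0 * e 1 * e 2"
  have sg: "\<sigma> \<in> {-1, 1}" using e[of 0] e[of 1] e[of 2] by (auto simp: \<sigma>_def)
  have "a * \<Delta> \<noteq> 0" using a0 D0 by simp
  from choose_determinant[where E = "\<lambda>p. Ep p (C0 p)" and B = "\<lambda>_. a", OF S E0 sg Qf Qp this]
  obtain l D where l: "prime l" "l \<notin> S" "\<not> int l dvd a * \<Delta>" and sD: "\<sigma> * D > 0"
    and Dq: "\<forall>q. prime q \<and> q \<notin> S \<and> int q dvd D \<longrightarrow> q = l" and vl: "vp l D = 1"
    and DS: "\<forall>p\<in>S. \<forall>K. \<exists>\<epsilon>. \<not> int p dvd \<epsilon> \<and> int p ^ K dvd \<epsilon>^2 * Ep p (C0 p) - D"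
    and DQ: "\<forall>q\<in>Q. Legendre (- D) (int q) = Legendre a (int q)" by blast
  have Dn: "D \<noteq> 0" using sD by auto
  have la: "\<not> int l dvd a" "\<not> int l dvd \<Delta>" using l(3) by auto
  have DQ': "\<exists>t. int q ^ K dvd a * t^2 + D" if q: "prime q" "q \<notin> S" "int q dvd \<Delta>" for q K
  proof -
    have qQ: "q \<in> Q" using q by (simp add: Q_def pdivs_def)
    have q2: "q \<noteq> 2" using q S(3) by auto
    have "\<not> int q dvd - D" using Dq q la(2) by auto
    then have "\<exists>t. \<not> int q dvd t \<and> int q ^ K dvd t^2 * a - (- D)"
      using unit_square_ratio[OF q(1), of a "- D" K] Qp[OF qQ] DQ qQ q2 by blast
    then show ?thesis by (auto simp: mult.commute)
  qed
  obtain s t c \<epsilon> where D: "D = c * \<Delta> + r * s * t - a * t^2 - b * s^2"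
    and \<epsilon>: "\<forall>p\<in>S. \<not> int p dvd \<epsilon> p \<and> int p ^ k p dvd s - \<epsilon> p * g p 0 2 \<and>
    int p ^ k p dvd t - \<epsilon> p * g p 1 2 \<and> int p ^ k p dvd c - (\<epsilon> p)^2 * C0 p"
    using complete_ternary[OF S(1,2) \<Delta>_def D0 DS[unfolded Ep_def, rule_format] DQ', of k] by blast
  define f2 where "f2 i j = (if j = 0 then a else if i = 0 then r else b)" for i j :: nat
  define f where "f = with_column f2 2 (\<lambda>i. if i = 0 then s else t) c"
  have f: "f 0 0 = a" "f 0 1 = r" "f 1 1 = b" "f 0 2 = s" "f 1 2 = t" "f 2 2 = c"
    by (simp_all add: f_def with_column_def f2_def)
  have fD: "disc3 f = D" unfolding disc3_def f D \<Delta>_def ..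
  have cS: "int p ^ k p dvd c - (\<epsilon> p)^2 * g p 2 2" if p: "p \<in> S" for p
  proof -
    have "c - (\<epsilon> p)^2 * g p 2 2 = (c - (\<epsilon> p)^2 * C0 p) + (\<epsilon> p)^2 * (C0 p - g p 2 2)" by (simp add: algebra_simps)
    also have "int p ^ k p dvd \<dots>" by (rule dvd_add) (use \<epsilon> p C0 in auto)
    finally show ?thesis .
  qed
  have r2: "rsig 2 (\<lambda>i j. real_of_int (f i j)) (\<lambda>i. real_of_int (e i))"
    by (rule rsig_2) (use e a d f in auto)
  have r3: "rsig 3 (\<lambda>i j. real_of_int (f i j)) (\<lambda>i. real_of_int (e i))"
  proof -
    define F where "F i j = real_of_int (f i j)" for i j
    \<comment> \<open>Cramer's rule: v represents the cross terms of the last column, and the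
      remaining pivot, c minus the value at v, is D/\<Delta>.\<close>
    define v where "v i = (if i = 0 then real_of_int (2 * b * s - r * t) / real_of_int \<Delta> else real_of_int (2 * a * t - r * s) / real_of_int \<Delta>)" for i :: nat
    have FF: "F 0 0 = a" "F 0 1 = r" "F 1 1 = b" "F 0 2 = s" "F 1 2 = t" "F 2 2 = c" by (simp_all only: F_def f)
    have rD: "real_of_int \<Delta> \<noteq> 0" using D0 by simp
    have v0: "2 * a * v 0 + r * v 1 = s"
    proof -
      have "2 * a * (2 * b * s - r * t) + r * (2 * a * t - r * s) = s * \<Delta>" by (simp add: \<Delta>_def algebra_simps power2_eq_square)
      then have "real_of_int (2 * a * (2 * b * s - r * t) + r * (2 * a * t - r * s)) = real_of_int (s * \<Delta>)" by (simp only:)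
      then show ?thesis using rD by (simp add: v_def field_simps)
    qed
    have v1: "r * v 0 + 2 * b * v 1 = t"
    proof -
      have "r * (2 * b * s - r * t) + 2 * b * (2 * a * t - r * s) = t * \<Delta>" by (simp add: \<Delta>_def algebra_simps power2_eq_square)
      then have "real_of_int (r * (2 * b * s - r * t) + 2 * b * (2 * a * t - r * s)) = real_of_int (t * \<Delta>)" by (simp only:)
      then show ?thesis using rD by (simp add: v_def field_simps)
    qed
    have qv: "2 * qe 2 F v = s * v 0 + t * v 1"
    proof -
      have "2 * qe 2 F v = (2 * a * v 0 + r * v 1) * v 0 + (r * v 0 + 2 * b * v 1) * v 1"
        using FF by (simp add: qe_def eval_nat_numeral algebra_simps)
      then show ?thesis by (simp only: v0 v1)
    qed
    have cq: "real_of_int \<Delta> * (c - qe 2 F v) = D"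
    proof -
      have dv: "real_of_int \<Delta> * v 0 = 2 * b * s - r * t" "real_of_int \<Delta> * v 1 = 2 * a * t - r * s" using rD by (simp_all add: v_def)
      have "2 * (real_of_int \<Delta> * qe 2 F v) = real_of_int \<Delta> * (2 * qe 2 F v)" by (rule mult.left_commute)
      also have "\<dots> = s * (real_of_int \<Delta> * v 0) + t * (real_of_int \<Delta> * v 1)" unfolding qv by (simp only: distrib_left mult.left_commute)
      also have "\<dots> = s * (2 * b * s - r * t) + t * (2 * a * t - r * s)" unfolding dv by simp
      finally have "2 * (real_of_int \<Delta> * qe 2 F v) = s * (2 * b * s - r * t) + t * (2 * a * t - r * s)" .
      moreover have "real_of_int D = c * real_of_int \<Delta> + r * s * t - a * t^2 - b * s^2" unfolding D by simp
      ultimately show ?thesis by (simp add: algebra_simps power2_eq_square)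
    qed
    have "rsig (Suc 2) F ((\<lambda>i. real_of_int (e i))(2 := real_of_int (e 2)))"
    proof (rule rsig_step_pos[where c = v])
      show "rsig 2 F (\<lambda>i. real_of_int (e i))" using r2 by (rule rsig_cong) (auto simp: F_def)
      show "qb 2 F x v = (\<Sum>i<2. F i 2 * x i)" for x
      proof -
        have "qb 2 F x v = x 0 * (2 * a * v 0 + r * v 1) + x 1 * (r * v 0 + 2 * b * v 1)"
          using FF by (simp add: qb_def eval_nat_numeral algebra_simps)
        also have "\<dots> = (\<Sum>i<2. F i 2 * x i)" unfolding v0 v1 using FF by (simp add: eval_nat_numeral mult.commute)
        finally show ?thesis .
      qed
      show "real_of_int (e 2) \<in> {-1, 1}" using e[of 2] by auto
      have "(e 0 * e 1 * \<Delta>) * ((e 0 * e 1 * \<Delta>) * (e 2 * (c - qe 2 F v))) = (e 0 * e 1 * \<Delta>) * (\<sigma> * (real_of_int \<Delta> * (c - qe 2 F v)))"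
        by (simp add: \<sigma>_def mult_ac)
      also have "\<dots> = real_of_int ((e 0 * e 1 * \<Delta>) * (\<sigma> * D))" unfolding cq by simp
      also have "\<dots> > 0" unfolding of_int_0_less_iff using d sD by (simp add: \<Delta>_def)
      finally have pos: "(e 0 * e 1 * \<Delta>) * ((e 0 * e 1 * \<Delta>) * (e 2 * (c - qe 2 F v))) > 0" .
      have p: "real_of_int (e 0 * e 1 * \<Delta>) > 0" unfolding of_int_0_less_iff using d by (simp add: \<Delta>_def)
      have "e 2 * (c - qe 2 F v) > 0" by (rule zero_less_mult_pos[OF zero_less_mult_pos[OF pos p] p])
      then show "(F 2 2 - qe 2 F v) * real_of_int (e 2) > 0" using FF by (simp only: mult.commute)
    qed
    then have "rsig 3 F ((\<lambda>i. real_of_int (e i))(2 := real_of_int (e 2)))" by (simp only: numeral_3_eq_3 numeral_2_eq_2)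
    then show ?thesis unfolding F_def by (rule rsig_cong) auto
  qed
  have sqf: "\<not> int q ^ 2 dvd D" if q: "prime q" "q \<notin> S" for q
  proof
    assume q2: "int q ^ 2 dvd D"
    then have "int q dvd D" by (metis dvd_mult_left power2_eq_square)
    then have "q = l" using Dq q by blast
    then have "2 \<le> vp l D" unfolding vp_def using q2 Dn q(1) by (intro multiplicity_geI) (auto simp: not_prime_unit)
    then show False using vl by simp
  qed
  have leg: "Legendre (- \<Delta>) (int l) = 1"
    if P: "(\<Prod>p\<in>S. hilb p (- \<Delta>) (- (a * D))) = (if e 0 = e 1 \<and> e 1 = e 2 then -1 else 1)"
  proof -
    define A where "A = pdivs (a * \<Delta>) - S"
    have lA: "l \<notin> A" using l by (auto simp: A_def pdivs_def)
    have fin: "finite A" using finite_pdivs[of "a * \<Delta>"] a0 D0 by (simp add: A_def)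
    have "hprod (S \<union> (insert l A)) (- \<Delta>) (- (a * D)) = 1"
    proof (rule hilbert_product_formula)
      fix q assume q: "prime q" "int q dvd - \<Delta> * - (a * D)"
      then have "int q dvd (a * \<Delta>) * D" by (simp add: mult_ac)
      then have "int q dvd a * \<Delta> \<or> int q dvd D" using q(1) by (simp only: prime_dvd_mult_iff prime_nat_int_transfer)
      then show "q \<in> S \<union> insert l A" using Dq q(1) by (auto simp: A_def pdivs_def)
    qed (use S fin l a0 D0 Dn in \<open>auto simp: A_def pdivs_def\<close>)
    moreover have "(\<Prod>q\<in>S \<union> insert l A. hilb q (- \<Delta>) (- (a * D))) = (\<Prod>q\<in>S. hilb q (- \<Delta>) (- (a * D))) * (hilb l (- \<Delta>) (- (a * D)) * (\<Prod>q\<in>A. hilb q (- \<Delta>) (- (a * D))))"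
      by (subst prod.union_disjoint) (use S fin l lA in \<open>auto simp: A_def\<close>)
    \<comment> \<open>If q divides a, then -\<Delta> is 1 modulo q; if q divides \<Delta>, then D
      was chosen so that -aD is a square modulo q. Either way the symbol is trivial.\<close>
    moreover have "(\<Prod>q\<in>A. hilb q (- \<Delta>) (- (a * D))) = 1"
    proof (rule prod.neutral, rule ballI)
      fix q assume "q \<in> A"
      then have q: "prime q" "q \<notin> S" "int q dvd a * \<Delta>" by (auto simp: A_def pdivs_def)
      have q2: "q \<noteq> 2" using q S by auto
      show "hilb q (- \<Delta>) (- (a * D)) = 1"
      proof (cases "int q dvd a")
        case True
        have n: "\<not> int q dvd - \<Delta>" using aD[OF q(1,2) True] by simp
        have "Legendre (- \<Delta>) (int q) = Legendre 1 (int q)"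
          by (rule Legendre_cong) (use aD(2)[OF q(1,2) True] in \<open>simp only: cong_iff_dvd_diff\<close>)
        then have "Legendre (- \<Delta>) (int q) = 1" using Legendre_1[OF q(1)] by simp
        then show ?thesis using hilb_unit_right[OF q(1) q2 n, of "- (a * D)"] hilb_sym[of q "- \<Delta>" "- (a * D)"] by simp
      next
        case False
        then have d: "int q dvd \<Delta>" using q by (auto simp: prime_dvd_mult_iff)
        then have qQ: "q \<in> Q" using q by (simp add: Q_def pdivs_def)
        have nD: "\<not> int q dvd D" using Dq q la(2) d by auto
        then have n: "\<not> int q dvd - (a * D)" using False q(1) by (simp add: prime_dvd_mult_iff)
        have "Legendre (- (a * D)) (int q) = Legendre (a * (- D)) (int q)" by simp
        also have "\<dots> = Legendre a (int q) * Legendre a (int q)" unfolding Legendre_mult[OF q(1) q2] using DQ qQ by simp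
        also have "\<dots> = 1" using Legendre_cases[OF False] by auto
        finally show ?thesis using hilb_unit_right[OF q(1) q2 n] by simp
      qed
    qed
    \<comment> \<open>The prime l divides D exactly once and neither a nor \<Delta>, so the symbol
      at l reduces to a Legendre symbol.\<close>
    moreover have "hilb l (- \<Delta>) (- (a * D)) = Legendre (- \<Delta>) (int l)"
    proof -
      have l2: "l \<noteq> 2" using l S by auto
      have "vp l (- (a * D)) = vp l ((- a) * D)" by simp
      also have "\<dots> = 1" using vp_mult(1)[OF l(1), of "- a" D] a0 Dn vl vp_unit[OF l(1), of "- a"] la by simp
      finally show ?thesis using hilb_unit_right[OF l(1) l2, of "- \<Delta>" "- (a * D)"] la hilb_sym[of l "- \<Delta>" "- (a * D)"] by simp
    qed
    \<comment> \<open>The symbol at infinity is -1 exactly for definite forms: \<Delta> > 0 and aD >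
      0 mean that all three signs agree.\<close>
    moreover have "hilb_inf (- \<Delta>) (- (a * D)) = (if e 0 = e 1 \<and> e 1 = e 2 then -1 else 1)"
    proof -
      have "\<Delta> > 0 \<longleftrightarrow> e 0 = e 1" using d D0 e[of 0] e[of 1] unfolding \<Delta>_def[symmetric] by auto
      moreover have "a * D > 0 \<longleftrightarrow> e 1 = e 2"
        using a sD e[of 0] e[of 1] e[of 2] unfolding \<sigma>_def by (auto simp: zero_less_mult_iff)
      ultimately show ?thesis unfolding hilb_inf_def by simp
    qed
    ultimately show ?thesis using P unfolding hprod_def by (auto split: if_splits)
  qed
  have sm: "smooth_zero q 3 f"
    if P: "(\<Prod>p\<in>S. hilb p (- \<Delta>) (- (a * D))) = (if e 0 = e 1 \<and> e 1 = e 2 then -1 else 1)" and q: "prime q" "q \<notin> S" for q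
  proof -
    have q2: "q \<noteq> 2" using q S by auto
    have n2: "\<not> int q dvd 2" using prime_not_dvd_prime[OF q(1) two_is_prime_nat q2] by simp
    have qp: "prime (int q)" using q by simp
    show ?thesis
    proof (cases "int q dvd a")
      case True
      then have "int q dvd r - 1" using ra q by blast
      then have "\<not> int q dvd r" using qp by (metis dvd_diff_right_iff not_prime_unit)
      then show ?thesis using True f by (intro smooth_zero_coeff[of 0 1]) auto
    next
      case na: False
      then have n2a: "\<not> int q dvd 2 * f 0 0" using n2 qp f by (simp add: prime_dvd_mult_iff)
      show ?thesis
      proof (cases "int q dvd \<Delta>")
        case True
        have nD: "\<not> int q dvd D" using Dq q la(2) True by auto
        define m where "m = 2 * a * t - r * s"
        \<comment> \<open>Modulo a prime dividing \<Delta> this reads m^2 = -4aD, so m is a unit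
          there and the double root of the binary part is nonsingular in the third
          direction.\<close>
        have "m^2 + (2 * a) * (2 * D) = \<Delta> * (4 * a * c - s^2)" unfolding D \<Delta>_def m_def by (simp add: algebra_simps power2_eq_square)
        then have mm: "int q dvd m^2 + (2 * a) * (2 * D)" using True by simp
        have "\<not> int q dvd m"
        proof
          assume "int q dvd m"
          then have "int q dvd m^2" by (simp add: power2_eq_square)
          then have "int q dvd (2 * a) * (2 * D)" using mm by (metis dvd_add_right_iff)
          then show False using nD na n2 qp by (simp only: prime_dvd_mult_iff) blast
        qed
        then show ?thesis using True by (intro smooth_zero_binary_root[where f = f and y = 0, OF q(1) n2a]) (auto simp: f \<Delta>_def m_def simp del: One_nat_def)
      next
        case nd: False
        show ?thesis
        proof (cases "q = l")
          case False
          then have "\<not> int q dvd D" using Dq q by blast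
          then show ?thesis using na nd q q2 fD f by (intro smooth_zero_conic) (auto simp: \<Delta>_def simp del: One_nat_def)
        next
          case True
          \<comment> \<open>At l the binary part itself splits with distinct roots, since -\<Delta>
            is a nonzero square.\<close>
          have "QuadRes (int q) (- \<Delta>)" using leg[OF P] True unfolding Legendre_def by (simp split: if_splits)
          then obtain y where "[y^2 = - \<Delta>] (mod int q)" unfolding QuadRes_def by blast
          then have y: "int q dvd y^2 + \<Delta>" by (simp add: cong_iff_dvd_diff)
          have "\<not> int q dvd y"
          proof
            assume "int q dvd y"
            then have "int q dvd y^2" by (simp add: power2_eq_square)
            then show False using y nd by (metis dvd_add_right_iff)
          qed
          then show ?thesis using y by (intro smooth_zero_binary_root[where f = f and y = y, OF q(1) n2a]) (auto simp: f \<Delta>_def simp del: One_nat_def)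
        qed
      qed
    qed
  qed
  show ?thesis
    by (intro exI[of _ f] exI[of _ \<epsilon>]) (use \<epsilon> ab cS r3 a0 D0 Dn sqf sm fD f in \<open>simp add: \<Delta>_def del: One_nat_def\<close>)
qed

text \<open>The diagonalizing substitution is not unimodular: its determinant is h = 4 a \<Delta> up
  to sign. The fixed power of p lost in either direction is absorbed by the descent to primitive
  zeros.\<close>

lemma isotropic_3_iff_hilb:
  assumes p: "prime p" and a: "f 0 0 \<noteq> 0" and d: "4 * f 0 0 * f 1 1 - (f 0 1)^2 \<noteq> 0" and D: "disc3 f \<noteq> 0"
  shows "isotropic (Zp p) 3 (base_change (Zp p) f) \<longleftrightarrow>
    hilb p (- (4 * f 0 0 * f 1 1 - (f 0 1)^2)) (- (f 0 0 * disc3 f)) = 1"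
proof -
  define a b c r s t where "a = f 0 0" and "b = f 1 1" and "c = f 2 2" and "r = f 0 1" and "s = f 0 2" and "t = f 1 2"
  define \<Delta> m D where "\<Delta> = 4 * a * b - r^2" and "m = 2 * a * t - r * s" and "D = disc3 f"
  have Dd: "D = c * \<Delta> + r * s * t - a * t^2 - b * s^2" by (simp add: D_def disc3_def \<Delta>_def a_def b_def c_def r_def s_def t_def)
  have F: "qe 3 f v = a * (v 0)^2 + r * v 0 * v 1 + b * (v 1)^2 + s * v 0 * v 2 + t * v 1 * v 2 + c * (v 2)^2" for v
    by (simp add: qe_3 a_def b_def c_def r_def s_def t_def)
  \<comment> \<open>Completing the square turns \<open>4 a \<Delta> f\<close> into the conic \<open>Y\<^sup>2 + \<Delta> X\<^sup>2 + a D Z\<^sup>2\<close>.\<close>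
  have id: "tern (- \<Delta>) (- (a * D)) (\<Delta> * v 1 + m * v 2) (2 * a * v 0 + r * v 1 + s * v 2) (2 * v 2) = 4 * a * \<Delta> * qe 3 f v" for v
    unfolding F tern_def Dd unfolding \<Delta>_def m_def by (simp add: algebra_simps power2_eq_square)
  define h where "h = 4 * a * \<Delta>"
  have h0: "h \<noteq> 0" using a d by (simp add: h_def a_def \<Delta>_def b_def r_def)
  define C where "C = Suc (vp p h)"
  have all3: "(\<forall>i<3. P i) \<longleftrightarrow> P 0 \<and> P 1 \<and> P 2" for P :: "nat \<Rightarrow> bool"
    by (auto simp: eval_nat_numeral less_Suc_eq)
  have "(\<forall>k. \<exists>x. (\<exists>i<3. \<not> int p dvd x i) \<and> int p ^ k dvd qe 3 f x) \<longleftrightarrow> conic_iso p (- \<Delta>) (- (a * D))"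
  proof
    assume L: "\<forall>k. \<exists>x. (\<exists>i<3. \<not> int p dvd x i) \<and> int p ^ k dvd qe 3 f x"
    show "conic_iso p (- \<Delta>) (- (a * D))"
    proof (rule conic_isoI[OF p, where c = C])
      fix k
      obtain x where x: "\<exists>i<3. \<not> int p dvd x i" "int p ^ k dvd qe 3 f x" using L by blast
      define X Y Z where "X = 2 * a * x 0 + r * x 1 + s * x 2" and "Y = \<Delta> * x 1 + m * x 2" and "Z = 2 * x 2"
      have dv: "int p ^ k dvd tern (- \<Delta>) (- (a * D)) Y X Z" unfolding X_def Y_def Z_def id using x(2) by simp
      have "\<not> (int p ^ C dvd Y \<and> int p ^ C dvd X \<and> int p ^ C dvd Z)"
      proof
        assume "int p ^ C dvd Y \<and> int p ^ C dvd X \<and> int p ^ C dvd Z"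
        then have XYZ: "int p ^ C dvd Y" "int p ^ C dvd X" "int p ^ C dvd Z" by auto
        have "h * x 2 = (2 * a * \<Delta>) * Z" "h * x 1 = (4 * a) * Y - (2 * a * m) * Z"
          "h * x 0 = (2 * \<Delta>) * X - (2 * r) * Y + (r * m - s * \<Delta>) * Z"
          by (simp_all add: h_def X_def Y_def Z_def algebra_simps)
        moreover have "int p ^ C dvd (2 * a * \<Delta>) * Z" using XYZ by simp
        moreover have "int p ^ C dvd (4 * a) * Y - (2 * a * m) * Z" using XYZ by simp
        moreover have "int p ^ C dvd (2 * \<Delta>) * X - (2 * r) * Y + (r * m - s * \<Delta>) * Z"
          using XYZ by (intro dvd_add) (auto intro: dvd_diff)
        ultimately have "int p dvd x 0" "int p dvd x 1" "int p dvd x 2"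
          using dvd_mult_vp[OF p h0] unfolding C_def by metis+
        then show False using x(1) all3[of "\<lambda>i. int p dvd x i"] by blast
      qed
      then show "\<exists>x y z. \<not> (int p ^ C dvd x \<and> int p ^ C dvd y \<and> int p ^ C dvd z) \<and> int p ^ k dvd tern (- \<Delta>) (- (a * D)) x y z"
        using dv by blast
    qed
  next
    assume R: "conic_iso p (- \<Delta>) (- (a * D))"
    show "\<forall>k. \<exists>x. (\<exists>i<3. \<not> int p dvd x i) \<and> int p ^ k dvd qe 3 f x"
    proof
      fix k
      obtain Y X Z where XYZ: "\<not> (int p dvd Y \<and> int p dvd X \<and> int p dvd Z)" "int p ^ (k + 2 * C) dvd tern (- \<Delta>) (- (a * D)) Y X Z"
        using R unfolding conic_iso_def by blast
      \<comment> \<open>The inverse substitution multiplied by h, so that it has integer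
        coefficients.\<close>
      define v where "v i = (if i = 0 then 2 * \<Delta> * X - 2 * r * Y + r * m * Z - s * \<Delta> * Z
        else if i = 1 then 4 * a * Y - 2 * a * m * Z else 2 * a * \<Delta> * Z)" for i :: nat
      have eqs: "\<Delta> * v 1 + m * v 2 = h * Y" "2 * a * v 0 + r * v 1 + s * v 2 = h * X" "2 * v 2 = h * Z"
        by (simp_all add: v_def h_def algebra_simps)
      have "h * qe 3 f v = tern (- \<Delta>) (- (a * D)) (h * Y) (h * X) (h * Z)" using id[of v] unfolding eqs h_def by simp
      also have "\<dots> = h * (h * tern (- \<Delta>) (- (a * D)) Y X Z)" unfolding tern_def by (simp add: algebra_simps power2_eq_square)
      finally have "qe 3 f v = h * tern (- \<Delta>) (- (a * D)) Y X Z" using h0 by simp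
      then have 1: "int p ^ (k + 2 * C) dvd qe 3 f v" using XYZ(2) by simp
      have 2: "\<not> (\<forall>i<3. int p ^ C dvd v i)"
      proof
        assume "\<forall>i<3. int p ^ C dvd v i"
        then have v: "int p ^ C dvd v 0" "int p ^ C dvd v 1" "int p ^ C dvd v 2" by (auto simp: all3)
        have "int p ^ C dvd h * Y" unfolding eqs[symmetric] using v by simp
        moreover have "int p ^ C dvd h * X" unfolding eqs[symmetric] using v by simp
        moreover have "int p ^ C dvd h * Z" unfolding eqs[symmetric] using v by simp
        ultimately show False using dvd_mult_vp[OF p h0] XYZ(1) unfolding C_def by blast
      qed
      show "\<exists>x. (\<exists>i<3. \<not> int p dvd x i) \<and> int p ^ k dvd qe 3 f x" by (rule primitive_reduce[OF p 2 1])
    qed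
  qed
  also have "\<dots> \<longleftrightarrow> hilb p (- \<Delta>) (- (a * D)) = 1"
    by (rule conic_iso_iff_hilb[OF p]) (use a d D in \<open>auto simp: a_def b_def r_def D_def \<Delta>_def\<close>)
  finally show ?thesis unfolding base_isotropic_iff[OF p] by (simp add: a_def b_def r_def D_def \<Delta>_def)
qed

section \<open>Assembly of the global form\<close>

lemma isometric_isotropic_iff:
  fixes R (structure)
  assumes R: "cring R" and iso: "isometric R n f g"
  shows "isotropic R n f \<longleftrightarrow> isotropic R n g"
proof -
  let ?M = "coord_mod R n"
  interpret M: module R ?M by (rule coord_mod_module[OF R])
  obtain \<phi> where \<phi>: "\<phi> \<in> iso (add_monoid ?M) (add_monoid ?M)" "\<And>x. x \<in> carrier ?M \<Longrightarrow> qeval R n g (\<phi> x) = qeval R n f x"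
    using iso unfolding isometric_def by blast
  have hom: "\<phi> \<in> hom (add_monoid ?M) (add_monoid ?M)" and bij: "bij_betw \<phi> (carrier ?M) (carrier ?M)"
    using \<phi>(1) by (auto simp: iso_def)
  have z: "\<phi> \<zero>\<^bsub>?M\<^esub> = \<zero>\<^bsub>?M\<^esub>" using hom_one[OF hom M.a_group M.a_group] by simp
  have nz: "\<phi> x \<noteq> \<zero>\<^bsub>?M\<^esub> \<longleftrightarrow> x \<noteq> \<zero>\<^bsub>?M\<^esub>" if "x \<in> carrier ?M" for x
    using bij that z M.zero_closed unfolding bij_betw_def inj_on_def by metis
  have "isotropic R n g \<longleftrightarrow> (\<exists>x\<in>\<phi> ` carrier ?M. x \<noteq> \<zero>\<^bsub>?M\<^esub> \<and> qeval R n g x = \<zero>)"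
    using bij unfolding isotropic_def bij_betw_def by simp
  also have "\<dots> \<longleftrightarrow> isotropic R n f" unfolding isotropic_def using nz \<phi>(2) by auto
  finally show ?thesis by simp
qed

text \<open>Specializes the isometry threshold to an initial substitution that rescales the
  variables by units. In the ternary case only the last variable is rescaled; for n \<ge> 4 all
  factors are 1.\<close>

lemma isometric_by_diagonal:
  fixes f g :: "nat \<Rightarrow> nat \<Rightarrow> int"
  assumes thr: "\<forall>f. (\<forall>K. \<exists>W V. inv_mod (int p ^ K) n W V \<and> (\<forall>x. int p ^ k dvd qe n f (mv n W x) - qe n g x))
      \<longrightarrow> isometric (Zp p) n (base_change (Zp p) f) F"
    and diag: "\<And>K. \<exists>v w. (\<forall>i<n. int p ^ K dvd v i * w i - 1) \<and> (\<forall>i j. i \<le> j \<longrightarrow> j < n \<longrightarrow> int p ^ k dvd f i j * w i * w j - g i j)"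
  shows "isometric (Zp p) n (base_change (Zp p) f) F"
proof -
  define dg where "dg w i j = (if i = j then w i else 0)" for w :: "nat \<Rightarrow> int" and i j :: nat
  have mv: "mv n (dg w) x i = w i * x i" if "i < n" for w x i
  proof -
    have "mv n (dg w) x i = (\<Sum>j<n. if j = i then w i * x i else 0)" unfolding mv_def dg_def by (rule sum.cong) auto
    then show ?thesis using that by simp
  qed
  have "\<exists>W V. inv_mod (int p ^ K) n W V \<and> (\<forall>x. int p ^ k dvd qe n f (mv n W x) - qe n g x)" for K
  proof -
    obtain v w where vw: "\<forall>i<n. int p ^ K dvd v i * w i - 1" "\<forall>i j. i \<le> j \<longrightarrow> j < n \<longrightarrow> int p ^ k dvd f i j * w i * w j - g i j"
      using diag by blast
    have "int p ^ K dvd v i * (w i * y) - y" "int p ^ K dvd w i * (v i * y) - y" if "i < n" for i y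
    proof -
      have "int p ^ K dvd (v i * w i - 1) * y" using vw(1) that by simp
      then show "int p ^ K dvd v i * (w i * y) - y" "int p ^ K dvd w i * (v i * y) - y" by (simp_all add: algebra_simps)
    qed
    then have "inv_mod (int p ^ K) n (dg w) (dg v)" unfolding inv_mod_def by (simp add: mv)
    moreover have "int p ^ k dvd qe n f (mv n (dg w) x) - qe n g x" for x
    proof -
      have "qe n f (mv n (dg w) x) = qe n f (\<lambda>i. w i * x i)" by (rule qe_cong) (simp_all add: mv)
      also have "\<dots> = qe n (\<lambda>i j. f i j * w i * w j) x" unfolding qe_def by (simp add: mult_ac)
      finally show ?thesis using vw(2) by (simp add: qe_dvd_cong)
    qed
    ultimately show ?thesis by blast
  qed
  then show ?thesis using thr by blast
qed

theorem theorem5p1: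
  fixes n r s :: nat
    and S T :: "nat set"
    and F :: "nat \<Rightarrow> nat \<Rightarrow> nat \<Rightarrow> padic"
  assumes "n \<ge> 3"
    and "r + s = n"
    and "finite S"
    and "\<forall>p\<in>S. prime p"
    and "T \<subseteq> S"
    and "n = 3 \<longrightarrow> (if r * s = 0 then odd (card T) else even (card T))"
    and "\<forall>p\<in>S. qform (Zp p) n (F p)"
    and "\<forall>p\<in>S. nondegenerate (Zp p) n (F p)"
    and "\<forall>p\<in>S. anisotropic (Zp p) n (F p) \<longleftrightarrow> p \<in> T"
  shows "\<exists>f :: nat \<Rightarrow> nat \<Rightarrow> int.
    (\<forall>p\<in>S. isometric (Zp p) n (base_change (Zp p) f) (F p)) \<and>
    has_signature (base_change real_ring f) r s \<and>
    (n = 3 \<longrightarrow> (\<forall>p. prime p \<and> p \<notin> S \<longrightarrow>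
       isotropic (Zp p) n (base_change (Zp p) f) \<and>
       maximal_form p n (base_change (Zp p) f) \<and>
       universal (Zp p) n (base_change (Zp p) f))) \<and>
    (n \<ge> 4 \<longrightarrow> (\<forall>p. prime p \<and> p \<notin> S \<longrightarrow>
       universal (Zp p) n (base_change (Zp p) f)))"
proof -
  have S: "finite S" "\<And>p. p \<in> S \<Longrightarrow> prime p" using assms(3,4) by auto
  define thr where "thr p k g \<longleftrightarrow> (\<forall>f. (\<forall>K. \<exists>W V. inv_mod (int p ^ K) n W V \<and>
      (\<forall>x. int p ^ k dvd qe n f (mv n W x) - qe n g x)) \<longrightarrow> isometric (Zp p) n (base_change (Zp p) f) (F p))" for p k g
  have "\<forall>p\<in>S. \<exists>k g. thr p k g"
  proof
    fix p assume "p \<in> S"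
    then have "\<exists>k g. k \<ge> 1 \<and> thr p k g" unfolding thr_def using assms(4,7,8) by (intro padic_isometry_threshold) auto
    then show "\<exists>k g. thr p k g" by blast
  qed
  then obtain k0 g0 where "\<And>p. p \<in> S \<Longrightarrow> thr p (k0 p) (g0 p)" by metis
  note kg = this[unfolded thr_def]
  \<comment> \<open>With 2 adjoined, the criteria in which 2 must be invertible apply at every
    remaining prime.\<close>
  define S' where "S' = insert 2 S"
  have S': "finite S'" "\<And>p. p \<in> S' \<Longrightarrow> prime p" "2 \<in> S'" using S by (auto simp: S'_def)
  define k where "k p = (if p \<in> S then k0 p else 1)" for p
  \<comment> \<open>If \<open>2 \<notin> S\<close>, the form is made congruent to \<open>x\<^sub>0x\<^sub>1 + x\<^sub>2\<^sup>2\<close> modulo 2.\<close>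
  define g where "g p = (if p \<in> S then g0 p else (\<lambda>i j. if i = 0 \<and> j = 1 \<or> i = 2 \<and> j = 2 then 1 else 0))" for p
  define e where "e i = (if i < r then 1 else -1 :: int)" for i
  have e: "\<And>i. e i \<in> {-1, 1}" by (simp add: e_def)
  have sig: "has_signature (base_change real_ring f) r s" if "rsig n (\<lambda>i j. real_of_int (f i j)) (\<lambda>i. real_of_int (e i))" for f
  proof (rule rsig_has_signature)
    show "rsig (r + s) (\<lambda>i j. real_of_int (f i j)) (\<lambda>i. if i < r then 1 else -1)"
      unfolding assms(2) using that by (rule rsig_cong) (auto simp: e_def)
  qed
  show ?thesis
  proof (cases "n = 3")
    case False
    then have n4: "n \<ge> 4" using assms(1) by simp
    obtain f where f: "\<forall>p\<in>S'. \<forall>i j. i \<le> j \<longrightarrow> j < n \<longrightarrow> int p ^ k p dvd f i j - g p i j"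
      "rsig n (\<lambda>i j. real_of_int (f i j)) (\<lambda>i. real_of_int (e i))" "\<forall>q. prime q \<and> q \<notin> S' \<longrightarrow> smooth_zero q n f"
      using construct_ge4[where e = e and k = k and g = g, OF S' n4 e] by blast
    have "isometric (Zp p) n (base_change (Zp p) f) (F p)" if p: "p \<in> S" for p
    proof (rule isometric_by_diagonal[OF kg[OF p]])
      have "\<forall>i j. i \<le> j \<longrightarrow> j < n \<longrightarrow> int p ^ k0 p dvd f i j - g0 p i j"
        using bspec[OF f(1), of p] p by (simp add: S'_def k_def g_def)
      then show "\<exists>v w. (\<forall>i<n. int p ^ K dvd v i * w i - 1) \<and> (\<forall>i j. i \<le> j \<longrightarrow> j < n \<longrightarrow> int p ^ k0 p dvd f i j * w i * w j - g0 p i j)" for K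
        by (intro exI[of _ "\<lambda>_. 1"]) simp
    qed
    moreover have "smooth_zero q n f" if q: "prime q" "q \<notin> S" for q
    proof (cases "q = 2")
      case True
      have "\<forall>i j. i \<le> j \<longrightarrow> j < n \<longrightarrow> 2 dvd f i j - (if i = 0 \<and> j = 1 \<or> i = 2 \<and> j = 2 then 1 else 0)"
        using bspec[OF f(1) S'(3)] q(2) True by (simp add: k_def g_def)
      from this[rule_format, of 0 0] this[rule_format, of 0 1] show ?thesis
        using n4 True by (intro smooth_zero_coeff[of 0 1]) auto
    qed (use f(3) q in \<open>auto simp: S'_def\<close>)
    ultimately show ?thesis using False sig[OF f(2)] smooth_zero_universal by (intro exI[of _ f]) blast
  next
    case n3: True
    obtain f \<epsilon> where f: "\<forall>p\<in>S'. \<not> int p dvd \<epsilon> p \<and> int p ^ k p dvd f 0 0 - g p 0 0 \<and> int p ^ k p dvd f 0 1 - g p 0 1 \<and>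
        int p ^ k p dvd f 1 1 - g p 1 1 \<and> int p ^ k p dvd f 0 2 - \<epsilon> p * g p 0 2 \<and> int p ^ k p dvd f 1 2 - \<epsilon> p * g p 1 2 \<and>
        int p ^ k p dvd f 2 2 - (\<epsilon> p)^2 * g p 2 2"
      and rs: "rsig 3 (\<lambda>i j. real_of_int (f i j)) (\<lambda>i. real_of_int (e i))"
      and nz: "f 0 0 \<noteq> 0" "4 * f 0 0 * f 1 1 - (f 0 1)^2 \<noteq> 0" "disc3 f \<noteq> 0"
      and sqf: "\<forall>q. prime q \<and> q \<notin> S' \<longrightarrow> \<not> int q ^ 2 dvd disc3 f"
      and sm: "(\<Prod>p\<in>S'. hilb p (- (4 * f 0 0 * f 1 1 - (f 0 1)^2)) (- (f 0 0 * disc3 f))) = (if e 0 = e 1 \<and> e 1 = e 2 then -1 else 1)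
        \<longrightarrow> (\<forall>q. prime q \<and> q \<notin> S' \<longrightarrow> smooth_zero q 3 f)"
      using construct_3[where e = e and k = k and g = g, OF S' e] by blast
    have iso: "isometric (Zp p) n (base_change (Zp p) f) (F p)" if p: "p \<in> S" for p
    proof (rule isometric_by_diagonal[OF kg[OF p]])
      fix K
      have pr: "prime (int p)" using S(2) p by simp
      have fp: "\<not> int p dvd \<epsilon> p" "int p ^ k0 p dvd f 0 0 - g0 p 0 0" "int p ^ k0 p dvd f 0 1 - g0 p 0 1"
        "int p ^ k0 p dvd f 1 1 - g0 p 1 1" "int p ^ k0 p dvd f 0 2 - \<epsilon> p * g0 p 0 2" "int p ^ k0 p dvd f 1 2 - \<epsilon> p * g0 p 1 2"
        "int p ^ k0 p dvd f 2 2 - (\<epsilon> p)^2 * g0 p 2 2"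
        using bspec[OF f, of p] p by (simp_all add: S'_def k_def g_def)
      define M where "M = K + k0 p"
      have "coprime (int p) (\<epsilon> p)" using pr fp(1) by (rule prime_imp_coprime)
      then have "coprime (\<epsilon> p) (int p ^ M)" by (simp add: coprime_commute)
      then obtain \<eta> where "[\<epsilon> p * \<eta> = 1] (mod int p ^ M)" using cong_solve_coprime_int by blast
      then have "int p ^ M dvd \<epsilon> p * \<eta> - 1" by (simp add: cong_iff_dvd_diff)
      then have \<eta>: "int p ^ K dvd \<epsilon> p * \<eta> - 1" "int p ^ k0 p dvd \<epsilon> p * \<eta> - 1"
        by (auto simp: M_def power_add elim: dvd_mult_left dvd_mult_right)
      \<comment> \<open>Scaling the last variable by the inverse \<eta> of \<epsilon> removes the
        factors \<epsilon> and \<epsilon>^2 from the last column, so the result meets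
        \<open>g0 p\<close> to the threshold precision.\<close>
      define v w where "v i = (if i = 2 then \<epsilon> p else 1)" and "w i = (if i = 2 then \<eta> else 1)" for i :: nat
      have c: "int p ^ k0 p dvd x * \<eta> - y" if "int p ^ k0 p dvd x - \<epsilon> p * y" for x y
      proof -
        have "x * \<eta> - y = (x - \<epsilon> p * y) * \<eta> + y * (\<epsilon> p * \<eta> - 1)" by (simp add: algebra_simps)
        also have "int p ^ k0 p dvd \<dots>" by (rule dvd_add[OF dvd_mult2[OF that] dvd_mult[OF \<eta>(2)]])
        finally show ?thesis .
      qed
      have "int p ^ k0 p dvd f 2 2 * \<eta> - \<epsilon> p * g0 p 2 2" by (rule c) (use fp(7) in \<open>simp add: power2_eq_square mult.assoc\<close>)
      then have c2: "int p ^ k0 p dvd f 2 2 * \<eta> * \<eta> - g0 p 2 2" by (rule c)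
      have "int p ^ k0 p dvd f i j * w i * w j - g0 p i j" if "i \<le> j" "j < n" for i j
      proof -
        have "(j = 0 \<and> i = 0) \<or> (j = 1 \<and> i = 0) \<or> (j = 1 \<and> i = 1) \<or> (j = 2 \<and> i = 0) \<or> (j = 2 \<and> i = 1) \<or> (j = 2 \<and> i = 2)"
          using that n3 by arith
        then show ?thesis using fp(2-4) c[OF fp(5)] c[OF fp(6)] c2 by (elim disjE conjE) (simp_all add: w_def)
      qed
      moreover have "int p ^ K dvd v i * w i - 1" for i using \<eta>(1) by (simp add: v_def w_def)
      ultimately show "\<exists>v w. (\<forall>i<n. int p ^ K dvd v i * w i - 1) \<and>
          (\<forall>i j. i \<le> j \<longrightarrow> j < n \<longrightarrow> int p ^ k0 p dvd f i j * w i * w j - g0 p i j)" by blast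
    qed
    have two: "smooth_zero 2 3 f" "odd (disc3 f)" if "2 \<notin> S"
    proof -
      have d: "odd (\<epsilon> 2)" "even (f 0 0)" "odd (f 0 1)" "even (f 1 1)" "even (f 0 2)" "even (f 1 2)" "2 dvd f 2 2 - (\<epsilon> 2)^2"
        using bspec[OF f S'(3)] that by (auto simp: k_def g_def)
      show "smooth_zero 2 3 f" using d by (intro smooth_zero_coeff[of 0 1]) auto
      have "odd (f 2 2)" using d(1,7) by simp
      then show "odd (disc3 f)" using d unfolding disc3_def by simp
    qed
    \<comment> \<open>At p in S isotropy is transported from the given form; at an adjoined 2 it
      comes from the nonsingular zero.\<close>
    have h: "hilb p (- (4 * f 0 0 * f 1 1 - (f 0 1)^2)) (- (f 0 0 * disc3 f)) = (if p \<in> T then -1 else 1)" if p: "p \<in> S'" for p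
    proof -
      have pr: "prime p" using S' p by blast
      have "isotropic (Zp p) 3 (base_change (Zp p) f) \<longleftrightarrow> p \<notin> T"
      proof (cases "p \<in> S")
        case True
        then show ?thesis using isometric_isotropic_iff[OF Zp_cring[OF pr] iso[OF True]] assms(9) n3 by auto
      next
        case False
        then have "p = 2" using p by (simp add: S'_def)
        then show ?thesis using False two smooth_zero_isotropic[OF pr] assms(5) by auto
      qed
      moreover have "- (4 * f 0 0 * f 1 1 - (f 0 1)^2) \<noteq> 0" "- (f 0 0 * disc3 f) \<noteq> 0" using nz by simp_all
      note hilb_values[OF pr this]
      ultimately show ?thesis unfolding isotropic_3_iff_hilb[OF pr nz] by (simp only: split: if_split) blast
    qed
    have "(\<Prod>p\<in>S'. hilb p (- (4 * f 0 0 * f 1 1 - (f 0 1)^2)) (- (f 0 0 * disc3 f))) = (\<Prod>p\<in>S'. if p \<in> T then -1 else 1)"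
      by (rule prod.cong[OF refl h])
    also have "\<dots> = (-1) ^ card (S' \<inter> T)" using S'(1) by (simp add: prod.If_cases)
    also have "S' \<inter> T = T" using assms(5) by (auto simp: S'_def)
    \<comment> \<open>The form is definite exactly when rs = 0, so the parity hypothesis makes the
      number of anisotropic places, the real one included, even.\<close>
    also have "(-1 :: int) ^ card T = (if e 0 = e 1 \<and> e 1 = e 2 then -1 else 1)"
    proof -
      have "r = 0 \<and> s = 3 \<or> r = 1 \<and> s = 2 \<or> r = 2 \<and> s = 1 \<or> r = 3 \<and> s = 0" using assms(2) n3 by arith
      then have "e 0 = e 1 \<and> e 1 = e 2 \<longleftrightarrow> r * s = 0" by (auto simp: e_def)
      then show ?thesis using assms(6) n3 by (auto split: if_splits)
    qed
    finally have sm': "smooth_zero q 3 f" if "prime q" "q \<notin> S" for q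
      using sm two that by (cases "q = 2") (auto simp: S'_def)
    have "maximal_form q 3 (base_change (Zp q) f)" if q: "prime q" "q \<notin> S" for q
    proof (rule maximal_form_3[OF q(1)], fold disc3_def)
      show "\<not> int q ^ 2 dvd disc3 f"
      proof (cases "q = 2")
        case True
        then show ?thesis using two(2) q(2) by (auto simp: power2_eq_square elim: dvd_mult_left)
      qed (use sqf q in \<open>auto simp: S'_def\<close>)
    qed
    then show ?thesis using n3 iso sig[of f] rs sm' smooth_zero_universal smooth_zero_isotropic by (intro exI[of _ f]) auto
  qed
qed

end
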